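(* Let $(M,\mathcal{O})$ be a formal manifold and let $\mathcal{F}$ be a sheaf of $\mathcal{O}$-modules. For every open cover $\{U_\alpha\}_{\alpha\in\Gamma}$ of $M$, the canonical map $$\bigoplus_{\alpha\in\Gamma}\mathrm{D}_c^\infty(U_\alpha;\mathcal{F})\to\mathrm{D}_c^\infty(M;\mathcal{F}),\qquad\{\eta_\alpha\}_{\alpha\in\Gamma}\mapsto\sum_{\alpha\in\Gamma}\mathrm{ext}_{M,U_\alpha}(\eta_\alpha)$$ has a continuous linear right inverse. In particular, this linear map is continuous, open and surjective.
   Context: Formal manifolds. For a smooth manifold $N$ and $k\in\mathbb{N}$, $N^{(k)}$ is the locally ringed space $(N,\mathcal{O}_N^{(k)})$ over $\mathrm{Spec}(\mathbb{C})$ with $\mathcal{O}_N^{(k)}(U)=\mathrm{C}^\infty(U)[[y_1,\dots,y_k]]$ (complex-valued smooth functions). A formal manifold is a locally ringed space $(M,\mathcal{O})$ over $\mathrm{Spec}(\mathbb{C})$ with $M$ paracompact Hausdorff such that every point has an open neighborhood $U$ with $(U,\mathcal{O}|_U)\cong(\mathbb{R}^n)^{(k)}$ for some $n,k\in\mathbb{N}$. For $f\in\mathcal{O}(U)$, $f(a)\in\mathbb{C}$ is the residue of the germ of $f$ at $a$. The reduction is the smooth manifold $\underline{M}=(M,\underline{\mathcal{O}})$, where $\underline{\mathcal{O}}$ is the quotient of $\mathcal{O}$ by the ideal sheaf of sections $f$ with $f(a)=0$ for all $a$. $\underline{\mathcal{D}}$ is the sheaf of complex-valued smooth densities on $\underline{M}$,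 an $\mathcal{O}$-module via $\mathcal{O}\to\underline{\mathcal{O}}$. Differential operators. For sheaves $\mathcal{F}_1,\mathcal{F}_2$ of $\mathcal{O}$-modules, a $\mathbb{C}$-linear sheaf homomorphism $D:\mathcal{F}_1\to\mathcal{F}_2$ has order $\le r$ if for every open $U$ and $f_0,\dots,f_r\in\mathcal{O}(U)$, $[\cdots[[D|_U,f_0],f_1],\dots,f_r]=0$, where $[D,f]=D\circ f-f\circ D$. It is a differential operator if it is locally of finite order; $\mathrm{supp}\,D$ is the complement of the largest open set on which $D$ is zero. $\mathrm{Diff}_c$: differential operators with compact support; $\mathrm{Diff}_{K,r}$: those of order $\le r$ supported in the compact set $K$. Compactly supported formal densities. For $U\subset M$ open, $\mathrm{D}_c^\infty(U;\mathcal{F})$ is the image of $\rho_U:\mathrm{Diff}_c(\mathcal{F}|_U,\underline{\mathcal{D}}|_U)\to\mathrm{Hom}_{\mathbb{C}}(\mathcal{F}(U),\mathbb{C})$, $\rho_U(D)(u)=\int_U D(u)$. For $K\subset U$ compact and $r\in\mathbb{N}$, $\mathrm{Diff}_{K,r}(\mathcal{F}|_U,\underline{\mathcal{D}}|_U)$ has the topology of the seminorms $|D|_{X,u}=\sup_{a\in U}|(X(D(u)))(a)|$ ($X\in\mathrm{Diff}_c(\underline{\mathcal{D}}|_U,\underline{\mathcal{O}}|_U)$, $u\in\mathcal{F}(U)$), its image $\mathrm{D}^\infty_{K,r}(U;\mathcal{F})$ under $\rho_U$ has the quotient topology, and $\mathrm{D}_c^\infty(U;\mathcal{F})=\varinjlim_{(K,r)}\mathrm{D}^\infty_{K,r}(U;\mathcal{F})$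 has the inductive limit topology (in the category of possibly non-Hausdorff locally convex spaces over $\mathbb{C}$; direct sums carry the locally convex direct sum topology). For open $V\subset U$ the extension map $\mathrm{ext}_{U,V}:\mathrm{D}_c^\infty(V;\mathcal{F})\to\mathrm{D}_c^\infty(U;\mathcal{F})$ is $\eta\mapsto(u\mapsto\eta(u|_V))$ (it does land in $\mathrm{D}_c^\infty(U;\mathcal{F})$). *)

theory Defs
  imports
    "HOL-Analysis.Analysis"
    "HOL-Library.Poly_Mapping"
    "HOL-Algebra.QuotRing"
    "HOL-Algebra.Module"
    "Jordan_Normal_Form.Determinant"
begin

section \<open>Complex vector spaces and locally convex topologies\<close>

text \<open>
  Complex vector spaces and algebras are \<open>(complex, 'v) module\<close> records over this ring.  In a
  record that is only a module, the fields \<open>mult\<close> and \<open>one\<close> carry no information.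
\<close>

definition complex_ring :: "complex ring" where
  "complex_ring = \<lparr>carrier = UNIV, mult = (*), one = 1, zero = 0, add = (+)\<rparr>"

definition complex_linear ::
  "(complex, 'v) module \<Rightarrow> (complex, 'w) module \<Rightarrow> ('v \<Rightarrow> 'w) \<Rightarrow> bool" where
  "complex_linear V W f \<longleftrightarrow>
     f \<in> carrier V \<rightarrow> carrier W \<and>
     (\<forall>x\<in>carrier V. \<forall>y\<in>carrier V. f (x \<oplus>\<^bsub>V\<^esub> y) = f x \<oplus>\<^bsub>W\<^esub> f y) \<and>
     (\<forall>c. \<forall>x\<in>carrier V. f (c \<odot>\<^bsub>V\<^esub> x) = c \<odot>\<^bsub>W\<^esub> f x)"

definition convex_in :: "(complex, 'v) module \<Rightarrow> 'v set \<Rightarrow> bool" where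
  "convex_in V C \<longleftrightarrow> C \<subseteq> carrier V \<and>
     (\<forall>x\<in>C. \<forall>y\<in>C. \<forall>t::real. 0 \<le> t \<and> t \<le> 1 \<longrightarrow>
        (complex_of_real t \<odot>\<^bsub>V\<^esub> x) \<oplus>\<^bsub>V\<^esub> (complex_of_real (1 - t) \<odot>\<^bsub>V\<^esub> y) \<in> C)"

definition locally_convex_space :: "(complex, 'v) module \<Rightarrow> 'v topology \<Rightarrow> bool" where
  "locally_convex_space V T \<longleftrightarrow>
     Module.module complex_ring V \<and>
     topspace T = carrier V \<and>
     continuous_map (prod_topology T T) T (\<lambda>(x, y). x \<oplus>\<^bsub>V\<^esub> y) \<and>
     continuous_map (prod_topology euclidean T) T (\<lambda>(c, x). c \<odot>\<^bsub>V\<^esub> x) \<and>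
     (\<forall>N. openin T N \<and> \<zero>\<^bsub>V\<^esub> \<in> N \<longrightarrow>
        (\<exists>C N'. convex_in V C \<and> C \<subseteq> N \<and> openin T N' \<and> \<zero>\<^bsub>V\<^esub> \<in> N' \<and> N' \<subseteq> C))"

definition seminorm_topology ::
  "(complex, 'v) module \<Rightarrow> ('v \<Rightarrow> real) set \<Rightarrow> 'v topology" where
  "seminorm_topology V P = topology_generated_by
     (insert (carrier V)
       {{y \<in> carrier V. p (y \<ominus>\<^bsub>V\<^esub> x) < e} | p x e. p \<in> P \<and> x \<in> carrier V \<and> 0 < e})"

definition quotient_topology :: "'v topology \<Rightarrow> ('v \<Rightarrow> 'w) \<Rightarrow> 'w topology" where
  "quotient_topology T f = topology
     (\<lambda>S. S \<subseteq> f ` topspace T \<and> openin T {x \<in> topspace T. f x \<in> S})"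

text \<open>
  The finest locally convex topology on \<open>V\<close> making all maps \<open>f i\<close> from \<open>T i\<close> continuous, i.e. the
  topology of a colimit of locally convex spaces with underlying vector space \<open>V\<close>.  It is generated
  by the union of all such topologies, since suprema of locally convex topologies are again
  locally convex.
\<close>

definition final_locally_convex_topology ::
  "(complex, 'v) module \<Rightarrow> 'i set \<Rightarrow> ('i \<Rightarrow> 'w topology) \<Rightarrow> ('i \<Rightarrow> 'w \<Rightarrow> 'v) \<Rightarrow> 'v topology" where
  "final_locally_convex_topology V I T f = topology_generated_by
     (\<Union>{{S. openin T' S} | T'.
          locally_convex_space V T' \<and> (\<forall>i\<in>I. continuous_map (T i) T' (f i))})"

definition direct_sum :: "'i set \<Rightarrow> ('i \<Rightarrow> (complex, 'v) module) \<Rightarrow> (complex, 'i \<Rightarrow> 'v) module" where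
  "direct_sum I E =
     \<lparr>carrier = {x \<in> (\<Pi>\<^sub>E i\<in>I. carrier (E i)). finite {i \<in> I. x i \<noteq> \<zero>\<^bsub>E i\<^esub>}},
      mult = undefined, one = undefined,
      zero = (\<lambda>i\<in>I. \<zero>\<^bsub>E i\<^esub>),
      add = (\<lambda>x y. \<lambda>i\<in>I. x i \<oplus>\<^bsub>E i\<^esub> y i),
      smult = (\<lambda>c x. \<lambda>i\<in>I. c \<odot>\<^bsub>E i\<^esub> x i)\<rparr>"

definition direct_sum_topology ::
  "'i set \<Rightarrow> ('i \<Rightarrow> (complex, 'v) module) \<Rightarrow> ('i \<Rightarrow> 'v topology) \<Rightarrow> ('i \<Rightarrow> 'v) topology" where
  "direct_sum_topology I E T = final_locally_convex_topology (direct_sum I E) I T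
     (\<lambda>i v. \<lambda>j\<in>I. if j = i then v else \<zero>\<^bsub>E j\<^esub>)"


section \<open>Sheaves, locally ringed spaces and sheaves of modules\<close>

text \<open>
  One record serves for sheaves of complex algebras (\<open>'k = complex\<close>) and for sheaves of modules
  over such a sheaf (\<open>'k\<close> the type of its sections).  \<open>restr F U V\<close> is the restriction from \<open>U\<close>
  to \<open>V\<close>.  The restriction of a sheaf to an open set \<open>U\<close> is the same record, used with
  \<open>subtopology X U\<close> or only evaluated on open subsets of \<open>U\<close>.
\<close>

record ('a, 'k, 's) presheaf =
  sections :: "'a set \<Rightarrow> ('k, 's) module"
  restr :: "'a set \<Rightarrow> 'a set \<Rightarrow> 's \<Rightarrow> 's"

abbreviation sec :: "('a, 'k, 's) presheaf \<Rightarrow> 'a set \<Rightarrow> 's set" where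
  "sec F U \<equiv> carrier (sections F U)"

definition opens_in :: "'a topology \<Rightarrow> 'a set \<Rightarrow> 'a set set" where
  "opens_in X U = {V. openin X V \<and> V \<subseteq> U}"

definition sheaf_of_sets :: "'a topology \<Rightarrow> ('a, 'k, 's) presheaf \<Rightarrow> bool" where
  "sheaf_of_sets X F \<longleftrightarrow>
     (\<forall>U. openin X U \<longrightarrow> (\<forall>s\<in>sec F U. restr F U U s = s)) \<and>
     (\<forall>U V. openin X U \<and> V \<in> opens_in X U \<longrightarrow> restr F U V \<in> sec F U \<rightarrow> sec F V) \<and>
     (\<forall>U V W. openin X U \<and> V \<in> opens_in X U \<and> W \<in> opens_in X V \<longrightarrow>
        (\<forall>s\<in>sec F U. restr F V W (restr F U V s) = restr F U W s)) \<and>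
     (\<forall>\<U> s. (\<forall>V\<in>\<U>. openin X V \<and> s V \<in> sec F V) \<and>
        (\<forall>V\<in>\<U>. \<forall>W\<in>\<U>. restr F V (V \<inter> W) (s V) = restr F W (V \<inter> W) (s W)) \<longrightarrow>
        (\<exists>!t. t \<in> sec F (\<Union>\<U>) \<and> (\<forall>V\<in>\<U>. restr F (\<Union>\<U>) V t = s V)))"

definition sheaf_of_complex_algebras :: "'a topology \<Rightarrow> ('a, complex, 'r) presheaf \<Rightarrow> bool" where
  "sheaf_of_complex_algebras X \<O> \<longleftrightarrow>
     sheaf_of_sets X \<O> \<and>
     (\<forall>U. openin X U \<longrightarrow> Module.algebra complex_ring (sections \<O> U)) \<and>
     (\<forall>U V. openin X U \<and> V \<in> opens_in X U \<longrightarrow>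
        restr \<O> U V \<in> Ring.ring_hom (sections \<O> U) (sections \<O> V) \<and>
        complex_linear (sections \<O> U) (sections \<O> V) (restr \<O> U V))"

definition sheaf_of_modules ::
  "'a topology \<Rightarrow> ('a, complex, 'r) presheaf \<Rightarrow> ('a, 'r, 'm) presheaf \<Rightarrow> bool" where
  "sheaf_of_modules X \<O> F \<longleftrightarrow>
     sheaf_of_sets X F \<and>
     (\<forall>U. openin X U \<longrightarrow> Module.module (sections \<O> U) (sections F U)) \<and>
     (\<forall>U V. openin X U \<and> V \<in> opens_in X U \<longrightarrow>
        (\<forall>s\<in>sec F U. \<forall>t\<in>sec F U.
           restr F U V (s \<oplus>\<^bsub>sections F U\<^esub> t) = restr F U V s \<oplus>\<^bsub>sections F V\<^esub> restr F U V t) \<and>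
        (\<forall>f\<in>sec \<O> U. \<forall>s\<in>sec F U.
           restr F U V (f \<odot>\<^bsub>sections F U\<^esub> s) = restr \<O> U V f \<odot>\<^bsub>sections F V\<^esub> restr F U V s))"

definition germ :: "'a topology \<Rightarrow> ('a, 'k, 's) presheaf \<Rightarrow> 'a \<Rightarrow> 'a set \<Rightarrow> 's \<Rightarrow> ('a set \<times> 's) set" where
  "germ X F a U s = {(V, t). openin X V \<and> a \<in> V \<and> t \<in> sec F V \<and>
     (\<exists>W. openin X W \<and> a \<in> W \<and> W \<subseteq> U \<inter> V \<and> restr F U W s = restr F V W t)}"

text \<open>
  Operations on germs: each union runs over representatives and, as they all give the same germ,
  is a single germ.
\<close>

definition stalk ::
  "'a topology \<Rightarrow> ('a, complex, 'r) presheaf \<Rightarrow> 'a \<Rightarrow> ('a set \<times> 'r) set ring" where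
  "stalk X \<O> a =
     \<lparr>carrier = {germ X \<O> a U f | U f. openin X U \<and> a \<in> U \<and> f \<in> sec \<O> U},
      mult = (\<lambda>A B. \<Union>(U, f)\<in>A. \<Union>(V, g)\<in>B. germ X \<O> a (U \<inter> V)
                (restr \<O> U (U \<inter> V) f \<otimes>\<^bsub>sections \<O> (U \<inter> V)\<^esub> restr \<O> V (U \<inter> V) g)),
      one = germ X \<O> a (topspace X) \<one>\<^bsub>sections \<O> (topspace X)\<^esub>,
      zero = germ X \<O> a (topspace X) \<zero>\<^bsub>sections \<O> (topspace X)\<^esub>,
      add = (\<lambda>A B. \<Union>(U, f)\<in>A. \<Union>(V, g)\<in>B. germ X \<O> a (U \<inter> V)
                (restr \<O> U (U \<inter> V) f \<oplus>\<^bsub>sections \<O> (U \<inter> V)\<^esub> restr \<O> V (U \<inter> V) g))\<rparr>"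

definition local_ring :: "('b, 'e) ring_scheme \<Rightarrow> bool" where
  "local_ring R \<longleftrightarrow> cring R \<and> (\<exists>!I. maximalideal I R)"

definition locally_ringed_space :: "'a topology \<Rightarrow> ('a, complex, 'r) presheaf \<Rightarrow> bool" where
  "locally_ringed_space X \<O> \<longleftrightarrow>
     sheaf_of_complex_algebras X \<O> \<and> (\<forall>a\<in>topspace X. local_ring (stalk X \<O> a))"

text \<open>
  An isomorphism of ringed spaces induces isomorphisms of stalks, so it is automatically an
  isomorphism of locally ringed spaces.
\<close>

definition isomorphic_ringed_spaces ::
  "'a topology \<Rightarrow> ('a, complex, 'r) presheaf \<Rightarrow> 'b topology \<Rightarrow> ('b, complex, 's) presheaf \<Rightarrow> bool" where
  "isomorphic_ringed_spaces X \<O> Y \<P> \<longleftrightarrow>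
     (\<exists>\<phi> \<Psi>. homeomorphic_map X Y \<phi> \<and>
        (let pre = (\<lambda>V. {x \<in> topspace X. \<phi> x \<in> V}) in
         \<forall>V. openin Y V \<longrightarrow>
           \<Psi> V \<in> ring_iso (sections \<P> V) (sections \<O> (pre V)) \<and>
           complex_linear (sections \<P> V) (sections \<O> (pre V)) (\<Psi> V) \<and>
           (\<forall>W\<in>opens_in Y V. \<forall>f\<in>sec \<P> V.
              restr \<O> (pre V) (pre W) (\<Psi> V f) = \<Psi> W (restr \<P> V W f))))"


section \<open>Formal manifolds\<close>

text \<open>
  Points of \<open>\<real>\<^sup>n\<close> are functions \<open>nat \<Rightarrow> real\<close> vanishing from index \<open>n\<close> on, as in
  \<^const>\<open>Euclidean_space\<close>.
\<close>

definition partial_deriv ::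
  "nat \<Rightarrow> ((nat \<Rightarrow> real) \<Rightarrow> 'b::real_normed_vector) \<Rightarrow> (nat \<Rightarrow> real) \<Rightarrow> 'b" where
  "partial_deriv i f x = vector_derivative (\<lambda>t. f (x(i := t))) (at (x i))"

definition smooth_on :: "nat \<Rightarrow> (nat \<Rightarrow> real) set \<Rightarrow> ((nat \<Rightarrow> real) \<Rightarrow> complex) \<Rightarrow> bool" where
  "smooth_on n U f \<longleftrightarrow>
     (\<forall>is. set is \<subseteq> {..<n} \<longrightarrow>
        continuous_map (subtopology (Euclidean_space n) U) euclidean (foldr partial_deriv is f) \<and>
        (\<forall>i<n. \<forall>x\<in>U. (\<lambda>t. foldr partial_deriv is f (x(i := t))) differentiable (at (x i))))"

text \<open>
  The structure sheaf of \<open>(\<real>\<^sup>n)\<^sup>(\<^sup>k\<^sup>)\<close>: a section over \<open>U\<close> is a power series in \<open>k\<close> variables,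
  given by its coefficient functions, one for each multi-index.  The coefficient functions are
  extended by zero outside \<open>U\<close>.
\<close>

type_synonym formal_series = "(nat \<Rightarrow>\<^sub>0 nat) \<Rightarrow> (nat \<Rightarrow> real) \<Rightarrow> complex"

definition standard_formal_sheaf :: "nat \<Rightarrow> nat \<Rightarrow> (nat \<Rightarrow> real, complex, formal_series) presheaf" where
  "standard_formal_sheaf n k =
     \<lparr>sections = (\<lambda>U.
        \<lparr>carrier = {F. (\<forall>I. smooth_on n U (F I) \<and> (\<forall>x. x \<notin> U \<longrightarrow> F I x = 0)) \<and>
                       (\<forall>I. \<not> Poly_Mapping.keys I \<subseteq> {..<k} \<longrightarrow> F I = (\<lambda>x. 0))},
         mult = (\<lambda>F G I x. \<Sum>(J, L)\<in>{(J, L). J + L = I}. F J x * G L x),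
         one = (\<lambda>I x. if I = 0 \<and> x \<in> U then 1 else 0),
         zero = (\<lambda>I x. 0),
         add = (\<lambda>F G I x. F I x + G I x),
         smult = (\<lambda>c F I x. c * F I x)\<rparr>),
      restr = (\<lambda>U V F I x. if x \<in> V then F I x else 0)\<rparr>"

definition paracompact_space :: "'a topology \<Rightarrow> bool" where
  "paracompact_space X \<longleftrightarrow>
     (\<forall>\<U>. (\<forall>U\<in>\<U>. openin X U) \<and> \<Union>\<U> = topspace X \<longrightarrow>
        (\<exists>\<V>. (\<forall>V\<in>\<V>. openin X V \<and> (\<exists>U\<in>\<U>. V \<subseteq> U)) \<and> \<Union>\<V> = topspace X \<and> locally_finite_in X \<V>))"

definition formal_manifold :: "'a topology \<Rightarrow> ('a, complex, 'r) presheaf \<Rightarrow> bool" where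
  "formal_manifold X \<O> \<longleftrightarrow>
     locally_ringed_space X \<O> \<and> Hausdorff_space X \<and> paracompact_space X \<and>
     (\<forall>a\<in>topspace X. \<exists>U n k. openin X U \<and> a \<in> U \<and>
        isomorphic_ringed_spaces (subtopology X U) \<O> (Euclidean_space n) (standard_formal_sheaf n k))"

text \<open>
  \<open>value_at X \<O> U f a\<close> is \<open>f(a)\<close>, the residue of the germ of \<open>f\<close> at \<open>a\<close>.  On a formal manifold
  the constants map isomorphically onto the residue field, so the residue is a complex number.
\<close>

definition value_at ::
  "'a topology \<Rightarrow> ('a, complex, 'r) presheaf \<Rightarrow> 'a set \<Rightarrow> 'r \<Rightarrow> 'a \<Rightarrow> complex" where
  "value_at X \<O> U f a =
     (let R = stalk X \<O> a; m = (THE I. maximalideal I R) in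
      THE c. m +>\<^bsub>R\<^esub> germ X \<O> a U f
           = m +>\<^bsub>R\<^esub> germ X \<O> a U (c \<odot>\<^bsub>sections \<O> U\<^esub> \<one>\<^bsub>sections \<O> U\<^esub>))"


section \<open>The reduction, smooth densities and their integrals\<close>

text \<open>
  The quotient of \<open>\<O>\<close> by the ideal sheaf of sections with all values zero, as a sheaf of
  \<open>\<O>\<close>-modules.  A class in the presheaf quotient is determined by the function \<open>a \<mapsto> f(a)\<close>, so the
  associated sheaf consists of the functions that locally have this form.  They are extended by
  zero outside their domain.
\<close>

definition reduction :: "'a topology \<Rightarrow> ('a, complex, 'r) presheaf \<Rightarrow> ('a, 'r, 'a \<Rightarrow> complex) presheaf" where
  "reduction X \<O> =
     \<lparr>sections = (\<lambda>U.
        \<lparr>carrier = {g. (\<forall>a. a \<notin> U \<longrightarrow> g a = 0) \<and>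
                       (\<forall>a\<in>U. \<exists>V\<in>opens_in X U. a \<in> V \<and>
                          (\<exists>f\<in>sec \<O> V. \<forall>b\<in>V. g b = value_at X \<O> V f b))},
         mult = (\<lambda>g h a. g a * h a),
         one = (\<lambda>a. if a \<in> U then 1 else 0),
         zero = (\<lambda>a. 0),
         add = (\<lambda>g h a. g a + h a),
         smult = (\<lambda>f g a. value_at X \<O> U f a * g a)\<rparr>),
      restr = (\<lambda>U V g a. if a \<in> V then g a else 0)\<rparr>"

record 'a chart =
  chart_dom :: "'a set"
  chart_map :: "'a \<Rightarrow> nat \<Rightarrow> real"
  chart_dim :: nat

abbreviation chart_inv :: "'a chart \<Rightarrow> (nat \<Rightarrow> real) \<Rightarrow> 'a" where
  "chart_inv c \<equiv> inv_into (chart_dom c) (chart_map c)"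

abbreviation chart_image :: "'a chart \<Rightarrow> (nat \<Rightarrow> real) set" where
  "chart_image c \<equiv> chart_map c ` chart_dom c"

definition charts :: "'a topology \<Rightarrow> ('a, complex, 'r) presheaf \<Rightarrow> 'a chart set" where
  "charts X \<O> = {c. openin X (chart_dom c) \<and>
     openin (Euclidean_space (chart_dim c)) (chart_image c) \<and>
     homeomorphic_map (subtopology X (chart_dom c))
       (subtopology (Euclidean_space (chart_dim c)) (chart_image c)) (chart_map c) \<and>
     (\<forall>V\<in>opens_in X (chart_dom c). \<forall>g.
        g \<in> sec (reduction X \<O>) V \<longleftrightarrow>
        (\<forall>a. a \<notin> V \<longrightarrow> g a = 0) \<and>
        smooth_on (chart_dim c) (chart_map c ` V) (\<lambda>x. g (chart_inv c x)))}"

definition transition_det :: "'a chart \<Rightarrow> 'a chart \<Rightarrow> 'a \<Rightarrow> real" where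
  "transition_det c c' a = Determinant.det (Matrix.mat (chart_dim c) (chart_dim c)
     (\<lambda>(i, j). partial_deriv j (\<lambda>x. chart_map c' (chart_inv c x) i) (chart_map c a)))"

text \<open>
  A complex-valued smooth density \<open>\<rho>\<close> is given by its coefficient functions: in the chart \<open>c\<close> with
  coordinates \<open>x\<close> it is \<open>\<rho> c |dx|\<close>.  The transformation law comes from
  \<open>|dx'| = |det (\<partial>x'/\<partial>x)| |dx|\<close>.  Coefficients are extended by zero outside \<open>U \<inter> chart_dom c\<close>.
\<close>

type_synonym 'a density = "'a chart \<Rightarrow> 'a \<Rightarrow> complex"

definition density_sheaf :: "'a topology \<Rightarrow> ('a, complex, 'r) presheaf \<Rightarrow> ('a, 'r, 'a density) presheaf" where
  "density_sheaf X \<O> =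
     \<lparr>sections = (\<lambda>U.
        \<lparr>carrier = {\<rho>. (\<forall>c. c \<notin> charts X \<O> \<longrightarrow> \<rho> c = (\<lambda>a. 0)) \<and>
                       (\<forall>c\<in>charts X \<O>. \<rho> c \<in> sec (reduction X \<O>) (U \<inter> chart_dom c)) \<and>
                       (\<forall>c\<in>charts X \<O>. \<forall>c'\<in>charts X \<O>. \<forall>a\<in>U \<inter> chart_dom c \<inter> chart_dom c'.
                          \<rho> c a = complex_of_real \<bar>transition_det c c' a\<bar> * \<rho> c' a)},
         mult = undefined, one = undefined,
         zero = (\<lambda>c a. 0),
         add = (\<lambda>\<rho> \<sigma> c a. \<rho> c a + \<sigma> c a),
         smult = (\<lambda>f \<rho> c a. value_at X \<O> U f a * \<rho> c a)\<rparr>),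
      restr = (\<lambda>U V \<rho> c a. if a \<in> V then \<rho> c a else 0)\<rparr>"

definition partition_of_unity ::
  "'a topology \<Rightarrow> ('a, complex, 'r) presheaf \<Rightarrow> ('a chart \<Rightarrow> 'a \<Rightarrow> real) \<Rightarrow> bool" where
  "partition_of_unity X \<O> p \<longleftrightarrow>
     (\<forall>c\<in>charts X \<O>.
        (\<lambda>a. complex_of_real (p c a)) \<in> sec (reduction X \<O>) (topspace X) \<and>
        (\<forall>a. 0 \<le> p c a) \<and>
        X closure_of {a. p c a \<noteq> 0} \<subseteq> chart_dom c) \<and>
     (\<forall>a\<in>topspace X. \<exists>V. openin X V \<and> a \<in> V \<and> finite {c \<in> charts X \<O>. \<exists>b\<in>V. p c b \<noteq> 0}) \<and>
     (\<forall>a\<in>topspace X. (\<Sum>c\<in>{c \<in> charts X \<O>. p c a \<noteq> 0}. p c a) = 1)"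

text \<open>
  The Lebesgue integral over the image of the chart \<open>c\<close>.  Points of the product measure space are
  \<open>undefined\<close> rather than zero from index \<open>chart_dim c\<close> on, so they are first converted.
\<close>

definition chart_integral :: "'a chart \<Rightarrow> ('a \<Rightarrow> complex) \<Rightarrow> complex" where
  "chart_integral c g =
     (LINT x|(\<Pi>\<^sub>M i\<in>{..<chart_dim c}. lborel).
        (let y = (\<lambda>i. if i < chart_dim c then x i else 0) in
         if y \<in> chart_image c then g (chart_inv c y) else 0))"

text \<open>
  The partition of unity is indexed by the set of all charts and an arbitrary one is used; by the
  transformation formula the integral does not depend on it.  The same formula serves for
  the integral over an open set \<open>U\<close> of a density \<open>\<rho>\<close> over \<open>U\<close> with compact support: \<open>\<rho>\<close> is extended by
  zero, and a partition of unity on \<open>X\<close> restricts to one on \<open>U\<close>.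
\<close>

definition density_integral :: "'a topology \<Rightarrow> ('a, complex, 'r) presheaf \<Rightarrow> 'a density \<Rightarrow> complex" where
  "density_integral X \<O> \<rho> =
     (let p = (SOME p. partition_of_unity X \<O> p) in
      \<Sum>c\<in>{c \<in> charts X \<O>. \<exists>a. complex_of_real (p c a) * \<rho> c a \<noteq> 0}.
        chart_integral c (\<lambda>a. complex_of_real (p c a) * \<rho> c a))"


section \<open>Differential operators\<close>

definition complex_scale ::
  "('a, complex, 'r) presheaf \<Rightarrow> ('a, 'r, 's) presheaf \<Rightarrow> 'a set \<Rightarrow> complex \<Rightarrow> 's \<Rightarrow> 's" where
  "complex_scale \<O> F U c s = (c \<odot>\<^bsub>sections \<O> U\<^esub> \<one>\<^bsub>sections \<O> U\<^esub>) \<odot>\<^bsub>sections F U\<^esub> s"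

text \<open>
  \<open>\<complex>\<close>-linear sheaf homomorphisms from the restriction of \<open>F\<close> to \<open>U\<close> to the restriction of \<open>G\<close>.
  They are families indexed by the open subsets of \<open>U\<close>, \<open>undefined\<close> outside their domains.
\<close>

definition sheaf_homs ::
  "'a topology \<Rightarrow> ('a, complex, 'r) presheaf \<Rightarrow> ('a, 'r, 's) presheaf \<Rightarrow> ('a, 'r, 't) presheaf \<Rightarrow>
   'a set \<Rightarrow> ('a set \<Rightarrow> 's \<Rightarrow> 't) set" where
  "sheaf_homs X \<O> F G U =
     {D \<in> (\<Pi>\<^sub>E V\<in>opens_in X U. sec F V \<rightarrow>\<^sub>E sec G V).
       (\<forall>V\<in>opens_in X U.
          (\<forall>s\<in>sec F V. \<forall>t\<in>sec F V.
             D V (s \<oplus>\<^bsub>sections F V\<^esub> t) = D V s \<oplus>\<^bsub>sections G V\<^esub> D V t) \<and>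
          (\<forall>c. \<forall>s\<in>sec F V. D V (complex_scale \<O> F V c s) = complex_scale \<O> G V c (D V s)) \<and>
          (\<forall>W\<in>opens_in X V. \<forall>s\<in>sec F V. restr G V W (D V s) = D W (restr F V W s)))}"

definition commutator ::
  "('a, complex, 'r) presheaf \<Rightarrow> ('a, 'r, 's) presheaf \<Rightarrow> ('a, 'r, 't) presheaf \<Rightarrow>
   'a set \<Rightarrow> ('a set \<Rightarrow> 's \<Rightarrow> 't) \<Rightarrow> 'r \<Rightarrow> ('a set \<Rightarrow> 's \<Rightarrow> 't)" where
  "commutator \<O> F G U D f = (\<lambda>V s.
     D V (restr \<O> U V f \<odot>\<^bsub>sections F V\<^esub> s) \<ominus>\<^bsub>sections G V\<^esub> (restr \<O> U V f \<odot>\<^bsub>sections G V\<^esub> D V s))"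

definition vanishes_on ::
  "'a topology \<Rightarrow> ('a, 'r, 's) presheaf \<Rightarrow> ('a, 'r, 't) presheaf \<Rightarrow>
   'a set \<Rightarrow> ('a set \<Rightarrow> 's \<Rightarrow> 't) \<Rightarrow> bool" where
  "vanishes_on X F G U D \<longleftrightarrow> (\<forall>V\<in>opens_in X U. \<forall>s\<in>sec F V. D V s = \<zero>\<^bsub>sections G V\<^esub>)"

definition order_le ::
  "'a topology \<Rightarrow> ('a, complex, 'r) presheaf \<Rightarrow> ('a, 'r, 's) presheaf \<Rightarrow> ('a, 'r, 't) presheaf \<Rightarrow>
   'a set \<Rightarrow> nat \<Rightarrow> ('a set \<Rightarrow> 's \<Rightarrow> 't) \<Rightarrow> bool" where
  "order_le X \<O> F G U r D \<longleftrightarrow>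
     (\<forall>V\<in>opens_in X U. \<forall>fs. length fs = Suc r \<and> set fs \<subseteq> sec \<O> V \<longrightarrow>
        vanishes_on X F G V (foldl (commutator \<O> F G V) D fs))"

definition op_support ::
  "'a topology \<Rightarrow> ('a, 'r, 's) presheaf \<Rightarrow> ('a, 'r, 't) presheaf \<Rightarrow>
   'a set \<Rightarrow> ('a set \<Rightarrow> 's \<Rightarrow> 't) \<Rightarrow> 'a set" where
  "op_support X F G U D = U - \<Union>{V \<in> opens_in X U. vanishes_on X F G V D}"

text \<open>\<open>Diff\<^sub>c(F|\<^sub>U, G|\<^sub>U)\<close> as a complex vector space, and \<open>Diff\<^sub>K\<^sub>,\<^sub>r(F|\<^sub>U, G|\<^sub>U)\<close> as a subspace of it.\<close>

definition Diff_c ::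
  "'a topology \<Rightarrow> ('a, complex, 'r) presheaf \<Rightarrow> ('a, 'r, 's) presheaf \<Rightarrow> ('a, 'r, 't) presheaf \<Rightarrow>
   'a set \<Rightarrow> (complex, 'a set \<Rightarrow> 's \<Rightarrow> 't) module" where
  "Diff_c X \<O> F G U =
     \<lparr>carrier = {D \<in> sheaf_homs X \<O> F G U.
                  (\<forall>a\<in>U. \<exists>V\<in>opens_in X U. a \<in> V \<and> (\<exists>r. order_le X \<O> F G V r D)) \<and>
                  compactin X (op_support X F G U D)},
      mult = undefined, one = undefined,
      zero = (\<lambda>V\<in>opens_in X U. \<lambda>s\<in>sec F V. \<zero>\<^bsub>sections G V\<^esub>),
      add = (\<lambda>D E. \<lambda>V\<in>opens_in X U. \<lambda>s\<in>sec F V. D V s \<oplus>\<^bsub>sections G V\<^esub> E V s),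
      smult = (\<lambda>c D. \<lambda>V\<in>opens_in X U. \<lambda>s\<in>sec F V. complex_scale \<O> G V c (D V s))\<rparr>"

definition Diff_Kr ::
  "'a topology \<Rightarrow> ('a, complex, 'r) presheaf \<Rightarrow> ('a, 'r, 's) presheaf \<Rightarrow> ('a, 'r, 't) presheaf \<Rightarrow>
   'a set \<Rightarrow> 'a set \<Rightarrow> nat \<Rightarrow> (complex, 'a set \<Rightarrow> 's \<Rightarrow> 't) module" where
  "Diff_Kr X \<O> F G U K r = Diff_c X \<O> F G U
     \<lparr>carrier := {D \<in> carrier (Diff_c X \<O> F G U).
                    op_support X F G U D \<subseteq> K \<and> order_le X \<O> F G U r D}\<rparr>"


section \<open>Compactly supported formal densities\<close>

definition rho ::
  "'a topology \<Rightarrow> ('a, complex, 'r) presheaf \<Rightarrow> ('a, 'r, 'm) presheaf \<Rightarrow> 'a set \<Rightarrow>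
   ('a set \<Rightarrow> 'm \<Rightarrow> 'a density) \<Rightarrow> 'm \<Rightarrow> complex" where
  "rho X \<O> F U D = (\<lambda>u\<in>sec F U. density_integral X \<O> (D U u))"

text \<open>\<open>D\<^sub>c\<^sup>\<infinity>(U; F)\<close> with the vector space structure of the space of linear functionals on \<open>F(U)\<close>.\<close>

definition formal_densities ::
  "'a topology \<Rightarrow> ('a, complex, 'r) presheaf \<Rightarrow> ('a, 'r, 'm) presheaf \<Rightarrow> 'a set \<Rightarrow>
   (complex, 'm \<Rightarrow> complex) module" where
  "formal_densities X \<O> F U =
     \<lparr>carrier = rho X \<O> F U ` carrier (Diff_c X \<O> F (density_sheaf X \<O>) U),
      mult = undefined, one = undefined,
      zero = (\<lambda>u\<in>sec F U. 0),
      add = (\<lambda>\<eta> \<theta>. \<lambda>u\<in>sec F U. \<eta> u + \<theta> u),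
      smult = (\<lambda>c \<eta>. \<lambda>u\<in>sec F U. c * \<eta> u)\<rparr>"

text \<open>The seminorms are suprema of nonnegative numbers; 0 is inserted because \<open>U\<close> may be empty.\<close>

definition Diff_Kr_topology ::
  "'a topology \<Rightarrow> ('a, complex, 'r) presheaf \<Rightarrow> ('a, 'r, 'm) presheaf \<Rightarrow> 'a set \<Rightarrow> 'a set \<Rightarrow> nat \<Rightarrow>
   ('a set \<Rightarrow> 'm \<Rightarrow> 'a density) topology" where
  "Diff_Kr_topology X \<O> F U K r =
     seminorm_topology (Diff_Kr X \<O> F (density_sheaf X \<O>) U K r)
       {\<lambda>D. Sup (insert 0 ((\<lambda>a. cmod (Y U (D U u) a)) ` U)) | Y u.
          Y \<in> carrier (Diff_c X \<O> (density_sheaf X \<O>) (reduction X \<O>) U) \<and> u \<in> sec F U}"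

definition formal_densities_topology ::
  "'a topology \<Rightarrow> ('a, complex, 'r) presheaf \<Rightarrow> ('a, 'r, 'm) presheaf \<Rightarrow> 'a set \<Rightarrow>
   ('m \<Rightarrow> complex) topology" where
  "formal_densities_topology X \<O> F U =
     final_locally_convex_topology (formal_densities X \<O> F U)
       ({K. compactin X K \<and> K \<subseteq> U} \<times> (UNIV :: nat set))
       (\<lambda>(K, r). quotient_topology (Diff_Kr_topology X \<O> F U K r) (rho X \<O> F U))
       (\<lambda>_ \<eta>. \<eta>)"

definition ext_map ::
  "('a, 'r, 'm) presheaf \<Rightarrow> 'a set \<Rightarrow> 'a set \<Rightarrow> ('m \<Rightarrow> complex) \<Rightarrow> ('m \<Rightarrow> complex)" where
  "ext_map F U V \<eta> = (\<lambda>u\<in>sec F U. \<eta> (restr F U V u))"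

abbreviation density_sum ::
  "'a topology \<Rightarrow> ('a, complex, 'r) presheaf \<Rightarrow> ('a, 'r, 'm) presheaf \<Rightarrow>
   'i set \<Rightarrow> ('i \<Rightarrow> 'a set) \<Rightarrow> (complex, 'i \<Rightarrow> 'm \<Rightarrow> complex) module" where
  "density_sum X \<O> F \<Gamma> U \<equiv> direct_sum \<Gamma> (\<lambda>\<alpha>. formal_densities X \<O> F (U \<alpha>))"

abbreviation density_sum_topology ::
  "'a topology \<Rightarrow> ('a, complex, 'r) presheaf \<Rightarrow> ('a, 'r, 'm) presheaf \<Rightarrow>
   'i set \<Rightarrow> ('i \<Rightarrow> 'a set) \<Rightarrow> ('i \<Rightarrow> 'm \<Rightarrow> complex) topology" where
  "density_sum_topology X \<O> F \<Gamma> U \<equiv> direct_sum_topology \<Gamma>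
     (\<lambda>\<alpha>. formal_densities X \<O> F (U \<alpha>)) (\<lambda>\<alpha>. formal_densities_topology X \<O> F (U \<alpha>))"

definition sum_ext ::
  "'a topology \<Rightarrow> ('a, complex, 'r) presheaf \<Rightarrow> ('a, 'r, 'm) presheaf \<Rightarrow>
   'i set \<Rightarrow> ('i \<Rightarrow> 'a set) \<Rightarrow> ('i \<Rightarrow> 'm \<Rightarrow> complex) \<Rightarrow> ('m \<Rightarrow> complex)" where
  "sum_ext X \<O> F \<Gamma> U \<eta> =
     (\<Oplus>\<^bsub>formal_densities X \<O> F (topspace X)\<^esub>
        \<alpha>\<in>{\<alpha> \<in> \<Gamma>. \<eta> \<alpha> \<noteq> \<zero>\<^bsub>formal_densities X \<O> F (U \<alpha>)\<^esub>}. ext_map F (topspace X) (U \<alpha>) (\<eta> \<alpha>))"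

end

theory Submission
  imports Defs
begin

text \<open>
  Choose a partition of unity \<open>e\<^sub>\<alpha> \<in> \<O>(M)\<close> subordinate to the cover.  The right inverse sends \<open>\<eta>\<close> to the
  family of functionals \<open>u \<mapsto> \<eta>(e\<^sub>\<alpha> u)\<close>, where \<open>u \<in> F(U\<^sub>\<alpha>)\<close> and \<open>e\<^sub>\<alpha> u\<close> is extended by zero.  For
  \<open>\<eta> = \<rho>(D)\<close> the component at \<open>\<alpha>\<close> is \<open>\<rho>(D \<circ> e\<^sub>\<alpha>)\<close>; it vanishes for all but the finitely many \<open>\<alpha>\<close>
  whose \<open>e\<^sub>\<alpha>\<close> has support meeting that of \<open>D\<close>, and the components add up to \<open>\<eta>\<close> because
  \<open>\<Sum> e\<^sub>\<alpha> = 1\<close> locally.  Continuity may be tested on the spaces \<open>Diff\<^sub>K\<^sub>,\<^sub>r\<close>, where \<open>D \<mapsto> D \<circ> e\<^sub>\<alpha>\<close> and the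
  extension by zero are linear and every seminorm of the image is dominated by a single seminorm
  of \<open>D\<close>.  A linear map with a continuous linear right inverse is surjective, and open because
  translations are continuous.
\<close>

text \<open>The sheaf \<open>F\<close> is an arbitrary module sheaf, so its operators have no local
  formula; everything about them comes from restriction, gluing and commutators. The obstacle is
  that \<rho> may have a kernel: an operation on functionals has to be read off from the functional
  itself, which is why \<open>u\<close> is multiplied and extended to the whole manifold before
  \<eta> is applied. One seminorm suffices to dominate another because a test operator on a member
  of the cover extends by zero, while one on the manifold can be cut off near a compact set. Final
  topologies are generated by all locally convex competitors and may fail to be Hausdorff. Maps into
  them are tested against each competitor separately. Bump functions come from exp(-1/t) and are
  constant in the formal variables, so they equal one and zero as sections of \<O>, not only in
  their values. The same construction, applied to the cover by all charts, provides the partition of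
  unity that the integral picks by \<open>SOME\<close>; linearity of the integral, and hence of
  \<rho>, rests on it.\<close>

lemma complex_ring_simps [simp]:
  "carrier complex_ring = UNIV" "\<zero>\<^bsub>complex_ring\<^esub> = 0" "\<one>\<^bsub>complex_ring\<^esub> = 1"
  "a \<oplus>\<^bsub>complex_ring\<^esub> b = a + b" "a \<otimes>\<^bsub>complex_ring\<^esub> b = a * b"
  by (simp_all add: complex_ring_def)

lemma cring_complex_ring: "cring complex_ring"
proof (rule cringI)
  show "abelian_group complex_ring"
    by (rule abelian_groupI) (auto simp: add.assoc add.commute intro: exI[of _ "- x" for x])
  show "Group.comm_monoid complex_ring"
    by unfold_locales (auto simp: mult.assoc mult.commute)
qed (auto simp: distrib_right)

text \<open>The module laws over \<open>complex_ring\<close> in terms of the ordinary operations on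
  complex numbers, so that they apply to concrete scalars without unfolding the ring record.\<close>

lemma
  assumes "Module.module complex_ring V"
  shows complex_module_smult_closed: "x \<in> carrier V \<Longrightarrow> a \<odot>\<^bsub>V\<^esub> x \<in> carrier V"
    and complex_module_smult_l_distr: "x \<in> carrier V \<Longrightarrow> (a + b) \<odot>\<^bsub>V\<^esub> x = a \<odot>\<^bsub>V\<^esub> x \<oplus>\<^bsub>V\<^esub> b \<odot>\<^bsub>V\<^esub> x"
    and complex_module_smult_r_distr: "x \<in> carrier V \<Longrightarrow> y \<in> carrier V \<Longrightarrow>
      a \<odot>\<^bsub>V\<^esub> (x \<oplus>\<^bsub>V\<^esub> y) = a \<odot>\<^bsub>V\<^esub> x \<oplus>\<^bsub>V\<^esub> a \<odot>\<^bsub>V\<^esub> y"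
    and complex_module_smult_assoc1: "x \<in> carrier V \<Longrightarrow> (a * b) \<odot>\<^bsub>V\<^esub> x = a \<odot>\<^bsub>V\<^esub> (b \<odot>\<^bsub>V\<^esub> x)"
    and complex_module_smult_one: "x \<in> carrier V \<Longrightarrow> 1 \<odot>\<^bsub>V\<^esub> x = x"
    and complex_module_smult_r_null: "a \<odot>\<^bsub>V\<^esub> \<zero>\<^bsub>V\<^esub> = \<zero>\<^bsub>V\<^esub>"
proof -
  interpret Module.module complex_ring V by fact
  show "x \<in> carrier V \<Longrightarrow> a \<odot>\<^bsub>V\<^esub> x \<in> carrier V"
    "x \<in> carrier V \<Longrightarrow> (a + b) \<odot>\<^bsub>V\<^esub> x = a \<odot>\<^bsub>V\<^esub> x \<oplus>\<^bsub>V\<^esub> b \<odot>\<^bsub>V\<^esub> x"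
    "x \<in> carrier V \<Longrightarrow> y \<in> carrier V \<Longrightarrow> a \<odot>\<^bsub>V\<^esub> (x \<oplus>\<^bsub>V\<^esub> y) = a \<odot>\<^bsub>V\<^esub> x \<oplus>\<^bsub>V\<^esub> a \<odot>\<^bsub>V\<^esub> y"
    "x \<in> carrier V \<Longrightarrow> (a * b) \<odot>\<^bsub>V\<^esub> x = a \<odot>\<^bsub>V\<^esub> (b \<odot>\<^bsub>V\<^esub> x)"
    "x \<in> carrier V \<Longrightarrow> 1 \<odot>\<^bsub>V\<^esub> x = x"
    "a \<odot>\<^bsub>V\<^esub> \<zero>\<^bsub>V\<^esub> = \<zero>\<^bsub>V\<^esub>"
    using smult_l_distr[of a b x] smult_r_distr[of a x y] smult_assoc1[of a b x] smult_one[of x] by simp_all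
qed

section \<open>Final locally convex topologies\<close>

text \<open>Pulling back along a constant map gives the indiscrete topology. It is a competitor in
  every final topology and thereby fixes the underlying set of the latter.\<close>

lemma locally_convex_space_trivial:
  assumes "Module.module complex_ring V"
  shows "locally_convex_space V (pullback_topology (carrier V) (\<lambda>_. ()) (discrete_topology UNIV))"
proof -
  interpret Module.module complex_ring V by fact
  let ?T = "pullback_topology (carrier V) (\<lambda>_. ()) (discrete_topology UNIV)"
  have top: "topspace ?T = carrier V" by (auto simp: topspace_pullback_topology)
  have cont: "continuous_map S ?T g" if "g \<in> topspace S \<rightarrow> carrier V" for S :: "'x topology" and g
    by (rule continuous_map_pullback') (use that in \<open>auto simp: o_def\<close>)
  have "convex_in V (carrier V)" by (auto simp: convex_in_def)
  moreover have "N = carrier V" if "openin ?T N" "\<zero>\<^bsub>V\<^esub> \<in> N" for N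
    using that by (auto simp: openin_pullback_topology split: if_splits)
  moreover have "openin ?T (carrier V)" using top by (metis openin_topspace)
  ultimately show ?thesis
    unfolding locally_convex_space_def using top assms
    by (intro conjI allI impI exI[of _ "carrier V"]; (rule cont)?; auto simp: complex_module_smult_closed)
qed

text \<open>Since \<open>L\<close> is linear, preimages of convex sets are convex and the operations
  of \<open>V\<close> followed by \<open>L\<close> are those of \<open>W\<close> preceded by
  \<open>L\<close>. This turns a topology on the target of a map into a competitor on its
  source.\<close>

lemma locally_convex_space_pullback:
  assumes V: "Module.module complex_ring V" and L: "complex_linear V W L"
    and T: "locally_convex_space W T"
  shows "locally_convex_space V (pullback_topology (carrier V) L T)"
proof -
  interpret V: Module.module complex_ring V by fact
  interpret W: Module.module complex_ring W using T by (simp add: locally_convex_space_def)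
  let ?P = "pullback_topology (carrier V) L T"
  have tT: "topspace T = carrier W"
    and addT: "continuous_map (prod_topology T T) T (\<lambda>(x, y). x \<oplus>\<^bsub>W\<^esub> y)"
    and smT: "continuous_map (prod_topology euclidean T) T (\<lambda>(c, x). c \<odot>\<^bsub>W\<^esub> x)"
    and lcT: "\<And>N. openin T N \<Longrightarrow> \<zero>\<^bsub>W\<^esub> \<in> N \<Longrightarrow>
        \<exists>C N'. convex_in W C \<and> C \<subseteq> N \<and> openin T N' \<and> \<zero>\<^bsub>W\<^esub> \<in> N' \<and> N' \<subseteq> C"
    using T unfolding locally_convex_space_def by blast+
  have Lc: "L x \<in> carrier W" if "x \<in> carrier V" for x using L that by (auto simp: complex_linear_def)
  have La: "L (x \<oplus>\<^bsub>V\<^esub> y) = L x \<oplus>\<^bsub>W\<^esub> L y" if "x \<in> carrier V" "y \<in> carrier V" for x y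
    using L that by (auto simp: complex_linear_def)
  have Ls: "L (c \<odot>\<^bsub>V\<^esub> x) = c \<odot>\<^bsub>W\<^esub> L x" if "x \<in> carrier V" for x c
    using L that by (auto simp: complex_linear_def)
  have L0: "L \<zero>\<^bsub>V\<^esub> = \<zero>\<^bsub>W\<^esub>"
    using Ls[of "\<zero>\<^bsub>V\<^esub>" 0] V.smult_l_null[of "\<zero>\<^bsub>V\<^esub>"] W.smult_l_null[of "L \<zero>\<^bsub>V\<^esub>"] Lc by simp
  have top: "topspace ?P = carrier V" using Lc by (auto simp: topspace_pullback_topology tT)
  have LP: "continuous_map ?P T L" using continuous_map_pullback[of T T id] by simp
  have "continuous_map (prod_topology ?P ?P) ?P (\<lambda>(x, y). x \<oplus>\<^bsub>V\<^esub> y)"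
  proof (rule continuous_map_pullback')
    have "continuous_map (prod_topology ?P ?P) T ((\<lambda>(x, y). x \<oplus>\<^bsub>W\<^esub> y) \<circ> (\<lambda>(x, y). (L x, L y)))"
      using LP by (intro continuous_map_compose[OF _ addT]) (simp add: continuous_map_prod_top)
    then show "continuous_map (prod_topology ?P ?P) T (L \<circ> (\<lambda>(x, y). x \<oplus>\<^bsub>V\<^esub> y))"
      by (rule continuous_map_eq) (auto simp: top La)
  qed (auto simp: top)
  moreover have "continuous_map (prod_topology euclidean ?P) ?P (\<lambda>(c, x). c \<odot>\<^bsub>V\<^esub> x)"
  proof (rule continuous_map_pullback')
    have "continuous_map (prod_topology euclidean ?P) T ((\<lambda>(c, x). c \<odot>\<^bsub>W\<^esub> x) \<circ> (\<lambda>(c, x). (id c, L x)))"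
      using LP by (intro continuous_map_compose[OF _ smT]) (subst continuous_map_prod_top, simp)
    then show "continuous_map (prod_topology euclidean ?P) T (L \<circ> (\<lambda>(c, x). c \<odot>\<^bsub>V\<^esub> x))"
      by (rule continuous_map_eq) (auto simp: top Ls)
  qed (auto simp: top)
  moreover have "\<exists>C N'. convex_in V C \<and> C \<subseteq> N \<and> openin ?P N' \<and> \<zero>\<^bsub>V\<^esub> \<in> N' \<and> N' \<subseteq> C"
    if N: "openin ?P N" "\<zero>\<^bsub>V\<^esub> \<in> N" for N
  proof -
    obtain U where U: "openin T U" "N = L -` U \<inter> carrier V"
      using N(1) by (auto simp: openin_pullback_topology)
    have "\<zero>\<^bsub>W\<^esub> \<in> U" using N(2) U(2) L0 by auto
    then obtain C N' where C: "convex_in W C" "C \<subseteq> U" "openin T N'" "\<zero>\<^bsub>W\<^esub> \<in> N'" "N' \<subseteq> C"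
      using lcT U(1) by meson
    have "convex_in V (L -` C \<inter> carrier V)"
      using C(1) unfolding convex_in_def by (auto simp: La Ls)
    moreover have "L -` C \<inter> carrier V \<subseteq> N" using C(2) U(2) by auto
    moreover have "openin ?P (L -` N' \<inter> carrier V)" using C(3) by (auto simp: openin_pullback_topology)
    moreover have "\<zero>\<^bsub>V\<^esub> \<in> L -` N' \<inter> carrier V" using C(4) L0 by auto
    ultimately show ?thesis using C(5) by blast
  qed
  ultimately show ?thesis unfolding locally_convex_space_def using top V by blast
qed

text \<open>The sources are arbitrary topological spaces and the maps arbitrary functions into
  \<open>V\<close>, so that the quotient topologies on the images of \<open>Diff_Kr\<close> fit in
  as they stand.\<close>

locale final_family =
  fixes V :: "(complex, 'v) module" and I :: "'i set" and T :: "'i \<Rightarrow> 'w topology"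
    and f :: "'i \<Rightarrow> 'w \<Rightarrow> 'v"
  assumes V: "Module.module complex_ring V"
    and f: "i \<in> I \<Longrightarrow> f i \<in> topspace (T i) \<rightarrow> carrier V"
begin

abbreviation "final \<equiv> final_locally_convex_topology V I T f"

sublocale Module.module complex_ring V by (rule V)

lemma openin_finalI:
  assumes "locally_convex_space V T'" "\<And>i. i \<in> I \<Longrightarrow> continuous_map (T i) T' (f i)" "openin T' S"
  shows "openin final S"
  unfolding final_locally_convex_topology_def
  by (rule topology_generated_by_Basis) (use assms in blast)

text \<open>The indiscrete topology is a competitor, so all of \<open>V\<close> is open; conversely,
  the open sets of each competitor lie in \<open>V\<close>.\<close>

lemma topspace_final: "topspace final = carrier V"
proof -
  let ?T = "pullback_topology (carrier V) (\<lambda>_. ()) (discrete_topology UNIV)"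
  have top: "topspace ?T = carrier V" by (auto simp: topspace_pullback_topology)
  have "continuous_map (T i) ?T (f i)" if "i \<in> I" for i
    by (rule continuous_map_pullback') (use f[OF that] in \<open>auto simp: o_def\<close>)
  then have "openin final (carrier V)"
    using openin_finalI[OF locally_convex_space_trivial[OF V]] top by (metis openin_topspace)
  then have 1: "carrier V \<subseteq> topspace final" by (rule openin_subset)
  have "S \<subseteq> carrier V" if "locally_convex_space V T'" "openin T' S" for T' S
    using that openin_subset unfolding locally_convex_space_def by fastforce
  then have "topspace final \<subseteq> carrier V"
    unfolding final_locally_convex_topology_def topology_generated_by_topspace by blast
  with 1 show ?thesis by simp
qed

text \<open>The open sets of the competitors form a subbasis, so only their preimages have to be
  examined.\<close>

lemma continuous_map_into_final:
  assumes "g \<in> topspace S \<rightarrow> carrier V"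
    and "\<And>T'. locally_convex_space V T' \<Longrightarrow> (\<And>i. i \<in> I \<Longrightarrow> continuous_map (T i) T' (f i)) \<Longrightarrow>
       continuous_map S T' g"
  shows "continuous_map S final g"
  unfolding final_locally_convex_topology_def
proof (rule continuous_on_generated_topo)
  show "openin S (g -` A \<inter> topspace S)"
    if A: "A \<in> \<Union> {{S. openin T' S} |T'. locally_convex_space V T' \<and> (\<forall>i\<in>I. continuous_map (T i) T' (f i))}" for A
  proof -
    obtain T' where T': "locally_convex_space V T'" "\<And>i. i \<in> I \<Longrightarrow> continuous_map (T i) T' (f i)" "openin T' A"
      using A by auto
    have "{x \<in> topspace S. g x \<in> A} = g -` A \<inter> topspace S" by auto
    then show ?thesis
      using openin_continuous_map_preimage[OF assms(2)[OF T'(1,2)] T'(3)] by metis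
  qed
  show "g ` topspace S \<subseteq> \<Union> (\<Union> {{S. openin T' S} |T'. locally_convex_space V T' \<and> (\<forall>i\<in>I. continuous_map (T i) T' (f i))})"
    using assms(1) topspace_final
    unfolding final_locally_convex_topology_def topology_generated_by_topspace by blast
qed

lemma continuous_map_final_component:
  assumes "i \<in> I" shows "continuous_map (T i) final (f i)"
  by (rule continuous_map_into_final) (use f assms in auto)

text \<open>The universal property of the colimit: the pullback of \<open>T'\<close> along
  \<open>L\<close> is itself a competitor, hence its open sets are open in the final
  topology.\<close>

lemma continuous_map_from_final:
  assumes L: "complex_linear V W L" and T': "locally_convex_space W T'"
    and c: "\<And>i. i \<in> I \<Longrightarrow> continuous_map (T i) T' (\<lambda>x. L (f i x))"
  shows "continuous_map final T' L"
proof -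
  let ?P = "pullback_topology (carrier V) L T'"
  have P: "locally_convex_space V ?P" by (rule locally_convex_space_pullback[OF V L T'])
  have fP: "continuous_map (T i) ?P (f i)" if "i \<in> I" for i
    by (rule continuous_map_pullback') (use that c f in \<open>auto simp: o_def\<close>)
  have "openin final {x \<in> carrier V. L x \<in> S}" if "openin T' S" for S
    by (rule openin_finalI[OF P fP]) (use that in \<open>auto simp: openin_pullback_topology\<close>)
  then show ?thesis
    using L T' unfolding continuous_map_def topspace_final complex_linear_def locally_convex_space_def by auto
qed

text \<open>In a competitor, translation is continuous because addition is, and the final topology
  is finer than every competitor. Openness of the canonical map needs only this much of the
  topological vector space structure.\<close>

lemma continuous_map_translation:
  assumes a: "a \<in> carrier V"
  shows "continuous_map final final (\<lambda>x. a \<oplus>\<^bsub>V\<^esub> x)"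
proof (rule continuous_map_into_final)
  fix T' assume T': "locally_convex_space V T'" "\<And>i. i \<in> I \<Longrightarrow> continuous_map (T i) T' (f i)"
  have tT: "topspace T' = carrier V" using T' by (auto simp: locally_convex_space_def)
  have "continuous_map T' T' ((\<lambda>(x, y). x \<oplus>\<^bsub>V\<^esub> y) \<circ> (\<lambda>x. (a, x)))"
    by (rule continuous_map_compose[where X'="prod_topology T' T'"])
      (use T' tT a in \<open>auto simp: locally_convex_space_def continuous_map_pairedI\<close>)
  then have c: "continuous_map T' T' (\<lambda>x. a \<oplus>\<^bsub>V\<^esub> x)" by (simp add: o_def)
  have "openin final S" if "openin T' S" for S using openin_finalI[OF T'] that by auto
  then have "continuous_map final T' id"
    unfolding continuous_map_def topspace_final tT
  proof (intro conjI allI impI)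
    fix S assume *: "openin T' S" "\<And>S. openin T' S \<Longrightarrow> openin final S"
    then have "{x \<in> carrier V. id x \<in> S} = S" using openin_subset tT by force
    then show "openin final {x \<in> carrier V. id x \<in> S}" using * by simp
  qed auto
  from continuous_map_compose[OF this c] show "continuous_map final T' (\<lambda>x. a \<oplus>\<^bsub>V\<^esub> x)"
    by (simp add: o_def)
qed (use a in \<open>auto simp: topspace_final\<close>)

end

section \<open>Quotient topologies and seminorm topologies\<close>

lemma istopology_quotient:
  "istopology (\<lambda>S. S \<subseteq> f ` topspace T \<and> openin T {x \<in> topspace T. f x \<in> S})"
proof -
  have 1: "{x \<in> topspace T. f x \<in> S \<inter> S'} = {x \<in> topspace T. f x \<in> S} \<inter> {x \<in> topspace T. f x \<in> S'}" for S S'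
    by auto
  have 2: "{x \<in> topspace T. f x \<in> \<Union>K} = (\<Union>S\<in>K. {x \<in> topspace T. f x \<in> S})" for K by auto
  show ?thesis unfolding istopology_def 1 2 by (auto intro: openin_Union)
qed

lemma openin_quotient_topology:
  "openin (quotient_topology T f) S \<longleftrightarrow> S \<subseteq> f ` topspace T \<and> openin T {x \<in> topspace T. f x \<in> S}"
  by (simp add: quotient_topology_def topology_inverse'[OF istopology_quotient])

lemma topspace_quotient_topology: "topspace (quotient_topology T f) = f ` topspace T"
proof -
  have "{x \<in> topspace T. f x \<in> f ` topspace T} = topspace T" by auto
  then have "openin (quotient_topology T f) (f ` topspace T)"
    unfolding openin_quotient_topology using openin_topspace[of T] by simp
  then show ?thesis using openin_quotient_topology[of T f "topspace (quotient_topology T f)"] openin_subset by blast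
qed

text \<open>The commuting square makes the \<open>f\<close>-preimage of a \<open>g\<close>-preimage
  equal to the \<open>L\<close>-preimage of an \<open>f'\<close>-preimage, and the latter is open by
  continuity of \<open>L\<close>.\<close>

lemma continuous_map_quotient_topology:
  assumes L: "continuous_map T T' L" and g: "\<And>x. x \<in> topspace T \<Longrightarrow> g (f x) = f' (L x)"
  shows "continuous_map (quotient_topology T f) (quotient_topology T' f') g"
  unfolding continuous_map_def topspace_quotient_topology
proof (intro conjI allI impI)
  have LT: "L x \<in> topspace T'" if "x \<in> topspace T" for x using L that by (auto simp: continuous_map_def)
  show "g \<in> f ` topspace T \<rightarrow> f' ` topspace T'" using g LT by auto
  have g2: "f x \<in> {y \<in> f ` topspace T. g y \<in> S} \<longleftrightarrow> f' (L x) \<in> S" if "x \<in> topspace T" for x S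
    using g[OF that] that by auto
  fix S assume S: "openin (quotient_topology T' f') S"
  have "openin T {x \<in> topspace T. L x \<in> {x \<in> topspace T'. f' x \<in> S}}"
    by (rule openin_continuous_map_preimage[OF L]) (use S in \<open>simp add: openin_quotient_topology\<close>)
  moreover have "{x \<in> topspace T. L x \<in> {x \<in> topspace T'. f' x \<in> S}} =
     {x \<in> topspace T. f x \<in> {y \<in> f ` topspace T. g y \<in> S}}" using LT g2 by blast
  ultimately show "openin (quotient_topology T f) {y \<in> f ` topspace T. g y \<in> S}"
    by (auto simp: openin_quotient_topology)
qed

lemma topspace_seminorm_topology: "topspace (seminorm_topology V P) = carrier V"
  by (auto simp: seminorm_topology_def topology_generated_by_topspace)

lemma complex_linear_zero:
  assumes "Module.module complex_ring V" "Module.module complex_ring W" "complex_linear V W L"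
  shows "L \<zero>\<^bsub>V\<^esub> = \<zero>\<^bsub>W\<^esub>"
proof -
  interpret V: Module.module complex_ring V by fact
  interpret W: Module.module complex_ring W by fact
  have "L (0 \<odot>\<^bsub>V\<^esub> \<zero>\<^bsub>V\<^esub>) = 0 \<odot>\<^bsub>W\<^esub> L \<zero>\<^bsub>V\<^esub>" "L \<zero>\<^bsub>V\<^esub> \<in> carrier W"
    using assms(3) unfolding complex_linear_def by blast+
  then show ?thesis using V.smult_l_null[of "\<zero>\<^bsub>V\<^esub>"] W.smult_l_null by simp
qed

lemma complex_linear_minus:
  assumes "Module.module complex_ring V" "Module.module complex_ring W" "complex_linear V W L"
    "x \<in> carrier V" "y \<in> carrier V"
  shows "L (x \<ominus>\<^bsub>V\<^esub> y) = L x \<ominus>\<^bsub>W\<^esub> L y"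
proof -
  interpret V: Module.module complex_ring V by fact
  interpret W: Module.module complex_ring W by fact
  have Lc: "L x \<in> carrier W" if "x \<in> carrier V" for x using assms(3) that by (auto simp: complex_linear_def)
  have La: "L (x \<oplus>\<^bsub>V\<^esub> y) = L x \<oplus>\<^bsub>W\<^esub> L y" if "x \<in> carrier V" "y \<in> carrier V" for x y
    using assms(3) that by (auto simp: complex_linear_def)
  have "L (\<ominus>\<^bsub>V\<^esub> y) \<oplus>\<^bsub>W\<^esub> L y = \<zero>\<^bsub>W\<^esub>"
    using La[of "\<ominus>\<^bsub>V\<^esub> y" y] assms complex_linear_zero[OF assms(1-3)] by (simp add: V.l_neg)
  then have "L (\<ominus>\<^bsub>V\<^esub> y) = \<ominus>\<^bsub>W\<^esub> L y" using assms(5) by (simp add: Lc W.minus_equality)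
  then show ?thesis using assms(4,5) La[of x "\<ominus>\<^bsub>V\<^esub> y"] by (simp add: a_minus_def)
qed

text \<open>Around a point \<open>z\<close> with q(L z - x) < e, the p-ball of radius e - q(L z - x)
  is mapped into the given subbasic set by subadditivity of \<open>q\<close>. The condition on
  \<open>p\<close> at zero puts \<open>z\<close> into its own ball.\<close>

lemma continuous_map_seminorm_topology:
  assumes V: "Module.module complex_ring V" and W: "Module.module complex_ring W"
    and L: "complex_linear V W L"
    and sub: "\<And>q x y. q \<in> Q \<Longrightarrow> x \<in> carrier W \<Longrightarrow> y \<in> carrier W \<Longrightarrow> q (x \<oplus>\<^bsub>W\<^esub> y) \<le> q x + q y"
    and pq: "\<And>q. q \<in> Q \<Longrightarrow> \<exists>p\<in>P. p \<zero>\<^bsub>V\<^esub> \<le> 0 \<and> (\<forall>x\<in>carrier V. q (L x) \<le> p x)"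
  shows "continuous_map (seminorm_topology V P) (seminorm_topology W Q) L"
  unfolding seminorm_topology_def[of W]
proof (rule continuous_on_generated_topo)
  interpret V: Module.module complex_ring V by fact
  interpret W: Module.module complex_ring W by fact
  have Lc: "L x \<in> carrier W" if "x \<in> carrier V" for x using L that by (auto simp: complex_linear_def)
  let ?S = "insert (carrier W) {{y \<in> carrier W. p (y \<ominus>\<^bsub>W\<^esub> x) < e} |p x e. p \<in> Q \<and> x \<in> carrier W \<and> 0 < e}"
  show "L ` topspace (seminorm_topology V P) \<subseteq> \<Union>?S" using Lc by (auto simp: topspace_seminorm_topology)
  fix S assume "S \<in> ?S"
  then consider "S = carrier W" |
    (b) q x e where "S = {y \<in> carrier W. q (y \<ominus>\<^bsub>W\<^esub> x) < e}" "q \<in> Q" "x \<in> carrier W" "0 < e" by auto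
  then show "openin (seminorm_topology V P) (L -` S \<inter> topspace (seminorm_topology V P))"
  proof cases
    case 1
    then have "L -` S \<inter> topspace (seminorm_topology V P) = topspace (seminorm_topology V P)"
      using Lc by (auto simp: topspace_seminorm_topology)
    then show ?thesis by simp
  next
    case b
    obtain p where p: "p \<in> P" "p \<zero>\<^bsub>V\<^esub> \<le> 0" "\<And>x. x \<in> carrier V \<Longrightarrow> q (L x) \<le> p x" using pq[OF b(2)] by auto
    show ?thesis
    proof (subst openin_subopen, intro ballI)
      fix z assume "z \<in> L -` S \<inter> topspace (seminorm_topology V P)"
      then have z: "z \<in> carrier V" "q (L z \<ominus>\<^bsub>W\<^esub> x) < e" using b by (auto simp: topspace_seminorm_topology)
      let ?d = "e - q (L z \<ominus>\<^bsub>W\<^esub> x)"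
      let ?N = "{y \<in> carrier V. p (y \<ominus>\<^bsub>V\<^esub> z) < ?d}"
      have "openin (seminorm_topology V P) ?N" unfolding seminorm_topology_def
        by (rule topology_generated_by_Basis) (use p z in force)
      moreover have "z \<in> ?N" using p z by (simp add: a_minus_def V.r_neg)
      moreover have "?N \<subseteq> L -` S \<inter> topspace (seminorm_topology V P)"
      proof
        fix y assume "y \<in> ?N"
        then have y: "y \<in> carrier V" "p (y \<ominus>\<^bsub>V\<^esub> z) < ?d" by auto
        have "L y \<ominus>\<^bsub>W\<^esub> x = L (y \<ominus>\<^bsub>V\<^esub> z) \<oplus>\<^bsub>W\<^esub> (L z \<ominus>\<^bsub>W\<^esub> x)"
          using complex_linear_minus[OF V W L y(1) z(1)] Lc[OF y(1)] Lc[OF z(1)] b(3)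
          by (simp add: a_minus_def W.a_assoc W.r_neg1)
        then have "q (L y \<ominus>\<^bsub>W\<^esub> x) \<le> q (L (y \<ominus>\<^bsub>V\<^esub> z)) + q (L z \<ominus>\<^bsub>W\<^esub> x)"
          using sub[OF b(2), of "L (y \<ominus>\<^bsub>V\<^esub> z)" "L z \<ominus>\<^bsub>W\<^esub> x"] y z b(3) Lc by simp
        also have "\<dots> < e" using p(3)[of "y \<ominus>\<^bsub>V\<^esub> z"] y z by simp
        finally show "y \<in> L -` S \<inter> topspace (seminorm_topology V P)"
          using y(1) b(1) Lc[OF y(1)] by (simp add: topspace_seminorm_topology)
      qed
      ultimately show "\<exists>T. openin (seminorm_topology V P) T \<and> z \<in> T \<and> T \<subseteq> L -` S \<inter> topspace (seminorm_topology V P)"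
        by blast
    qed
  qed
qed

text \<open>A preimage of \<open>y\<close> near \<open>x\<close> is obtained by adding \<open>R (y - S x)\<close> to \<open>x\<close>.\<close>

lemma open_map_right_inverse:
  assumes V: "Module.module complex_ring V" and W: "Module.module complex_ring W"
    and S: "complex_linear V W S" and R: "complex_linear W V R"
    and SR: "\<And>y. y \<in> carrier W \<Longrightarrow> S (R y) = y"
    and tops: "topspace T = carrier V" "topspace T' = carrier W"
    and Rc: "continuous_map T' T R"
    and tr: "\<And>a. a \<in> carrier V \<Longrightarrow> continuous_map T T (\<lambda>x. a \<oplus>\<^bsub>V\<^esub> x)"
    and tr': "\<And>a. a \<in> carrier W \<Longrightarrow> continuous_map T' T' (\<lambda>x. a \<oplus>\<^bsub>W\<^esub> x)"
  shows "open_map T T' S"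
  unfolding open_map_def
proof (intro allI impI, subst openin_subopen, intro ballI)
  interpret V: Module.module complex_ring V by fact
  interpret W: Module.module complex_ring W by fact
  fix A y assume A: "openin T A" and "y \<in> S ` A"
  then obtain x where x: "x \<in> A" "y = S x" by auto
  have xV: "x \<in> carrier V" using x A openin_subset tops by blast
  have Sc: "S x \<in> carrier W" if "x \<in> carrier V" for x using S that by (auto simp: complex_linear_def)
  have Rcl: "R x \<in> carrier V" if "x \<in> carrier W" for x using R that by (auto simp: complex_linear_def)
  have Sa: "S (x \<oplus>\<^bsub>V\<^esub> y) = S x \<oplus>\<^bsub>W\<^esub> S y" if "x \<in> carrier V" "y \<in> carrier V" for x y
    using S that by (auto simp: complex_linear_def)
  have yW: "y \<in> carrier W" using x xV Sc by simp
  let ?g = "\<lambda>z. x \<oplus>\<^bsub>V\<^esub> R (\<ominus>\<^bsub>W\<^esub> y \<oplus>\<^bsub>W\<^esub> z)"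
  have "continuous_map T' T ((\<lambda>v. x \<oplus>\<^bsub>V\<^esub> v) \<circ> (R \<circ> (\<lambda>z. \<ominus>\<^bsub>W\<^esub> y \<oplus>\<^bsub>W\<^esub> z)))"
    by (intro continuous_map_compose[OF _ tr] continuous_map_compose[OF tr' Rc] xV) (use yW in auto)
  then have g: "continuous_map T' T ?g" by (simp add: o_def)
  let ?B = "{z \<in> topspace T'. ?g z \<in> A}"
  have "openin T' ?B" by (rule openin_continuous_map_preimage[OF g A])
  moreover have "y \<in> ?B" using yW x xV complex_linear_zero[OF W V R] by (simp add: tops W.l_neg)
  moreover have "?B \<subseteq> S ` A"
  proof
    fix z assume z: "z \<in> ?B"
    then have zW: "z \<in> carrier W" by (simp add: tops)
    have "S (?g z) = y \<oplus>\<^bsub>W\<^esub> (\<ominus>\<^bsub>W\<^esub> y \<oplus>\<^bsub>W\<^esub> z)"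
      using xV yW zW x by (subst Sa) (auto simp: SR Rcl)
    also have "\<dots> = z" using yW zW by (simp add: W.r_neg1 W.r_neg2)
    finally show "z \<in> S ` A" using z by (metis (mono_tags, lifting) imageI mem_Collect_eq)
  qed
  ultimately show "\<exists>B. openin T' B \<and> y \<in> B \<and> B \<subseteq> S ` A" by blast
qed

text \<open>Induction with the continuity of addition. It is applied in a competitor topology on the
  direct sum, where the right inverse is a finite sum of components once the compact set is
  fixed.\<close>

lemma continuous_map_finsum:
  assumes T: "locally_convex_space V T" and "finite J"
    and "\<And>j. j \<in> J \<Longrightarrow> continuous_map S T (g j)"
  shows "continuous_map S T (\<lambda>x. \<Oplus>\<^bsub>V\<^esub>j\<in>J. g j x)"
  using assms(2,3)
proof (induction J rule: finite_induct)
  interpret V: Module.module complex_ring V using T by (simp add: locally_convex_space_def)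
  have top: "topspace T = carrier V" using T by (simp add: locally_convex_space_def)
  case empty
  then show ?case by (simp add: top)
next
  interpret V: Module.module complex_ring V using T by (simp add: locally_convex_space_def)
  have top: "topspace T = carrier V" using T by (simp add: locally_convex_space_def)
  case (insert j J)
  have "continuous_map S T ((\<lambda>(x, y). x \<oplus>\<^bsub>V\<^esub> y) \<circ> (\<lambda>x. (g j x, \<Oplus>\<^bsub>V\<^esub>j\<in>J. g j x)))"
    by (rule continuous_map_compose[where X'="prod_topology T T"])
      (use T insert in \<open>auto simp: locally_convex_space_def continuous_map_pairedI\<close>)
  then show ?case
  proof (rule continuous_map_eq)
    fix x assume "x \<in> topspace S"
    then have "\<And>i. i \<in> insert j J \<Longrightarrow> g i x \<in> carrier V" using insert.prems top by (auto simp: continuous_map_def)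
    then show "((\<lambda>(x, y). x \<oplus>\<^bsub>V\<^esub> y) \<circ> (\<lambda>x. (g j x, \<Oplus>\<^bsub>V\<^esub>j\<in>J. g j x))) x = (\<Oplus>\<^bsub>V\<^esub>j\<in>insert j J. g j x)"
      using insert.hyps by (subst V.finsum_insert) auto
  qed
qed

section \<open>Direct sums of complex vector spaces\<close>

locale module_family =
  fixes I :: "'i set" and E :: "'i \<Rightarrow> (complex, 'v) module"
  assumes E: "i \<in> I \<Longrightarrow> Module.module complex_ring (E i)"
begin

text \<open>The injection used anonymously in \<open>direct_sum_topology\<close>, named so that
  finite sums of such maps can be written down.\<close>

definition inj :: "'i \<Rightarrow> 'v \<Rightarrow> 'i \<Rightarrow> 'v" where
  "inj i v = (\<lambda>j\<in>I. if j = i then v else \<zero>\<^bsub>E j\<^esub>)"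

lemma direct_sum_carrier:
  "x \<in> carrier (direct_sum I E) \<longleftrightarrow> x \<in> (\<Pi>\<^sub>E i\<in>I. carrier (E i)) \<and> finite {i \<in> I. x i \<noteq> \<zero>\<^bsub>E i\<^esub>}"
  by (simp add: direct_sum_def)

lemma direct_sum_ops:
  "\<zero>\<^bsub>direct_sum I E\<^esub> = (\<lambda>i\<in>I. \<zero>\<^bsub>E i\<^esub>)"
  "x \<oplus>\<^bsub>direct_sum I E\<^esub> y = (\<lambda>i\<in>I. x i \<oplus>\<^bsub>E i\<^esub> y i)"
  "c \<odot>\<^bsub>direct_sum I E\<^esub> x = (\<lambda>i\<in>I. c \<odot>\<^bsub>E i\<^esub> x i)"
  by (simp_all add: direct_sum_def)

lemma direct_sum_add_closed:
  assumes "x \<in> carrier (direct_sum I E)" "y \<in> carrier (direct_sum I E)"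
  shows "x \<oplus>\<^bsub>direct_sum I E\<^esub> y \<in> carrier (direct_sum I E)"
proof -
  have a: "abelian_group (E i)" if "i \<in> I" for i using E[OF that] by (simp add: Module.module_def)
  have "finite ({i \<in> I. x i \<noteq> \<zero>\<^bsub>E i\<^esub>} \<union> {i \<in> I. y i \<noteq> \<zero>\<^bsub>E i\<^esub>})"
    using assms by (auto simp: direct_sum_carrier)
  moreover have "{i \<in> I. (\<lambda>i\<in>I. x i \<oplus>\<^bsub>E i\<^esub> y i) i \<noteq> \<zero>\<^bsub>E i\<^esub>} \<subseteq>
    {i \<in> I. x i \<noteq> \<zero>\<^bsub>E i\<^esub>} \<union> {i \<in> I. y i \<noteq> \<zero>\<^bsub>E i\<^esub>}"
    using a by (auto simp: abelian_group_def abelian_monoid.l_zero abelian_monoid.zero_closed)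
  ultimately have "finite {i \<in> I. (\<lambda>i\<in>I. x i \<oplus>\<^bsub>E i\<^esub> y i) i \<noteq> \<zero>\<^bsub>E i\<^esub>}" by (rule rev_finite_subset)
  then show ?thesis
    using assms a unfolding direct_sum_carrier direct_sum_ops
    by (simp add: PiE_iff abelian_group_def abelian_monoid.a_closed)
qed

lemma direct_sum_smult_closed:
  assumes "x \<in> carrier (direct_sum I E)"
  shows "c \<odot>\<^bsub>direct_sum I E\<^esub> x \<in> carrier (direct_sum I E)"
proof -
  have "{i \<in> I. (\<lambda>i\<in>I. c \<odot>\<^bsub>E i\<^esub> x i) i \<noteq> \<zero>\<^bsub>E i\<^esub>} \<subseteq> {i \<in> I. x i \<noteq> \<zero>\<^bsub>E i\<^esub>}"
    using E by (auto simp: complex_module_smult_r_null)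
  then have "finite {i \<in> I. (\<lambda>i\<in>I. c \<odot>\<^bsub>E i\<^esub> x i) i \<noteq> \<zero>\<^bsub>E i\<^esub>}"
    by (rule finite_subset) (use assms in \<open>simp add: direct_sum_carrier\<close>)
  then show ?thesis
    using assms E unfolding direct_sum_carrier direct_sum_ops
    by (simp add: PiE_iff complex_module_smult_closed)
qed

lemma module_direct_sum: "Module.module complex_ring (direct_sum I E)"
proof -
  have a: "abelian_group (E i)" if "i \<in> I" for i using E[OF that] by (simp add: Module.module_def)
  have m: "abelian_monoid (E i)" if "i \<in> I" for i using a[OF that] by (simp add: abelian_group_def)
  note cl = direct_sum_carrier PiE_iff
  have xc: "x i \<in> carrier (E i)" if "x \<in> carrier (direct_sum I E)" "i \<in> I" for x i using that by (auto simp: cl)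
  have ex: "x = (\<lambda>i\<in>I. x i)" if "x \<in> carrier (direct_sum I E)" for x
    using that by (auto simp: cl extensional_def)
  show ?thesis
  proof (rule moduleI[OF cring_complex_ring])
    show "abelian_group (direct_sum I E)"
    proof (rule abelian_groupI)
      show "\<zero>\<^bsub>direct_sum I E\<^esub> \<in> carrier (direct_sum I E)"
        using m by (auto simp: cl direct_sum_ops abelian_monoid.zero_closed)
    next
      fix x assume x: "x \<in> carrier (direct_sum I E)"
      \<comment> \<open>The additive inverse is taken to be the multiple by -1, for which finiteness
        of the support is already known.\<close>
      have "(-1) \<odot>\<^bsub>direct_sum I E\<^esub> x \<oplus>\<^bsub>direct_sum I E\<^esub> x = \<zero>\<^bsub>direct_sum I E\<^esub>"
      proof -
        have "(-1) \<odot>\<^bsub>E i\<^esub> x i \<oplus>\<^bsub>E i\<^esub> x i = \<zero>\<^bsub>E i\<^esub>" if "i \<in> I" for i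
        proof -
          note E = E[OF that] and x = xc[OF x that]
          have "(-1) \<odot>\<^bsub>E i\<^esub> x i \<oplus>\<^bsub>E i\<^esub> 1 \<odot>\<^bsub>E i\<^esub> x i = 0 \<odot>\<^bsub>E i\<^esub> x i"
            using complex_module_smult_l_distr[OF E x, of "-1" 1] by simp
          also have "\<dots> = \<zero>\<^bsub>E i\<^esub>" using module.smult_l_null[OF E x] by simp
          finally show ?thesis using complex_module_smult_one[OF E x] by simp
        qed
        then show ?thesis by (auto simp: direct_sum_ops)
      qed
      then show "\<exists>y\<in>carrier (direct_sum I E). y \<oplus>\<^bsub>direct_sum I E\<^esub> x = \<zero>\<^bsub>direct_sum I E\<^esub>"
        using direct_sum_smult_closed[OF x] by blast
      have "\<zero>\<^bsub>direct_sum I E\<^esub> \<oplus>\<^bsub>direct_sum I E\<^esub> x = (\<lambda>i\<in>I. x i)"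
        using m xc[OF x] by (auto simp: direct_sum_ops abelian_monoid.l_zero)
      then show "\<zero>\<^bsub>direct_sum I E\<^esub> \<oplus>\<^bsub>direct_sum I E\<^esub> x = x" using ex[OF x] by simp
    next
      fix x y z assume x: "x \<in> carrier (direct_sum I E)" "y \<in> carrier (direct_sum I E)" "z \<in> carrier (direct_sum I E)"
      show "x \<oplus>\<^bsub>direct_sum I E\<^esub> y \<oplus>\<^bsub>direct_sum I E\<^esub> z = x \<oplus>\<^bsub>direct_sum I E\<^esub> (y \<oplus>\<^bsub>direct_sum I E\<^esub> z)"
        unfolding direct_sum_ops by (rule restrict_ext) (use m x xc in \<open>simp add: abelian_monoid.a_assoc\<close>)
    next
      fix x y assume x: "x \<in> carrier (direct_sum I E)" "y \<in> carrier (direct_sum I E)"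
      show "x \<oplus>\<^bsub>direct_sum I E\<^esub> y = y \<oplus>\<^bsub>direct_sum I E\<^esub> x"
        unfolding direct_sum_ops by (rule restrict_ext) (use m x xc in \<open>simp add: abelian_monoid.a_comm\<close>)
    qed (rule direct_sum_add_closed)
  next
    fix x assume x: "x \<in> carrier (direct_sum I E)"
    have "\<one>\<^bsub>complex_ring\<^esub> \<odot>\<^bsub>direct_sum I E\<^esub> x = (\<lambda>i\<in>I. x i)"
      unfolding direct_sum_ops by (rule restrict_ext) (use complex_module_smult_one[OF E xc[OF x]] in simp)
    then show "\<one>\<^bsub>complex_ring\<^esub> \<odot>\<^bsub>direct_sum I E\<^esub> x = x" using ex[OF x] by simp
  next
    fix a b x assume x: "x \<in> carrier (direct_sum I E)"
    show "(a \<oplus>\<^bsub>complex_ring\<^esub> b) \<odot>\<^bsub>direct_sum I E\<^esub> x = a \<odot>\<^bsub>direct_sum I E\<^esub> x \<oplus>\<^bsub>direct_sum I E\<^esub> b \<odot>\<^bsub>direct_sum I E\<^esub> x"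
      unfolding direct_sum_ops
      by (rule restrict_ext) (use complex_module_smult_l_distr[OF E xc[OF x]] in simp)
    show "(a \<otimes>\<^bsub>complex_ring\<^esub> b) \<odot>\<^bsub>direct_sum I E\<^esub> x = a \<odot>\<^bsub>direct_sum I E\<^esub> (b \<odot>\<^bsub>direct_sum I E\<^esub> x)"
      unfolding direct_sum_ops
      by (rule restrict_ext) (use complex_module_smult_assoc1[OF E xc[OF x]] in simp)
  next
    fix a x y assume x: "x \<in> carrier (direct_sum I E)" "y \<in> carrier (direct_sum I E)"
    show "a \<odot>\<^bsub>direct_sum I E\<^esub> (x \<oplus>\<^bsub>direct_sum I E\<^esub> y) = a \<odot>\<^bsub>direct_sum I E\<^esub> x \<oplus>\<^bsub>direct_sum I E\<^esub> a \<odot>\<^bsub>direct_sum I E\<^esub> y"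
      unfolding direct_sum_ops
      by (rule restrict_ext) (use complex_module_smult_r_distr[OF E xc[OF x(1)] xc[OF x(2)]] in simp)
  qed (rule direct_sum_smult_closed)
qed

lemma inj_linear:
  assumes "i \<in> I" shows "complex_linear (E i) (direct_sum I E) (inj i)"
proof -
  have m: "abelian_monoid (E i)" if "i \<in> I" for i
    using E[OF that] by (simp add: Module.module_def abelian_group_def)
  have "finite {j \<in> I. inj i v j \<noteq> \<zero>\<^bsub>E j\<^esub>}" for v
    by (rule finite_subset[of _ "{i}"]) (auto simp: inj_def)
  then have "inj i \<in> carrier (E i) \<rightarrow> carrier (direct_sum I E)"
    using m by (auto simp: direct_sum_carrier PiE_iff inj_def abelian_monoid.zero_closed)
  then show ?thesis
    unfolding complex_linear_def
    using m E by (auto simp: direct_sum_ops inj_def abelian_monoid.r_zero abelian_monoid.zero_closed complex_module_smult_r_null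
        intro!: restrict_ext)
qed

text \<open>Turns an abstract finite sum in the direct sum into an explicit family, so that a family
  given by components can be recognised as a sum of injections.\<close>

lemma finsum_inj_apply:
  assumes "finite J" "J \<subseteq> I" "\<And>j. j \<in> J \<Longrightarrow> v j \<in> carrier (E j)"
  shows "(\<Oplus>\<^bsub>direct_sum I E\<^esub>j\<in>J. inj j (v j)) = (\<lambda>i\<in>I. if i \<in> J then v i else \<zero>\<^bsub>E i\<^esub>)"
  using assms
proof (induction J rule: finite_induct)
  interpret D: Module.module complex_ring "direct_sum I E" by (rule module_direct_sum)
  case empty
  then show ?case by (simp add: direct_sum_ops)
next
  interpret D: Module.module complex_ring "direct_sum I E" by (rule module_direct_sum)
  have m: "abelian_monoid (E i)" if "i \<in> I" for i
    using E[OF that] by (simp add: Module.module_def abelian_group_def)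
  case (insert j J)
  have "inj i (v i) \<in> carrier (direct_sum I E)" if "i \<in> insert j J" for i
  proof -
    have "i \<in> I" "v i \<in> carrier (E i)" using insert.prems that by auto
    then show ?thesis using inj_linear[of i] by (auto simp: complex_linear_def)
  qed
  then have "(\<Oplus>\<^bsub>direct_sum I E\<^esub>j\<in>insert j J. inj j (v j)) =
     inj j (v j) \<oplus>\<^bsub>direct_sum I E\<^esub> (\<lambda>i\<in>I. if i \<in> J then v i else \<zero>\<^bsub>E i\<^esub>)"
  proof (subst D.finsum_insert)
    show "inj j (v j) \<oplus>\<^bsub>direct_sum I E\<^esub> (\<Oplus>\<^bsub>direct_sum I E\<^esub>j\<in>J. inj j (v j)) =
      inj j (v j) \<oplus>\<^bsub>direct_sum I E\<^esub> (\<lambda>i\<in>I. if i \<in> J then v i else \<zero>\<^bsub>E i\<^esub>)"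
      by (subst insert.IH) (use insert.prems in auto)
  qed (use insert.hyps in auto)
  also have "\<dots> = (\<lambda>i\<in>I. if i \<in> insert j J then v i else \<zero>\<^bsub>E i\<^esub>)"
    unfolding direct_sum_ops
    by (rule restrict_ext)
      (use insert m in \<open>auto simp: inj_def abelian_monoid.r_zero abelian_monoid.l_zero abelian_monoid.zero_closed\<close>)
  finally show ?case .
qed

end

section \<open>Sheaves of modules\<close>

lemma opens_in_iff: "V \<in> opens_in X U \<longleftrightarrow> openin X V \<and> V \<subseteq> U"
  by (simp add: opens_in_def)

context
  fixes X :: "'a topology" and F :: "('a, 'k, 's) presheaf"
  assumes F: "sheaf_of_sets X F"
begin

lemma sheaf_restr_id: "openin X U \<Longrightarrow> s \<in> sec F U \<Longrightarrow> restr F U U s = s"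
  using F by (simp add: sheaf_of_sets_def)

lemma sheaf_restr_closed: "openin X U \<Longrightarrow> V \<in> opens_in X U \<Longrightarrow> s \<in> sec F U \<Longrightarrow> restr F U V s \<in> sec F V"
proof -
  have "\<forall>U V. openin X U \<and> V \<in> opens_in X U \<longrightarrow> restr F U V \<in> sec F U \<rightarrow> sec F V"
    using F unfolding sheaf_of_sets_def by (elim conjE)
  then show "openin X U \<Longrightarrow> V \<in> opens_in X U \<Longrightarrow> s \<in> sec F U \<Longrightarrow> restr F U V s \<in> sec F V" by blast
qed

lemma sheaf_restr_restr:
  "openin X U \<Longrightarrow> V \<in> opens_in X U \<Longrightarrow> W \<in> opens_in X V \<Longrightarrow> s \<in> sec F U \<Longrightarrow>
   restr F V W (restr F U V s) = restr F U W s"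
proof -
  have "\<forall>U V W. openin X U \<and> V \<in> opens_in X U \<and> W \<in> opens_in X V \<longrightarrow>
        (\<forall>s\<in>sec F U. restr F V W (restr F U V s) = restr F U W s)"
    using F unfolding sheaf_of_sets_def by (elim conjE)
  then show "openin X U \<Longrightarrow> V \<in> opens_in X U \<Longrightarrow> W \<in> opens_in X V \<Longrightarrow> s \<in> sec F U \<Longrightarrow>
     restr F V W (restr F U V s) = restr F U W s" by blast
qed

lemma sheaf_glue_unique:
  assumes "\<And>V. V \<in> \<U> \<Longrightarrow> openin X V \<and> s V \<in> sec F V"
    and "\<And>V W. V \<in> \<U> \<Longrightarrow> W \<in> \<U> \<Longrightarrow> restr F V (V \<inter> W) (s V) = restr F W (V \<inter> W) (s W)"
  shows "\<exists>!t. t \<in> sec F (\<Union>\<U>) \<and> (\<forall>V\<in>\<U>. restr F (\<Union>\<U>) V t = s V)"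
proof -
  have "\<forall>\<U> s. (\<forall>V\<in>\<U>. openin X V \<and> s V \<in> sec F V) \<and>
        (\<forall>V\<in>\<U>. \<forall>W\<in>\<U>. restr F V (V \<inter> W) (s V) = restr F W (V \<inter> W) (s W)) \<longrightarrow>
        (\<exists>!t. t \<in> sec F (\<Union>\<U>) \<and> (\<forall>V\<in>\<U>. restr F (\<Union>\<U>) V t = s V))"
    using F unfolding sheaf_of_sets_def by (elim conjE)
  from this[THEN spec, THEN spec, THEN mp, of \<U> s] show ?thesis using assms by blast
qed

text \<open>The open sets on which the two sections agree cover \<open>U\<close>. Both sections glue
  the restrictions of \<open>s\<close> to this cover, and a glued section is unique.\<close>

lemma sheaf_eqI:
  assumes U: "openin X U" and s: "s \<in> sec F U" and t: "t \<in> sec F U"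
    and loc: "\<And>a. a \<in> U \<Longrightarrow> \<exists>W\<in>opens_in X U. a \<in> W \<and> restr F U W s = restr F U W t"
  shows "s = t"
proof -
  let ?\<U> = "{W \<in> opens_in X U. restr F U W s = restr F U W t}"
  have un: "\<Union>?\<U> = U" 
  proof
    show "U \<subseteq> \<Union>?\<U>" using loc by blast
  qed (auto simp: opens_in_iff)
  have "\<exists>!u. u \<in> sec F (\<Union>?\<U>) \<and> (\<forall>V\<in>?\<U>. restr F (\<Union>?\<U>) V u = restr F U V s)"
  proof (rule sheaf_glue_unique)
    fix V assume "V \<in> ?\<U>" then show "openin X V \<and> restr F U V s \<in> sec F V"
      using sheaf_restr_closed[OF U _ s, of V] unfolding opens_in_iff by blast
  next
    fix V W assume "V \<in> ?\<U>" "W \<in> ?\<U>"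
    then have "V \<in> opens_in X U" "W \<in> opens_in X U" "V \<inter> W \<in> opens_in X V" "V \<inter> W \<in> opens_in X W"
      by (auto simp: opens_in_iff)
    then show "restr F V (V \<inter> W) (restr F U V s) = restr F W (V \<inter> W) (restr F U W s)"
      by (simp only: sheaf_restr_restr[OF U _ _ s])
  qed
  then have "\<exists>!u. u \<in> sec F U \<and> (\<forall>V\<in>?\<U>. restr F U V u = restr F U V s)" unfolding un .
  moreover have "s \<in> sec F U \<and> (\<forall>V\<in>?\<U>. restr F U V s = restr F U V s)" using s by simp
  moreover have "t \<in> sec F U \<and> (\<forall>V\<in>?\<U>. restr F U V t = restr F U V s)" using t by simp
  ultimately show ?thesis by blast
qed

lemma sheaf_eqI2:
  assumes U: "openin X U" and s: "s \<in> sec F U" and t: "t \<in> sec F U"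
    and V: "openin X V" "openin X W" "V \<union> W = U"
    and eq: "restr F U V s = restr F U V t" "restr F U W s = restr F U W t"
  shows "s = t"
proof (rule sheaf_eqI[OF U s t])
  fix a assume "a \<in> U"
  then have "a \<in> V \<or> a \<in> W" using V by auto
  then show "\<exists>W\<in>opens_in X U. a \<in> W \<and> restr F U W s = restr F U W t"
    using V eq by (auto simp: opens_in_iff)
qed

text \<open>The sheaf axiom indexes sections by open sets, whereas local constructions index them by
  points. Several points may share a neighbourhood; \<open>pick\<close> selects one of them, and
  compatibility shows that the selection does not affect the section.\<close>

lemma sheaf_glue_local:
  assumes U: "openin X U"
    and cov: "\<And>a. a \<in> U \<Longrightarrow> openin X (N a) \<and> a \<in> N a \<and> N a \<subseteq> U \<and> s a \<in> sec F (N a)"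
    and compat: "\<And>a b. a \<in> U \<Longrightarrow> b \<in> U \<Longrightarrow> restr F (N a) (N a \<inter> N b) (s a) = restr F (N b) (N a \<inter> N b) (s b)"
  shows "\<exists>t\<in>sec F U. \<forall>a\<in>U. restr F U (N a) t = s a"
proof -
  let ?\<U> = "N ` U"
  define pick where "pick V = (SOME a. a \<in> U \<and> N a = V)" for V
  have pick: "pick (N a) \<in> U \<and> N (pick (N a)) = N a" if "a \<in> U" for a
    unfolding pick_def by (rule someI) (use that in auto)
  have same: "s (pick (N a)) = s a" if "a \<in> U" for a
  proof -
    let ?b = "pick (N a)"
    have "restr F (N ?b) (N ?b \<inter> N a) (s ?b) = restr F (N a) (N ?b \<inter> N a) (s a)"
      using compat pick that by blast
    then have "restr F (N a) (N a) (s ?b) = restr F (N a) (N a) (s a)" using pick[OF that] by simp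
    moreover have "s ?b \<in> sec F (N a)" using cov pick[OF that] by metis
    ultimately show ?thesis using sheaf_restr_id cov[OF that] by simp
  qed
  have un: "\<Union>?\<U> = U" using cov by blast
  have "\<exists>!t. t \<in> sec F (\<Union>?\<U>) \<and> (\<forall>V\<in>?\<U>. restr F (\<Union>?\<U>) V t = s (pick V))"
  proof (rule sheaf_glue_unique)
    fix V assume "V \<in> ?\<U>" then show "openin X V \<and> s (pick V) \<in> sec F V"
      using cov same by auto
  next
    fix V W assume "V \<in> ?\<U>" "W \<in> ?\<U>"
    then show "restr F V (V \<inter> W) (s (pick V)) = restr F W (V \<inter> W) (s (pick W))"
      using compat same by auto
  qed
  then obtain t where t: "t \<in> sec F (\<Union>?\<U>)" "\<forall>V\<in>?\<U>. restr F (\<Union>?\<U>) V t = s (pick V)" by blast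
  show ?thesis
    by (rule bexI[of _ t]) (use t same un in auto)
qed

end

section \<open>Sheaves of complex algebras and constant sections\<close>

locale ringed =
  fixes X :: "'a topology" and \<O> :: "('a, complex, 'r) presheaf"
  assumes alg: "sheaf_of_complex_algebras X \<O>"
begin

lemma O_sheaf: "sheaf_of_sets X \<O>" using alg by (simp add: sheaf_of_complex_algebras_def)

lemma O_algebra: "openin X U \<Longrightarrow> Module.algebra complex_ring (sections \<O> U)"
  using alg by (simp add: sheaf_of_complex_algebras_def)

lemma O_cring: "openin X U \<Longrightarrow> cring (sections \<O> U)"
  using O_algebra algebra.M_cring by blast

lemma O_module: "openin X U \<Longrightarrow> Module.module complex_ring (sections \<O> U)"
  using O_algebra algebra.axioms(1) by blast

lemma O_ring_hom: "openin X U \<Longrightarrow> V \<in> opens_in X U \<Longrightarrow> restr \<O> U V \<in> Ring.ring_hom (sections \<O> U) (sections \<O> V)"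
  using alg by (simp add: sheaf_of_complex_algebras_def)

lemmas O_restr_closed = sheaf_restr_closed[OF O_sheaf]
lemmas O_restr_restr = sheaf_restr_restr[OF O_sheaf]
lemmas O_restr_id = sheaf_restr_id[OF O_sheaf]
lemmas O_eqI = sheaf_eqI[OF O_sheaf]
lemmas O_glue_local = sheaf_glue_local[OF O_sheaf]

lemma O_restr_add:
  "openin X U \<Longrightarrow> V \<in> opens_in X U \<Longrightarrow> f \<in> sec \<O> U \<Longrightarrow> g \<in> sec \<O> U \<Longrightarrow>
   restr \<O> U V (f \<oplus>\<^bsub>sections \<O> U\<^esub> g) = restr \<O> U V f \<oplus>\<^bsub>sections \<O> V\<^esub> restr \<O> U V g"
  using O_ring_hom by (simp add: Ring.ring_hom_def)

lemma O_restr_mult: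
  "openin X U \<Longrightarrow> V \<in> opens_in X U \<Longrightarrow> f \<in> sec \<O> U \<Longrightarrow> g \<in> sec \<O> U \<Longrightarrow>
   restr \<O> U V (f \<otimes>\<^bsub>sections \<O> U\<^esub> g) = restr \<O> U V f \<otimes>\<^bsub>sections \<O> V\<^esub> restr \<O> U V g"
  using O_ring_hom by (simp add: Ring.ring_hom_def)

lemma O_restr_one:
  "openin X U \<Longrightarrow> V \<in> opens_in X U \<Longrightarrow> restr \<O> U V \<one>\<^bsub>sections \<O> U\<^esub> = \<one>\<^bsub>sections \<O> V\<^esub>"
  using O_ring_hom by (simp add: Ring.ring_hom_def)

lemma O_restr_smult:
  "openin X U \<Longrightarrow> V \<in> opens_in X U \<Longrightarrow> f \<in> sec \<O> U \<Longrightarrow>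
   restr \<O> U V (c \<odot>\<^bsub>sections \<O> U\<^esub> f) = c \<odot>\<^bsub>sections \<O> V\<^esub> restr \<O> U V f"
  using alg by (simp add: sheaf_of_complex_algebras_def complex_linear_def)

lemma O_ring_hom_ring:
  "openin X U \<Longrightarrow> V \<in> opens_in X U \<Longrightarrow> ring_hom_ring (sections \<O> U) (sections \<O> V) (restr \<O> U V)"
  using O_ring_hom O_cring by (auto intro!: ring_hom_ringI2 simp: opens_in_iff cring.axioms(1))

lemma O_restr_zero:
  "openin X U \<Longrightarrow> V \<in> opens_in X U \<Longrightarrow> restr \<O> U V \<zero>\<^bsub>sections \<O> U\<^esub> = \<zero>\<^bsub>sections \<O> V\<^esub>"
proof -
  assume "openin X U" "V \<in> opens_in X U"
  then interpret h: ring_hom_ring "sections \<O> U" "sections \<O> V" "restr \<O> U V" using O_ring_hom_ring by blast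
  show ?thesis by simp
qed

lemma O_restr_minus:
  assumes "openin X U" "V \<in> opens_in X U" "f \<in> sec \<O> U" "g \<in> sec \<O> U"
  shows "restr \<O> U V (f \<ominus>\<^bsub>sections \<O> U\<^esub> g) = restr \<O> U V f \<ominus>\<^bsub>sections \<O> V\<^esub> restr \<O> U V g"
proof -
  interpret h: ring_hom_ring "sections \<O> U" "sections \<O> V" "restr \<O> U V" using O_ring_hom_ring assms by blast
  show ?thesis using assms by (simp add: a_minus_def)
qed

text \<open>With these sections, complex scaling in a module sheaf becomes a case of multiplication
  by a section of \<O>, and the lemmas on the latter apply to it.\<close>

definition const :: "'a set \<Rightarrow> complex \<Rightarrow> 'r" where
  "const U c = c \<odot>\<^bsub>sections \<O> U\<^esub> \<one>\<^bsub>sections \<O> U\<^esub>"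

lemma complex_scale_const: "complex_scale \<O> F U c s = const U c \<odot>\<^bsub>sections F U\<^esub> s"
  by (simp add: complex_scale_def const_def)

lemma const_closed: "openin X U \<Longrightarrow> const U c \<in> sec \<O> U"
  using complex_module_smult_closed[OF O_module] cring.cring_simprules(6)[OF O_cring] by (simp add: const_def)

lemma restr_const: "openin X U \<Longrightarrow> V \<in> opens_in X U \<Longrightarrow> restr \<O> U V (const U c) = const V c"
  by (simp add: const_def O_restr_smult O_restr_one cring.cring_simprules(6)[OF O_cring])

lemma const_one: "openin X U \<Longrightarrow> const U 1 = \<one>\<^bsub>sections \<O> U\<^esub>"
  by (simp add: const_def complex_module_smult_one[OF O_module] cring.cring_simprules(6)[OF O_cring])

lemma const_add: "openin X U \<Longrightarrow> const U (c + d) = const U c \<oplus>\<^bsub>sections \<O> U\<^esub> const U d"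
  by (simp add: const_def complex_module_smult_l_distr[OF O_module] cring.cring_simprules(6)[OF O_cring])

lemma const_mult:
  assumes "openin X U" shows "const U (c * d) = const U c \<otimes>\<^bsub>sections \<O> U\<^esub> const U d"
proof -
  interpret A: Module.algebra complex_ring "sections \<O> U" using O_algebra assms .
  have "const U c \<otimes>\<^bsub>sections \<O> U\<^esub> const U d = c \<odot>\<^bsub>sections \<O> U\<^esub> (\<one>\<^bsub>sections \<O> U\<^esub> \<otimes>\<^bsub>sections \<O> U\<^esub> const U d)"
    using A.smult_assoc2[of c "\<one>\<^bsub>sections \<O> U\<^esub>" "const U d"] const_closed[OF assms] by (simp add: const_def)
  then show ?thesis using const_closed[OF assms]
    by (simp add: const_def complex_module_smult_assoc1[OF O_module[OF assms]])
qed

end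

section \<open>Modules over the structure sheaf and extension by zero\<close>

locale module_sheaf = ringed X \<O> for X :: "'a topology" and \<O> :: "('a, complex, 'r) presheaf" +
  fixes F :: "('a, 'r, 's) presheaf"
  assumes mods: "sheaf_of_modules X \<O> F"
begin

lemma sheaf: "sheaf_of_sets X F" using mods by (simp add: sheaf_of_modules_def)

lemma mod: "openin X U \<Longrightarrow> Module.module (sections \<O> U) (sections F U)"
  using mods by (simp add: sheaf_of_modules_def)

lemma grp: "openin X U \<Longrightarrow> abelian_group (sections F U)"
  using mod by (simp add: Module.module_def)

lemmas restr_closed = sheaf_restr_closed[OF sheaf]
lemmas restr_restr = sheaf_restr_restr[OF sheaf]
lemmas restr_id = sheaf_restr_id[OF sheaf]
lemmas eqI = sheaf_eqI[OF sheaf]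
lemmas eqI2 = sheaf_eqI2[OF sheaf]

lemma restr_add:
  "openin X U \<Longrightarrow> V \<in> opens_in X U \<Longrightarrow> s \<in> sec F U \<Longrightarrow> t \<in> sec F U \<Longrightarrow>
   restr F U V (s \<oplus>\<^bsub>sections F U\<^esub> t) = restr F U V s \<oplus>\<^bsub>sections F V\<^esub> restr F U V t"
  using mods by (simp add: sheaf_of_modules_def)

lemma restr_smult:
  "openin X U \<Longrightarrow> V \<in> opens_in X U \<Longrightarrow> f \<in> sec \<O> U \<Longrightarrow> s \<in> sec F U \<Longrightarrow>
   restr F U V (f \<odot>\<^bsub>sections F U\<^esub> s) = restr \<O> U V f \<odot>\<^bsub>sections F V\<^esub> restr F U V s"
  using mods by (simp add: sheaf_of_modules_def)

lemma zero_closed: "openin X U \<Longrightarrow> \<zero>\<^bsub>sections F U\<^esub> \<in> sec F U"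
  using grp by (simp add: abelian_group_def abelian_monoid.zero_closed)

lemma add_closed: "openin X U \<Longrightarrow> s \<in> sec F U \<Longrightarrow> t \<in> sec F U \<Longrightarrow> s \<oplus>\<^bsub>sections F U\<^esub> t \<in> sec F U"
  using grp by (simp add: abelian_group_def abelian_monoid.a_closed)

lemma smult_closed: "openin X U \<Longrightarrow> f \<in> sec \<O> U \<Longrightarrow> s \<in> sec F U \<Longrightarrow> f \<odot>\<^bsub>sections F U\<^esub> s \<in> sec F U"
  by (rule module.smult_closed[OF mod])

lemma smult_r_null: "openin X U \<Longrightarrow> f \<in> sec \<O> U \<Longrightarrow> f \<odot>\<^bsub>sections F U\<^esub> \<zero>\<^bsub>sections F U\<^esub> = \<zero>\<^bsub>sections F U\<^esub>"
  by (rule module.smult_r_null[OF mod])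

lemma smult_l_null: "openin X U \<Longrightarrow> s \<in> sec F U \<Longrightarrow> \<zero>\<^bsub>sections \<O> U\<^esub> \<odot>\<^bsub>sections F U\<^esub> s = \<zero>\<^bsub>sections F U\<^esub>"
  by (rule module.smult_l_null[OF mod])

lemma smult_one: "openin X U \<Longrightarrow> s \<in> sec F U \<Longrightarrow> \<one>\<^bsub>sections \<O> U\<^esub> \<odot>\<^bsub>sections F U\<^esub> s = s"
  by (rule module.smult_one[OF mod])

lemma smult_r_distr: "openin X U \<Longrightarrow> f \<in> sec \<O> U \<Longrightarrow> s \<in> sec F U \<Longrightarrow> t \<in> sec F U \<Longrightarrow>
   f \<odot>\<^bsub>sections F U\<^esub> (s \<oplus>\<^bsub>sections F U\<^esub> t) = f \<odot>\<^bsub>sections F U\<^esub> s \<oplus>\<^bsub>sections F U\<^esub> f \<odot>\<^bsub>sections F U\<^esub> t"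
  by (rule module.smult_r_distr[OF mod])

lemma smult_l_distr: "openin X U \<Longrightarrow> f \<in> sec \<O> U \<Longrightarrow> g \<in> sec \<O> U \<Longrightarrow> s \<in> sec F U \<Longrightarrow>
   (f \<oplus>\<^bsub>sections \<O> U\<^esub> g) \<odot>\<^bsub>sections F U\<^esub> s = f \<odot>\<^bsub>sections F U\<^esub> s \<oplus>\<^bsub>sections F U\<^esub> g \<odot>\<^bsub>sections F U\<^esub> s"
  by (rule module.smult_l_distr[OF mod])

lemma smult_assoc: "openin X U \<Longrightarrow> f \<in> sec \<O> U \<Longrightarrow> g \<in> sec \<O> U \<Longrightarrow> s \<in> sec F U \<Longrightarrow>
   (f \<otimes>\<^bsub>sections \<O> U\<^esub> g) \<odot>\<^bsub>sections F U\<^esub> s = f \<odot>\<^bsub>sections F U\<^esub> (g \<odot>\<^bsub>sections F U\<^esub> s)"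
  by (rule module.smult_assoc1[OF mod])

lemma smult_left_commute:
  assumes "openin X U" "f \<in> sec \<O> U" "g \<in> sec \<O> U" "s \<in> sec F U"
  shows "f \<odot>\<^bsub>sections F U\<^esub> (g \<odot>\<^bsub>sections F U\<^esub> s) = g \<odot>\<^bsub>sections F U\<^esub> (f \<odot>\<^bsub>sections F U\<^esub> s)"
  using smult_assoc[OF assms] smult_assoc[OF assms(1,3,2,4)] cring.cring_simprules(14)[OF O_cring] assms by metis

lemma minus_closed: "openin X U \<Longrightarrow> s \<in> sec F U \<Longrightarrow> t \<in> sec F U \<Longrightarrow> s \<ominus>\<^bsub>sections F U\<^esub> t \<in> sec F U"
  by (rule abelian_group.minus_closed[OF grp])

lemma smult_minus:
  assumes "openin X U" "f \<in> sec \<O> U" "s \<in> sec F U" "t \<in> sec F U"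
  shows "f \<odot>\<^bsub>sections F U\<^esub> (s \<ominus>\<^bsub>sections F U\<^esub> t) = f \<odot>\<^bsub>sections F U\<^esub> s \<ominus>\<^bsub>sections F U\<^esub> f \<odot>\<^bsub>sections F U\<^esub> t"
proof -
  interpret Module.module "sections \<O> U" "sections F U" using mod assms by blast
  show ?thesis using assms by (simp add: a_minus_def smult_r_distr smult_r_minus)
qed

lemma diff_zero: "openin X U \<Longrightarrow> \<zero>\<^bsub>sections F U\<^esub> \<ominus>\<^bsub>sections F U\<^esub> \<zero>\<^bsub>sections F U\<^esub> = \<zero>\<^bsub>sections F U\<^esub>"
  using grp abelian_group.r_neg[OF grp zero_closed] by (simp add: a_minus_def)

lemma diff_add_distrib:
  assumes "openin X U" "a \<in> sec F U" "b \<in> sec F U" "c \<in> sec F U" "d \<in> sec F U"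
  shows "(a \<oplus>\<^bsub>sections F U\<^esub> b) \<ominus>\<^bsub>sections F U\<^esub> (c \<oplus>\<^bsub>sections F U\<^esub> d)
    = (a \<ominus>\<^bsub>sections F U\<^esub> c) \<oplus>\<^bsub>sections F U\<^esub> (b \<ominus>\<^bsub>sections F U\<^esub> d)"
proof -
  interpret abelian_group "sections F U" using grp assms by blast
  show ?thesis using assms by (simp add: a_minus_def minus_add a_ac)
qed

lemma restr_zero:
  assumes "openin X U" "V \<in> opens_in X U"
  shows "restr F U V \<zero>\<^bsub>sections F U\<^esub> = \<zero>\<^bsub>sections F V\<^esub>"
proof -
  have V: "openin X V" using assms by (simp add: opens_in_iff)
  interpret U: Module.module "sections \<O> U" "sections F U" using mod assms by blast
  interpret V: Module.module "sections \<O> V" "sections F V" using mod V by blast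
  have "restr F U V (\<zero>\<^bsub>sections \<O> U\<^esub> \<odot>\<^bsub>sections F U\<^esub> \<zero>\<^bsub>sections F U\<^esub>) =
     \<zero>\<^bsub>sections \<O> V\<^esub> \<odot>\<^bsub>sections F V\<^esub> restr F U V \<zero>\<^bsub>sections F U\<^esub>"
    using assms by (simp only: restr_smult O_restr_zero U.R.zero_closed U.M.zero_closed)
  then show ?thesis using restr_closed[OF assms] by simp
qed

lemma restr_diff:
  assumes "openin X U" "V \<in> opens_in X U" "s \<in> sec F U" "t \<in> sec F U"
  shows "restr F U V (s \<ominus>\<^bsub>sections F U\<^esub> t) = restr F U V s \<ominus>\<^bsub>sections F V\<^esub> restr F U V t"
proof -
  have V: "openin X V" using assms by (simp add: opens_in_iff)
  interpret U: abelian_group "sections F U" using grp assms by blast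
  interpret V: abelian_group "sections F V" using grp V by blast
  have "restr F U V (\<ominus>\<^bsub>sections F U\<^esub> t) \<oplus>\<^bsub>sections F V\<^esub> restr F U V t = \<zero>\<^bsub>sections F V\<^esub>"
    using assms by (simp flip: restr_add add: U.l_neg restr_zero)
  then have "restr F U V (\<ominus>\<^bsub>sections F U\<^esub> t) = \<ominus>\<^bsub>sections F V\<^esub> restr F U V t"
    using assms by (simp add: V.minus_equality restr_closed)
  then show ?thesis using assms by (simp add: a_minus_def restr_add)
qed

lemma complex_scale_closed: "openin X U \<Longrightarrow> s \<in> sec F U \<Longrightarrow> complex_scale \<O> F U c s \<in> sec F U"
  by (simp add: complex_scale_const const_closed smult_closed)

lemma restr_complex_scale:
  "openin X U \<Longrightarrow> V \<in> opens_in X U \<Longrightarrow> s \<in> sec F U \<Longrightarrow>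
   restr F U V (complex_scale \<O> F U c s) = complex_scale \<O> F V c (restr F U V s)"
  by (simp add: complex_scale_const const_closed restr_smult restr_const)

text \<open>Extension by zero. Sections of an abstract sheaf are not functions, so the extension can
  only be described by its restrictions to \<open>V\<close> and to \<open>U - K\<close>; these sets
  cover \<open>U\<close> under the assumptions below, and gluing provides a unique such section
  whenever \<open>s\<close> vanishes off \<open>K\<close>.\<close>

definition extz :: "'a set \<Rightarrow> 'a set \<Rightarrow> 'a set \<Rightarrow> 's \<Rightarrow> 's" where
  "extz U V K s = (THE t. t \<in> sec F U \<and> restr F U V t = s \<and> restr F U (U - K) t = \<zero>\<^bsub>sections F (U - K)\<^esub>)"

context
  fixes U V K
  assumes UVK: "openin X U" "openin X V" "V \<subseteq> U" "openin X (U - K)" "U \<inter> K \<subseteq> V"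
begin

lemma extz_unique:
  assumes s: "s \<in> sec F V" and z: "restr F V (V - K) s = \<zero>\<^bsub>sections F (V - K)\<^esub>"
  shows "\<exists>!t. t \<in> sec F U \<and> restr F U V t = s \<and> restr F U (U - K) t = \<zero>\<^bsub>sections F (U - K)\<^esub>"
proof -
  let ?\<U> = "{V, U - K}" and ?s = "\<lambda>W. if W = V then s else \<zero>\<^bsub>sections F W\<^esub>"
  have VK: "V \<inter> (U - K) = V - K" using UVK by auto
  have VKo: "openin X (V - K)" using UVK VK by (metis openin_Int)
  \<comment> \<open>If the two members of the cover coincide, the family has one member only, and
    its two prescriptions have to agree.\<close>
  have s0: "s = \<zero>\<^bsub>sections F V\<^esub>" if "V = U - K"
  proof -
    have "V - K = V" using that by auto
    then show ?thesis using z sheaf_restr_id[OF sheaf UVK(2) s] by simp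
  qed
  have "\<exists>!t. t \<in> sec F (\<Union>?\<U>) \<and> (\<forall>W\<in>?\<U>. restr F (\<Union>?\<U>) W t = ?s W)"
  proof (rule sheaf_glue_unique[OF sheaf])
    fix W assume "W \<in> ?\<U>" then show "openin X W \<and> ?s W \<in> sec F W"
      using UVK s zero_closed by auto
  next
    have 1: "restr F V (V - K) s = restr F (U - K) (V - K) \<zero>\<^bsub>sections F (U - K)\<^esub>"
      using z restr_zero[OF UVK(4), of "V - K"] VKo Diff_mono[OF UVK(3) subset_refl, of K] by (simp add: opens_in_iff)
    have VK2: "(U - K) \<inter> V = V - K" using UVK by auto
    fix W W' assume "W \<in> ?\<U>" "W' \<in> ?\<U>"
    then consider "W = W'" | "W = V" "W' = U - K" "W' \<noteq> V" | "W' = V" "W = U - K" "W \<noteq> V" by blast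
    then show "restr F W (W \<inter> W') (?s W) = restr F W' (W \<inter> W') (?s W')"
    proof cases
      case 2
      have "restr F V (V \<inter> W') s = restr F W' (V \<inter> W') \<zero>\<^bsub>sections F W'\<^esub>" unfolding 2(2) VK by (rule 1)
      then show ?thesis using 2(1,3) by simp
    next
      case 3
      have "restr F W (W \<inter> V) \<zero>\<^bsub>sections F W\<^esub> = restr F V (W \<inter> V) s" unfolding 3(2) VK2 by (rule 1[symmetric])
      then show ?thesis using 3(1,3) by simp
    qed simp
  qed
  moreover have "\<Union>?\<U> = U" using UVK by auto
  moreover have "(\<forall>W\<in>?\<U>. restr F U W t = ?s W) \<longleftrightarrow>
      restr F U V t = s \<and> restr F U (U - K) t = \<zero>\<^bsub>sections F (U - K)\<^esub>" for t
    using s0 by auto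
  ultimately show ?thesis by simp
qed

lemma extz:
  assumes "s \<in> sec F V" "restr F V (V - K) s = \<zero>\<^bsub>sections F (V - K)\<^esub>"
  shows extz_closed: "extz U V K s \<in> sec F U" and restr_extz: "restr F U V (extz U V K s) = s"
    and extz_zero: "restr F U (U - K) (extz U V K s) = \<zero>\<^bsub>sections F (U - K)\<^esub>"
  using theI'[OF extz_unique[OF assms]] unfolding extz_def by blast+

text \<open>That \<open>s\<close> is a section vanishing off \<open>K\<close> is deduced from
  \<open>t\<close>. Identities for extensions thus reduce to two restrictions of the proposed
  extension.\<close>

lemma extz_eqI:
  assumes "t \<in> sec F U" "restr F U V t = s" "restr F U (U - K) t = \<zero>\<^bsub>sections F (U - K)\<^esub>"
  shows "extz U V K s = t"
proof -
  have "V \<inter> (U - K) = V - K" using UVK by auto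
  then have VKo: "V - K \<in> opens_in X V" "V - K \<in> opens_in X (U - K)" "V \<in> opens_in X U" "U - K \<in> opens_in X U"
    using UVK openin_Int[OF UVK(2,4)] by (auto simp: opens_in_iff)
  have "s \<in> sec F V" using assms UVK VKo restr_closed by blast
  moreover have "restr F V (V - K) s = restr F (U - K) (V - K) (restr F U (U - K) t)"
    unfolding assms(2)[symmetric] using restr_restr[OF UVK(1) VKo(3,1) assms(1)] restr_restr[OF UVK(1) VKo(4,2) assms(1)] by simp
  then have "restr F V (V - K) s = \<zero>\<^bsub>sections F (V - K)\<^esub>" using assms(3) restr_zero[OF UVK(4) VKo(2)] by simp
  ultimately show ?thesis using the1_equality[OF extz_unique] assms unfolding extz_def by blast
qed

end

end

section \<open>Differential operators\<close>

locale two_module_sheaves =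
  ringed X \<O> + F: module_sheaf X \<O> F + G: module_sheaf X \<O> G
  for X :: "'a topology" and \<O> :: "('a, complex, 'r) presheaf"
    and F :: "('a, 'r, 's) presheaf" and G :: "('a, 'r, 't) presheaf"
begin

text \<open>Keeps from \<open>sheaf_homs\<close> only what a commutator visibly inherits: it is
  additive and compatible with restriction, but it is not cut down to its domain as
  \<open>sheaf_homs\<close> demands.\<close>

definition additive_hom :: "'a set \<Rightarrow> ('a set \<Rightarrow> 's \<Rightarrow> 't) \<Rightarrow> bool" where
  "additive_hom U D \<longleftrightarrow> (\<forall>V\<in>opens_in X U.
     (\<forall>s\<in>sec F V. D V s \<in> sec G V) \<and>
     (\<forall>s\<in>sec F V. \<forall>t\<in>sec F V. D V (s \<oplus>\<^bsub>sections F V\<^esub> t) = D V s \<oplus>\<^bsub>sections G V\<^esub> D V t) \<and>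
     (\<forall>W\<in>opens_in X V. \<forall>s\<in>sec F V. restr G V W (D V s) = D W (restr F V W s)))"

lemma additive_homD:
  assumes "additive_hom U D" "V \<in> opens_in X U"
  shows additive_hom_closed: "s \<in> sec F V \<Longrightarrow> D V s \<in> sec G V"
    and additive_hom_add: "s \<in> sec F V \<Longrightarrow> t \<in> sec F V \<Longrightarrow>
      D V (s \<oplus>\<^bsub>sections F V\<^esub> t) = D V s \<oplus>\<^bsub>sections G V\<^esub> D V t"
    and additive_hom_restr: "W \<in> opens_in X V \<Longrightarrow> s \<in> sec F V \<Longrightarrow> restr G V W (D V s) = D W (restr F V W s)"
  using assms unfolding additive_hom_def by blast+

lemma additive_hom_zero:
  assumes "additive_hom U D" "V \<in> opens_in X U"
  shows "D V \<zero>\<^bsub>sections F V\<^esub> = \<zero>\<^bsub>sections G V\<^esub>"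
proof -
  have V: "openin X V" using assms by (simp add: opens_in_iff)
  interpret F': abelian_group "sections F V" using F.grp V .
  interpret G': abelian_group "sections G V" using G.grp V .
  have "D V \<zero>\<^bsub>sections F V\<^esub> \<oplus>\<^bsub>sections G V\<^esub> D V \<zero>\<^bsub>sections F V\<^esub> = D V \<zero>\<^bsub>sections F V\<^esub>"
    using additive_hom_add[OF assms F'.zero_closed F'.zero_closed] by simp
  then show ?thesis
    using additive_hom_closed[OF assms F'.zero_closed] by (metis G'.add.l_cancel_one')
qed

lemma additive_hom_subset: "additive_hom U D \<Longrightarrow> V \<subseteq> U \<Longrightarrow> additive_hom V D"
  unfolding additive_hom_def by (rule ballI, erule bspec) (auto simp: opens_in_iff)

lemma sheaf_homs_additive: "D \<in> sheaf_homs X \<O> F G U \<Longrightarrow> additive_hom U D"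
  unfolding sheaf_homs_def additive_hom_def by auto

abbreviation comm where "comm U \<equiv> commutator \<O> F G U"

lemma comm_apply: "comm U D f V s =
    D V (restr \<O> U V f \<odot>\<^bsub>sections F V\<^esub> s) \<ominus>\<^bsub>sections G V\<^esub> (restr \<O> U V f \<odot>\<^bsub>sections G V\<^esub> D V s)"
  by (simp add: commutator_def)

lemma additive_hom_comm:
  assumes U: "openin X U" and D: "additive_hom U D" and f: "f \<in> sec \<O> U"
  shows "additive_hom U (comm U D f)"
  unfolding additive_hom_def
proof (intro ballI conjI)
  fix V assume V: "V \<in> opens_in X U"
  then have Vo: "openin X V" by (simp add: opens_in_iff)
  note cl = additive_hom_closed[OF D V]
  have fV: "restr \<O> U V f \<in> sec \<O> V" using O_restr_closed U V f .
  fix s assume s: "s \<in> sec F V"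
  show "comm U D f V s \<in> sec G V"
    unfolding comm_apply using Vo s fV by (intro G.minus_closed G.smult_closed cl F.smult_closed)
  { fix t assume t: "t \<in> sec F V"
    show "comm U D f V (s \<oplus>\<^bsub>sections F V\<^esub> t) = comm U D f V s \<oplus>\<^bsub>sections G V\<^esub> comm U D f V t"
      unfolding comm_apply using Vo s t fV
      by (simp add: F.smult_r_distr additive_hom_add[OF D V] F.smult_closed cl G.smult_r_distr
          G.diff_add_distrib G.smult_closed) }
  fix W assume W: "W \<in> opens_in X V"
  then have WU: "W \<in> opens_in X U" using V by (auto simp: opens_in_iff)
  show "restr G V W (comm U D f V s) = comm U D f W (restr F V W s)"
    unfolding comm_apply using Vo s fV W
    by (simp add: G.restr_diff cl F.smult_closed G.smult_closed G.restr_smult additive_hom_restr[OF D V]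
        F.restr_smult O_restr_restr[OF U V W f])
qed

abbreviation comms where "comms U \<equiv> foldl (comm U)"

lemma additive_hom_comms:
  "openin X U \<Longrightarrow> additive_hom U D \<Longrightarrow> set fs \<subseteq> sec \<O> U \<Longrightarrow> additive_hom U (comms U D fs)"
  by (induction fs arbitrary: D) (auto simp: additive_hom_comm)

text \<open>Iterated commutators are local: below V' only the restrictions of the functions and the
  action of the operator there matter. Both operators are generalised in the induction because the
  head of the list replaces each by its commutator.\<close>

lemma comms_agree:
  assumes V: "openin X V" "V' \<in> opens_in X V" and "set fs \<subseteq> sec \<O> V"
    and "\<And>W s. W \<in> opens_in X V' \<Longrightarrow> s \<in> sec F W \<Longrightarrow> D W s = E W s"
    and "W \<in> opens_in X V'" "s \<in> sec F W"
  shows "comms V D fs W s = comms V' E (map (restr \<O> V V') fs) W s"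
  using assms(3-)
proof (induction fs arbitrary: D E W s)
  case (Cons f fs)
  have "comms V (comm V D f) fs W s = comms V' (comm V' E (restr \<O> V V' f)) (map (restr \<O> V V') fs) W s"
  proof (rule Cons.IH)
    fix W s assume W: "W \<in> opens_in X V'" and s: "s \<in> sec F W"
    then have Wo: "openin X W" and WV: "W \<in> opens_in X V" using V by (auto simp: opens_in_iff)
    have "restr \<O> V W f \<odot>\<^bsub>sections F W\<^esub> s \<in> sec F W"
      using F.smult_closed[OF Wo O_restr_closed[OF V(1) WV] s] Cons.prems by simp
    then show "comm V D f W s = comm V' E (restr \<O> V V' f) W s"
      using Cons.prems s W V by (simp add: comm_apply O_restr_restr)
  qed (use Cons.prems in auto)
  then show ?case by simp
qed simp

lemma map_restr_id: "openin X V \<Longrightarrow> set fs \<subseteq> sec \<O> V \<Longrightarrow> map (restr \<O> V V) fs = fs"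
  by (rule map_idI) (auto simp: O_restr_id)

lemma comms_cong:
  assumes V: "openin X V" and fs: "set fs \<subseteq> sec \<O> V"
    and "\<And>W s. W \<in> opens_in X V \<Longrightarrow> s \<in> sec F W \<Longrightarrow> D W s = E W s"
    and "W \<in> opens_in X V" "s \<in> sec F W"
  shows "comms V D fs W s = comms V E fs W s"
proof -
  have "V \<in> opens_in X V" using V by (simp add: opens_in_iff)
  from comms_agree[OF V this fs assms(3-5)] show ?thesis using map_restr_id[OF V fs] by simp
qed

text \<open>Multiplications by sections commute, so [D \<circ> e, f] = [D, f] \<circ> e, and this
  identity is iterated.\<close>

lemma comms_mult_right:
  assumes V: "openin X V" and e: "e \<in> sec \<O> V" and "set fs \<subseteq> sec \<O> V"
    and "\<And>W s. W \<in> opens_in X V \<Longrightarrow> s \<in> sec F W \<Longrightarrow> D' W s = D W (restr \<O> V W e \<odot>\<^bsub>sections F W\<^esub> s)"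
    and "W \<in> opens_in X V" "s \<in> sec F W"
  shows "comms V D' fs W s = comms V D fs W (restr \<O> V W e \<odot>\<^bsub>sections F W\<^esub> s)"
  using assms(3-)
proof (induction fs arbitrary: D' D W s)
  case (Cons f fs)
  have "comms V (comm V D' f) fs W s = comms V (comm V D f) fs W (restr \<O> V W e \<odot>\<^bsub>sections F W\<^esub> s)"
  proof (rule Cons.IH)
    fix W s assume W: "W \<in> opens_in X V" and s: "s \<in> sec F W"
    then have Wo: "openin X W" by (auto simp: opens_in_iff)
    have f: "restr \<O> V W f \<in> sec \<O> W" and e': "restr \<O> V W e \<in> sec \<O> W"
      using O_restr_closed[OF V W] e Cons.prems by auto
    show "comm V D' f W s = comm V D f W (restr \<O> V W e \<odot>\<^bsub>sections F W\<^esub> s)"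
      unfolding comm_apply Cons.prems(2)[OF W s] Cons.prems(2)[OF W F.smult_closed[OF Wo f s]]
        F.smult_left_commute[OF Wo e' f s] ..
  qed (use Cons.prems in auto)
  then show ?case by simp
qed simp

lemma comms_add:
  assumes V: "openin X V" and "set fs \<subseteq> sec \<O> V" and "additive_hom V D" "additive_hom V E"
    and "\<And>W s. W \<in> opens_in X V \<Longrightarrow> s \<in> sec F W \<Longrightarrow> D' W s = D W s \<oplus>\<^bsub>sections G W\<^esub> E W s"
    and "W \<in> opens_in X V" "s \<in> sec F W"
  shows "comms V D' fs W s = comms V D fs W s \<oplus>\<^bsub>sections G W\<^esub> comms V E fs W s"
  using assms(2-)
proof (induction fs arbitrary: D' D E W s)
  case (Cons f fs)
  have "comms V (comm V D' f) fs W s = comms V (comm V D f) fs W s \<oplus>\<^bsub>sections G W\<^esub> comms V (comm V E f) fs W s"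
  proof (rule Cons.IH)
    fix W s assume W: "W \<in> opens_in X V" and s: "s \<in> sec F W"
    then have Wo: "openin X W" by (auto simp: opens_in_iff)
    have f: "restr \<O> V W f \<in> sec \<O> W" using O_restr_closed[OF V W] Cons.prems by auto
    note fs = F.smult_closed[OF Wo f s]
    note cl = additive_hom_closed[OF Cons.prems(2) W] additive_hom_closed[OF Cons.prems(3) W]
    show "comm V D' f W s = comm V D f W s \<oplus>\<^bsub>sections G W\<^esub> comm V E f W s"
      unfolding comm_apply Cons.prems(4)[OF W s] Cons.prems(4)[OF W fs]
      using cl[OF s] cl[OF fs] Wo f by (simp add: G.smult_r_distr G.diff_add_distrib G.smult_closed)
  qed (use Cons.prems additive_hom_comm[OF V] in auto)
  then show ?case by simp
qed simp

text \<open>The counterpart on the target side, [g D, f] = g [D, f]. With \<open>g\<close> constant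
  it gives the order of a complex multiple.\<close>

lemma comms_mult_left:
  assumes V: "openin X V" and g: "g \<in> sec \<O> V" and "set fs \<subseteq> sec \<O> V" and "additive_hom V D"
    and "\<And>W s. W \<in> opens_in X V \<Longrightarrow> s \<in> sec F W \<Longrightarrow> D' W s = restr \<O> V W g \<odot>\<^bsub>sections G W\<^esub> D W s"
    and "W \<in> opens_in X V" "s \<in> sec F W"
  shows "comms V D' fs W s = restr \<O> V W g \<odot>\<^bsub>sections G W\<^esub> comms V D fs W s"
  using assms(3-)
proof (induction fs arbitrary: D' D W s)
  case (Cons f fs)
  have "comms V (comm V D' f) fs W s = restr \<O> V W g \<odot>\<^bsub>sections G W\<^esub> comms V (comm V D f) fs W s"
  proof (rule Cons.IH)
    fix W s assume W: "W \<in> opens_in X V" and s: "s \<in> sec F W"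
    then have Wo: "openin X W" by (auto simp: opens_in_iff)
    have f: "restr \<O> V W f \<in> sec \<O> W" and g': "restr \<O> V W g \<in> sec \<O> W"
      using O_restr_closed[OF V W] g Cons.prems by auto
    note fs = F.smult_closed[OF Wo f s]
    note cl = additive_hom_closed[OF Cons.prems(2) W]
    show "comm V D' f W s = restr \<O> V W g \<odot>\<^bsub>sections G W\<^esub> comm V D f W s"
      unfolding comm_apply Cons.prems(3)[OF W s] Cons.prems(3)[OF W fs]
      using cl[OF s] cl[OF fs] Wo f g'
      by (simp add: G.smult_minus G.smult_closed G.smult_left_commute[OF Wo f g'])
  qed (use Cons.prems additive_hom_comm[OF V] in auto)
  then show ?case by simp
qed simp

section \<open>Order, vanishing and support of operators\<close>

abbreviation ord where "ord \<equiv> order_le X \<O> F G"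
abbreviation van where "van \<equiv> vanishes_on X F G"

lemma ord_iff: "ord U r D \<longleftrightarrow> (\<forall>V\<in>opens_in X U. \<forall>fs. length fs = Suc r \<and> set fs \<subseteq> sec \<O> V \<longrightarrow>
   (\<forall>W\<in>opens_in X V. \<forall>s\<in>sec F W. comms V D fs W s = \<zero>\<^bsub>sections G W\<^esub>))"
  by (simp add: order_le_def vanishes_on_def)

lemma ordI:
  assumes "\<And>V fs W s. V \<in> opens_in X U \<Longrightarrow> openin X V \<Longrightarrow> length fs = Suc r \<Longrightarrow> set fs \<subseteq> sec \<O> V \<Longrightarrow>
    W \<in> opens_in X V \<Longrightarrow> s \<in> sec F W \<Longrightarrow> comms V D fs W s = \<zero>\<^bsub>sections G W\<^esub>"
  shows "ord U r D"
  unfolding ord_iff using assms by (simp add: opens_in_iff)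

lemma ordD:
  assumes "ord U r D" "V \<in> opens_in X U" "length fs = Suc r" "set fs \<subseteq> sec \<O> V"
    "W \<in> opens_in X V" "s \<in> sec F W"
  shows "comms V D fs W s = \<zero>\<^bsub>sections G W\<^esub>"
  using assms unfolding ord_iff by blast

lemma ord_subset: "ord U r D \<Longrightarrow> V \<subseteq> U \<Longrightarrow> ord V r D"
  unfolding order_le_def by (rule ballI, erule bspec) (auto simp: opens_in_iff)

lemma ord_cong:
  assumes "\<And>W s. W \<in> opens_in X U \<Longrightarrow> s \<in> sec F W \<Longrightarrow> D W s = E W s" and E: "ord U r E"
  shows "ord U r D"
proof (rule ordI)
  fix V fs W s assume *: "V \<in> opens_in X U" "openin X V" "length fs = Suc r" "set fs \<subseteq> sec \<O> V"
    "W \<in> opens_in X V" "s \<in> sec F W"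
  have "comms V D fs W s = comms V E fs W s"
    by (rule comms_cong) (use * assms(1) in \<open>auto simp: opens_in_iff\<close>)
  then show "comms V D fs W s = \<zero>\<^bsub>sections G W\<^esub>" using ordD[OF E] * by simp
qed

text \<open>An iterated commutator is compatible with restriction, so its vanishing may be checked
  near each point. There it is the commutator with the restricted functions, to which the local
  bound applies.\<close>

lemma ord_local:
  assumes D: "additive_hom U D"
    and loc: "\<And>a. a \<in> U \<Longrightarrow> \<exists>W\<in>opens_in X U. a \<in> W \<and> ord W r D"
  shows "ord U r D"
proof (rule ordI)
  fix V fs W s assume V: "V \<in> opens_in X U" "openin X V" and fs: "length fs = Suc r" "set fs \<subseteq> sec \<O> V"
    and W: "W \<in> opens_in X V" and s: "s \<in> sec F W"
  have Wo: "openin X W" "W \<subseteq> V" "V \<subseteq> U" using V W by (auto simp: opens_in_iff)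
  have h: "additive_hom V (comms V D fs)"
    using additive_hom_comms V fs additive_hom_subset[OF D] Wo by blast
  show "comms V D fs W s = \<zero>\<^bsub>sections G W\<^esub>"
  proof (rule G.eqI[OF Wo(1) additive_hom_closed[OF h W s] G.zero_closed[OF Wo(1)]])
    fix a assume a: "a \<in> W"
    then obtain N where N: "N \<in> opens_in X U" "a \<in> N" "ord N r D" using loc Wo by blast
    let ?M = "N \<inter> W"
    have M: "?M \<in> opens_in X W" "?M \<in> opens_in X N" "?M \<in> opens_in X V" "?M \<in> opens_in X ?M"
      using N Wo by (auto simp: opens_in_iff)
    note sM = F.restr_closed[OF Wo(1) M(1) s]
    have "restr G W ?M (comms V D fs W s) = comms V D fs ?M (restr F W ?M s)"
      by (rule additive_hom_restr[OF h W M(1) s])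
    also have "\<dots> = comms ?M D (map (restr \<O> V ?M) fs) ?M (restr F W ?M s)"
      by (rule comms_agree) (use V M fs sM in auto)
    also have "\<dots> = \<zero>\<^bsub>sections G ?M\<^esub>"
      by (rule ordD[OF N(3)]) (use M fs sM O_restr_closed[OF V(2) M(3)] in auto)
    finally show "\<exists>M\<in>opens_in X W. a \<in> M \<and> restr G W M (comms V D fs W s) = restr G W M \<zero>\<^bsub>sections G W\<^esub>"
      using M N(2) a G.restr_zero[OF Wo(1) M(1)] by (intro bexI[of _ ?M]) auto
  qed
qed

lemma ord_Suc:
  assumes "openin X U" "ord U r D" shows "ord U (Suc r) D"
proof (rule ordI)
  fix V fs W s assume V: "V \<in> opens_in X U" "openin X V" and fs: "length fs = Suc (Suc r)" "set fs \<subseteq> sec \<O> V"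
    and W: "W \<in> opens_in X V" and s: "s \<in> sec F W"
  \<comment> \<open>\<open>foldl\<close> applies the last function outermost. Splitting it off
    leaves a commutator with an operator that already vanishes.\<close>
  obtain gs g where gs: "fs = gs @ [g]" using fs(1) by (metis length_Suc_conv_rev)
  have Wo: "openin X W" using W by (simp add: opens_in_iff)
  have g: "restr \<O> V W g \<in> sec \<O> W" using O_restr_closed[OF V(2) W] fs gs by simp
  have z: "comms V D gs W t = \<zero>\<^bsub>sections G W\<^esub>" if "t \<in> sec F W" for t
    using ordD[OF assms(2) V(1) _ _ W that] fs gs by simp
  show "comms V D fs W s = \<zero>\<^bsub>sections G W\<^esub>"
    using z[OF s] z[OF F.smult_closed[OF Wo g s]] G.smult_r_null[OF Wo g] G.diff_zero[OF Wo]
    by (simp add: gs comm_apply)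
qed

lemma ord_mono:
  assumes "openin X U" "ord U r D" "r \<le> r'"
  shows "ord U r' D"
  using assms(3) by (induction r' rule: dec_induct) (use assms in \<open>auto simp: ord_Suc\<close>)

lemma ord_add:
  assumes "ord U r D" "ord U r E" "additive_hom U D" "additive_hom U E"
    and "\<And>W s. W \<in> opens_in X U \<Longrightarrow> s \<in> sec F W \<Longrightarrow> D' W s = D W s \<oplus>\<^bsub>sections G W\<^esub> E W s"
  shows "ord U r D'"
proof (rule ordI)
  fix V fs W s assume V: "V \<in> opens_in X U" "openin X V" and fs: "length fs = Suc r" "set fs \<subseteq> sec \<O> V"
    and W: "W \<in> opens_in X V" and s: "s \<in> sec F W"
  have "comms V D' fs W s = comms V D fs W s \<oplus>\<^bsub>sections G W\<^esub> comms V E fs W s"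
    by (rule comms_add) (use V fs W s assms in \<open>auto simp: opens_in_iff additive_hom_subset\<close>)
  then show "comms V D' fs W s = \<zero>\<^bsub>sections G W\<^esub>"
    using ordD[OF assms(1) V(1) fs W s] ordD[OF assms(2) V(1) fs W s] W
      abelian_monoid.l_zero[OF abelian_group.axioms(1)[OF G.grp] G.zero_closed]
    by (simp add: opens_in_iff)
qed

lemma ord_mult_left:
  assumes U: "openin X U" "g \<in> sec \<O> U" "ord U r D" "additive_hom U D"
    and D': "\<And>W s. W \<in> opens_in X U \<Longrightarrow> s \<in> sec F W \<Longrightarrow> D' W s = restr \<O> U W g \<odot>\<^bsub>sections G W\<^esub> D W s"
  shows "ord U r D'"
proof (rule ordI)
  fix V fs W s assume V: "V \<in> opens_in X U" "openin X V" and fs: "length fs = Suc r" "set fs \<subseteq> sec \<O> V"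
    and W: "W \<in> opens_in X V" and s: "s \<in> sec F W"
  note g = O_restr_closed[OF U(1) V(1) U(2)]
  have "comms V D' fs W s = restr \<O> V W (restr \<O> U V g) \<odot>\<^bsub>sections G W\<^esub> comms V D fs W s"
  proof (rule comms_mult_left[OF V(2) g fs(2)])
    fix W s assume W: "W \<in> opens_in X V" "s \<in> sec F W"
    then have "W \<in> opens_in X U" using V by (auto simp: opens_in_iff)
    then show "D' W s = restr \<O> V W (restr \<O> U V g) \<odot>\<^bsub>sections G W\<^esub> D W s"
      using D' W O_restr_restr[OF U(1) V(1) W(1) U(2)] by simp
  qed (use V W s assms in \<open>auto simp: opens_in_iff additive_hom_subset\<close>)
  then show "comms V D' fs W s = \<zero>\<^bsub>sections G W\<^esub>"
    using ordD[OF assms(3) V(1) fs W s] W G.smult_r_null[OF _ O_restr_closed[OF V(2) W g]]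
    by (simp add: opens_in_iff)
qed

lemma ord_mult_right:
  assumes U: "openin X U" "e \<in> sec \<O> U" "ord U r D"
    and D': "\<And>W s. W \<in> opens_in X U \<Longrightarrow> s \<in> sec F W \<Longrightarrow> D' W s = D W (restr \<O> U W e \<odot>\<^bsub>sections F W\<^esub> s)"
  shows "ord U r D'"
proof (rule ordI)
  fix V fs W s assume V: "V \<in> opens_in X U" "openin X V" and fs: "length fs = Suc r" "set fs \<subseteq> sec \<O> V"
    and W: "W \<in> opens_in X V" and s: "s \<in> sec F W"
  have Wo: "openin X W" using W by (simp add: opens_in_iff)
  note e = O_restr_closed[OF U(1) V(1) U(2)]
  have "comms V D' fs W s = comms V D fs W (restr \<O> V W (restr \<O> U V e) \<odot>\<^bsub>sections F W\<^esub> s)"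
  proof (rule comms_mult_right[OF V(2) e fs(2)])
    fix W s assume W: "W \<in> opens_in X V" "s \<in> sec F W"
    then have "W \<in> opens_in X U" using V by (auto simp: opens_in_iff)
    then show "D' W s = D W (restr \<O> V W (restr \<O> U V e) \<odot>\<^bsub>sections F W\<^esub> s)"
      using D' W O_restr_restr[OF U(1) V(1) W(1) U(2)] by simp
  qed (use V W s assms in \<open>auto simp: opens_in_iff\<close>)
  then show "comms V D' fs W s = \<zero>\<^bsub>sections G W\<^esub>"
    using ordD[OF assms(3) V(1) fs W F.smult_closed[OF Wo O_restr_closed[OF V(2) W e] s]] by simp
qed

text \<open>Provides any desired order bound off the support, so that order bounds have to be
  established only near it.\<close>

lemma van_ord:
  assumes U: "openin X U" and v: "van U D"
  shows "ord U r D"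
proof (rule ordI)
  fix V fs W s assume V: "V \<in> opens_in X U" "openin X V" and fs: "length fs = Suc r" "set fs \<subseteq> sec \<O> V"
    and W: "W \<in> opens_in X V" and s: "s \<in> sec F W"
  have vV: "D W s = \<zero>\<^bsub>sections G W\<^esub>" if "W \<in> opens_in X V" "s \<in> sec F W" for W s
    using v V that by (auto simp: vanishes_on_def opens_in_iff)
  have "comms V D fs W s = \<zero>\<^bsub>sections G W\<^esub>" using fs(2) vV W s
  proof (induction fs arbitrary: D W s)
    case (Cons f fs)
    have "comms V (comm V D f) fs W s = \<zero>\<^bsub>sections G W\<^esub>"
    proof (rule Cons.IH)
      fix W s assume W: "W \<in> opens_in X V" and s: "s \<in> sec F W"
      have Wo: "openin X W" using W by (simp add: opens_in_iff)
      have f: "restr \<O> V W f \<in> sec \<O> W" using O_restr_closed[OF V(2) W] Cons.prems by simp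
      show "comm V D f W s = \<zero>\<^bsub>sections G W\<^esub>"
        unfolding comm_apply Cons.prems(2)[OF W s] Cons.prems(2)[OF W F.smult_closed[OF Wo f s]]
        by (simp add: G.smult_r_null[OF Wo f] G.diff_zero[OF Wo])
    qed (use Cons.prems in auto)
    then show ?case by simp
  qed simp
  then show "comms V D fs W s = \<zero>\<^bsub>sections G W\<^esub>" .
qed

lemma van_local:
  assumes D: "additive_hom U D"
    and loc: "\<And>a. a \<in> U \<Longrightarrow> \<exists>W\<in>opens_in X U. a \<in> W \<and> van W D"
  shows "van U D"
  unfolding vanishes_on_def
proof (intro ballI)
  fix V s assume V: "V \<in> opens_in X U" and s: "s \<in> sec F V"
  then have Vo: "openin X V" "V \<subseteq> U" by (auto simp: opens_in_iff)
  show "D V s = \<zero>\<^bsub>sections G V\<^esub>"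
  proof (rule G.eqI[OF Vo(1) additive_hom_closed[OF D V s] G.zero_closed[OF Vo(1)]])
    fix a assume a: "a \<in> V"
    then obtain N where N: "N \<in> opens_in X U" "a \<in> N" "van N D" using loc Vo by blast
    have M: "N \<inter> V \<in> opens_in X V" "N \<inter> V \<in> opens_in X N" using N Vo by (auto simp: opens_in_iff)
    have "restr G V (N \<inter> V) (D V s) = \<zero>\<^bsub>sections G (N \<inter> V)\<^esub>"
      using additive_hom_restr[OF D V M(1) s] N(3) M(2) F.restr_closed[OF Vo(1) M(1) s]
      by (simp add: vanishes_on_def)
    then show "\<exists>M\<in>opens_in X V. a \<in> M \<and> restr G V M (D V s) = restr G V M \<zero>\<^bsub>sections G V\<^esub>"
      using M N(2) a G.restr_zero[OF Vo(1) M(1)] by (intro bexI[of _ "N \<inter> V"]) auto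
  qed
qed

lemma van_subset: "van U D \<Longrightarrow> V \<subseteq> U \<Longrightarrow> van V D"
  unfolding vanishes_on_def by (rule ballI, erule bspec) (auto simp: opens_in_iff)

text \<open>A homomorphism of sheaves cannot enlarge supports, because it commutes with restriction
  and maps zero to zero.\<close>

lemma additive_hom_local:
  assumes D: "additive_hom U D" and V: "V \<in> opens_in X U" and W: "W \<in> opens_in X V" and s: "s \<in> sec F V"
    and z: "restr F V W s = \<zero>\<^bsub>sections F W\<^esub>"
  shows "restr G V W (D V s) = \<zero>\<^bsub>sections G W\<^esub>"
proof -
  have "W \<in> opens_in X U" using V W by (auto simp: opens_in_iff)
  then show ?thesis using additive_hom_restr[OF D V W s] z additive_hom_zero[OF D] by simp
qed

text \<open>The complement of the support is the union of all open sets on which \<open>D\<close>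
  vanishes. That \<open>D\<close> vanishes on the union as well is locality of sections of
  \<open>G\<close>.\<close>

lemma
  assumes D: "additive_hom U D"
  shows openin_minus_op_support: "openin X (U - op_support X F G U D)"
    and van_op_support: "van (U - op_support X F G U D) D"
proof -
  let ?W = "\<Union>{V \<in> opens_in X U. van V D}"
  have W: "?W \<subseteq> U" "openin X ?W" by (auto simp: opens_in_iff)
  have eq: "U - op_support X F G U D = ?W" using W by (auto simp: op_support_def)
  show "openin X (U - op_support X F G U D)" unfolding eq by (rule W)
  show "van (U - op_support X F G U D) D" unfolding eq
  proof (rule van_local[OF additive_hom_subset[OF D W(1)]])
    fix a assume "a \<in> ?W"
    then obtain V where "V \<in> opens_in X U" "van V D" "a \<in> V" by auto
    then show "\<exists>V\<in>opens_in X ?W. a \<in> V \<and> van V D"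
      by (intro bexI[of _ V]) (auto simp: opens_in_iff)
  qed
qed

lemma op_support_subsetI:
  assumes "openin X (U - K)" "van (U - K) D"
  shows "op_support X F G U D \<subseteq> K"
  using assms by (auto simp: op_support_def opens_in_iff)

end

lemma (in module_sheaf)
  assumes "openin X U"
  shows complex_scale_add_left: "s \<in> sec F U \<Longrightarrow> complex_scale \<O> F U (c + d) s =
      complex_scale \<O> F U c s \<oplus>\<^bsub>sections F U\<^esub> complex_scale \<O> F U d s"
    and complex_scale_add: "s \<in> sec F U \<Longrightarrow> t \<in> sec F U \<Longrightarrow>
      complex_scale \<O> F U c (s \<oplus>\<^bsub>sections F U\<^esub> t) =
      complex_scale \<O> F U c s \<oplus>\<^bsub>sections F U\<^esub> complex_scale \<O> F U c t"
    and complex_scale_mult: "s \<in> sec F U \<Longrightarrow> complex_scale \<O> F U (c * d) s =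
      complex_scale \<O> F U c (complex_scale \<O> F U d s)"
    and complex_scale_one: "s \<in> sec F U \<Longrightarrow> complex_scale \<O> F U 1 s = s"
    and complex_scale_zero: "complex_scale \<O> F U c \<zero>\<^bsub>sections F U\<^esub> = \<zero>\<^bsub>sections F U\<^esub>"
    and complex_scale_smult: "f \<in> sec \<O> U \<Longrightarrow> s \<in> sec F U \<Longrightarrow> complex_scale \<O> F U c (f \<odot>\<^bsub>sections F U\<^esub> s) =
      f \<odot>\<^bsub>sections F U\<^esub> complex_scale \<O> F U c s"
  using assms by (simp_all add: complex_scale_const const_add const_mult const_one const_closed
      smult_l_distr smult_r_distr smult_assoc smult_one smult_r_null smult_left_commute[of U "const U c"])

text \<open>The Hausdorff property makes compact sets closed, so that \<open>U - K\<close> is open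
  and extension by zero along it makes sense.\<close>

locale hausdorff_module_sheaves = two_module_sheaves +
  assumes hausdorff: "Hausdorff_space X"
begin

text \<open>Elements of \<open>sheaf_homs\<close> are \<open>undefined\<close> outside their
  domains; this brings a family into that form. The operations of \<open>Diff_c\<close> are written
  in the same way.\<close>

definition mk :: "'a set \<Rightarrow> ('a set \<Rightarrow> 'c \<Rightarrow> 'd) \<Rightarrow> ('a set \<Rightarrow> 'c \<Rightarrow> 'd)" where
  "mk U E = (\<lambda>V\<in>opens_in X U. \<lambda>s\<in>sec F V. E V s)"

lemma mk_apply: "V \<in> opens_in X U \<Longrightarrow> s \<in> sec F V \<Longrightarrow> mk U E V s = E V s"
  by (simp add: mk_def)

lemma mk_cong: "(\<And>V s. V \<in> opens_in X U \<Longrightarrow> s \<in> sec F V \<Longrightarrow> E V s = E' V s) \<Longrightarrow> mk U E = mk U E'"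
  unfolding mk_def by (auto intro!: restrict_ext)

lemma sheaf_homs_mk: "D \<in> sheaf_homs X \<O> F G U \<Longrightarrow> mk U D = D"
proof -
  assume "D \<in> sheaf_homs X \<O> F G U"
  then have D: "D \<in> (\<Pi>\<^sub>E V\<in>opens_in X U. sec F V \<rightarrow>\<^sub>E sec G V)" by (simp add: sheaf_homs_def)
  have "(\<lambda>V\<in>opens_in X U. \<lambda>s\<in>sec F V. D V s) = (\<lambda>V\<in>opens_in X U. D V)"
    by (rule restrict_ext, rule extensional_restrict) (use D in \<open>auto simp: PiE_iff\<close>)
  also have "\<dots> = D" by (rule extensional_restrict) (use D in \<open>auto simp: PiE_iff\<close>)
  finally show ?thesis by (simp add: mk_def)
qed

lemma sheaf_homs_scale:
  "D \<in> sheaf_homs X \<O> F G U \<Longrightarrow> V \<in> opens_in X U \<Longrightarrow> s \<in> sec F V \<Longrightarrow>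
   D V (complex_scale \<O> F V c s) = complex_scale \<O> G V c (D V s)"
  by (simp add: sheaf_homs_def)

lemma mk_sheaf_homs:
  assumes E: "additive_hom U E"
    and sc: "\<And>V s c. V \<in> opens_in X U \<Longrightarrow> openin X V \<Longrightarrow> s \<in> sec F V \<Longrightarrow>
      E V (complex_scale \<O> F V c s) = complex_scale \<O> G V c (E V s)"
  shows "mk U E \<in> sheaf_homs X \<O> F G U"
  unfolding sheaf_homs_def
proof (intro CollectI conjI ballI allI)
  show "mk U E \<in> (\<Pi>\<^sub>E V\<in>opens_in X U. sec F V \<rightarrow>\<^sub>E sec G V)"
    using additive_hom_closed[OF E] by (auto simp: mk_def)
next
  fix V s assume V: "V \<in> opens_in X U" and s: "s \<in> sec F V"
  then have Vo: "openin X V" by (simp add: opens_in_iff)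
  { fix t assume t: "t \<in> sec F V"
    show "mk U E V (s \<oplus>\<^bsub>sections F V\<^esub> t) = mk U E V s \<oplus>\<^bsub>sections G V\<^esub> mk U E V t"
      using V s t by (simp add: mk_apply F.add_closed[OF Vo] additive_hom_add[OF E V]) }
  { fix c show "mk U E V (complex_scale \<O> F V c s) = complex_scale \<O> G V c (mk U E V s)"
      using V s Vo by (simp add: mk_apply F.complex_scale_closed sc) }
  { fix W assume W: "W \<in> opens_in X V"
    then have "W \<in> opens_in X U" using V by (auto simp: opens_in_iff)
    then show "restr G V W (mk U E V s) = mk U E W (restr F V W s)"
      using V s Vo W by (simp add: mk_apply F.restr_closed additive_hom_restr[OF E]) }
qed

text \<open>Membership in \<open>Diff_Kr\<close> for compact K \<subseteq> U, with containment of
  the support replaced by vanishing on \<open>U - K\<close>. This version involves no union over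
  open sets and is easier to verify and to use.\<close>

definition dop :: "'a set \<Rightarrow> 'a set \<Rightarrow> nat \<Rightarrow> ('a set \<Rightarrow> 'c \<Rightarrow> 'd) \<Rightarrow> bool" where
  "dop U K r D \<longleftrightarrow> D \<in> sheaf_homs X \<O> F G U \<and> compactin X K \<and> K \<subseteq> U \<and> van (U - K) D \<and> ord U r D"

lemma dopD:
  assumes "dop U K r D"
  shows "D \<in> sheaf_homs X \<O> F G U" "compactin X K" "K \<subseteq> U" "van (U - K) D" "ord U r D" "additive_hom U D"
  using assms sheaf_homs_additive by (auto simp: dop_def)

lemma van_cong:
  "(\<And>W s. W \<in> opens_in X U \<Longrightarrow> s \<in> sec F W \<Longrightarrow> D W s = E W s) \<Longrightarrow> van U E \<Longrightarrow> van U D"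
  by (simp add: vanishes_on_def)

lemma openin_minus_compact: "openin X U \<Longrightarrow> compactin X K \<Longrightarrow> openin X (U - K)"
  using compactin_imp_closedin[OF hausdorff] by blast

lemma dopI:
  assumes "openin X U" "additive_hom U E"
    and "\<And>V s c. V \<in> opens_in X U \<Longrightarrow> openin X V \<Longrightarrow> s \<in> sec F V \<Longrightarrow>
      E V (complex_scale \<O> F V c s) = complex_scale \<O> G V c (E V s)"
    and "compactin X K" "K \<subseteq> U" "van (U - K) E" "ord U r E"
  shows "dop U K r (mk U E)"
  unfolding dop_def
proof (intro conjI mk_sheaf_homs assms)
  show "van (U - K) (mk U E)"
  proof (rule van_cong[OF _ assms(6)])
    fix W s assume "W \<in> opens_in X (U - K)" "s \<in> sec F W"
    moreover from this have "W \<in> opens_in X U" by (auto simp: opens_in_iff)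
    ultimately show "mk U E W s = E W s" by (simp add: mk_apply)
  qed
  show "ord U r (mk U E)" by (rule ord_cong[OF _ assms(7)]) (auto simp: mk_apply)
qed

lemma dop_mono: "openin X U \<Longrightarrow> dop U K r D \<Longrightarrow> K \<subseteq> K' \<Longrightarrow> compactin X K' \<Longrightarrow> K' \<subseteq> U \<Longrightarrow> r \<le> r' \<Longrightarrow> dop U K' r' D"
  unfolding dop_def using ord_mono van_subset[of "U - K" D "U - K'"] by blast

lemma op_support_compact:
  assumes U: "openin X U" and D: "dop U K r D"
  shows "op_support X F G U D \<subseteq> K" "compactin X (op_support X F G U D)"
proof -
  note d = dopD[OF D]
  show sub: "op_support X F G U D \<subseteq> K"
    by (rule op_support_subsetI[OF openin_minus_compact[OF U d(2)] d(4)])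
  have "op_support X F G U D \<subseteq> U" by (auto simp: op_support_def)
  \<comment> \<open>The support is known to be closed only relative to \<open>U\<close>. Lying in
    \<open>K\<close>, it is the intersection of \<open>K\<close> with a set closed in the whole
    space.\<close>
  then have "op_support X F G U D = (topspace X - (U - op_support X F G U D)) \<inter> K"
    using sub d(3) compactin_subset_topspace[OF d(2)] by blast
  then show "compactin X (op_support X F G U D)"
    using closed_Int_compactin[of X "topspace X - (U - op_support X F G U D)" K]
      closedin_diff[OF closedin_topspace openin_minus_op_support[OF d(6)]] d(2) by simp
qed

text \<open>Locally finite order becomes globally finite order: finitely many of the neighbourhoods
  cover the compact support, and off the support every bound holds. Hence \<open>Diff_c\<close> is
  the union of the spaces \<open>Diff_Kr\<close>.\<close>

lemma carrier_Diff_c: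
  assumes U: "openin X U"
  shows "carrier (Diff_c X \<O> F G U) = {D. \<exists>K r. dop U K r D}"
proof (intro equalityI subsetI CollectI)
  fix D assume "D \<in> carrier (Diff_c X \<O> F G U)"
  then have D: "D \<in> sheaf_homs X \<O> F G U" and c: "compactin X (op_support X F G U D)"
    and l: "\<And>a. a \<in> U \<Longrightarrow> \<exists>V\<in>opens_in X U. a \<in> V \<and> (\<exists>r. ord V r D)"
    by (auto simp: Diff_c_def)
  let ?S = "op_support X F G U D"
  have SU: "?S \<subseteq> U" by (auto simp: op_support_def)
  note a = sheaf_homs_additive[OF D]
  let ?\<U> = "{V \<in> opens_in X U. \<exists>r. ord V r D}"
  have "?S \<subseteq> \<Union>?\<U>" using l SU by blast
  moreover have "\<And>V. V \<in> ?\<U> \<Longrightarrow> openin X V" by (auto simp: opens_in_iff)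
  ultimately obtain \<V> where V: "finite \<V>" "\<V> \<subseteq> ?\<U>" "?S \<subseteq> \<Union>\<V>"
    using c unfolding compactin_def by meson
  have "\<forall>V\<in>\<V>. \<exists>r. ord V r D" using V by auto
  then obtain r where r: "\<And>V. V \<in> \<V> \<Longrightarrow> ord V (r V) D" by metis
  \<comment> \<open>The inserted 0 keeps the maximum defined when the finite subcover is
    empty.\<close>
  have "ord U (Max (insert 0 (r ` \<V>))) D"
  proof (rule ord_local[OF a])
    fix x assume x: "x \<in> U"
    show "\<exists>W\<in>opens_in X U. x \<in> W \<and> ord W (Max (insert 0 (r ` \<V>))) D"
    proof (cases "x \<in> ?S")
      case True
      then obtain V where "V \<in> \<V>" "x \<in> V" using \<open>?S \<subseteq> \<Union>\<V>\<close> by auto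
      moreover have "V \<in> opens_in X U" using \<open>V \<in> \<V>\<close> V by auto
      moreover have "r V \<le> Max (insert 0 (r ` \<V>))" using V \<open>V \<in> \<V>\<close> by auto
      ultimately show ?thesis using ord_mono[OF _ r] by (auto simp: opens_in_iff)
    next
      case False
      then show ?thesis
        using van_ord[OF openin_minus_op_support[OF a] van_op_support[OF a]] openin_minus_op_support[OF a] x
        by (intro bexI[of _ "U - ?S"]) (auto simp: opens_in_iff)
    qed
  qed
  then have "dop U ?S (Max (insert 0 (r ` \<V>))) D"
    using D c SU van_op_support[OF a] by (simp add: dop_def)
  then show "\<exists>K r. dop U K r D" by blast
next
  fix D assume "D \<in> {D. \<exists>K r. dop U K r D}"
  then obtain K r where D: "dop U K r D" by blast
  have "\<exists>V\<in>opens_in X U. a \<in> V \<and> (\<exists>r. ord V r D)" if "a \<in> U" for a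
    using that dopD(5)[OF D] U by (auto simp: opens_in_iff)
  then show "D \<in> carrier (Diff_c X \<O> F G U)"
    using op_support_compact[OF U D] dopD(1)[OF D] by (simp add: Diff_c_def)
qed

lemma carrier_Diff_Kr:
  assumes U: "openin X U" and K: "compactin X K" "K \<subseteq> U"
  shows "carrier (Diff_Kr X \<O> F G U K r) = {D. dop U K r D}"
proof (intro equalityI subsetI CollectI)
  fix D assume "D \<in> carrier (Diff_Kr X \<O> F G U K r)"
  then have D: "D \<in> carrier (Diff_c X \<O> F G U)" "op_support X F G U D \<subseteq> K" "ord U r D"
    by (auto simp: Diff_Kr_def)
  then have h: "D \<in> sheaf_homs X \<O> F G U" by (simp add: Diff_c_def)
  have "van (U - K) D"
    using van_subset[OF van_op_support[OF sheaf_homs_additive[OF h]], of "U - K"] D(2) by blast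
  then show "dop U K r D" using h D(3) K by (simp add: dop_def)
next
  fix D assume D: "D \<in> {D. dop U K r D}"
  then show "D \<in> carrier (Diff_Kr X \<O> F G U K r)"
    using op_support_compact(1)[OF U, of K r D] dopD(5)[of U K r D] carrier_Diff_c[OF U]
    by (auto simp: Diff_Kr_def)
qed

lemma Diff_ops:
  "\<zero>\<^bsub>Diff_Kr X \<O> F G U K r\<^esub> = mk U (\<lambda>V s. \<zero>\<^bsub>sections G V\<^esub>)"
  "D \<oplus>\<^bsub>Diff_Kr X \<O> F G U K r\<^esub> E = mk U (\<lambda>V s. D V s \<oplus>\<^bsub>sections G V\<^esub> E V s)"
  "c \<odot>\<^bsub>Diff_Kr X \<O> F G U K r\<^esub> D = mk U (\<lambda>V s. complex_scale \<O> G V c (D V s))"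
  by (simp_all add: Diff_Kr_def Diff_c_def mk_def)

lemma G_zero_add: "openin X V \<Longrightarrow> x \<in> sec G V \<Longrightarrow> \<zero>\<^bsub>sections G V\<^esub> \<oplus>\<^bsub>sections G V\<^esub> x = x"
  using abelian_monoid.l_zero[OF abelian_group.axioms(1)[OF G.grp]] .

lemma dop_zero:
  assumes U: "openin X U" shows "dop U {} r (mk U (\<lambda>V s. \<zero>\<^bsub>sections G V\<^esub>))"
proof (rule dopI[OF U])
  show "additive_hom U (\<lambda>V s. \<zero>\<^bsub>sections G V\<^esub>)"
    unfolding additive_hom_def
    by (auto simp: opens_in_iff G.zero_closed G_zero_add G.restr_zero)
  show v: "van (U - {}) (\<lambda>V s. \<zero>\<^bsub>sections G V\<^esub>)" by (simp add: vanishes_on_def)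
  show "ord U r (\<lambda>V s. \<zero>\<^bsub>sections G V\<^esub>)" using van_ord[OF U] v by simp
qed (auto simp: G.complex_scale_zero)

lemma dop_smult:
  assumes U: "openin X U" and D: "dop U K r D"
  shows "dop U K r (mk U (\<lambda>V s. complex_scale \<O> G V c (D V s)))"
proof (rule dopI[OF U])
  note d = dopD[OF D]
  show "additive_hom U (\<lambda>V s. complex_scale \<O> G V c (D V s))"
    unfolding additive_hom_def
  proof (intro ballI conjI)
    fix V s assume V: "V \<in> opens_in X U" and s: "s \<in> sec F V"
    then have Vo: "openin X V" by (simp add: opens_in_iff)
    note cl = additive_hom_closed[OF d(6) V]
    show "complex_scale \<O> G V c (D V s) \<in> sec G V" using G.complex_scale_closed[OF Vo cl[OF s]] .
    { fix t assume t: "t \<in> sec F V"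
      show "complex_scale \<O> G V c (D V (s \<oplus>\<^bsub>sections F V\<^esub> t)) =
        complex_scale \<O> G V c (D V s) \<oplus>\<^bsub>sections G V\<^esub> complex_scale \<O> G V c (D V t)"
        using s t cl by (simp add: additive_hom_add[OF d(6) V] G.complex_scale_add[OF Vo]) }
    { fix W assume W: "W \<in> opens_in X V"
      show "restr G V W (complex_scale \<O> G V c (D V s)) = complex_scale \<O> G W c (D W (restr F V W s))"
        using additive_hom_restr[OF d(6) V W s] G.restr_complex_scale[OF Vo W cl[OF s]] by simp }
  qed
  show "complex_scale \<O> G V c (D V (complex_scale \<O> F V c' s)) =
      complex_scale \<O> G V c' (complex_scale \<O> G V c (D V s))"
    if "V \<in> opens_in X U" "openin X V" "s \<in> sec F V" for V s c'
    using that additive_hom_closed[OF d(6) that(1,3)]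
    by (simp add: sheaf_homs_scale[OF d(1)] G.complex_scale_mult[symmetric] mult.commute)
  show "van (U - K) (\<lambda>V s. complex_scale \<O> G V c (D V s))"
    using d(4) by (simp add: vanishes_on_def opens_in_iff G.complex_scale_zero)
  show "ord U r (\<lambda>V s. complex_scale \<O> G V c (D V s))"
  proof (rule ord_mult_left[OF U _ d(5,6)])
    show "const U c \<in> sec \<O> U" using const_closed[OF U] .
    show "complex_scale \<O> G W c (D W s) = restr \<O> U W (const U c) \<odot>\<^bsub>sections G W\<^esub> D W s"
      if "W \<in> opens_in X U" for W s
      using restr_const[OF U that] by (simp add: complex_scale_const)
  qed
qed (use dopD[OF D] in auto)

lemma dop_add:
  assumes U: "openin X U" and D: "dop U K r D" and E: "dop U K r E"
  shows "dop U K r (mk U (\<lambda>V s. D V s \<oplus>\<^bsub>sections G V\<^esub> E V s))"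
proof (rule dopI[OF U])
  note d = dopD[OF D] and e = dopD[OF E]
  show "additive_hom U (\<lambda>V s. D V s \<oplus>\<^bsub>sections G V\<^esub> E V s)"
    unfolding additive_hom_def
  proof (intro ballI conjI)
    fix V s assume V: "V \<in> opens_in X U" and s: "s \<in> sec F V"
    then have Vo: "openin X V" by (simp add: opens_in_iff)
    interpret abelian_group "sections G V" using G.grp Vo .
    note cl = additive_hom_closed[OF d(6) V] additive_hom_closed[OF e(6) V]
    show "D V s \<oplus>\<^bsub>sections G V\<^esub> E V s \<in> sec G V" using cl s by simp
    { fix t assume t: "t \<in> sec F V"
      show "D V (s \<oplus>\<^bsub>sections F V\<^esub> t) \<oplus>\<^bsub>sections G V\<^esub> E V (s \<oplus>\<^bsub>sections F V\<^esub> t) =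
        (D V s \<oplus>\<^bsub>sections G V\<^esub> E V s) \<oplus>\<^bsub>sections G V\<^esub> (D V t \<oplus>\<^bsub>sections G V\<^esub> E V t)"
        using s t cl by (simp add: additive_hom_add[OF d(6) V] additive_hom_add[OF e(6) V] a_ac) }
    { fix W assume W: "W \<in> opens_in X V"
      show "restr G V W (D V s \<oplus>\<^bsub>sections G V\<^esub> E V s) =
        D W (restr F V W s) \<oplus>\<^bsub>sections G W\<^esub> E W (restr F V W s)"
        using additive_hom_restr[OF d(6) V W s] additive_hom_restr[OF e(6) V W s] G.restr_add[OF Vo W] cl s by simp }
  qed
  show "D V (complex_scale \<O> F V c s) \<oplus>\<^bsub>sections G V\<^esub> E V (complex_scale \<O> F V c s) =
      complex_scale \<O> G V c (D V s \<oplus>\<^bsub>sections G V\<^esub> E V s)"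
    if "V \<in> opens_in X U" "openin X V" "s \<in> sec F V" for V s c
    using that additive_hom_closed[OF d(6) that(1,3)] additive_hom_closed[OF e(6) that(1,3)]
    by (simp add: sheaf_homs_scale[OF d(1)] sheaf_homs_scale[OF e(1)] G.complex_scale_add)
  show "van (U - K) (\<lambda>V s. D V s \<oplus>\<^bsub>sections G V\<^esub> E V s)"
    using d(4) e(4) by (simp add: vanishes_on_def opens_in_iff G_zero_add G.zero_closed)
  show "ord U r (\<lambda>V s. D V s \<oplus>\<^bsub>sections G V\<^esub> E V s)"
    by (rule ord_add[OF d(5) e(5) d(6) e(6)]) simp
qed (use dopD[OF D] in auto)

lemma dop_eqI:
  assumes "dop U K r D" "dop U K' r' E"
    and "\<And>V s. V \<in> opens_in X U \<Longrightarrow> openin X V \<Longrightarrow> s \<in> sec F V \<Longrightarrow> D V s = E V s"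
  shows "D = E"
  using mk_cong[of U D E] sheaf_homs_mk[OF dopD(1)[OF assms(1)]] sheaf_homs_mk[OF dopD(1)[OF assms(2)]] assms(3)
  by (simp add: opens_in_iff)

lemma module_Diff_Kr:
  assumes U: "openin X U" and K: "compactin X K" "K \<subseteq> U"
  shows "Module.module complex_ring (Diff_Kr X \<O> F G U K r)" (is "Module.module _ ?M")
proof -
  note C = carrier_Diff_Kr[OF U K]
  note ops = Diff_ops[of U K r]
  have z: "dop U K r (mk U (\<lambda>V s. \<zero>\<^bsub>sections G V\<^esub>))"
    using dop_mono[OF U dop_zero[OF U], of K r r] K by auto
  note cl = additive_hom_closed[OF dopD(6)]
  note am = abelian_group.axioms(1)[OF G.grp]
  show ?thesis
  proof (rule moduleI[OF cring_complex_ring])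
    show "abelian_group ?M"
    proof (rule abelian_groupI)
      show "x \<oplus>\<^bsub>?M\<^esub> y \<in> carrier ?M" if "x \<in> carrier ?M" "y \<in> carrier ?M" for x y
        using that dop_add[OF U] by (simp add: C ops)
      show "\<zero>\<^bsub>?M\<^esub> \<in> carrier ?M" using z by (simp add: C ops)
      show "x \<oplus>\<^bsub>?M\<^esub> y \<oplus>\<^bsub>?M\<^esub> z = x \<oplus>\<^bsub>?M\<^esub> (y \<oplus>\<^bsub>?M\<^esub> z)"
        if "x \<in> carrier ?M" "y \<in> carrier ?M" "z \<in> carrier ?M" for x y z
        unfolding ops by (rule mk_cong)
          (use that in \<open>simp add: mk_apply C opens_in_iff abelian_monoid.a_assoc[OF am] cl\<close>)
      show "x \<oplus>\<^bsub>?M\<^esub> y = y \<oplus>\<^bsub>?M\<^esub> x" if "x \<in> carrier ?M" "y \<in> carrier ?M" for x y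
        unfolding ops by (rule mk_cong)
          (use that in \<open>simp add: C opens_in_iff abelian_monoid.a_comm[OF am] cl\<close>)
      fix x assume "x \<in> carrier ?M"
      then have x: "dop U K r x" by (simp add: C)
      show "\<zero>\<^bsub>?M\<^esub> \<oplus>\<^bsub>?M\<^esub> x = x" unfolding ops
        by (rule dop_eqI[OF dop_add[OF U z x] x])
          (simp add: mk_apply G_zero_add cl[OF x])
      show "\<exists>y\<in>carrier ?M. y \<oplus>\<^bsub>?M\<^esub> x = \<zero>\<^bsub>?M\<^esub>"
      proof
        show "(-1) \<odot>\<^bsub>?M\<^esub> x \<in> carrier ?M" using dop_smult[OF U x] by (simp add: ops C)
        show "((-1) \<odot>\<^bsub>?M\<^esub> x) \<oplus>\<^bsub>?M\<^esub> x = \<zero>\<^bsub>?M\<^esub>"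
          unfolding ops
        proof (rule mk_cong)
          fix V s assume V: "V \<in> opens_in X U" and s: "s \<in> sec F V"
          then have Vo: "openin X V" by (simp add: opens_in_iff)
          \<comment> \<open>The operator is written as its multiple by 1, so that additivity in the
            scalar turns the sum into the multiple by 0.\<close>
          have "complex_scale \<O> G V (-1) (x V s) \<oplus>\<^bsub>sections G V\<^esub> complex_scale \<O> G V 1 (x V s) =
              complex_scale \<O> G V 0 (x V s)"
            using G.complex_scale_add_left[OF Vo cl[OF x V s], of "-1" 1] by simp
          also have "\<dots> = \<zero>\<^bsub>sections G V\<^esub>"
            using G.smult_l_null[OF Vo cl[OF x V s]] module.smult_l_null[OF O_module[OF Vo]]
              cring.cring_simprules(6)[OF O_cring[OF Vo]] by (simp add: complex_scale_def)
          finally show "mk U (\<lambda>V s. complex_scale \<O> G V (- 1) (x V s)) V s \<oplus>\<^bsub>sections G V\<^esub> x V s = \<zero>\<^bsub>sections G V\<^esub>"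
            using V s G.complex_scale_one[OF Vo cl[OF x V s]] by (simp add: mk_apply)
        qed
      qed
    qed
    fix a x assume "x \<in> carrier ?M"
    then have x: "dop U K r x" by (simp add: C)
    show "a \<odot>\<^bsub>?M\<^esub> x \<in> carrier ?M" using dop_smult[OF U x] by (simp add: C ops)
    show "\<one>\<^bsub>complex_ring\<^esub> \<odot>\<^bsub>?M\<^esub> x = x" unfolding ops
      by (rule dop_eqI[OF dop_smult[OF U x] x]) (simp add: mk_apply G.complex_scale_one cl[OF x])
    fix b
    show "(a \<oplus>\<^bsub>complex_ring\<^esub> b) \<odot>\<^bsub>?M\<^esub> x = a \<odot>\<^bsub>?M\<^esub> x \<oplus>\<^bsub>?M\<^esub> b \<odot>\<^bsub>?M\<^esub> x"
      unfolding ops by (rule mk_cong) (simp add: mk_apply opens_in_iff G.complex_scale_add_left cl[OF x])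
    show "(a \<otimes>\<^bsub>complex_ring\<^esub> b) \<odot>\<^bsub>?M\<^esub> x = a \<odot>\<^bsub>?M\<^esub> (b \<odot>\<^bsub>?M\<^esub> x)"
      unfolding ops by (rule mk_cong) (simp add: mk_apply opens_in_iff G.complex_scale_mult cl[OF x])
  next
    fix a x y assume "x \<in> carrier ?M" "y \<in> carrier ?M"
    then have x: "dop U K r x" "dop U K r y" by (simp_all add: C)
    show "a \<odot>\<^bsub>?M\<^esub> (x \<oplus>\<^bsub>?M\<^esub> y) = a \<odot>\<^bsub>?M\<^esub> x \<oplus>\<^bsub>?M\<^esub> a \<odot>\<^bsub>?M\<^esub> y"
      unfolding ops by (rule mk_cong) (simp add: mk_apply opens_in_iff G.complex_scale_add cl[OF x(1)] cl[OF x(2)])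
  qed
qed

section \<open>Multiplying operators by a section and extending them by zero\<close>

definition cut_op :: "'a set \<Rightarrow> 'a set \<Rightarrow> 'b \<Rightarrow> ('a set \<Rightarrow> 'c \<Rightarrow> 'd) \<Rightarrow> ('a set \<Rightarrow> 'c \<Rightarrow> 'd)" where
  "cut_op U V e D = mk V (\<lambda>W s. D W (restr \<O> U W e \<odot>\<^bsub>sections F W\<^esub> s))"

text \<open>The composite vanishes off \<open>K\<close> because \<open>D\<close> does and off
  \<open>S\<close> because \<open>e\<close> does, and \<open>V - K\<close> and \<open>V - S\<close>
  cover V - K \<inter> S. Since S lies in V within U, the support becomes compact inside
  \<open>V\<close>; composing with \<open>e\<close> on the source side leaves the order bound
  intact.\<close>

lemma dop_cut_op:
  assumes U: "openin X U" and V: "V \<in> opens_in X U" and e: "e \<in> sec \<O> U"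
    and S: "closedin X S" "U \<inter> S \<subseteq> V" "restr \<O> U (U - S) e = \<zero>\<^bsub>sections \<O> (U - S)\<^esub>"
    and D: "dop U K r D"
  shows "dop V (K \<inter> S) r (cut_op U V e D)"
  unfolding cut_op_def
proof (rule dopI)
  note d = dopD[OF D]
  show Vo: "openin X V" using V by (simp add: opens_in_iff)
  have VU: "V \<subseteq> U" using V by (simp add: opens_in_iff)
  have WU: "W \<in> opens_in X U" if "W \<in> opens_in X V" for W using that VU by (auto simp: opens_in_iff)
  note eW = O_restr_closed[OF U _ e]
  let ?E = "\<lambda>W s. D W (restr \<O> U W e \<odot>\<^bsub>sections F W\<^esub> s)"
  show ah: "additive_hom V ?E"
    unfolding additive_hom_def
  proof (intro ballI conjI)
    fix W s assume W: "W \<in> opens_in X V" and s: "s \<in> sec F W"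
    have Wo: "openin X W" using W by (simp add: opens_in_iff)
    note eW' = eW[OF WU[OF W]]
    note sm = F.smult_closed[OF Wo eW']
    show "?E W s \<in> sec G W" by (rule additive_hom_closed[OF d(6) WU[OF W] sm[OF s]])
    { fix t assume t: "t \<in> sec F W"
      show "?E W (s \<oplus>\<^bsub>sections F W\<^esub> t) = ?E W s \<oplus>\<^bsub>sections G W\<^esub> ?E W t"
        using s t by (simp add: F.smult_r_distr[OF Wo eW'] additive_hom_add[OF d(6) WU[OF W]] sm) }
    { fix W' assume W': "W' \<in> opens_in X W"
      show "restr G W W' (?E W s) = ?E W' (restr F W W' s)"
        using s by (simp add: additive_hom_restr[OF d(6) WU[OF W] W'] sm F.restr_smult[OF Wo W' eW']
            O_restr_restr[OF U WU[OF W] W' e]) }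
  qed
  show "?E W (complex_scale \<O> F W c s) = complex_scale \<O> G W c (?E W s)"
    if "W \<in> opens_in X V" "openin X W" "s \<in> sec F W" for W s c
    using that sheaf_homs_scale[OF d(1) WU F.smult_closed[OF _ eW]] WU eW
    by (simp flip: F.complex_scale_smult)
  show "compactin X (K \<inter> S)" using closed_Int_compactin[OF S(1) d(2)] by (simp add: Int_commute)
  show "K \<inter> S \<subseteq> V" using d(3) S(2) by blast
  show "van (V - K \<inter> S) ?E"
  proof (rule van_local[OF additive_hom_subset[OF ah]])
    fix a assume a: "a \<in> V - K \<inter> S"
    show "\<exists>W\<in>opens_in X (V - K \<inter> S). a \<in> W \<and> van W ?E"
    proof (cases "a \<in> K")
      case False
      have "van (V - K) ?E"
        unfolding vanishes_on_def
      proof (intro ballI)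
        fix W s assume W: "W \<in> opens_in X (V - K)" "s \<in> sec F W"
        then have "W \<in> opens_in X U" "W \<in> opens_in X (U - K)" "openin X W" using VU by (auto simp: opens_in_iff)
        then show "?E W s = \<zero>\<^bsub>sections G W\<^esub>" using d(4) W(2) eW F.smult_closed by (auto simp: vanishes_on_def)
      qed
      then show ?thesis using a False openin_minus_compact[OF Vo d(2)]
        by (intro bexI[of _ "V - K"]) (auto simp: opens_in_iff)
    next
      case True
      have "van (V - S) ?E"
        unfolding vanishes_on_def
      proof (intro ballI)
        fix W s assume W: "W \<in> opens_in X (V - S)" "s \<in> sec F W"
        then have W2: "W \<in> opens_in X U" "W \<in> opens_in X (U - S)" "openin X W" "U - S \<in> opens_in X U"
          using VU S(1) U by (auto simp: opens_in_iff)
        have "restr \<O> U W e = \<zero>\<^bsub>sections \<O> W\<^esub>"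
          using O_restr_restr[OF U W2(4,2) e] S(3) O_restr_zero[OF _ W2(2)] W2(4) by (simp add: opens_in_iff)
        then show "?E W s = \<zero>\<^bsub>sections G W\<^esub>"
          using F.smult_l_null[OF W2(3) W(2)] additive_hom_zero[OF d(6) W2(1)] by simp
      qed
      then show ?thesis using a True S(1) Vo
        by (intro bexI[of _ "V - S"]) (auto simp: opens_in_iff)
    qed
  qed auto
  show "ord V r ?E"
  proof (rule ord_mult_right[OF Vo O_restr_closed[OF U V e] ord_subset[OF d(5) VU]])
    show "?E W s = D W (restr \<O> V W (restr \<O> U V e) \<odot>\<^bsub>sections F W\<^esub> s)" if "W \<in> opens_in X V" for W s
      using O_restr_restr[OF U V that e] by simp
  qed
qed

text \<open>Extension by zero is applied to the values in \<open>G\<close>, which vanish off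
  \<open>K\<close>. No section of \<open>F\<close> has to be extended, so \<open>F\<close> remains
  arbitrary.\<close>

definition ext_op :: "'a set \<Rightarrow> 'a set \<Rightarrow> 'a set \<Rightarrow> ('a set \<Rightarrow> 'c \<Rightarrow> 'd) \<Rightarrow> ('a set \<Rightarrow> 'c \<Rightarrow> 'd)" where
  "ext_op U V K D = mk U (\<lambda>W s. G.extz W (W \<inter> V) K (D (W \<inter> V) (restr F W (W \<inter> V) s)))"

context
  fixes U V K r D
  assumes U: "openin X U" and V: "V \<in> opens_in X U" and D: "dop V K r D"
begin

lemma ext_op_setting:
  assumes "W \<in> opens_in X U"
  shows "openin X W" "openin X (W \<inter> V)" "W \<inter> V \<subseteq> W" "openin X (W - K)" "W \<inter> K \<subseteq> W \<inter> V"
    "W \<inter> V \<in> opens_in X V" "W \<inter> V \<in> opens_in X W" "W - K \<in> opens_in X W"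
  using assms V dopD(2,3)[OF D] openin_minus_compact by (auto simp: opens_in_iff)

lemma ext_op_ok:
  assumes W: "W \<in> opens_in X U" and s: "s \<in> sec F W"
  shows "D (W \<inter> V) (restr F W (W \<inter> V) s) \<in> sec G (W \<inter> V)"
    "restr G (W \<inter> V) (W \<inter> V - K) (D (W \<inter> V) (restr F W (W \<inter> V) s)) = \<zero>\<^bsub>sections G (W \<inter> V - K)\<^esub>"
proof -
  note d = dopD[OF D] and e = ext_op_setting[OF W]
  note sV = F.restr_closed[OF e(1) e(7) s]
  show "D (W \<inter> V) (restr F W (W \<inter> V) s) \<in> sec G (W \<inter> V)" by (rule additive_hom_closed[OF d(6) e(6) sV])
  have o: "W \<inter> V - K \<in> opens_in X (W \<inter> V)" "W \<inter> V - K \<in> opens_in X (V - K)"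
    using openin_minus_compact[OF e(2) d(2)] by (auto simp: opens_in_iff)
  show "restr G (W \<inter> V) (W \<inter> V - K) (D (W \<inter> V) (restr F W (W \<inter> V) s)) = \<zero>\<^bsub>sections G (W \<inter> V - K)\<^esub>"
    using additive_hom_restr[OF d(6) e(6) o(1) sV] d(4) o(2) F.restr_closed[OF e(2) o(1) sV]
    by (simp add: vanishes_on_def)
qed

lemma ext_op_props:
  assumes W: "W \<in> opens_in X U" and s: "s \<in> sec F W"
  shows "ext_op U V K D W s \<in> sec G W"
    "restr G W (W \<inter> V) (ext_op U V K D W s) = D (W \<inter> V) (restr F W (W \<inter> V) s)"
    "restr G W (W - K) (ext_op U V K D W s) = \<zero>\<^bsub>sections G (W - K)\<^esub>"
  using G.extz_closed[OF ext_op_setting(1-5)[OF W] ext_op_ok[OF W s]]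
    G.restr_extz[OF ext_op_setting(1-5)[OF W] ext_op_ok[OF W s]]
    G.extz_zero[OF ext_op_setting(1-5)[OF W] ext_op_ok[OF W s]] W s
  by (simp_all add: ext_op_def mk_apply)

lemma ext_op_eqI:
  assumes W: "W \<in> opens_in X U" and s: "s \<in> sec F W" and t: "t \<in> sec G W"
    "restr G W (W \<inter> V) t = D (W \<inter> V) (restr F W (W \<inter> V) s)" "restr G W (W - K) t = \<zero>\<^bsub>sections G (W - K)\<^esub>"
  shows "ext_op U V K D W s = t"
  using G.extz_eqI[OF ext_op_setting(1-5)[OF W] t] W s by (simp add: ext_op_def mk_apply)

text \<open>Identities between extended sections are checked on the pieces W \<inter> V and W - K.
  Over \<open>V\<close> the extension acts as \<open>D\<close>, over \<open>U - K\<close> it is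
  zero, and these two sets cover \<open>U\<close>; locality of the order then gives the
  bound.\<close>

lemma dop_ext_op: "dop U K r (ext_op U V K D)"
proof -
  note d = dopD[OF D]
  let ?E = "ext_op U V K D"
  have Vo: "openin X V" "V \<subseteq> U" using V by (auto simp: opens_in_iff)
  have ah: "additive_hom U ?E"
    unfolding additive_hom_def
  proof (intro ballI conjI)
    fix W s assume W: "W \<in> opens_in X U" and s: "s \<in> sec F W"
    note e = ext_op_setting[OF W]
    have WK: "openin X (W - K)" by (rule e)
    show "?E W s \<in> sec G W" by (rule ext_op_props[OF W s])
    { fix t assume t: "t \<in> sec F W"
      show "?E W (s \<oplus>\<^bsub>sections F W\<^esub> t) = ?E W s \<oplus>\<^bsub>sections G W\<^esub> ?E W t"
        using ext_op_props[OF W s] ext_op_props[OF W t] s t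
        by (intro ext_op_eqI[OF W])
          (simp_all add: F.add_closed[OF e(1)] G.add_closed[OF e(1)] G.restr_add[OF e(1,7)] G.restr_add[OF e(1,8)]
            F.restr_add[OF e(1,7)] additive_hom_add[OF d(6) e(6)] F.restr_closed[OF e(1,7)]
            G_zero_add[OF WK] G.zero_closed[OF WK]) }
    { fix W' assume W': "W' \<in> opens_in X W"
      then have W'U: "W' \<in> opens_in X U" using W by (auto simp: opens_in_iff)
      note e' = ext_op_setting[OF W'U]
      have o: "W' \<inter> V \<in> opens_in X (W \<inter> V)" "W' - K \<in> opens_in X (W - K)"
        using W' e'(2,4) by (auto simp: opens_in_iff)
      show "restr G W W' (?E W s) = ?E W' (restr F W W' s)"
      proof (rule ext_op_eqI[OF W'U, symmetric])
        show "restr F W W' s \<in> sec F W'" by (rule F.restr_closed[OF e(1) W' s])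
        show "restr G W W' (?E W s) \<in> sec G W'" by (rule G.restr_closed[OF e(1) W' ext_op_props(1)[OF W s]])
        have "restr G W' (W' \<inter> V) (restr G W W' (?E W s)) = restr G (W \<inter> V) (W' \<inter> V) (restr G W (W \<inter> V) (?E W s))"
          using G.restr_restr[OF e(1) W' e'(7) ext_op_props(1)[OF W s]]
            G.restr_restr[OF e(1) e(7) o(1) ext_op_props(1)[OF W s]] by simp
        also have "\<dots> = D (W' \<inter> V) (restr F (W \<inter> V) (W' \<inter> V) (restr F W (W \<inter> V) s))"
          unfolding ext_op_props(2)[OF W s]
          by (rule additive_hom_restr[OF d(6) e(6) o(1) F.restr_closed[OF e(1,7) s]])
        also have "\<dots> = D (W' \<inter> V) (restr F W' (W' \<inter> V) (restr F W W' s))"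
          using F.restr_restr[OF e(1,7) o(1) s] F.restr_restr[OF e(1) W' e'(7) s] by simp
        finally show "restr G W' (W' \<inter> V) (restr G W W' (?E W s)) = \<dots>" .
        have "restr G W' (W' - K) (restr G W W' (?E W s)) = restr G (W - K) (W' - K) (restr G W (W - K) (?E W s))"
          using G.restr_restr[OF e(1) W' e'(8) ext_op_props(1)[OF W s]]
            G.restr_restr[OF e(1) e(8) o(2) ext_op_props(1)[OF W s]] by simp
        then show "restr G W' (W' - K) (restr G W W' (?E W s)) = \<zero>\<^bsub>sections G (W' - K)\<^esub>"
          using ext_op_props(3)[OF W s] G.restr_zero[OF e(4) o(2)] by simp
      qed }
  qed
  have van: "van (U - K) ?E"
    unfolding vanishes_on_def
  proof (intro ballI)
    fix W s assume W: "W \<in> opens_in X (U - K)" and s: "s \<in> sec F W"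
    have WU: "W \<in> opens_in X U" and WK: "W - K = W" and Wo: "openin X W" using W by (auto simp: opens_in_iff)
    show "?E W s = \<zero>\<^bsub>sections G W\<^esub>"
      using ext_op_props(1,3)[OF WU s] G.restr_id[OF Wo] by (simp add: WK)
  qed
  have VE: "?E W s = D W s" if W: "W \<in> opens_in X V" and s: "s \<in> sec F W" for W s
  proof -
    have WU: "W \<in> opens_in X U" and WV: "W \<inter> V = W" and Wo: "openin X W" using W Vo by (auto simp: opens_in_iff)
    show ?thesis
      using ext_op_props(1,2)[OF WU s] G.restr_id[OF Wo] F.restr_id[OF Wo s] by (simp add: WV)
  qed
  have UK: "openin X (U - K)" by (rule openin_minus_compact[OF U d(2)])
  have ord: "ord U r ?E"
  proof (rule ord_local[OF ah])
    fix a assume a: "a \<in> U"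
    show "\<exists>W\<in>opens_in X U. a \<in> W \<and> ord W r ?E"
    proof (cases "a \<in> K")
      case True
      then show ?thesis using d(3) V ord_cong[OF VE d(5)] by blast
    next
      case False
      then show ?thesis using a van_ord[OF UK van] UK by (intro bexI[of _ "U - K"]) (auto simp: opens_in_iff)
    qed
  qed
  have "dop U K r (mk U ?E)"
  proof (rule dopI[OF U ah _ d(2) _ van ord])
    show "K \<subseteq> U" using d(3) Vo by blast
    fix W s c assume W: "W \<in> opens_in X U" "openin X W" and s: "s \<in> sec F W"
    note e = ext_op_setting[OF W(1)]
    show "?E W (complex_scale \<O> F W c s) = complex_scale \<O> G W c (?E W s)"
      using ext_op_props[OF W(1) s] s
      by (intro ext_op_eqI[OF W(1)])
        (simp_all add: F.complex_scale_closed[OF e(1)] G.complex_scale_closed[OF e(1)]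
          G.restr_complex_scale[OF e(1,7)] G.restr_complex_scale[OF e(1,8)]
          F.restr_complex_scale[OF e(1,7)] sheaf_homs_scale[OF d(1) e(6)] F.restr_closed[OF e(1,7)]
          G.complex_scale_zero[OF e(4)])
  qed
  moreover have "mk U ?E = ?E" unfolding ext_op_def by (rule mk_cong) (simp add: mk_apply)
  ultimately show ?thesis by simp
qed

end

lemma cut_op_linear:
  assumes U: "openin X U" and V: "V \<in> opens_in X U" and e: "e \<in> sec \<O> U"
    and S: "closedin X S" "U \<inter> S \<subseteq> V" "restr \<O> U (U - S) e = \<zero>\<^bsub>sections \<O> (U - S)\<^esub>"
    and K: "compactin X K" "K \<subseteq> U"
  shows "complex_linear (Diff_Kr X \<O> F G U K r) (Diff_Kr X \<O> F G V (K \<inter> S) r) (cut_op U V e)"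
proof -
  have Vo: "openin X V" using V by (simp add: opens_in_iff)
  have KS: "compactin X (K \<inter> S)" "K \<inter> S \<subseteq> V"
    using closed_Int_compactin[OF S(1) K(1)] K(2) S(2) by (auto simp: Int_commute)
  have WU: "W \<in> opens_in X U" "openin X W" if "W \<in> opens_in X V" for W using that V by (auto simp: opens_in_iff)
  have es: "restr \<O> U W e \<odot>\<^bsub>sections F W\<^esub> s \<in> sec F W" if "W \<in> opens_in X V" "s \<in> sec F W" for W s
    using F.smult_closed[OF WU(2) O_restr_closed[OF U WU(1) e]] that by blast
  show ?thesis
    unfolding complex_linear_def carrier_Diff_Kr[OF U K] carrier_Diff_Kr[OF Vo KS] Diff_ops cut_op_def
    using dop_cut_op[OF U V e S]
    by (auto simp: cut_op_def mk_apply WU es intro!: mk_cong)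
qed

lemma ext_op_linear:
  assumes U: "openin X U" and V: "V \<in> opens_in X U" and K: "compactin X K" "K \<subseteq> V"
  shows "complex_linear (Diff_Kr X \<O> F G V K r) (Diff_Kr X \<O> F G U K r) (ext_op U V K)"
proof -
  have Vo: "openin X V" and KU: "K \<subseteq> U" using V K by (auto simp: opens_in_iff)
  note M = carrier_Diff_Kr[OF Vo K]
  show ?thesis
    unfolding complex_linear_def M carrier_Diff_Kr[OF U K(1) KU]
  proof (intro conjI ballI allI)
    show "ext_op U V K \<in> {D. dop V K r D} \<rightarrow> {D. dop U K r D}" using dop_ext_op[OF U V] by auto
    fix x assume "x \<in> {D. dop V K r D}" then have x: "dop V K r x" by simp
    note ex = dop_ext_op[OF U V x]
    { fix y assume "y \<in> {D. dop V K r D}" then have y: "dop V K r y" by simp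
      note xy = dop_add[OF Vo x y]
      show "ext_op U V K (x \<oplus>\<^bsub>Diff_Kr X \<O> F G V K r\<^esub> y) =
          ext_op U V K x \<oplus>\<^bsub>Diff_Kr X \<O> F G U K r\<^esub> ext_op U V K y"
        unfolding Diff_ops
      proof (rule dop_eqI[OF dop_ext_op[OF U V xy] dop_add[OF U ex dop_ext_op[OF U V y]]])
        fix W s assume W: "W \<in> opens_in X U" and s: "s \<in> sec F W"
        note e = ext_op_setting[OF U V x W]
        note px = ext_op_props[OF U V x W s] and py = ext_op_props[OF U V y W s]
        show "ext_op U V K (mk V (\<lambda>V s. x V s \<oplus>\<^bsub>sections G V\<^esub> y V s)) W s =
          mk U (\<lambda>W s. ext_op U V K x W s \<oplus>\<^bsub>sections G W\<^esub> ext_op U V K y W s) W s"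
          using px py s W
          by (intro ext_op_eqI[OF U V xy W s])
            (simp_all add: mk_apply G.add_closed[OF e(1)] G.restr_add[OF e(1,7)] G.restr_add[OF e(1,8)]
              e(6) F.restr_closed[OF e(1,7)] G_zero_add[OF e(4)] G.zero_closed[OF e(4)])
      qed }
    { fix c
      note cx = dop_smult[OF Vo x, of c]
      show "ext_op U V K (c \<odot>\<^bsub>Diff_Kr X \<O> F G V K r\<^esub> x) = c \<odot>\<^bsub>Diff_Kr X \<O> F G U K r\<^esub> ext_op U V K x"
        unfolding Diff_ops
      proof (rule dop_eqI[OF dop_ext_op[OF U V cx] dop_smult[OF U ex]])
        fix W s assume W: "W \<in> opens_in X U" and s: "s \<in> sec F W"
        note e = ext_op_setting[OF U V x W]
        note px = ext_op_props[OF U V x W s]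
        show "ext_op U V K (mk V (\<lambda>V s. complex_scale \<O> G V c (x V s))) W s =
          mk U (\<lambda>W s. complex_scale \<O> G W c (ext_op U V K x W s)) W s"
          using px s W
          by (intro ext_op_eqI[OF U V cx W s])
            (simp_all add: mk_apply G.complex_scale_closed[OF e(1)] G.restr_complex_scale[OF e(1,7)]
              G.restr_complex_scale[OF e(1,8)] e(6) F.restr_closed[OF e(1,7)] G.complex_scale_zero[OF e(4)])
      qed }
  qed
qed

end

section \<open>Smooth functions on Euclidean space\<close>

text \<open>For i < n the coordinate line through \<open>x\<close> stays among the sequences
  vanishing from \<open>n\<close> on and depends continuously on its parameter, so an open set
  contains a piece of it.\<close>

lemma partial_deriv_line:
  assumes x: "x \<in> topspace (Euclidean_space n)" and i: "i < n" and W: "openin (Euclidean_space n) W" and xW: "x \<in> W"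
  shows "\<forall>\<^sub>F t in nhds (x i). x(i := t) \<in> W"
proof -
  have "continuous_map euclideanreal (Euclidean_space n) (\<lambda>t. x(i := t))"
  proof -
    have "continuous_map euclideanreal euclidean (\<lambda>t. (x(i := t)) j)" for j by (cases "j = i") auto
    then have "continuous_map euclideanreal (powertop_real UNIV) (\<lambda>t. x(i := t))"
      by (subst continuous_map_componentwise_UNIV) auto
    then show ?thesis using x i unfolding Euclidean_space_def by (auto simp: continuous_map_in_subtopology)
  qed
  from openin_continuous_map_preimage[OF this W] have "open {t. x(i := t) \<in> W}" by simp
  moreover have "x i \<in> {t. x(i := t) \<in> W}" using xW by simp
  ultimately show ?thesis unfolding eventually_nhds by blast
qed

text \<open>\<open>partial_deriv\<close> acts on functions of all sequences. On an open set it
  depends only on the values there, since it looks along short pieces of coordinate lines.\<close>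

lemma partial_derivs_cong_open:
  assumes W: "openin (Euclidean_space n) W" and fg: "\<And>x. x \<in> W \<Longrightarrow> f x = g x"
    and "set is \<subseteq> {..<n}" "x \<in> W"
  shows "foldr partial_deriv is f x = foldr partial_deriv is g x"
  using assms(3,4)
proof (induction "is" arbitrary: x)
  case (Cons i "is")
  have x: "x \<in> topspace (Euclidean_space n)" using W Cons.prems openin_subset by blast
  have "\<forall>\<^sub>F t in nhds (x i). x(i := t) \<in> W" by (rule partial_deriv_line[OF x _ W]) (use Cons.prems in auto)
  then have "\<forall>\<^sub>F t in nhds (x i). t \<in> UNIV \<longrightarrow>
      foldr partial_deriv is f (x(i := t)) = foldr partial_deriv is g (x(i := t))"
    by (rule eventually_mono) (use Cons in auto)
  then have "vector_derivative (\<lambda>t. foldr partial_deriv is f (x(i := t))) (at (x i)) =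
      vector_derivative (\<lambda>t. foldr partial_deriv is g (x(i := t))) (at (x i))"
    by (rule vector_derivative_cong_eq) auto
  then show ?case by (simp only: foldr.simps o_apply partial_deriv_def[of i])
qed (use fg in auto)

lemma smooth_onD:
  assumes "smooth_on n U f" "set is \<subseteq> {..<n}"
  shows "continuous_map (subtopology (Euclidean_space n) U) euclidean (foldr partial_deriv is f)"
    "i < n \<Longrightarrow> x \<in> U \<Longrightarrow> (\<lambda>t. foldr partial_deriv is f (x(i := t))) differentiable (at (x i))"
  using assms unfolding smooth_on_def by blast+

text \<open>Near each point the iterated derivatives of \<open>f\<close> agree with those of the
  local function \<open>g\<close>, and both continuity and differentiability can be tested near a
  point.\<close>

lemma smooth_on_local:
  assumes U: "openin (Euclidean_space n) U"
    and loc: "\<And>x. x \<in> U \<Longrightarrow> \<exists>W g. openin (Euclidean_space n) W \<and> x \<in> W \<and> smooth_on n W g \<and> (\<forall>y\<in>W. f y = g y)"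
  shows "smooth_on n U f"
  unfolding smooth_on_def
proof (intro allI impI conjI ballI)
  fix "is" assume is': "set is \<subseteq> {..<n}"
  let ?E = "Euclidean_space n"
  have "\<forall>x\<in>U. \<exists>W g. openin ?E W \<and> x \<in> W \<and> smooth_on n W g \<and> (\<forall>y\<in>W. f y = g y)"
    using loc by blast
  then obtain W g where W: "\<And>x. x \<in> U \<Longrightarrow> openin ?E (W x)" "\<And>x. x \<in> U \<Longrightarrow> x \<in> W x"
    and g: "\<And>x. x \<in> U \<Longrightarrow> smooth_on n (W x) (g x)" "\<And>x y. x \<in> U \<Longrightarrow> y \<in> W x \<Longrightarrow> f y = g x y"
    by metis
  have eq: "foldr partial_deriv is f y = foldr partial_deriv is (g x) y" if "x \<in> U" "y \<in> W x" for x y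
    by (rule partial_derivs_cong_open[OF W(1)[OF that(1)] g(2)[OF that(1)] is' that(2)])
  show "continuous_map (subtopology ?E U) euclidean (foldr partial_deriv is f)"
  proof (rule pasting_lemma[where I = U and T = "\<lambda>x. W x \<inter> U" and f = "\<lambda>x. foldr partial_deriv is (g x)"])
    fix x assume x: "x \<in> U"
    show "openin (subtopology ?E U) (W x \<inter> U)" using W(1)[OF x] by (auto simp: openin_subtopology)
    have "continuous_map (subtopology ?E (W x)) euclidean (foldr partial_deriv is (g x))"
      by (rule smooth_onD(1)[OF g(1)[OF x] is'])
    then have "continuous_map (subtopology (subtopology ?E (W x)) U) euclidean (foldr partial_deriv is (g x))"
      by (rule continuous_map_from_subtopology)
    then show "continuous_map (subtopology (subtopology ?E U) (W x \<inter> U)) euclidean (foldr partial_deriv is (g x))"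
      by (simp add: subtopology_subtopology Int_ac)
  qed (use eq[symmetric] W openin_subset[OF U] in auto)
  fix i x assume i: "i < n" and x: "x \<in> U"
  have xE: "x \<in> topspace ?E" using x U openin_subset by blast
  have ev: "\<forall>\<^sub>F t in nhds (x i). x(i := t) \<in> W x" by (rule partial_deriv_line[OF xE i W(1)[OF x] W(2)[OF x]])
  obtain D where D: "((\<lambda>t. foldr partial_deriv is (g x) (x(i := t))) has_derivative D) (at (x i))"
    using smooth_onD(2)[OF g(1)[OF x] is' i W(2)[OF x]] unfolding differentiable_def by blast
  have "((\<lambda>t. foldr partial_deriv is f (x(i := t))) has_derivative D) (at (x i))"
    by (rule has_derivative_transform_eventually[OF D])
      (use ev eq[OF x] W(2)[OF x] x in \<open>auto simp: eventually_at_filter elim!: eventually_mono\<close>)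
  then show "(\<lambda>t. foldr partial_deriv is f (x(i := t))) differentiable (at (x i))"
    unfolding differentiable_def by blast
qed

lemma smooth_on_subset: "smooth_on n U f \<Longrightarrow> V \<subseteq> U \<Longrightarrow> smooth_on n V f"
  unfolding smooth_on_def using continuous_map_from_subtopology_mono by blast

lemma smooth_on_cong:
  assumes "openin (Euclidean_space n) U" "smooth_on n U g" "\<And>x. x \<in> U \<Longrightarrow> f x = g x"
  shows "smooth_on n U f"
  by (rule smooth_on_local[OF assms(1)]) (use assms in blast)

section \<open>Smooth functions of one variable and bump functions\<close>

definition flat :: "real poly \<Rightarrow> real \<Rightarrow> real" where
  "flat p t = (if 0 < t then poly p (inverse t) * exp (- inverse t) else 0)"

text \<open>
  A class of functions closed under differentiation: the derivative of \<open>flat p\<close> is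
  \<open>flat q\<close> with \<open>q(s) = s\<^sup>2 (p(s) - p'(s))\<close>.
\<close>

inductive smooth1 :: "(real \<Rightarrow> real) \<Rightarrow> bool" where
  const: "smooth1 (\<lambda>x. c)"
| flat: "smooth1 (flat p)"
| add: "smooth1 f \<Longrightarrow> smooth1 g \<Longrightarrow> smooth1 (\<lambda>x. f x + g x)"
| mult: "smooth1 f \<Longrightarrow> smooth1 g \<Longrightarrow> smooth1 (\<lambda>x. f x * g x)"
| inverse: "smooth1 f \<Longrightarrow> (\<And>x. f x \<noteq> 0) \<Longrightarrow> smooth1 (\<lambda>x. inverse (f x))"
| affine: "smooth1 f \<Longrightarrow> smooth1 (\<lambda>x. f (a * x + b))"

lemma poly_times_exp_tendsto_0: "((\<lambda>s. poly p s * exp (- s)) \<longlongrightarrow> (0::real)) at_top"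
proof -
  have "((\<lambda>s. \<Sum>i\<le>degree p. coeff p i * (s ^ i / exp s)) \<longlongrightarrow> (\<Sum>i\<le>degree p. coeff p i * 0)) at_top"
    by (intro tendsto_sum tendsto_mult tendsto_const tendsto_power_div_exp_0)
  then show ?thesis
    by (simp add: poly_altdef sum_distrib_right exp_minus divide_inverse mult.assoc)
qed

lemma flat_derivative:
  "(flat p has_real_derivative flat ([:0, 0, 1:] * (p - pderiv p)) t) (at t)"
proof -
  consider "t < 0" | "t = 0" | "0 < t" by linarith
  then show ?thesis
  proof cases
    case 1
    have "((\<lambda>x. 0) has_real_derivative 0) (at t)" by simp
    then have "(flat p has_real_derivative 0) (at t)"
      by (rule DERIV_cong_ev[THEN iffD1, rotated -1])
        (use eventually_nhds_in_open[of "{..<0}" t] 1 in \<open>auto elim!: eventually_mono simp: flat_def\<close>)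
    then show ?thesis using 1 by (simp add: flat_def)
  next
    case 2
    \<comment> \<open>The difference quotient at 0 is p(1/h) exp(-1/h) / h. With s = 1/h the
      division by \<open>h\<close> becomes the extra factor s in q(s) = s p(s).\<close>
    let ?q = "[:0, 1:] * p"
    have "((\<lambda>h. flat p h / h) \<longlongrightarrow> 0) (at_left 0)"
      by (rule tendsto_eventually) (auto simp: eventually_at_left_field flat_def intro!: exI[of _ "-1"])
    moreover have "((\<lambda>h. flat p h / h) \<longlongrightarrow> 0) (at_right 0)"
    proof -
      have "((\<lambda>h. poly ?q (inverse h) * exp (- inverse h)) \<longlongrightarrow> 0) (at_right 0)"
        by (rule filterlim_compose[OF poly_times_exp_tendsto_0 filterlim_inverse_at_top_right])
      then show ?thesis
        by (rule Lim_transform_eventually)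
          (auto simp: eventually_at_right_field flat_def field_simps intro!: exI[of _ 1])
    qed
    ultimately have "((\<lambda>h. flat p h / h) \<longlongrightarrow> 0) (at 0)"
      by (simp add: filterlim_at_split)
    then show ?thesis using 2 by (simp add: DERIV_def flat_def)
  next
    case 3
    have "((\<lambda>x. poly p (inverse x) * exp (- inverse x)) has_real_derivative
       poly (pderiv p) (inverse t) * (- (inverse t ^ 2)) * exp (- inverse t) +
       poly p (inverse t) * (exp (- inverse t) * inverse t ^ 2)) (at t)"
      by (rule derivative_eq_intros DERIV_chain2[OF poly_DERIV] refl | use 3 in \<open>simp add: power2_eq_square\<close>)+
    then have "((\<lambda>x. poly p (inverse x) * exp (- inverse x)) has_real_derivative
       flat ([:0, 0, 1:] * (p - pderiv p)) t) (at t)"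
      using 3 by (simp add: flat_def algebra_simps power2_eq_square)
    then show ?thesis
      by (rule DERIV_cong_ev[THEN iffD1, rotated -1])
        (use eventually_nhds_in_open[of "{0<..}" t] 3 in \<open>auto elim!: eventually_mono simp: flat_def\<close>)
  qed
qed

lemma smooth1_derivative: "smooth1 f \<Longrightarrow> \<exists>f'. smooth1 f' \<and> (\<forall>x. (f has_real_derivative f' x) (at x))"
proof (induction rule: smooth1.induct)
  case (const c)
  then show ?case using smooth1.const[of 0] by (intro exI[of _ "\<lambda>_. 0"]) auto
next
  case (flat p)
  then show ?case using flat_derivative smooth1.flat by blast
next
  case (add f g)
  then obtain f' g' where "smooth1 f'" "smooth1 g'" "\<And>x. (f has_real_derivative f' x) (at x)"
    "\<And>x. (g has_real_derivative g' x) (at x)" by blast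
  then show ?case by (intro exI[of _ "\<lambda>x. f' x + g' x"]) (auto intro: smooth1.add DERIV_add)
next
  case (mult f g)
  then obtain f' g' where "smooth1 f'" "smooth1 g'" "\<And>x. (f has_real_derivative f' x) (at x)"
    "\<And>x. (g has_real_derivative g' x) (at x)" by blast
  then show ?case
    by (intro exI[of _ "\<lambda>x. f' x * g x + g' x * f x"])
      (auto intro!: DERIV_mult smooth1.add[OF smooth1.mult[OF _ mult.hyps(2)] smooth1.mult[OF _ mult.hyps(1)]])
next
  case (inverse f)
  then obtain f' where f': "smooth1 f'" "\<And>x. (f has_real_derivative f' x) (at x)" by blast
  have "smooth1 (\<lambda>x. (-1) * (inverse (f x) * f' x * inverse (f x)))"
    using f' inverse by (intro smooth1.mult smooth1.const smooth1.inverse)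
  moreover have "((\<lambda>x. inverse (f x)) has_real_derivative (-1) * (inverse (f x) * f' x * inverse (f x))) (at x)" for x
    by (rule derivative_eq_intros f' inverse refl)+ (simp add: inverse)
  ultimately show ?case by blast
next
  case (affine f a b)
  then obtain f' where f': "smooth1 f'" "\<And>x. (f has_real_derivative f' x) (at x)" by blast
  have "smooth1 (\<lambda>x. f' (a * x + b) * a)"
    using f' by (intro smooth1.mult smooth1.const smooth1.affine)
  moreover have "((\<lambda>x. f (a * x + b)) has_real_derivative f' (a * x + b) * a) (at x)" for x
    by (rule DERIV_chain2[OF f'(2)]) (auto intro!: derivative_eq_intros)
  ultimately show ?case by blast
qed

lemma smooth1_continuous: "smooth1 f \<Longrightarrow> continuous_on UNIV f"
  using smooth1_derivative by (metis DERIV_isCont continuous_at_imp_continuous_on)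

lemma smooth_plateau:
  obtains b :: "real \<Rightarrow> real" where "smooth1 b" "\<And>t. 0 \<le> b t" "\<And>t. b t \<le> 1"
    "\<And>t. \<bar>t\<bar> \<le> 1 \<Longrightarrow> b t = 1" "\<And>t. 2 \<le> \<bar>t\<bar> \<Longrightarrow> b t = 0"
proof -
  \<comment> \<open>The classical function exp(-1/t) for t > 0, continued by 0.\<close>
  define h where "h = flat 1"
  have h: "h t \<ge> 0" "t \<le> 0 \<Longrightarrow> h t = 0" "t > 0 \<Longrightarrow> h t > 0" for t by (auto simp: h_def flat_def)
  \<comment> \<open>Positive everywhere, because t > 0 or 1 - t > 0. Hence h / d is a smooth step, 0
    for t \<le> 0 and 1 for t \<ge> 1.\<close>
  define d where "d t = h t + h (1 - t)" for t
  have d: "d t > 0" for t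
    using h[of t] h[of "1 - t"] unfolding d_def by (cases "t > 0") (auto intro: add_pos_nonneg add_nonneg_pos)
  define s where "s t = h t * inverse (d t)" for t
  have sh: "smooth1 h" unfolding h_def by (rule smooth1.flat)
  have "smooth1 (\<lambda>t. h ((-1) * t + 1))" by (rule smooth1.affine[OF sh])
  then have "smooth1 d" unfolding d_def using smooth1.add[OF sh] by fastforce
  then have ss: "smooth1 s" unfolding s_def
    using d by (intro smooth1.mult smooth1.inverse sh) (metis less_irrefl)+
  have s: "0 \<le> s t" "s t \<le> 1" "t \<le> 0 \<Longrightarrow> s t = 0" "1 \<le> t \<Longrightarrow> s t = 1" for t
    using h[of t] h[of "1 - t"] d[of t] by (auto simp: s_def d_def field_simps)
  \<comment> \<open>The step rises on [-2, -1] in the first factor and falls on [1, 2] in the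
    second.\<close>
  have "smooth1 (\<lambda>t. s (1 * t + 2) * s ((-1) * t + 2))" by (intro smooth1.mult smooth1.affine ss)
  then show ?thesis
  proof (rule that)
    fix t :: real assume "2 \<le> \<bar>t\<bar>"
    then have "1 * t + 2 \<le> 0 \<or> (-1) * t + 2 \<le> 0" by linarith
    then show "s (1 * t + 2) * s ((-1) * t + 2) = 0" using s(3) by auto
  qed (use s in \<open>auto simp: mult_le_one\<close>)
qed

text \<open>Along the i-th coordinate line only the i-th factor varies; \<open>\<gamma>'\<close> is
  the list of factors with this one differentiated.\<close>

lemma partial_deriv_prod:
  fixes i n :: nat
  assumes "i < n" "\<And>j. j < n \<Longrightarrow> j \<noteq> i \<Longrightarrow> \<gamma>' j = \<gamma> j"
    "\<And>t. (\<gamma> i has_real_derivative \<gamma>' i t) (at t)"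
  shows "((\<lambda>t. \<Prod>j<n. complex_of_real (\<gamma> j ((x(i := t)) j))) has_vector_derivative
     (\<Prod>j<n. complex_of_real (\<gamma>' j (x j)))) (at (x i))"
proof -
  let ?P = "\<Prod>j\<in>{..<n} - {i}. complex_of_real (\<gamma> j (x j))"
  have 1: "(\<Prod>j<n. complex_of_real (\<gamma> j ((x(i := t)) j))) = complex_of_real (\<gamma> i t) * ?P" for t
    using assms(1) by (subst prod.remove[OF finite_lessThan, of i]) (auto intro!: prod.cong)
  have 2: "(\<Prod>j<n. complex_of_real (\<gamma>' j (x j))) = complex_of_real (\<gamma>' i (x i)) * ?P"
    using assms(1,2) by (subst prod.remove[OF finite_lessThan, of i]) (auto intro!: prod.cong)
  have "((\<lambda>t. complex_of_real (\<gamma> i t)) has_vector_derivative complex_of_real (\<gamma>' i (x i))) (at (x i))"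
    using assms(3)[of "x i"] by (simp add: has_real_derivative_iff_has_vector_derivative has_vector_derivative_of_real)
  then show ?thesis unfolding 1 2 by (rule has_vector_derivative_mult_left)
qed

text \<open>All iterated partial derivatives of such a product are again products of functions from
  \<open>smooth1\<close>, so continuity and differentiability need only be known for
  products.\<close>

lemma smooth_on_prod:
  assumes "\<And>j. smooth1 (\<gamma> j)"
  shows "smooth_on n U (\<lambda>x. \<Prod>j<n. complex_of_real (\<gamma> j (x j)))"
proof -
  let ?f = "\<lambda>\<gamma> x. \<Prod>j<n. complex_of_real (\<gamma> j (x j))"
  have ders: "\<exists>\<delta>. (\<forall>j. smooth1 (\<delta> j)) \<and> foldr partial_deriv is (?f \<gamma>) = ?f \<delta>" if "set is \<subseteq> {..<n}" for "is"
    using that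
  proof (induction "is")
    case Nil
    then show ?case using assms by auto
  next
    case (Cons i "is")
    then obtain \<delta> where d: "\<And>j. smooth1 (\<delta> j)" "foldr partial_deriv is (?f \<gamma>) = ?f \<delta>" by auto
    obtain d' where d': "smooth1 d'" "\<And>x. (\<delta> i has_real_derivative d' x) (at x)" using smooth1_derivative[OF d(1)] by blast
    have "partial_deriv i (?f \<delta>) x = ?f (\<delta>(i := d')) x" for x
      unfolding partial_deriv_def
      by (rule vector_derivative_at, rule partial_deriv_prod) (use Cons.prems d' in auto)
    then have "foldr partial_deriv (i # is) (?f \<gamma>) = ?f (\<delta>(i := d'))" using d(2) by auto
    moreover have "smooth1 ((\<delta>(i := d')) j)" for j using d d' by auto
    ultimately show ?case by blast
  qed
  show ?thesis
    unfolding smooth_on_def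
  proof (intro allI impI conjI ballI)
    fix "is" assume "set is \<subseteq> {..<n}"
    then obtain \<delta> where d: "\<And>j. smooth1 (\<delta> j)" "foldr partial_deriv is (?f \<gamma>) = ?f \<delta>" using ders by blast
    have "continuous_on UNIV (\<lambda>x. \<delta> j (x j))" for j
      using continuous_on_compose2[OF smooth1_continuous[OF d(1)], of UNIV "\<lambda>x. x j" j]
      by (auto intro: continuous_on_product_coordinates)
    then have "continuous_on UNIV (?f \<delta>)" by (intro continuous_on_prod continuous_on_of_real)
    then show "continuous_map (subtopology (Euclidean_space n) U) euclidean (foldr partial_deriv is (?f \<gamma>))"
      unfolding d(2) Euclidean_space_def euclidean_product_topology
      by (intro continuous_map_from_subtopology) auto
    fix i x assume i: "i < n"
    obtain d' where d': "\<And>x. (\<delta> i has_real_derivative d' x) (at x)" using smooth1_derivative[OF d(1)] by blast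
    show "(\<lambda>t. foldr partial_deriv is (?f \<gamma>) (x(i := t))) differentiable (at (x i))"
      unfolding d(2)
      by (rule differentiableI_vector, rule partial_deriv_prod[where \<gamma>'="\<delta>(i := d')"]) (use i d' in auto)
  qed
qed

lemma smooth_on_const: "smooth_on n U (\<lambda>x. c)"
proof -
  have "foldr partial_deriv is (\<lambda>x. c) = (\<lambda>x. if is = [] then c else 0)" for "is"
  proof (induction "is")
    case (Cons i "is")
    then show ?case by (cases "is") (auto simp: partial_deriv_def fun_eq_iff)
  qed auto
  then show ?thesis by (simp add: smooth_on_def)
qed

lemma box_in_open:
  assumes W: "openin (Euclidean_space n) W" and p: "p \<in> W"
  obtains e where "e > 0" "{x \<in> topspace (Euclidean_space n). \<forall>i<n. \<bar>x i - p i\<bar> \<le> 2 * e} \<subseteq> W"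
proof -
  obtain U where U: "openin (powertop_real UNIV) U" "W = U \<inter> {x. \<forall>i\<ge>n. x i = 0}"
    using W unfolding Euclidean_space_def openin_subtopology by auto
  obtain S where S: "p \<in> Pi\<^sub>E UNIV S" "\<And>i. openin euclideanreal (S i)" "Pi\<^sub>E UNIV S \<subseteq> U"
    using product_topology_open_contains_basis[OF U(1)] p U(2) by (metis IntD1 UNIV_I)
  have "\<exists>e>0. ball (p i) e \<subseteq> S i" for i
    using S(1) S(2)[of i] by (auto simp: open_contains_ball PiE_iff)
  then obtain d where d: "\<And>i. d i > 0" "\<And>i. ball (p i) (d i) \<subseteq> S i" by metis
  \<comment> \<open>The factor 1/3 makes 2 e smaller than every radius, and the inserted 1 covers n
    = 0, where there are no radii. Coordinates from \<open>n\<close> on vanish at \<open>x\<close>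
    and at \<open>p\<close> alike and impose no further condition.\<close>
  let ?e = "Min (insert 1 (d ` {..<n})) / 3"
  have e: "?e > 0" using d(1) by auto
  have de: "2 * ?e < d i" if "i < n" for i
  proof -
    have "Min (insert 1 (d ` {..<n})) \<le> d i" using that by (intro Min_le) auto
    then show ?thesis using e by linarith
  qed
  show ?thesis
  proof (rule that[OF e], rule subsetI)
    fix x assume x: "x \<in> {x \<in> topspace (Euclidean_space n). \<forall>i<n. \<bar>x i - p i\<bar> \<le> 2 * ?e}"
    have "x i \<in> S i" for i
    proof (cases "i < n")
      case True
      then have "x i \<in> ball (p i) (d i)" using x de[OF True] by (force simp: dist_real_def abs_minus_commute)
      then show ?thesis using d(2) by blast
    next
      case False
      then have "x i = p i" using x p U(2) by (auto simp: topspace_Euclidean_space)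
      then show ?thesis using S(1) by auto
    qed
    then have "x \<in> Pi\<^sub>E UNIV S" by auto
    then show "x \<in> W" using S(3) U(2) x by (auto simp: topspace_Euclidean_space)
  qed
qed

lemma euclidean_bump:
  assumes W: "openin (Euclidean_space n) W" and p: "p \<in> W"
  obtains f :: "(nat \<Rightarrow> real) \<Rightarrow> real" and N C
  where "smooth_on n W (\<lambda>x. complex_of_real (f x))" "\<And>x. 0 \<le> f x" "\<And>x. f x \<le> 1"
    "openin (Euclidean_space n) N" "p \<in> N" "N \<subseteq> W" "\<And>x. x \<in> N \<Longrightarrow> f x = 1"
    "compactin (Euclidean_space n) C" "C \<subseteq> W" "\<And>x. x \<in> W - C \<Longrightarrow> f x = 0"
proof -
  let ?E = "Euclidean_space n"
  obtain e where e: "e > 0" "{x \<in> topspace ?E. \<forall>i<n. \<bar>x i - p i\<bar> \<le> 2 * e} \<subseteq> W"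
    using box_in_open[OF assms] .
  obtain b where b: "smooth1 b" "\<And>t. 0 \<le> b t" "\<And>t. b t \<le> 1"
    "\<And>t. \<bar>t\<bar> \<le> 1 \<Longrightarrow> b t = 1" "\<And>t. 2 \<le> \<bar>t\<bar> \<Longrightarrow> b t = 0" using smooth_plateau by metis
  \<comment> \<open>This is b((t - p j) / e), written in the affine form under which
    \<open>smooth1\<close> is closed. The product is one on the cube of half-width \<open>e\<close>
    around \<open>p\<close> and zero off that of half-width 2 e.\<close>
  define \<gamma> where "\<gamma> j t = b (inverse e * t + - inverse e * p j)" for j t
  define f where "f x = (\<Prod>j<n. \<gamma> j (x j))" for x
  have ge: "\<gamma> j t = b ((t - p j) / e)" for j t using e by (simp add: \<gamma>_def field_simps)
  define N where "N = {x \<in> topspace ?E. \<forall>i\<in>{..<n}. x i \<in> {p i - e<..<p i + e}}"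
  define C where "C = {x \<in> topspace ?E. \<forall>i<n. \<bar>x i - p i\<bar> \<le> 2 * e}"
  have pE: "p \<in> topspace ?E" using p W openin_subset by blast
  have ci: "continuous_map ?E euclideanreal (\<lambda>x. x i)" for i
    unfolding Euclidean_space_def
    by (intro continuous_map_from_subtopology continuous_map_product_projection) auto
  show ?thesis
  proof (rule that[of f N C])
    have "smooth1 (\<gamma> j)" for j using smooth1.affine[OF b(1), of "inverse e" "- inverse e * p j"]
      by (simp add: \<gamma>_def [abs_def])
    from smooth_on_prod[OF this] show "smooth_on n W (\<lambda>x. complex_of_real (f x))"
      by (simp add: f_def)
    show "0 \<le> f x" "f x \<le> 1" for x unfolding f_def using b by (auto intro!: prod_nonneg prod_le_1 simp: ge)
    have "openin ?E (topspace ?E \<inter> (\<Inter>i\<in>{..<n}. {x \<in> topspace ?E. x i \<in> {p i - e<..<p i + e}}))"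
      by (rule openin_Int_Inter) (auto simp del: greaterThanLessThan_iff intro!: openin_continuous_map_preimage[OF ci])
    moreover have "topspace ?E \<inter> (\<Inter>i\<in>{..<n}. {x \<in> topspace ?E. x i \<in> {p i - e<..<p i + e}}) = N"
      by (auto simp: N_def)
    ultimately show "openin ?E N" by simp
    show "p \<in> N" using e pE by (auto simp: N_def)
    have "N \<subseteq> C" using e by (force simp: N_def C_def abs_le_iff)
    then show "N \<subseteq> W" using e(2) by (auto simp: C_def)
    show "f x = 1" if "x \<in> N" for x
    proof -
      have "\<bar>(x j - p j) / e\<bar> \<le> 1" if "j < n" for j
        using \<open>x \<in> N\<close> that e by (force simp: N_def abs_le_iff field_simps)
      then show ?thesis unfolding f_def by (intro prod.neutral) (auto simp: ge intro: b(4))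
    qed
    show "C \<subseteq> W" using e(2) by (simp add: C_def)
    show "f x = 0" if x: "x \<in> W - C" for x
    proof -
      have "x \<in> topspace ?E" using x W openin_subset by blast
      then obtain j where j: "j < n" "\<bar>x j - p j\<bar> > 2 * e" using x by (auto simp: C_def not_le)
      then have "2 \<le> \<bar>(x j - p j) / e\<bar>" using e by (simp add: abs_divide field_simps)
      then have "\<gamma> j (x j) = 0" using b(5) by (simp only: ge)
      then show ?thesis unfolding f_def using j by (intro prod_zero) auto
    qed
    \<comment> \<open>With the singleton {0} as factor from index \<open>n\<close> on, the cube is a
      full product of compact sets.\<close>
    have "C = Pi\<^sub>E UNIV (\<lambda>i. if i < n then {p i - 2 * e..p i + 2 * e} else {0})"
    proof (rule Set.set_eqI)
      fix x
      have "x \<in> C \<longleftrightarrow> (\<forall>i. x i \<in> (if i < n then {p i - 2 * e..p i + 2 * e} else {0}))"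
      proof
        assume "x \<in> C"
        then have "x i = 0" if "\<not> i < n" for i using that by (simp add: C_def topspace_Euclidean_space)
        moreover have "x i \<in> {p i - 2 * e..p i + 2 * e}" if "i < n" for i
        proof -
          have "\<bar>x i - p i\<bar> \<le> 2 * e" using \<open>x \<in> C\<close> that by (simp add: C_def)
          then show ?thesis by (simp add: abs_le_iff)
        qed
        ultimately show "\<forall>i. x i \<in> (if i < n then {p i - 2 * e..p i + 2 * e} else {0})" by simp
      next
        assume x: "\<forall>i. x i \<in> (if i < n then {p i - 2 * e..p i + 2 * e} else {0})"
        have "x i = 0" if "n \<le> i" for i using x[rule_format, of i] that by simp
        moreover have "\<bar>x i - p i\<bar> \<le> 2 * e" if "i < n" for i
          using x[rule_format, of i] that by (simp add: abs_le_iff)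
        ultimately show "x \<in> C" by (simp add: C_def topspace_Euclidean_space)
      qed
      then show "x \<in> C \<longleftrightarrow> x \<in> Pi\<^sub>E UNIV (\<lambda>i. if i < n then {p i - 2 * e..p i + 2 * e} else {0})"
        by (simp only: PiE_UNIV_domain Pi_iff Ball_def UNIV_I simp_thms)
    qed
    then have "compactin (powertop_real UNIV) C" by (simp add: compactin_PiE)
    then show "compactin ?E C" unfolding Euclidean_space_def
      by (auto simp: compactin_subtopology C_def topspace_Euclidean_space)
  qed
qed

section \<open>Sums and products of smooth functions\<close>

lemma smooth_on_coinduct:
  assumes U: "openin (Euclidean_space n) U" and "S f"
    and cont: "\<And>g. S g \<Longrightarrow> continuous_map (subtopology (Euclidean_space n) U) euclidean g"
    and diff: "\<And>g i x. S g \<Longrightarrow> i < n \<Longrightarrow> x \<in> U \<Longrightarrow> (\<lambda>t. g (x(i := t))) differentiable (at (x i))"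
    and step: "\<And>g i. S g \<Longrightarrow> i < n \<Longrightarrow> \<exists>h. S h \<and> (\<forall>x\<in>U. partial_deriv i g x = h x)"
  shows "smooth_on n U f"
proof -
  \<comment> \<open>Smoothness is a coinductive property: all iterated derivatives stay in the class
    \<open>S\<close>. The equality holds on \<open>U\<close> only, where openness lets it survive a
    further derivative.\<close>
  have ders: "\<exists>h. S h \<and> (\<forall>x\<in>U. foldr partial_deriv is f x = h x)" if "set is \<subseteq> {..<n}" for "is"
    using that
  proof (induction "is")
    case Nil
    then show ?case using \<open>S f\<close> by auto
  next
    case (Cons i "is")
    then obtain h where h: "S h" "\<And>x. x \<in> U \<Longrightarrow> foldr partial_deriv is f x = h x" by auto
    have i: "i < n" using Cons.prems by simp
    obtain h' where h': "S h'" "\<And>x. x \<in> U \<Longrightarrow> partial_deriv i h x = h' x" using step[OF h(1) i] by auto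
    have "foldr partial_deriv [i] (foldr partial_deriv is f) x = foldr partial_deriv [i] h x" if "x \<in> U" for x
      by (rule partial_derivs_cong_open[OF U h(2)]) (use i that in auto)
    then show ?case using h' by auto
  qed
  show ?thesis
    unfolding smooth_on_def
  proof (intro allI impI conjI ballI)
    fix "is" assume "set is \<subseteq> {..<n}"
    then obtain h where h: "S h" "\<And>x. x \<in> U \<Longrightarrow> foldr partial_deriv is f x = h x" using ders by blast
    show "continuous_map (subtopology (Euclidean_space n) U) euclidean (foldr partial_deriv is f)"
      by (rule continuous_map_eq[OF cont[OF h(1)]]) (use h(2) in auto)
    fix i x assume i: "i < n" and x: "x \<in> U"
    have xE: "x \<in> topspace (Euclidean_space n)" using x U openin_subset by blast
    have ev: "\<forall>\<^sub>F t in nhds (x i). x(i := t) \<in> U" by (rule partial_deriv_line[OF xE i U x])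
    obtain D where D: "((\<lambda>t. h (x(i := t))) has_derivative D) (at (x i))"
      using diff[OF h(1) i x] unfolding differentiable_def by blast
    have "((\<lambda>t. foldr partial_deriv is f (x(i := t))) has_derivative D) (at (x i))"
      by (rule has_derivative_transform_eventually[OF D])
        (use ev h(2) x in \<open>auto simp: eventually_at_filter elim!: eventually_mono\<close>)
    then show "(\<lambda>t. foldr partial_deriv is f (x(i := t))) differentiable (at (x i))"
      unfolding differentiable_def by blast
  qed
qed

lemma smooth_on_partial_deriv:
  assumes "smooth_on n U f" "i < n" shows "smooth_on n U (partial_deriv i f)"
  unfolding smooth_on_def
proof (intro allI impI)
  fix "is" assume *: "set is \<subseteq> {..<n}"
  have eq: "foldr partial_deriv (is @ [i]) f = foldr partial_deriv is (partial_deriv i f)" by simp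
  have "set (is @ [i]) \<subseteq> {..<n}" using * assms by auto
  from smooth_onD[OF assms(1) this, unfolded eq] show
    "continuous_map (subtopology (Euclidean_space n) U) euclidean (foldr partial_deriv is (partial_deriv i f)) \<and>
     (\<forall>j<n. \<forall>x\<in>U. (\<lambda>t. foldr partial_deriv is (partial_deriv i f) (x(j := t))) differentiable (at (x j)))"
    by blast
qed

lemma smooth_on_continuous:
  "smooth_on n U f \<Longrightarrow> continuous_map (subtopology (Euclidean_space n) U) euclidean f"
  using smooth_onD(1)[of n U f "[]"] by simp

lemma smooth_on_differentiable:
  "smooth_on n U f \<Longrightarrow> i < n \<Longrightarrow> x \<in> U \<Longrightarrow> (\<lambda>t. f (x(i := t))) differentiable (at (x i))"
  using smooth_onD(2)[of n U f "[]"] by simp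

text \<open>Finite sums of products of smooth functions are closed under partial derivatives.\<close>

inductive smooth_products :: "nat \<Rightarrow> (nat \<Rightarrow> real) set \<Rightarrow> ((nat \<Rightarrow> real) \<Rightarrow> complex) \<Rightarrow> bool" for n U where
  prod: "smooth_on n U f \<Longrightarrow> smooth_on n U g \<Longrightarrow> smooth_products n U (\<lambda>x. f x * g x)"
| add: "smooth_products n U f \<Longrightarrow> smooth_products n U g \<Longrightarrow> smooth_products n U (\<lambda>x. f x + g x)"

lemma smooth_products_smooth_on:
  assumes U: "openin (Euclidean_space n) U" and "smooth_products n U f"
  shows "smooth_on n U f"
proof (rule smooth_on_coinduct[OF U, of "smooth_products n U", OF assms(2)])
  let ?T = "subtopology (Euclidean_space n) U"
  have cm: "continuous_map ?T euclidean f \<longleftrightarrow> continuous_on (topspace ?T) f" for f :: "(nat \<Rightarrow> real) \<Rightarrow> complex"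
    by (simp add: Euclidean_space_def euclidean_product_topology subtopology_subtopology)
  show "continuous_map ?T euclidean g" if "smooth_products n U g" for g
    using that
  proof induction
    case (prod f g)
    then show ?case using smooth_on_continuous[of n U f] smooth_on_continuous[of n U g]
      unfolding cm by (intro continuous_on_mult)
  next
    case (add f g)
    then show ?case unfolding cm by (intro continuous_on_add)
  qed
  show d: "(\<lambda>t. g (x(i := t))) differentiable (at (x i))" if "smooth_products n U g" "i < n" "x \<in> U" for g i x
    using that
  proof induction
    case (prod f g)
    then show ?case using smooth_on_differentiable by (intro differentiable_mult)
  next
    case (add f g)
    then show ?case by (intro differentiable_add)
  qed
  show "\<exists>h. smooth_products n U h \<and> (\<forall>x\<in>U. partial_deriv i g x = h x)"
    if "smooth_products n U g" "i < n" for g i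
    using that
  proof induction
    case (prod f g)
    let ?h = "\<lambda>x. f x * partial_deriv i g x + partial_deriv i f x * g x"
    have "smooth_products n U ?h"
      using prod smooth_on_partial_deriv by (intro smooth_products.intros) blast+
    moreover have "partial_deriv i (\<lambda>x. f x * g x) x = ?h x" if x: "x \<in> U" for x
    proof -
      have "((\<lambda>t. f (x(i := t)) * g (x(i := t))) has_vector_derivative
          f (x(i := x i)) * partial_deriv i g x + partial_deriv i f x * g (x(i := x i))) (at (x i))"
        unfolding partial_deriv_def
        by (intro has_vector_derivative_mult)
          (use prod x smooth_on_differentiable in \<open>auto simp flip: vector_derivative_works\<close>)
      then show ?thesis unfolding partial_deriv_def by (simp add: vector_derivative_at)
    qed
    ultimately show ?case by blast
  next
    case (add f g)
    then obtain f' g' where h: "smooth_products n U f'" "smooth_products n U g'"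
      "\<And>x. x \<in> U \<Longrightarrow> partial_deriv i f x = f' x" "\<And>x. x \<in> U \<Longrightarrow> partial_deriv i g x = g' x" by auto
    have "partial_deriv i (\<lambda>x. f x + g x) x = f' x + g' x" if x: "x \<in> U" for x
    proof -
      have "((\<lambda>t. f (x(i := t)) + g (x(i := t))) has_vector_derivative
          partial_deriv i f x + partial_deriv i g x) (at (x i))"
        unfolding partial_deriv_def
        by (intro has_vector_derivative_add)
          (use add x d in \<open>auto simp flip: vector_derivative_works\<close>)
      then show ?thesis using h(3,4)[OF x] by (simp add: partial_deriv_def vector_derivative_at)
    qed
    then show ?case using smooth_products.add[OF h(1,2)] by blast
  qed
qed

lemma smooth_on_mult:
  "openin (Euclidean_space n) U \<Longrightarrow> smooth_on n U f \<Longrightarrow> smooth_on n U g \<Longrightarrow> smooth_on n U (\<lambda>x. f x * g x)"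
  by (rule smooth_products_smooth_on) (auto intro: smooth_products.intros)

lemma smooth_on_add:
  assumes "openin (Euclidean_space n) U" "smooth_on n U f" "smooth_on n U g"
  shows "smooth_on n U (\<lambda>x. f x + g x)"
proof -
  \<comment> \<open>The class is generated by products of smooth functions, so each summand is
    written with a factor 1.\<close>
  have "smooth_products n U (\<lambda>x. f x * 1 + g x * 1)"
    using assms by (intro smooth_products.intros smooth_on_const)
  then show ?thesis using smooth_products_smooth_on[OF assms(1)] by simp
qed

lemma smooth_on_sum:
  assumes "openin (Euclidean_space n) U" "\<And>i. i \<in> I \<Longrightarrow> smooth_on n U (f i)"
  shows "smooth_on n U (\<lambda>x. \<Sum>i\<in>I. f i x)"
  using assms(2) by (induction I rule: infinite_finite_induct) (auto simp: smooth_on_const smooth_on_add[OF assms(1)])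

section \<open>Values of sections\<close>

text \<open>An ideal exceeding the kernel contains some \<open>x\<close> with nonzero image. If
  \<open>y\<close> maps to the inverse of that image, then 1 - y x lies in the kernel, so the ideal
  contains 1.\<close>

lemma kernel_maximalideal_into_complex:
  fixes R (structure)
  assumes hom: "ring_hom_ring R complex_ring h" and surj: "\<And>c. \<exists>x\<in>carrier R. h x = c"
  shows "maximalideal (a_kernel R complex_ring h) R"
proof -
  interpret ring_hom_ring R complex_ring h by (rule hom)
  let ?S = complex_ring
  interpret K: ideal "a_kernel R ?S h" R by (rule kernel_is_ideal)
  have "h \<one> \<noteq> 0" using hom_one by simp
  have ker: "a_kernel R ?S h = {x \<in> carrier R. h x = 0}"
    unfolding a_kernel_def' by (simp only: complex_ring_simps)
  have one: "\<one> \<notin> a_kernel R ?S h" unfolding ker using \<open>h \<one> \<noteq> 0\<close> by blast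
  show ?thesis
  proof
    show "carrier R \<noteq> a_kernel R ?S h" using one by blast
    fix J assume J: "ideal J R" "a_kernel R ?S h \<subseteq> J" "J \<subseteq> carrier R"
    interpret J: ideal J R by fact
    have "J = carrier R" if ne: "J \<noteq> a_kernel R ?S h"
    proof -
      obtain x where x: "x \<in> J" "h x \<noteq> 0" using J ne unfolding ker by blast
      obtain y where y: "y \<in> carrier R" "h y = inverse (h x)" using surj by blast
      have xR: "x \<in> carrier R" using x J by blast
      have yx: "h (y \<otimes> x) = h \<one>" using xR y x hom_one by simp
      have "h (\<one> \<ominus> y \<otimes> x) = h \<one> \<oplus>\<^bsub>?S\<^esub> (\<ominus>\<^bsub>?S\<^esub> h (y \<otimes> x))"
        using xR y by (simp only: a_minus_def hom_add hom_a_inv R.one_closed R.m_closed R.a_inv_closed)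
      also have "\<dots> = \<zero>\<^bsub>?S\<^esub>" unfolding yx by (rule S.r_neg) simp
      finally have "h (\<one> \<ominus> y \<otimes> x) = 0" by simp
      then have "\<one> \<ominus> y \<otimes> x \<in> J" using J(2) R.minus_closed[OF R.one_closed R.m_closed[OF y(1) xR]]
        unfolding ker by blast
      moreover have "y \<otimes> x \<in> J" using x y by (simp add: J.I_l_closed)
      ultimately have "(\<one> \<ominus> y \<otimes> x) \<oplus> y \<otimes> x \<in> J" by (rule J.a_closed)
      moreover have "(\<one> \<ominus> y \<otimes> x) \<oplus> y \<otimes> x = \<one>" using xR y by (simp add: a_minus_def R.a_assoc R.l_neg)
      ultimately show ?thesis using J.one_imp_carrier by simp
    qed
    then show "J = a_kernel R ?S h \<or> J = carrier R" by blast
  qed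
qed

section \<open>Germs, stalks and the computation of residues\<close>

context ringed
begin

abbreviation grm where "grm \<equiv> germ X \<O>"

lemma germ_iff: "(V, t) \<in> grm a U f \<longleftrightarrow> openin X V \<and> a \<in> V \<and> t \<in> sec \<O> V \<and>
    (\<exists>W. openin X W \<and> a \<in> W \<and> W \<subseteq> U \<inter> V \<and> restr \<O> U W f = restr \<O> V W t)"
  by (simp add: germ_def)

lemma germ_eqI:
  assumes "openin X U" "openin X V" "f \<in> sec \<O> U" "g \<in> sec \<O> V" "openin X W" "a \<in> W" "W \<subseteq> U" "W \<subseteq> V"
    "restr \<O> U W f = restr \<O> V W g"
  shows "grm a U f = grm a V g"
proof -
  have sub: "grm a U f \<subseteq> grm a V g"
    if *: "openin X U" "openin X V" "f \<in> sec \<O> U" "g \<in> sec \<O> V" "W \<subseteq> U" "W \<subseteq> V" "restr \<O> U W f = restr \<O> V W g"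
    for U V f g
  proof clarify
    fix T t assume "(T, t) \<in> grm a U f"
    then obtain W' where t: "openin X T" "a \<in> T" "t \<in> sec \<O> T"
      and W': "openin X W'" "a \<in> W'" "W' \<subseteq> U \<inter> T" "restr \<O> U W' f = restr \<O> T W' t"
      unfolding germ_def by auto
    let ?M = "W \<inter> W'"
    have M: "openin X ?M" "a \<in> ?M" using assms W' by auto
    have o: "W \<in> opens_in X U" "W \<in> opens_in X V" "W' \<in> opens_in X U" "W' \<in> opens_in X T"
      "?M \<in> opens_in X W" "?M \<in> opens_in X W'"
      using * assms W' M by (auto simp: opens_in_iff)
    have "restr \<O> V ?M g = restr \<O> W ?M (restr \<O> V W g)" using O_restr_restr[OF *(2) o(2,5) *(4)] by simp
    also have "\<dots> = restr \<O> U ?M f" using *(7) O_restr_restr[OF *(1) o(1,5) *(3)] by simp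
    also have "\<dots> = restr \<O> W' ?M (restr \<O> U W' f)" using O_restr_restr[OF *(1) o(3,6) *(3)] by simp
    also have "\<dots> = restr \<O> T ?M t" using W'(4) O_restr_restr[OF t(1) o(4,6) t(3)] by simp
    finally show "(T, t) \<in> grm a V g" using t M * W' unfolding germ_def by blast
  qed
  show ?thesis using sub[of U V f g] sub[of V U g f] assms by auto
qed

lemma germ_self: "openin X U \<Longrightarrow> a \<in> U \<Longrightarrow> f \<in> sec \<O> U \<Longrightarrow> (U, f) \<in> grm a U f"
  unfolding germ_def by auto

lemma germ_restr:
  assumes "openin X U" "V \<in> opens_in X U" "a \<in> V" "f \<in> sec \<O> U"
  shows "grm a V (restr \<O> U V f) = grm a U f"
  by (rule germ_eqI[of _ _ _ _ V])
    (use assms O_restr_closed[OF assms(1,2,4)] O_restr_id[of V "restr \<O> U V f"] in \<open>auto simp: opens_in_iff\<close>)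

text \<open>All representatives agree on a smaller neighbourhood, so the members of the union that
  defines a stalk operation coincide. The operation \<open>b\<close> is kept general to treat sums
  and products at once.\<close>

lemma germ_op:
  assumes W: "openin X W" "a \<in> W" and f: "f \<in> sec \<O> W" and g: "g \<in> sec \<O> W"
    and cl: "\<And>U f g. openin X U \<Longrightarrow> f \<in> sec \<O> U \<Longrightarrow> g \<in> sec \<O> U \<Longrightarrow> b U f g \<in> sec \<O> U"
    and res: "\<And>U V f g. openin X U \<Longrightarrow> V \<in> opens_in X U \<Longrightarrow> f \<in> sec \<O> U \<Longrightarrow> g \<in> sec \<O> U \<Longrightarrow>
      restr \<O> U V (b U f g) = b V (restr \<O> U V f) (restr \<O> U V g)"
  shows "(\<Union>(U, f')\<in>grm a W f. \<Union>(V, g')\<in>grm a W g.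
      grm a (U \<inter> V) (b (U \<inter> V) (restr \<O> U (U \<inter> V) f') (restr \<O> V (U \<inter> V) g'))) = grm a W (b W f g)"
proof -
  have eq: "grm a (U \<inter> V) (b (U \<inter> V) (restr \<O> U (U \<inter> V) f') (restr \<O> V (U \<inter> V) g')) = grm a W (b W f g)"
    if fU: "(U, f') \<in> grm a W f" and gV: "(V, g') \<in> grm a W g" for U f' V g'
  proof -
    obtain W1 where U: "openin X U" "f' \<in> sec \<O> U"
      and W1: "openin X W1" "a \<in> W1" "W1 \<subseteq> W \<inter> U" "restr \<O> W W1 f = restr \<O> U W1 f'"
      using fU unfolding germ_iff by blast
    obtain W2 where V: "openin X V" "g' \<in> sec \<O> V"
      and W2: "openin X W2" "a \<in> W2" "W2 \<subseteq> W \<inter> V" "restr \<O> W W2 g = restr \<O> V W2 g'"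
      using gV unfolding germ_iff by blast
    let ?M = "W1 \<inter> W2"
    have M: "openin X ?M" "a \<in> ?M" using W1 W2 by auto
    have o: "W1 \<in> opens_in X W" "W1 \<in> opens_in X U" "W2 \<in> opens_in X W" "W2 \<in> opens_in X V"
      "?M \<in> opens_in X W1" "?M \<in> opens_in X W2" "?M \<in> opens_in X W" "?M \<in> opens_in X (U \<inter> V)"
      "U \<inter> V \<in> opens_in X U" "U \<inter> V \<in> opens_in X V"
      using W U V W1 W2 M by (auto simp: opens_in_iff)
    have UV: "openin X (U \<inter> V)" using U V by blast
    have 1: "restr \<O> W ?M f = restr \<O> (U \<inter> V) ?M (restr \<O> U (U \<inter> V) f')"
      using O_restr_restr[OF W(1) o(1,5) f] O_restr_restr[OF U(1) o(2,5) U(2)] O_restr_restr[OF U(1) o(9,8) U(2)] W1(4)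
      by simp
    have 2: "restr \<O> W ?M g = restr \<O> (U \<inter> V) ?M (restr \<O> V (U \<inter> V) g')"
      using O_restr_restr[OF W(1) o(3,6) g] O_restr_restr[OF V(1) o(4,6) V(2)] O_restr_restr[OF V(1) o(10,8) V(2)] W2(4)
      by simp
    note f'' = O_restr_closed[OF U(1) o(9) U(2)] and g'' = O_restr_closed[OF V(1) o(10) V(2)]
    show ?thesis
      by (rule germ_eqI[OF UV W(1) cl[OF UV f'' g''] cl[OF W(1) f g] M])
        (use 1 2 res[OF UV o(8) f'' g''] res[OF W(1) o(7) f g] W1 W2 in auto)
  qed
  have ne: "(W, f) \<in> grm a W f" "(W, g) \<in> grm a W g" using germ_self W f g by auto
  show ?thesis
  proof (intro equalityI subsetI)
    fix p assume "p \<in> (\<Union>(U, f')\<in>grm a W f. \<Union>(V, g')\<in>grm a W g.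
      grm a (U \<inter> V) (b (U \<inter> V) (restr \<O> U (U \<inter> V) f') (restr \<O> V (U \<inter> V) g')))"
    then show "p \<in> grm a W (b W f g)" using eq by fastforce
  next
    fix p assume p: "p \<in> grm a W (b W f g)"
    show "p \<in> (\<Union>(U, f')\<in>grm a W f. \<Union>(V, g')\<in>grm a W g.
      grm a (U \<inter> V) (b (U \<inter> V) (restr \<O> U (U \<inter> V) f') (restr \<O> V (U \<inter> V) g')))"
      by (rule UN_I[OF ne(1)], unfold prod.case, rule UN_I[OF ne(2)], unfold prod.case) (use p eq[OF ne] in simp)
  qed
qed

lemma stalk_add:
  "openin X W \<Longrightarrow> a \<in> W \<Longrightarrow> f \<in> sec \<O> W \<Longrightarrow> g \<in> sec \<O> W \<Longrightarrow>
   grm a W f \<oplus>\<^bsub>stalk X \<O> a\<^esub> grm a W g = grm a W (f \<oplus>\<^bsub>sections \<O> W\<^esub> g)"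
  using germ_op[of W a f g "\<lambda>U f g. f \<oplus>\<^bsub>sections \<O> U\<^esub> g"]
  by (simp add: stalk_def O_restr_add cring.cring_simprules(1)[OF O_cring])

lemma stalk_mult:
  "openin X W \<Longrightarrow> a \<in> W \<Longrightarrow> f \<in> sec \<O> W \<Longrightarrow> g \<in> sec \<O> W \<Longrightarrow>
   grm a W f \<otimes>\<^bsub>stalk X \<O> a\<^esub> grm a W g = grm a W (f \<otimes>\<^bsub>sections \<O> W\<^esub> g)"
  using germ_op[of W a f g "\<lambda>U f g. f \<otimes>\<^bsub>sections \<O> U\<^esub> g"]
  by (simp add: stalk_def O_restr_mult cring.cring_simprules(5)[OF O_cring])

lemma stalk_carrier:
  "carrier (stalk X \<O> a) = {grm a U f | U f. openin X U \<and> a \<in> U \<and> f \<in> sec \<O> U}"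
  by (simp add: stalk_def)

text \<open>A multiplicative evaluation compatible with restriction descends to a homomorphism
  \<open>h\<close> from the stalk onto the complex numbers. Its kernel is maximal and hence the
  unique maximal ideal that \<open>value_at\<close> refers to, so the residue can be read off from
  \<open>e\<close>.\<close>

theorem value_at_eqI:
  assumes local: "local_ring (stalk X \<O> a)" and U0: "openin X U0" "a \<in> U0"
    and e_add: "\<And>V f g. V \<in> opens_in X U0 \<Longrightarrow> a \<in> V \<Longrightarrow> f \<in> sec \<O> V \<Longrightarrow> g \<in> sec \<O> V \<Longrightarrow>
      e V (f \<oplus>\<^bsub>sections \<O> V\<^esub> g) = e V f + e V g"
    and e_mult: "\<And>V f g. V \<in> opens_in X U0 \<Longrightarrow> a \<in> V \<Longrightarrow> f \<in> sec \<O> V \<Longrightarrow> g \<in> sec \<O> V \<Longrightarrow>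
      e V (f \<otimes>\<^bsub>sections \<O> V\<^esub> g) = e V f * e V g"
    and e_one: "\<And>V. V \<in> opens_in X U0 \<Longrightarrow> a \<in> V \<Longrightarrow> e V \<one>\<^bsub>sections \<O> V\<^esub> = 1"
    and e_smult: "\<And>V f c. V \<in> opens_in X U0 \<Longrightarrow> a \<in> V \<Longrightarrow> f \<in> sec \<O> V \<Longrightarrow>
      e V (c \<odot>\<^bsub>sections \<O> V\<^esub> f) = c * e V f"
    and e_restr: "\<And>V W f. V \<in> opens_in X U0 \<Longrightarrow> W \<in> opens_in X V \<Longrightarrow> a \<in> W \<Longrightarrow> f \<in> sec \<O> V \<Longrightarrow>
      e W (restr \<O> V W f) = e V f"
    and V: "openin X V" "a \<in> V" and f: "f \<in> sec \<O> V"
  shows "value_at X \<O> V f a = e (V \<inter> U0) (restr \<O> V (V \<inter> U0) f)"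
proof -
  let ?R = "stalk X \<O> a"
  have cr: "cring ?R" using local by (simp add: local_ring_def)
  \<comment> \<open>The evaluation is given inside \<open>U0\<close> only, while germs may be
    represented on sets that leave \<open>U0\<close>.\<close>
  define e0 where "e0 V f = e (V \<inter> U0) (restr \<O> V (V \<inter> U0) f)" for V f
  have e0_restr: "e0 W (restr \<O> V W f) = e0 V f"
    if "openin X V" "W \<in> opens_in X V" "a \<in> W" "f \<in> sec \<O> V" for V W f
  proof -
    have o: "V \<inter> U0 \<in> opens_in X V" "W \<inter> U0 \<in> opens_in X (V \<inter> U0)" "W \<inter> U0 \<in> opens_in X W" "V \<inter> U0 \<in> opens_in X U0"
      using that U0 by (auto simp: opens_in_iff)
    have "e (W \<inter> U0) (restr \<O> V (W \<inter> U0) f) = e (V \<inter> U0) (restr \<O> V (V \<inter> U0) f)"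
      using e_restr[OF o(4,2) _ O_restr_closed[OF that(1) o(1) that(4)]] that(3) U0(2)
        O_restr_restr[OF that(1) o(1,2) that(4)] by simp
    then show ?thesis unfolding e0_def using O_restr_restr[OF that(1,2) o(3) that(4)] by simp
  qed
  have o: "W \<inter> U0 \<in> opens_in X W" "W \<inter> U0 \<in> opens_in X U0" if "openin X W" for W
    using that U0 by (auto simp: opens_in_iff)
  have aW: "a \<in> W \<inter> U0" if "a \<in> W" for W using that U0 by blast
  have oW: "openin X (W \<inter> U0)" if "openin X W" for W using that U0 by blast
  have e0_add: "e0 W (f \<oplus>\<^bsub>sections \<O> W\<^esub> g) = e0 W f + e0 W g"
    if "openin X W" "a \<in> W" "f \<in> sec \<O> W" "g \<in> sec \<O> W" for W f g
    unfolding e0_def O_restr_add[OF that(1) o(1)[OF that(1)] that(3,4)]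
    by (rule e_add[OF o(2)[OF that(1)] aW[OF that(2)]]) (use O_restr_closed[OF that(1) o(1)[OF that(1)]] that in auto)
  have e0_mult: "e0 W (f \<otimes>\<^bsub>sections \<O> W\<^esub> g) = e0 W f * e0 W g"
    if "openin X W" "a \<in> W" "f \<in> sec \<O> W" "g \<in> sec \<O> W" for W f g
    unfolding e0_def O_restr_mult[OF that(1) o(1)[OF that(1)] that(3,4)]
    by (rule e_mult[OF o(2)[OF that(1)] aW[OF that(2)]]) (use O_restr_closed[OF that(1) o(1)[OF that(1)]] that in auto)
  have e0_one: "e0 W \<one>\<^bsub>sections \<O> W\<^esub> = 1" if "openin X W" "a \<in> W" for W
    unfolding e0_def O_restr_one[OF that(1) o(1)[OF that(1)]]
    by (rule e_one[OF o(2)[OF that(1)] aW[OF that(2)]])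
  have e0_const: "e0 W (c \<odot>\<^bsub>sections \<O> W\<^esub> \<one>\<^bsub>sections \<O> W\<^esub>) = c" if "openin X W" "a \<in> W" for W c
  proof -
    have 1: "\<one>\<^bsub>sections \<O> (W \<inter> U0)\<^esub> \<in> sec \<O> (W \<inter> U0)" "\<one>\<^bsub>sections \<O> W\<^esub> \<in> sec \<O> W"
      using cring.cring_simprules(6)[OF O_cring] oW that by auto
    show ?thesis
      unfolding e0_def O_restr_smult[OF that(1) o(1)[OF that(1)] 1(2)] O_restr_one[OF that(1) o(1)[OF that(1)]]
      using e_smult[OF o(2)[OF that(1)] aW[OF that(2)] 1(1)] e_one[OF o(2)[OF that(1)] aW[OF that(2)]] by simp
  qed
  \<comment> \<open>An arbitrary representative of the germ is evaluated; \<open>e0\<close> is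
    unchanged by restriction, so the outcome depends on the germ alone.\<close>
  define h where "h A = (let (V, f) = (SOME p. p \<in> A) in e0 V f)" for A
  have h: "h (grm a V f) = e0 V f" if "openin X V" "a \<in> V" "f \<in> sec \<O> V" for V f
  proof -
    obtain V' f' where p: "(SOME p. p \<in> grm a V f) = (V', f')" by fastforce
    have "(SOME p. p \<in> grm a V f) \<in> grm a V f" by (rule someI[of "\<lambda>p. p \<in> grm a V f", OF germ_self[OF that]])
    then obtain W where V': "openin X V'" "f' \<in> sec \<O> V'"
      and W: "openin X W" "a \<in> W" "W \<subseteq> V \<inter> V'" "restr \<O> V W f = restr \<O> V' W f'"
      unfolding p germ_iff by blast
    have "e0 V' f' = e0 W (restr \<O> V' W f')"
      by (rule e0_restr[symmetric]) (use V' W in \<open>auto simp: opens_in_iff\<close>)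
    also have "\<dots> = e0 V f"
      unfolding W(4)[symmetric] by (rule e0_restr) (use that W in \<open>auto simp: opens_in_iff\<close>)
    finally show ?thesis by (simp add: h_def p)
  qed
  have common: "\<exists>W f g. openin X W \<and> a \<in> W \<and> f \<in> sec \<O> W \<and> g \<in> sec \<O> W \<and> A = grm a W f \<and> B = grm a W g"
    if "A \<in> carrier ?R" "B \<in> carrier ?R" for A B
  proof -
    obtain U f V g where *: "A = grm a U f" "openin X U" "a \<in> U" "f \<in> sec \<O> U"
      "B = grm a V g" "openin X V" "a \<in> V" "g \<in> sec \<O> V" using \<open>A \<in> carrier ?R\<close> \<open>B \<in> carrier ?R\<close>
      unfolding stalk_carrier by blast
    have oo: "U \<inter> V \<in> opens_in X U" "U \<inter> V \<in> opens_in X V" "a \<in> U \<inter> V" "openin X (U \<inter> V)"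
      using * by (auto simp: opens_in_iff)
    show ?thesis
      using germ_restr[OF *(2) oo(1,3) *(4)] germ_restr[OF *(6) oo(2,3) *(8)]
        O_restr_closed[OF *(2) oo(1) *(4)] O_restr_closed[OF *(6) oo(2) *(8)] *(1,5) oo(3,4) by metis
  qed
  have X: "openin X (topspace X)" "a \<in> topspace X" using V openin_subset by auto
  have one_in: "\<one>\<^bsub>sections \<O> W\<^esub> \<in> sec \<O> W" if "openin X W" for W using cring.cring_simprules(6)[OF O_cring[OF that]] .
  have "h \<in> Ring.ring_hom ?R complex_ring"
  proof (rule ring_hom_memI)
    fix A B assume AB: "A \<in> carrier ?R" "B \<in> carrier ?R"
    from common[OF AB] obtain W f g where *: "openin X W" "a \<in> W" "f \<in> sec \<O> W" "g \<in> sec \<O> W" "A = grm a W f" "B = grm a W g"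
      by blast
    show "h (A \<otimes>\<^bsub>?R\<^esub> B) = h A \<otimes>\<^bsub>complex_ring\<^esub> h B"
      using * by (simp add: stalk_mult h e0_mult cring.cring_simprules(5)[OF O_cring])
    show "h (A \<oplus>\<^bsub>?R\<^esub> B) = h A \<oplus>\<^bsub>complex_ring\<^esub> h B"
      using * by (simp add: stalk_add h e0_add cring.cring_simprules(1)[OF O_cring])
  next
    have "\<one>\<^bsub>?R\<^esub> = grm a (topspace X) \<one>\<^bsub>sections \<O> (topspace X)\<^esub>" by (simp add: stalk_def)
    then show "h \<one>\<^bsub>?R\<^esub> = \<one>\<^bsub>complex_ring\<^esub>" using X by (simp add: h e0_one one_in)
  qed simp
  then interpret h: ring_hom_ring ?R complex_ring h
    using cr cring_complex_ring by (auto intro!: ring_hom_ringI2 simp: cring.axioms(1))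
  have constV: "c \<odot>\<^bsub>sections \<O> V\<^esub> \<one>\<^bsub>sections \<O> V\<^esub> \<in> sec \<O> V" for c
    using complex_module_smult_closed[OF O_module[OF V(1)] one_in[OF V(1)]] .
  have gc: "grm a V g \<in> carrier ?R" if "g \<in> sec \<O> V" for g using that V unfolding stalk_carrier by blast
  have "maximalideal (a_kernel ?R complex_ring h) ?R"
  proof (rule kernel_maximalideal_into_complex[OF h.is_ring_hom_ring])
    fix c show "\<exists>x\<in>carrier ?R. h x = c"
      by (rule bexI[OF _ gc[OF constV[of c]]]) (simp add: h V constV e0_const)
  qed
  moreover have "\<exists>!I. maximalideal I ?R" using local by (simp add: local_ring_def)
  ultimately have m: "(THE I. maximalideal I ?R) = a_kernel ?R complex_ring h" by (rule the1_equality[rotated])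
  \<comment> \<open>Cosets of the kernel are the fibres of \<open>h\<close>, so equality of cosets
    becomes equality of values.\<close>
  have "value_at X \<O> V f a = (THE c. {x \<in> carrier ?R. h x = h (grm a V f)} =
      {x \<in> carrier ?R. h x = h (grm a V (c \<odot>\<^bsub>sections \<O> V\<^esub> \<one>\<^bsub>sections \<O> V\<^esub>))})"
    unfolding value_at_def Let_def m by (simp only: h.rcos_eq_homeq[OF gc[OF f]] h.rcos_eq_homeq[OF gc[OF constV]])
  also have "\<dots> = (THE c. {x \<in> carrier ?R. h x = e0 V f} = {x \<in> carrier ?R. h x = c})"
    using V f constV by (simp add: h e0_const)
  also have "\<dots> = e0 V f"
  proof (rule the_equality)
    fix c assume eq: "{x \<in> carrier ?R. h x = e0 V f} = {x \<in> carrier ?R. h x = c}"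
    have "grm a V f \<in> {x \<in> carrier ?R. h x = e0 V f}" using gc[OF f] V f by (simp add: h)
    then show "c = e0 V f" unfolding eq using V f by (simp add: h)
  qed simp
  finally show ?thesis by (simp add: e0_def)
qed

end

section \<open>Formal charts\<close>

context
  fixes n k :: nat
begin

abbreviation std where "std \<equiv> standard_formal_sheaf n k"

lemma std_sec: "F \<in> sec std U \<longleftrightarrow> (\<forall>I. smooth_on n U (F I) \<and> (\<forall>x. x \<notin> U \<longrightarrow> F I x = 0)) \<and>
    (\<forall>I. \<not> Poly_Mapping.keys I \<subseteq> {..<k} \<longrightarrow> F I = (\<lambda>x. 0))"
  by (simp add: standard_formal_sheaf_def)

lemma std_secD:
  assumes "F \<in> sec std U"
  shows std_smooth: "smooth_on n U (F I)" and std_outside: "x \<notin> U \<Longrightarrow> F I x = 0"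
    and std_keys: "\<not> Poly_Mapping.keys I \<subseteq> {..<k} \<Longrightarrow> F I = (\<lambda>x. 0)"
  using assms[unfolded std_sec] by (elim conjE, elim allE[of _ I], simp)+

lemma std_simps:
  "F \<otimes>\<^bsub>sections std U\<^esub> G = (\<lambda>I x. \<Sum>(J, L)\<in>{(J, L). J + L = I}. F J x * G L x)"
  "\<one>\<^bsub>sections std U\<^esub> = (\<lambda>I x. if I = 0 \<and> x \<in> U then 1 else 0)"
  "\<zero>\<^bsub>sections std U\<^esub> = (\<lambda>I x. 0)"
  "F \<oplus>\<^bsub>sections std U\<^esub> G = (\<lambda>I x. F I x + G I x)"
  "c \<odot>\<^bsub>sections std U\<^esub> F = (\<lambda>I x. c * F I x)"
  "restr std U V F = (\<lambda>I x. if x \<in> V then F I x else 0)"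
  by (simp_all add: standard_formal_sheaf_def)

text \<open>Multi-indices have natural entries, so J + L = 0 forces J = L = 0. The coefficient at 0
  is therefore multiplicative, which makes it the residue.\<close>

lemma std_mult_zero_coeff: "(F \<otimes>\<^bsub>sections std U\<^esub> G) 0 x = F 0 x * G 0 x"
proof -
  have *: "J = 0 \<and> L = 0" if "J + L = 0" for J L :: "nat \<Rightarrow>\<^sub>0 nat"
  proof -
    have "Poly_Mapping.lookup (J + L) i = 0" for i using that by simp
    then have "Poly_Mapping.lookup J i = 0" "Poly_Mapping.lookup L i = 0" for i by (auto simp: lookup_add)
    then show ?thesis by (auto intro!: poly_mapping_eqI)
  qed
  have "{(J, L). J + L = (0 :: nat \<Rightarrow>\<^sub>0 nat)} = {(0, 0)}"
  proof (intro equalityI subsetI)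
    fix p assume "p \<in> {(J, L). J + L = (0 :: nat \<Rightarrow>\<^sub>0 nat)}"
    then have "fst p + snd p = 0" by (simp add: case_prod_beta)
    from *[OF this] show "p \<in> {(0, 0)}" by (simp add: prod_eq_iff)
  qed simp
  then show ?thesis by (simp add: std_simps)
qed

lemma std_add_closed:
  assumes U: "openin (Euclidean_space n) U" and F: "F \<in> sec std U" and G: "G \<in> sec std U"
  shows "F \<oplus>\<^bsub>sections std U\<^esub> G \<in> sec std U"
  unfolding std_sec std_simps by (simp add: smooth_on_add[OF U] std_secD[OF F] std_secD[OF G])

lemma std_smult_closed:
  assumes U: "openin (Euclidean_space n) U" and F: "F \<in> sec std U"
  shows "c \<odot>\<^bsub>sections std U\<^esub> F \<in> sec std U"
  unfolding std_sec std_simps by (simp add: smooth_on_mult[OF U] smooth_on_const std_secD[OF F])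

lemma std_mult_closed:
  assumes U: "openin (Euclidean_space n) U" and F: "F \<in> sec std U" and G: "G \<in> sec std U"
  shows "F \<otimes>\<^bsub>sections std U\<^esub> G \<in> sec std U"
  unfolding std_sec
proof (intro conjI allI impI)
  fix I
  have "smooth_on n U (\<lambda>x. \<Sum>p\<in>{(J, L). J + L = I}. F (fst p) x * G (snd p) x)"
    by (intro smooth_on_sum[OF U] smooth_on_mult[OF U] std_smooth[OF F] std_smooth[OF G])
  then show "smooth_on n U ((F \<otimes>\<^bsub>sections std U\<^esub> G) I)" by (simp add: std_simps case_prod_beta)
  show "(F \<otimes>\<^bsub>sections std U\<^esub> G) I x = 0" if "x \<notin> U" for x
  proof -
    have "F J x = 0" for J using std_outside[OF F that] .
    then show ?thesis by (simp add: std_simps case_prod_beta)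
  qed
  assume I: "\<not> Poly_Mapping.keys I \<subseteq> {..<k}"
  \<comment> \<open>A variable of index at least \<open>k\<close> that occurs in \<open>I\<close>
    occurs in \<open>J\<close> or in \<open>L\<close>, and the corresponding coefficient
    vanishes.\<close>
  have "F J = (\<lambda>x. 0) \<or> G L = (\<lambda>x. 0)" if "J + L = I" for J L
  proof -
    have "Poly_Mapping.keys I \<subseteq> Poly_Mapping.keys J \<union> Poly_Mapping.keys L"
      using Poly_Mapping.keys_add[of J L] unfolding that .
    then have "\<not> Poly_Mapping.keys J \<subseteq> {..<k} \<or> \<not> Poly_Mapping.keys L \<subseteq> {..<k}" using I by blast
    then show ?thesis using std_keys[OF F, of J] std_keys[OF G, of L] by argo
  qed
  note z = this
  have "F (fst p) x * G (snd p) x = 0" if "p \<in> {(J, L). J + L = I}" for p x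
  proof -
    have "fst p + snd p = I" using that by (simp add: case_prod_beta)
    from z[OF this] have "F (fst p) x = 0 \<or> G (snd p) x = 0" by (metis (no_types))
    then show ?thesis by simp
  qed
  then have "(\<Sum>p\<in>{(J, L). J + L = I}. F (fst p) x * G (snd p) x) = 0" for x by (intro sum.neutral ballI)
  then show "(F \<otimes>\<^bsub>sections std U\<^esub> G) I = (\<lambda>x. 0)"
    by (simp add: std_simps case_prod_beta)
qed

text \<open>A function of the ordinary coordinates, regarded as a power series without formal
  part.\<close>

definition pure :: "(nat \<Rightarrow> real) set \<Rightarrow> ((nat \<Rightarrow> real) \<Rightarrow> complex) \<Rightarrow> formal_series" where
  "pure U h = (\<lambda>I x. if I = 0 \<and> x \<in> U then h x else 0)"

lemma pure_sec:
  assumes U: "openin (Euclidean_space n) U" and h: "smooth_on n U h"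
  shows "pure U h \<in> sec std U"
  unfolding std_sec
proof (intro conjI allI impI)
  fix I show "smooth_on n U (pure U h I)"
  proof (cases "I = 0")
    case True
    show ?thesis by (rule smooth_on_cong[OF U h]) (simp add: pure_def True)
  next
    case False
    then show ?thesis by (simp add: pure_def smooth_on_const)
  qed
qed (auto simp: pure_def fun_eq_iff)

end

text \<open>One isomorphism with the standard model, with the witnesses hidden in
  \<open>isomorphic_ringed_spaces\<close> made explicit.\<close>

locale formal_chart = ringed X \<O>
  for X :: "'a topology" and \<O> :: "('a, complex, 'r) presheaf" +
  fixes U\<^sub>0 :: "'a set" and n k :: nat and \<phi> :: "'a \<Rightarrow> nat \<Rightarrow> real"
    and \<Psi> :: "(nat \<Rightarrow> real) set \<Rightarrow> formal_series \<Rightarrow> 'r"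
  assumes local: "a \<in> topspace X \<Longrightarrow> local_ring (stalk X \<O> a)"
    and U0: "openin X U\<^sub>0"
    and hom: "homeomorphic_map (subtopology X U\<^sub>0) (Euclidean_space n) \<phi>"
    and iso: "openin (Euclidean_space n) V \<Longrightarrow>
      \<Psi> V \<in> ring_iso (sections (std n k) V) (sections \<O> {x \<in> U\<^sub>0. \<phi> x \<in> V})"
    and lin: "openin (Euclidean_space n) V \<Longrightarrow>
      complex_linear (sections (std n k) V) (sections \<O> {x \<in> U\<^sub>0. \<phi> x \<in> V}) (\<Psi> V)"
    and nat: "openin (Euclidean_space n) V \<Longrightarrow> W \<in> opens_in (Euclidean_space n) V \<Longrightarrow> F \<in> sec (std n k) V \<Longrightarrow>
      restr \<O> {x \<in> U\<^sub>0. \<phi> x \<in> V} {x \<in> U\<^sub>0. \<phi> x \<in> W} (\<Psi> V F) = \<Psi> W (restr (std n k) V W F)"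
begin

abbreviation "E \<equiv> Euclidean_space n"
abbreviation "S \<equiv> standard_formal_sheaf n k"

lemma topspace_U0: "topspace (subtopology X U\<^sub>0) = U\<^sub>0"
  using openin_subset[OF U0] by auto

lemma inj: "inj_on \<phi> U\<^sub>0"
  using homeomorphic_imp_injective_map[OF hom] unfolding topspace_U0 .

lemma image_U0: "\<phi> ` U\<^sub>0 = topspace E"
  using homeomorphic_imp_surjective_map[OF hom] unfolding topspace_U0 .

lemma open_image: "V \<in> opens_in X U\<^sub>0 \<Longrightarrow> openin E (\<phi> ` V)"
  using homeomorphic_map_openness[OF hom, of V, unfolded topspace_U0] U0
  by (simp add: opens_in_iff openin_open_subtopology)

lemma open_preimage: "openin E V \<Longrightarrow> {x \<in> U\<^sub>0. \<phi> x \<in> V} \<in> opens_in X U\<^sub>0"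
  using openin_continuous_map_preimage[OF homeomorphic_imp_continuous_map[OF hom], of V, unfolded topspace_U0] U0
  by (simp add: opens_in_iff openin_open_subtopology)

lemma preimage_image: "V \<subseteq> U\<^sub>0 \<Longrightarrow> {x \<in> U\<^sub>0. \<phi> x \<in> \<phi> ` V} = V"
  using inj by (auto simp: inj_on_def)

lemma image_preimage: "V \<subseteq> topspace E \<Longrightarrow> \<phi> ` {x \<in> U\<^sub>0. \<phi> x \<in> V} = V"
  using image_U0 by auto

text \<open>The ring isomorphisms of the chart, indexed by open subsets of the manifold instead of
  the model.\<close>

abbreviation \<psi> where "\<psi> V \<equiv> \<Psi> (\<phi> ` V)"

lemma opens: "V \<in> opens_in X U\<^sub>0 \<Longrightarrow> openin X V" "V \<in> opens_in X U\<^sub>0 \<Longrightarrow> V \<subseteq> U\<^sub>0"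
  by (auto simp: opens_in_iff)

lemma
  assumes V: "V \<in> opens_in X U\<^sub>0"
  shows psi_bij: "bij_betw (\<psi> V) (sec S (\<phi> ` V)) (sec \<O> V)"
    and psi_add: "F \<in> sec S (\<phi> ` V) \<Longrightarrow> G \<in> sec S (\<phi> ` V) \<Longrightarrow>
      \<psi> V (F \<oplus>\<^bsub>sections S (\<phi> ` V)\<^esub> G) = \<psi> V F \<oplus>\<^bsub>sections \<O> V\<^esub> \<psi> V G"
    and psi_mult: "F \<in> sec S (\<phi> ` V) \<Longrightarrow> G \<in> sec S (\<phi> ` V) \<Longrightarrow>
      \<psi> V (F \<otimes>\<^bsub>sections S (\<phi> ` V)\<^esub> G) = \<psi> V F \<otimes>\<^bsub>sections \<O> V\<^esub> \<psi> V G"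
    and psi_one: "\<psi> V \<one>\<^bsub>sections S (\<phi> ` V)\<^esub> = \<one>\<^bsub>sections \<O> V\<^esub>"
    and psi_smult: "F \<in> sec S (\<phi> ` V) \<Longrightarrow>
      \<psi> V (c \<odot>\<^bsub>sections S (\<phi> ` V)\<^esub> F) = c \<odot>\<^bsub>sections \<O> V\<^esub> \<psi> V F"
  using iso[OF open_image[OF V]] lin[OF open_image[OF V]]
  unfolding preimage_image[OF opens(2)[OF V]] ring_iso_def Ring.ring_hom_def complex_linear_def by auto

lemma psi_restr:
  assumes V: "V \<in> opens_in X U\<^sub>0" and W: "W \<in> opens_in X V" and F: "F \<in> sec S (\<phi> ` V)"
  shows "restr \<O> V W (\<psi> V F) = \<psi> W (restr S (\<phi> ` V) (\<phi> ` W) F)"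
proof -
  have W0: "W \<in> opens_in X U\<^sub>0" using V W by (auto simp: opens_in_iff)
  have "\<phi> ` W \<in> opens_in E (\<phi> ` V)" using open_image[OF W0] W by (auto simp: opens_in_iff)
  from nat[OF open_image[OF V] this F] show ?thesis
    by (simp add: preimage_image[OF opens(2)[OF V]] preimage_image[OF opens(2)[OF W0]])
qed

lemma psi_closed: "V \<in> opens_in X U\<^sub>0 \<Longrightarrow> F \<in> sec S (\<phi> ` V) \<Longrightarrow> \<psi> V F \<in> sec \<O> V"
  using psi_bij by (auto simp: bij_betw_def)

lemma psi_restr_closed:
  "V \<in> opens_in X U\<^sub>0 \<Longrightarrow> W \<in> opens_in X V \<Longrightarrow> F \<in> sec S (\<phi> ` V) \<Longrightarrow>
   restr S (\<phi> ` V) (\<phi> ` W) F \<in> sec S (\<phi> ` W)"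
  unfolding std_sec std_simps
proof (intro conjI allI impI)
  assume V: "V \<in> opens_in X U\<^sub>0" and W: "W \<in> opens_in X V"
    and F: "(\<forall>I. smooth_on n (\<phi> ` V) (F I) \<and> (\<forall>x. x \<notin> \<phi> ` V \<longrightarrow> F I x = 0)) \<and>
       (\<forall>I. \<not> Poly_Mapping.keys I \<subseteq> {..<k} \<longrightarrow> F I = (\<lambda>x. 0))"
  have W0: "W \<in> opens_in X U\<^sub>0" using V W by (auto simp: opens_in_iff)
  have sub: "\<phi> ` W \<subseteq> \<phi> ` V" using W by (auto simp: opens_in_iff)
  fix I
  have "smooth_on n (\<phi> ` W) (F I)" using F smooth_on_subset sub by blast
  then show "smooth_on n (\<phi> ` W) (\<lambda>x. if x \<in> \<phi> ` W then F I x else 0)"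
    by (rule smooth_on_cong[OF open_image[OF W0]]) simp
next
  fix I :: "nat \<Rightarrow>\<^sub>0 nat"
  assume "(\<forall>I. smooth_on n (\<phi> ` V) (F I) \<and> (\<forall>x. x \<notin> \<phi> ` V \<longrightarrow> F I x = 0)) \<and>
       (\<forall>I. \<not> Poly_Mapping.keys I \<subseteq> {..<k} \<longrightarrow> F I = (\<lambda>x. 0))" "\<not> Poly_Mapping.keys I \<subseteq> {..<k}"
  then have "F I = (\<lambda>x. 0)" by blast
  then have "F I x = 0" for x by (rule fun_cong)
  then show "(\<lambda>x. if x \<in> \<phi> ` W then F I x else 0) = (\<lambda>x. 0)" by (intro ext) (simp only: if_cancel)
qed simp

text \<open>The power series of a section in the chart. Its coefficient at multi-index 0 will be
  identified with the function of residues.\<close>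

definition coeffs :: "'a set \<Rightarrow> 'r \<Rightarrow> formal_series" where
  "coeffs V f = inv_into (sec S (\<phi> ` V)) (\<psi> V) f"

lemma
  assumes V: "V \<in> opens_in X U\<^sub>0"
  shows coeffs_closed: "f \<in> sec \<O> V \<Longrightarrow> coeffs V f \<in> sec S (\<phi> ` V)"
    and psi_coeffs: "f \<in> sec \<O> V \<Longrightarrow> \<psi> V (coeffs V f) = f"
    and coeffs_psi: "F \<in> sec S (\<phi> ` V) \<Longrightarrow> coeffs V (\<psi> V F) = F"
  using psi_bij[OF V] unfolding coeffs_def
  by (auto simp: bij_betw_def inv_into_into f_inv_into_f)

lemma
  assumes V: "V \<in> opens_in X U\<^sub>0" "a \<in> V"
  shows coeffs_add: "f \<in> sec \<O> V \<Longrightarrow> g \<in> sec \<O> V \<Longrightarrow>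
      coeffs V (f \<oplus>\<^bsub>sections \<O> V\<^esub> g) 0 (\<phi> a) = coeffs V f 0 (\<phi> a) + coeffs V g 0 (\<phi> a)"
    and coeffs_mult: "f \<in> sec \<O> V \<Longrightarrow> g \<in> sec \<O> V \<Longrightarrow>
      coeffs V (f \<otimes>\<^bsub>sections \<O> V\<^esub> g) 0 (\<phi> a) = coeffs V f 0 (\<phi> a) * coeffs V g 0 (\<phi> a)"
    and coeffs_one: "coeffs V \<one>\<^bsub>sections \<O> V\<^esub> 0 (\<phi> a) = 1"
    and coeffs_smult: "f \<in> sec \<O> V \<Longrightarrow> coeffs V (c \<odot>\<^bsub>sections \<O> V\<^esub> f) 0 (\<phi> a) = c * coeffs V f 0 (\<phi> a)"
proof -
  note E = open_image[OF V(1)]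
  { assume fg: "f \<in> sec \<O> V" "g \<in> sec \<O> V"
    let ?F = "coeffs V f" and ?G = "coeffs V g"
    note F = coeffs_closed[OF V(1) fg(1)] and G = coeffs_closed[OF V(1) fg(2)]
    have "f \<oplus>\<^bsub>sections \<O> V\<^esub> g = \<psi> V (?F \<oplus>\<^bsub>sections S (\<phi> ` V)\<^esub> ?G)"
      by (simp add: psi_add[OF V(1) F G] psi_coeffs[OF V(1)] fg)
    then show "coeffs V (f \<oplus>\<^bsub>sections \<O> V\<^esub> g) 0 (\<phi> a) = ?F 0 (\<phi> a) + ?G 0 (\<phi> a)"
      by (simp add: coeffs_psi[OF V(1) std_add_closed[OF E F G]]) (simp add: std_simps)
    have "f \<otimes>\<^bsub>sections \<O> V\<^esub> g = \<psi> V (?F \<otimes>\<^bsub>sections S (\<phi> ` V)\<^esub> ?G)"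
      by (simp add: psi_mult[OF V(1) F G] psi_coeffs[OF V(1)] fg)
    then show "coeffs V (f \<otimes>\<^bsub>sections \<O> V\<^esub> g) 0 (\<phi> a) = ?F 0 (\<phi> a) * ?G 0 (\<phi> a)"
      by (simp only: coeffs_psi[OF V(1) std_mult_closed[OF E F G]] std_mult_zero_coeff) }
  { have "\<one>\<^bsub>sections S (\<phi> ` V)\<^esub> = pure (\<phi> ` V) (\<lambda>x. 1)" by (simp add: std_simps pure_def fun_eq_iff)
    then have "\<one>\<^bsub>sections S (\<phi> ` V)\<^esub> \<in> sec S (\<phi> ` V)" using pure_sec[OF E smooth_on_const] by simp
    then show "coeffs V \<one>\<^bsub>sections \<O> V\<^esub> 0 (\<phi> a) = 1"
      using V(2) by (simp add: coeffs_psi[OF V(1)] flip: psi_one[OF V(1)]) (simp add: std_simps) }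
  { assume f: "f \<in> sec \<O> V"
    note F = coeffs_closed[OF V(1) f]
    have "c \<odot>\<^bsub>sections \<O> V\<^esub> f = \<psi> V (c \<odot>\<^bsub>sections S (\<phi> ` V)\<^esub> coeffs V f)"
      by (simp add: psi_smult[OF V(1) F] psi_coeffs[OF V(1)] f)
    then show "coeffs V (c \<odot>\<^bsub>sections \<O> V\<^esub> f) 0 (\<phi> a) = c * coeffs V f 0 (\<phi> a)"
      by (simp add: coeffs_psi[OF V(1) std_smult_closed[OF E F]]) (simp add: std_simps) }
qed

lemma coeffs_restr:
  assumes V: "V \<in> opens_in X U\<^sub>0" and W: "W \<in> opens_in X V" "a \<in> W" and f: "f \<in> sec \<O> V"
  shows "coeffs W (restr \<O> V W f) 0 (\<phi> a) = coeffs V f 0 (\<phi> a)"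
proof -
  have W0: "W \<in> opens_in X U\<^sub>0" using V W by (auto simp: opens_in_iff)
  note F = coeffs_closed[OF V f]
  have "restr \<O> V W f = \<psi> W (restr S (\<phi> ` V) (\<phi> ` W) (coeffs V f))"
    using psi_restr[OF V W(1) F] psi_coeffs[OF V f] by simp
  then have "coeffs W (restr \<O> V W f) = restr S (\<phi> ` V) (\<phi> ` W) (coeffs V f)"
    using coeffs_psi[OF W0 psi_restr_closed[OF V W(1) F]] by simp
  then show "coeffs W (restr \<O> V W f) 0 (\<phi> a) = coeffs V f 0 (\<phi> a)"
    using W(2) by (simp add: std_simps)
qed

text \<open>Taking the coefficient at 0 and evaluating it at \<phi> a respects sums, products,
  scalars and restriction, and such an evaluation determines the residue.\<close>

lemma value_at_chart:
  assumes V: "openin X V" "a \<in> V" "a \<in> U\<^sub>0" and f: "f \<in> sec \<O> V"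
  shows "value_at X \<O> V f a = coeffs (V \<inter> U\<^sub>0) (restr \<O> V (V \<inter> U\<^sub>0) f) 0 (\<phi> a)"
proof (rule value_at_eqI[where e = "\<lambda>V f. coeffs V f 0 (\<phi> a)"])
  show "local_ring (stalk X \<O> a)" using local V openin_subset by blast
qed (use V U0 f coeffs_add coeffs_mult coeffs_one coeffs_smult coeffs_restr in auto)

lemma value_at_psi:
  assumes V: "V \<in> opens_in X U\<^sub>0" "a \<in> V" and F: "F \<in> sec S (\<phi> ` V)"
  shows "value_at X \<O> V (\<psi> V F) a = F 0 (\<phi> a)"
proof -
  have "V \<inter> U\<^sub>0 = V" using opens[OF V(1)] by auto
  then show ?thesis
    using value_at_chart[OF opens(1)[OF V(1)] V(2) _ psi_closed[OF V(1) F]] opens[OF V(1)] V(2)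
      O_restr_id[OF opens(1)[OF V(1)] psi_closed[OF V(1) F]] coeffs_psi[OF V(1) F] by auto
qed

lemma value_at_coeffs:
  "V \<in> opens_in X U\<^sub>0 \<Longrightarrow> a \<in> V \<Longrightarrow> f \<in> sec \<O> V \<Longrightarrow> value_at X \<O> V f a = coeffs V f 0 (\<phi> a)"
  using value_at_psi[OF _ _ coeffs_closed] psi_coeffs by simp

abbreviation inv\<phi> where "inv\<phi> \<equiv> inv_into U\<^sub>0 \<phi>"

lemma inv_phi: "a \<in> U\<^sub>0 \<Longrightarrow> inv\<phi> (\<phi> a) = a"
  using inj by simp

text \<open>Coefficients at 0 are smooth, and conversely a smooth function is the value function of
  the series \<open>pure\<close> built from it. In a formal chart the reduction is thus exactly the
  sheaf of smooth functions.\<close>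

lemma reduction_smooth_iff:
  assumes V: "V \<in> opens_in X U\<^sub>0"
  shows "g \<in> sec (reduction X \<O>) V \<longleftrightarrow>
    (\<forall>a. a \<notin> V \<longrightarrow> g a = 0) \<and> smooth_on n (\<phi> ` V) (\<lambda>x. g (inv\<phi> x))"
proof (intro iffI conjI)
  assume g: "g \<in> sec (reduction X \<O>) V"
  then show "\<forall>a. a \<notin> V \<longrightarrow> g a = 0" by (simp add: reduction_def)
  show "smooth_on n (\<phi> ` V) (\<lambda>x. g (inv\<phi> x))"
  proof (rule smooth_on_local[OF open_image[OF V]])
    fix x assume "x \<in> \<phi> ` V"
    then obtain a where a: "a \<in> V" "x = \<phi> a" by auto
    obtain V' f where V': "V' \<in> opens_in X V" "a \<in> V'" and f: "f \<in> sec \<O> V'"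
      "\<And>b. b \<in> V' \<Longrightarrow> g b = value_at X \<O> V' f b" using g a(1) by (auto simp: reduction_def)
    have V0: "V' \<in> opens_in X U\<^sub>0" using V V' by (auto simp: opens_in_iff)
    have "g (inv\<phi> y) = coeffs V' f 0 y" if "y \<in> \<phi> ` V'" for y
      using that f(2) inv_phi value_at_coeffs[OF V0 _ f(1)] opens(2)[OF V0] by auto
    moreover have "smooth_on n (\<phi> ` V') (coeffs V' f 0)" using coeffs_closed[OF V0 f(1)] by (simp add: std_sec)
    ultimately show "\<exists>W h. openin E W \<and> x \<in> W \<and> smooth_on n W h \<and> (\<forall>y\<in>W. g (inv\<phi> y) = h y)"
      using open_image[OF V0] V'(2) a(2) by blast
  qed
next
  assume g: "(\<forall>a. a \<notin> V \<longrightarrow> g a = 0) \<and> smooth_on n (\<phi> ` V) (\<lambda>x. g (inv\<phi> x))"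
  let ?F = "pure (\<phi> ` V) (\<lambda>x. g (inv\<phi> x))"
  have F: "?F \<in> sec S (\<phi> ` V)" using pure_sec[OF open_image[OF V]] g by blast
  have "g b = value_at X \<O> V (\<psi> V ?F) b" if "b \<in> V" for b
    using value_at_psi[OF V that F] that inv_phi opens(2)[OF V] by (auto simp: pure_def)
  moreover have "V \<in> opens_in X V" using V by (simp add: opens_in_iff)
  ultimately show "g \<in> sec (reduction X \<O>) V"
    using g psi_closed[OF V F] unfolding reduction_def by auto
qed

text \<open>Guarantees that \<open>charts\<close> covers the manifold, as the integral
  requires.\<close>

lemma chart_in_charts: "\<lparr>chart_dom = U\<^sub>0, chart_map = \<phi>, chart_dim = n\<rparr> \<in> charts X \<O>"
  unfolding charts_def using U0 hom reduction_smooth_iff by (simp add: image_U0)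

lemma reduction_continuous_chart:
  assumes V: "V \<in> opens_in X U\<^sub>0" and g: "g \<in> sec (reduction X \<O>) V"
  shows "continuous_map (subtopology X V) euclidean g"
proof -
  have "continuous_map (subtopology E (\<phi> ` V)) euclidean (\<lambda>x. g (inv\<phi> x))"
    using smooth_on_continuous reduction_smooth_iff[OF V] g by blast
  moreover have "continuous_map (subtopology X V) (subtopology E (\<phi> ` V)) \<phi>"
  proof -
    have "continuous_map (subtopology (subtopology X U\<^sub>0) V) E \<phi>"
      using homeomorphic_imp_continuous_map[OF hom] by (rule continuous_map_from_subtopology)
    moreover have "subtopology (subtopology X U\<^sub>0) V = subtopology X V"
      using opens(2)[OF V] by (simp add: subtopology_subtopology Int_absorb1)
    ultimately show ?thesis by (auto simp: continuous_map_in_subtopology)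
  qed
  ultimately have "continuous_map (subtopology X V) euclidean ((\<lambda>x. g (inv\<phi> x)) \<circ> \<phi>)"
    by (rule continuous_map_compose[rotated])
  then show ?thesis
    by (rule continuous_map_eq) (use inv_phi opens(2)[OF V] in auto)
qed

text \<open>The Euclidean bump is inserted as a series without formal part. It is therefore one on
  \<open>N\<close> and zero on \<open>W - C\<close> as a section of \<O>, which is stronger than
  having these values.\<close>

lemma chart_bump:
  assumes W: "W \<in> opens_in X U\<^sub>0" and a: "a \<in> W"
  shows "\<exists>f\<in>sec \<O> W. \<exists>N C. openin X N \<and> a \<in> N \<and> N \<subseteq> W \<and> compactin X C \<and> C \<subseteq> W \<and> openin X (W - C) \<and>
    restr \<O> W N f = \<one>\<^bsub>sections \<O> N\<^esub> \<and> restr \<O> W (W - C) f = \<zero>\<^bsub>sections \<O> (W - C)\<^esub> \<and>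
    (\<forall>b\<in>W. \<exists>t::real. value_at X \<O> W f b = complex_of_real t \<and> 0 \<le> t \<and> t \<le> 1)"
proof -
  have pE: "\<phi> a \<in> \<phi> ` W" using a by simp
  obtain h N' C' where h: "smooth_on n (\<phi> ` W) (\<lambda>x. complex_of_real (h x))" "\<And>x. 0 \<le> h x" "\<And>x. h x \<le> 1"
    and N': "openin E N'" "\<phi> a \<in> N'" "N' \<subseteq> \<phi> ` W" "\<And>x. x \<in> N' \<Longrightarrow> h x = 1"
    and C': "compactin E C'" "C' \<subseteq> \<phi> ` W" "\<And>x. x \<in> \<phi> ` W - C' \<Longrightarrow> h x = 0"
    using euclidean_bump[OF open_image[OF W] pE] by metis
  let ?F = "pure (\<phi> ` W) (\<lambda>x. complex_of_real (h x))"
  have F: "?F \<in> sec S (\<phi> ` W)" by (rule pure_sec[OF open_image[OF W] h(1)])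
  let ?f = "\<psi> W ?F"
  define N where "N = {x \<in> U\<^sub>0. \<phi> x \<in> N'}"
  define C where "C = {x \<in> U\<^sub>0. \<phi> x \<in> C'}"
  have N0: "N \<in> opens_in X U\<^sub>0" unfolding N_def by (rule open_preimage[OF N'(1)])
  have sub: "{x \<in> U\<^sub>0. \<phi> x \<in> \<phi> ` W} = W" by (rule preimage_image[OF opens(2)[OF W]])
  have NW: "N \<subseteq> W" using N'(3) sub unfolding N_def by blast
  have CW: "C \<subseteq> W" using C'(2) sub unfolding C_def by blast
  have phiN: "\<phi> ` N = N'" unfolding N_def by (rule image_preimage[OF openin_subset[OF N'(1)]])
  have C'E: "C' \<subseteq> topspace E" using compactin_subset_topspace[OF C'(1)] .
  have phiC: "\<phi> ` C = C'" unfolding C_def by (rule image_preimage[OF C'E])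
  have "compactin (subtopology X U\<^sub>0) C"
    using homeomorphic_map_compactness[OF hom, of C] C'(1) phiC topspace_U0 unfolding C_def by auto
  then have C: "compactin X C" by (simp add: compactin_subtopology)
  have "Hausdorff_space E" unfolding Euclidean_space_def
    by (intro Hausdorff_space_subtopology) (simp add: Hausdorff_space_product_topology)
  then have clC: "closedin E C'" using C'(1) by (rule compactin_imp_closedin)
  have WC: "W - C \<in> opens_in X U\<^sub>0"
  proof -
    have "W - C = {x \<in> U\<^sub>0. \<phi> x \<in> \<phi> ` W - C'}" using sub by (auto simp: C_def)
    then show ?thesis using open_preimage[OF openin_diff[OF open_image[OF W] clC]] by simp
  qed
  have o: "N \<in> opens_in X W" "W - C \<in> opens_in X W" using N0 WC NW by (auto simp: opens_in_iff)
  have "restr S (\<phi> ` W) (\<phi> ` N) ?F = \<one>\<^bsub>sections S (\<phi> ` N)\<^esub>"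
    using N'(3,4) by (auto simp: phiN std_simps pure_def fun_eq_iff)
  then have 1: "restr \<O> W N ?f = \<one>\<^bsub>sections \<O> N\<^esub>" using psi_restr[OF W o(1) F] psi_one[OF N0] by simp
  have "\<phi> ` (W - C) = \<phi> ` W - C'" using inj_on_image_set_diff[OF inj, of W C] opens(2)[OF W] phiC by (auto simp: C_def)
  then have R0: "restr S (\<phi> ` W) (\<phi> ` (W - C)) ?F = (\<lambda>I x. 0)"
    using C'(3) by (auto simp: std_simps pure_def fun_eq_iff)
  have zz: "(\<lambda>I x. 0) \<in> sec S (\<phi> ` (W - C))" by (simp add: std_sec smooth_on_const)
  \<comment> \<open>That the zero series goes to zero is obtained from linearity, by writing the
    series as 0 times itself.\<close>
  have "\<psi> (W - C) (0 \<odot>\<^bsub>sections S (\<phi> ` (W - C))\<^esub> (\<lambda>I x. 0)) = 0 \<odot>\<^bsub>sections \<O> (W - C)\<^esub> \<psi> (W - C) (\<lambda>I x. 0)"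
    by (rule psi_smult[OF WC zz])
  then have "\<psi> (W - C) (\<lambda>I x. 0) = \<zero>\<^bsub>sections \<O> (W - C)\<^esub>"
    using module.smult_l_null[OF O_module[OF opens(1)[OF WC]] psi_closed[OF WC zz]] by (simp add: std_simps)
  then have 2: "restr \<O> W (W - C) ?f = \<zero>\<^bsub>sections \<O> (W - C)\<^esub>" using psi_restr[OF W o(2) F] R0 by simp
  have 3: "\<forall>b\<in>W. \<exists>t::real. value_at X \<O> W ?f b = complex_of_real t \<and> 0 \<le> t \<and> t \<le> 1"
    using value_at_psi[OF W _ F] h(2,3) by (auto simp: pure_def)
  show ?thesis
    by (rule bexI[OF _ psi_closed[OF W F]], rule exI[of _ N], rule exI[of _ C])
      (use 1 2 3 C CW NW opens(1)[OF N0] opens(1)[OF WC] N'(2) a opens(2)[OF W] in \<open>auto simp: N_def\<close>)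
qed

end

section \<open>Partitions of unity\<close>

context ringed
begin

text \<open>\<O> as a module over itself, which makes extension by zero and the module sheaf lemmas
  available for sections of \<O>.\<close>

definition self_module :: "('a, 'r, 'r) presheaf" where
  "self_module = \<lparr>sections = (\<lambda>U. \<lparr>carrier = sec \<O> U, mult = mult (sections \<O> U), one = \<one>\<^bsub>sections \<O> U\<^esub>,
     zero = \<zero>\<^bsub>sections \<O> U\<^esub>, add = add (sections \<O> U), smult = mult (sections \<O> U)\<rparr>),
     restr = restr \<O>\<rparr>"

lemma self_module_simps [simp]:
  "sec self_module U = sec \<O> U" "restr self_module = restr \<O>"
  "\<zero>\<^bsub>sections self_module U\<^esub> = \<zero>\<^bsub>sections \<O> U\<^esub>"
  "f \<oplus>\<^bsub>sections self_module U\<^esub> g = f \<oplus>\<^bsub>sections \<O> U\<^esub> g"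
  "f \<odot>\<^bsub>sections self_module U\<^esub> g = f \<otimes>\<^bsub>sections \<O> U\<^esub> g"
  by (simp_all add: self_module_def)

lemma sheaf_of_modules_self: "sheaf_of_modules X \<O> self_module"
proof -
  have "Module.module (sections \<O> U) (sections self_module U)" if U: "openin X U" for U
  proof -
    interpret R: cring "sections \<O> U" using O_cring U .
    show ?thesis
    proof (rule moduleI)
      show "abelian_group (sections self_module U)"
      proof (rule abelian_groupI)
        show "\<exists>y\<in>sec self_module U. y \<oplus>\<^bsub>sections self_module U\<^esub> x = \<zero>\<^bsub>sections self_module U\<^esub>"
          if "x \<in> sec self_module U" for x
          by (rule bexI[of _ "\<ominus>\<^bsub>sections \<O> U\<^esub> x"]) (use that R.l_neg in auto)
      qed (auto simp: R.a_ac)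
    qed (auto simp: R.is_cring R.l_distr R.r_distr R.m_assoc)
  qed
  moreover have "sheaf_of_sets X self_module"
    using O_sheaf unfolding sheaf_of_sets_def self_module_simps .
  ultimately show ?thesis
    unfolding sheaf_of_modules_def by (auto simp: O_restr_add O_restr_mult)
qed

sublocale self: module_sheaf X \<O> self_module
  by unfold_locales (rule sheaf_of_modules_self)

end

section \<open>A telescoping identity in commutative rings\<close>

context cring
begin

lemma finite_total_order_max:
  assumes "finite J" "J \<noteq> {}" and tr: "\<And>i j k. lt i j \<Longrightarrow> lt j k \<Longrightarrow> lt i k"
    and tot: "\<And>i j. i \<in> J \<Longrightarrow> j \<in> J \<Longrightarrow> i \<noteq> j \<Longrightarrow> lt i j \<or> lt j i"
  shows "\<exists>m\<in>J. \<forall>j\<in>J - {m}. lt j m"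
  using assms(1,2,4)
proof (induction rule: finite_ne_induct)
  case (insert x J)
  then obtain m where m: "m \<in> J" "\<forall>j\<in>J - {m}. lt j m" by auto
  have "lt x m \<or> lt m x" using insert m by auto
  then show ?case
  proof
    assume "lt x m" then show ?thesis using m by auto
  next
    assume "lt m x"
    then have "\<forall>j\<in>J. lt j x" using m tr by blast
    then show ?thesis by auto
  qed
qed auto

text \<open>Telescoping replaces the division by the sum in the usual construction of partitions of unity.\<close>

lemma telescoping_partition:
  assumes "finite J" and h: "\<And>j. j \<in> J \<Longrightarrow> h j \<in> carrier R"
    and irr: "\<And>i. \<not> lt i i" and tr: "\<And>i j k. lt i j \<Longrightarrow> lt j k \<Longrightarrow> lt i k"
    and tot: "\<And>i j. i \<in> J \<Longrightarrow> j \<in> J \<Longrightarrow> i \<noteq> j \<Longrightarrow> lt i j \<or> lt j i"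
  shows "(\<Oplus>j\<in>J. (\<one> \<ominus> h j) \<otimes> (\<Otimes>i\<in>J. if lt i j then h i else \<one>)) \<oplus> (\<Otimes>j\<in>J. h j) = \<one>"
  using assms(1,2,5)
proof (induction "card J" arbitrary: J)
  case 0
  then show ?case by simp
next
  case (Suc n)
  then have ne: "J \<noteq> {}" by auto
  \<comment> \<open>Let \<open>m\<close> be the maximum and Q the product of the other h. The other
    terms do not change when \<open>m\<close> is removed, as \<open>m\<close> precedes none of them,
    and the term of \<open>m\<close> is (1 - h m) Q. Together with the full product h m Q it gives
    Q, which leaves the induction hypothesis.\<close>
  have "\<exists>m\<in>J. \<forall>j\<in>J - {m}. lt j m"
    by (rule finite_total_order_max[OF Suc.prems(1) ne]) (fact tr, fact Suc.prems(3))
  then obtain m where m: "m \<in> J" "\<forall>j\<in>J - {m}. lt j m" by blast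
  let ?K = "J - {m}"
  let ?P = "\<lambda>J j. \<Otimes>i\<in>J. if lt i j then h i else \<one>"
  have fin: "finite ?K" using Suc.prems by simp
  have hK: "\<And>j. j \<in> ?K \<Longrightarrow> h j \<in> carrier R" and hm: "h m \<in> carrier R" using Suc.prems m by auto
  have J: "J = insert m ?K" "m \<notin> ?K" using m by auto
  have IH: "(\<Oplus>j\<in>?K. (\<one> \<ominus> h j) \<otimes> ?P ?K j) \<oplus> (\<Otimes>j\<in>?K. h j) = \<one>"
    by (rule Suc.hyps(1)) (use Suc m in auto)
  have Pc: "?P L j \<in> carrier R" if "L \<subseteq> J" for L j
    by (rule finprod_closed) (use that Suc.prems in auto)
  have PK: "?P J j = ?P ?K j" if "j \<in> ?K" for j
  proof -
    have nlt: "\<not> lt m j" using m that irr tr by blast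
    have "?P (insert m ?K) j = (if lt m j then h m else \<one>) \<otimes> ?P ?K j"
      by (rule finprod_insert[OF fin J(2)]) (use hK hm in auto)
    also have "\<dots> = ?P ?K j" using nlt Pc[of ?K j] by simp
    finally show ?thesis using J(1) by simp
  qed
  have Pm: "?P J m = (\<Otimes>j\<in>?K. h j)"
  proof -
    have "?P (insert m ?K) m = (if lt m m then h m else \<one>) \<otimes> ?P ?K m"
      by (rule finprod_insert[OF fin J(2)]) (use hK hm in auto)
    also have "\<dots> = ?P ?K m" using irr Pc[of ?K m] by simp
    also have "\<dots> = (\<Otimes>j\<in>?K. h j)" by (rule finprod_cong) (use m hK in \<open>auto simp: simp_implies_def\<close>)
    finally show ?thesis using J(1) by simp
  qed
  let ?S = "\<Oplus>j\<in>?K. (\<one> \<ominus> h j) \<otimes> ?P ?K j" and ?Q = "\<Otimes>j\<in>?K. h j"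
  have Q: "?Q \<in> carrier R" by (rule finprod_closed) (use hK in auto)
  have S: "?S \<in> carrier R" by (rule finsum_closed) (use hK Pc[of ?K] in auto)
  have "(\<Oplus>j\<in>insert m ?K. (\<one> \<ominus> h j) \<otimes> ?P J j) = (\<one> \<ominus> h m) \<otimes> ?P J m \<oplus> (\<Oplus>j\<in>?K. (\<one> \<ominus> h j) \<otimes> ?P J j)"
    by (rule finsum_insert[OF fin J(2)]) (use hK hm Pc[of J] in auto)
  also have "(\<Oplus>j\<in>?K. (\<one> \<ominus> h j) \<otimes> ?P J j) = ?S"
    by (rule finsum_cong) (use hK Pc[of ?K] PK in \<open>auto simp: simp_implies_def\<close>)
  finally have 1: "(\<Oplus>j\<in>J. (\<one> \<ominus> h j) \<otimes> ?P J j) = (\<one> \<ominus> h m) \<otimes> ?Q \<oplus> ?S" using Pm J(1) by simp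
  have 2: "(\<Otimes>j\<in>J. h j) = h m \<otimes> ?Q"
    using finprod_insert[OF fin J(2), of h] hK hm J(1) by auto
  have "(\<one> \<ominus> h m) \<otimes> ?Q \<oplus> ?S \<oplus> h m \<otimes> ?Q = (\<one> \<ominus> h m \<oplus> h m) \<otimes> ?Q \<oplus> ?S"
    using hm Q S by (simp add: l_distr a_ac)
  also have "\<one> \<ominus> h m \<oplus> h m = \<one>" using hm by (simp add: a_minus_def a_assoc l_neg)
  finally show ?case unfolding 1 2 using IH Q S by (simp add: a_comm)
qed

end

section \<open>Values of sections on a formal manifold\<close>

locale formal_mfd =
  fixes X :: "'a topology" and \<O> :: "('a, complex, 'r) presheaf"
  assumes fm: "formal_manifold X \<O>"

sublocale formal_mfd \<subseteq> ringed X \<O>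
  using fm by unfold_locales (simp add: formal_manifold_def locally_ringed_space_def)

context formal_mfd
begin

lemma hausdorff: "Hausdorff_space X" using fm by (simp add: formal_manifold_def)

lemma chart_at:
  assumes a: "a \<in> topspace X"
  obtains U\<^sub>0 n k \<phi> \<Psi> where "formal_chart X \<O> U\<^sub>0 n k \<phi> \<Psi>" "a \<in> U\<^sub>0"
proof -
  obtain U n k where U: "openin X U" "a \<in> U"
    and iso: "isomorphic_ringed_spaces (subtopology X U) \<O> (Euclidean_space n) (standard_formal_sheaf n k)"
    using fm a unfolding formal_manifold_def by blast
  have top: "topspace (subtopology X U) = U" using openin_subset[OF U(1)] by auto
  obtain \<phi> \<Psi> where h: "homeomorphic_map (subtopology X U) (Euclidean_space n) \<phi>"
    and P: "\<And>V. openin (Euclidean_space n) V \<Longrightarrow>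
           \<Psi> V \<in> ring_iso (sections (standard_formal_sheaf n k) V) (sections \<O> {x \<in> U. \<phi> x \<in> V}) \<and>
           complex_linear (sections (standard_formal_sheaf n k) V) (sections \<O> {x \<in> U. \<phi> x \<in> V}) (\<Psi> V) \<and>
           (\<forall>W\<in>opens_in (Euclidean_space n) V. \<forall>f\<in>sec (standard_formal_sheaf n k) V.
              restr \<O> {x \<in> U. \<phi> x \<in> V} {x \<in> U. \<phi> x \<in> W} (\<Psi> V f) = \<Psi> W (restr (standard_formal_sheaf n k) V W f))"
    using iso unfolding isomorphic_ringed_spaces_def Let_def top by blast
  have "formal_chart X \<O> U n k \<phi> \<Psi>"
  proof unfold_locales
    show "local_ring (stalk X \<O> a)" if "a \<in> topspace X" for a
      using fm that unfolding formal_manifold_def locally_ringed_space_def by blast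
  qed (use U h P in blast)+
  then show ?thesis using that U by blast
qed

abbreviation val where "val \<equiv> value_at X \<O>"

text \<open>Each rule is read off from the coefficient at 0 in a formal chart around
  \<open>a\<close>.\<close>

lemma
  assumes V: "openin X V" "a \<in> V" and f: "f \<in> sec \<O> V"
  shows value_restr: "W \<in> opens_in X V \<Longrightarrow> a \<in> W \<Longrightarrow> val W (restr \<O> V W f) a = val V f a"
    and value_add: "g \<in> sec \<O> V \<Longrightarrow> val V (f \<oplus>\<^bsub>sections \<O> V\<^esub> g) a = val V f a + val V g a"
    and value_mult: "g \<in> sec \<O> V \<Longrightarrow> val V (f \<otimes>\<^bsub>sections \<O> V\<^esub> g) a = val V f a * val V g a"
    and value_smult: "val V (c \<odot>\<^bsub>sections \<O> V\<^esub> f) a = c * val V f a"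
    and value_one: "val V \<one>\<^bsub>sections \<O> V\<^esub> a = 1"
proof -
  have "a \<in> topspace X" using V openin_subset by blast
  then obtain U\<^sub>0 n k \<phi> \<Psi> where "formal_chart X \<O> U\<^sub>0 n k \<phi> \<Psi>" and a: "a \<in> U\<^sub>0" using chart_at by blast
  then interpret formal_chart X \<O> U\<^sub>0 n k \<phi> \<Psi> by blast
  have o: "V \<inter> U\<^sub>0 \<in> opens_in X U\<^sub>0" "V \<inter> U\<^sub>0 \<in> opens_in X V" "a \<in> V \<inter> U\<^sub>0"
    using V U0 a by (auto simp: opens_in_iff)
  note val = value_at_chart[OF V a]
  note fc = O_restr_closed[OF V(1) o(2) f]
  { assume W: "W \<in> opens_in X V" "a \<in> W"
    have o': "W \<inter> U\<^sub>0 \<in> opens_in X (V \<inter> U\<^sub>0)" "W \<inter> U\<^sub>0 \<in> opens_in X W" "openin X W" "a \<in> W \<inter> U\<^sub>0"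
      using W U0 a by (auto simp: opens_in_iff)
    show "val W (restr \<O> V W f) a = val V f a"
      unfolding val[OF f] value_at_chart[OF o'(3) W(2) a O_restr_closed[OF V(1) W(1) f]]
        O_restr_restr[OF V(1) W(1) o'(2) f]
      using coeffs_restr[OF o(1) o'(1,4) fc] O_restr_restr[OF V(1) o(2) o'(1) f] by simp }
  { assume g: "g \<in> sec \<O> V"
    note gc = O_restr_closed[OF V(1) o(2) g]
    show "val V (f \<oplus>\<^bsub>sections \<O> V\<^esub> g) a = val V f a + val V g a"
      using cring.cring_simprules(1)[OF O_cring[OF V(1)] f g]
      by (simp add: val f g O_restr_add[OF V(1) o(2)] coeffs_add[OF o(1,3)] fc gc)
    show "val V (f \<otimes>\<^bsub>sections \<O> V\<^esub> g) a = val V f a * val V g a"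
      using cring.cring_simprules(5)[OF O_cring[OF V(1)] f g]
      by (simp add: val f g O_restr_mult[OF V(1) o(2)] coeffs_mult[OF o(1,3)] fc gc) }
  show "val V (c \<odot>\<^bsub>sections \<O> V\<^esub> f) a = c * val V f a"
    using complex_module_smult_closed[OF O_module[OF V(1)] f, of c]
    by (simp add: val f O_restr_smult[OF V(1) o(2)] coeffs_smult[OF o(1,3)] fc)
  show "val V \<one>\<^bsub>sections \<O> V\<^esub> a = 1"
    using cring.cring_simprules(6)[OF O_cring[OF V(1)]]
    by (simp add: val O_restr_one[OF V(1) o(2)] coeffs_one[OF o(1,3)])
qed

lemma one_closed: "openin X V \<Longrightarrow> \<one>\<^bsub>sections \<O> V\<^esub> \<in> sec \<O> V"
  using cring.cring_simprules(6)[OF O_cring] .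

lemma value_const: "openin X V \<Longrightarrow> a \<in> V \<Longrightarrow> val V (const V c) a = c"
  using value_smult[OF _ _ one_closed] value_one[OF _ _ one_closed] by (simp add: const_def)

lemma value_hom:
  assumes V: "openin X V" "a \<in> V"
  shows "ring_hom_cring (sections \<O> V) complex_ring (\<lambda>f. val V f a)"
  using O_cring[OF V(1)] cring_complex_ring value_add[OF V] value_mult[OF V] value_one[OF V one_closed[OF V(1)]]
  by (auto intro!: ring_hom_cring.intro ring_hom_cring_axioms.intro ring_hom_memI)

lemma value_zero: "openin X V \<Longrightarrow> a \<in> V \<Longrightarrow> val V \<zero>\<^bsub>sections \<O> V\<^esub> a = 0"
  using ring_hom_cring.hom_zero[OF value_hom] by simp

lemma value_minus:
  assumes V: "openin X V" "a \<in> V" and f: "f \<in> sec \<O> V" "g \<in> sec \<O> V"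
  shows "val V (f \<ominus>\<^bsub>sections \<O> V\<^esub> g) a = val V f a - val V g a"
proof -
  interpret R: cring "sections \<O> V" using O_cring V by blast
  have "(f \<ominus>\<^bsub>sections \<O> V\<^esub> g) \<oplus>\<^bsub>sections \<O> V\<^esub> g = f" using f by (simp add: a_minus_def R.a_assoc R.l_neg)
  then have "val V (f \<ominus>\<^bsub>sections \<O> V\<^esub> g) a + val V g a = val V f a"
    using value_add[OF V R.minus_closed[OF f] f(2)] by simp
  then show ?thesis by (simp add: algebra_simps)
qed

abbreviation M where "M \<equiv> topspace X"

lemma M_open: "openin X M" by simp

lemma opens_M: "openin X V \<Longrightarrow> V \<in> opens_in X M"
  by (simp add: opens_in_iff openin_subset)

text \<open>Being closed under products and under 1 - x, this set contains the values of every term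
  of the telescoping sum. That is how the partition becomes real and nonnegative without any
  division.\<close>

definition unit_interval :: "complex set" where
  "unit_interval = complex_of_real ` {0..1}"

lemma unit_interval:
  "1 \<in> unit_interval" "0 \<in> unit_interval" "x \<in> unit_interval \<Longrightarrow> y \<in> unit_interval \<Longrightarrow> x * y \<in> unit_interval"
  "x \<in> unit_interval \<Longrightarrow> 1 - x \<in> unit_interval"
proof -
  show "1 \<in> unit_interval" "0 \<in> unit_interval"
    unfolding unit_interval_def using image_eqI[of 1 complex_of_real 1 "{0..1}"] image_eqI[of 0 complex_of_real 0 "{0..1}"] by auto
  show "x * y \<in> unit_interval" if xy: "x \<in> unit_interval" "y \<in> unit_interval"
  proof -
    obtain s t where "x = complex_of_real s" "y = complex_of_real t" "s \<in> {0..1}" "t \<in> {0..1}"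
      using xy unfolding unit_interval_def by auto
    then show ?thesis unfolding unit_interval_def
      by (intro image_eqI[of _ _ "s * t"]) (auto simp: mult_le_one)
  qed
  show "1 - x \<in> unit_interval" if x: "x \<in> unit_interval"
  proof -
    obtain s where "x = complex_of_real s" "s \<in> {0..1}" using x unfolding unit_interval_def by auto
    then show ?thesis unfolding unit_interval_def by (intro image_eqI[of _ _ "1 - s"]) auto
  qed
qed

text \<open>
  Such an \<open>h\<close> is 1 minus a bump function.  Products of these vanish on the union of the sets \<open>N\<close>, so
  compact sets are treated by multiplying finitely many local ones.
\<close>

definition hole :: "'a set \<Rightarrow> 'a set \<Rightarrow> 'r \<Rightarrow> bool" where
  "hole N C h \<longleftrightarrow> h \<in> sec \<O> M \<and> openin X N \<and> compactin X C \<and> N \<subseteq> C \<and>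
     restr \<O> M N h = \<zero>\<^bsub>sections \<O> N\<^esub> \<and> restr \<O> M (M - C) h = \<one>\<^bsub>sections \<O> (M - C)\<^esub> \<and>
     (\<forall>b\<in>M. val M h b \<in> unit_interval)"

lemma compact_open_diff: "openin X V \<Longrightarrow> compactin X C \<Longrightarrow> openin X (V - C)"
  using compactin_imp_closedin[OF hausdorff] by blast

lemma hole_at:
  assumes W: "openin X W" and a: "a \<in> W"
  shows "\<exists>N C h. hole N C h \<and> a \<in> N \<and> C \<subseteq> W"
proof -
  have "a \<in> M" using W a openin_subset by blast
  then obtain U\<^sub>0 n k \<phi> \<Psi> where ch: "formal_chart X \<O> U\<^sub>0 n k \<phi> \<Psi>" and a0: "a \<in> U\<^sub>0" using chart_at by blast
  interpret formal_chart X \<O> U\<^sub>0 n k \<phi> \<Psi> by (rule ch)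
  let ?W = "W \<inter> U\<^sub>0"
  have W': "?W \<in> opens_in X U\<^sub>0" "a \<in> ?W" "openin X ?W" using W U0 a a0 by (auto simp: opens_in_iff)
  obtain f N C where f: "f \<in> sec \<O> ?W" and N: "openin X N" "a \<in> N" "N \<subseteq> ?W"
    and C: "compactin X C" "C \<subseteq> ?W" "openin X (?W - C)"
    and r: "restr \<O> ?W N f = \<one>\<^bsub>sections \<O> N\<^esub>" "restr \<O> ?W (?W - C) f = \<zero>\<^bsub>sections \<O> (?W - C)\<^esub>"
    and v: "\<forall>b\<in>?W. \<exists>t::real. val ?W f b = complex_of_real t \<and> 0 \<le> t \<and> t \<le> 1"
    using chart_bump[OF W'(1,2)] by blast
  have WM: "?W \<subseteq> M" using openin_subset[OF W'(3)] .
  have ez: "openin X M" "openin X ?W" "?W \<subseteq> M" "openin X (M - C)" "M \<inter> C \<subseteq> ?W"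
    using W'(3) WM C compact_open_diff[OF M_open C(1)] by auto
  define g where "g = self.extz M ?W C f"
  have g: "g \<in> sec \<O> M" "restr \<O> M ?W g = f" "restr \<O> M (M - C) g = \<zero>\<^bsub>sections \<O> (M - C)\<^esub>"
    using self.extz[OF ez, of f] f r(2) unfolding g_def by auto
  have oW: "?W \<in> opens_in X M" "M - C \<in> opens_in X M" "N \<in> opens_in X ?W" "N \<in> opens_in X M"
    using opens_M W'(3) ez(4) N by (auto simp: opens_in_iff openin_subset)
  have gN: "restr \<O> M N g = \<one>\<^bsub>sections \<O> N\<^esub>"
    using O_restr_restr[OF M_open oW(1,3) g(1)] g(2) r(1) by simp
  have gv: "val M g b \<in> unit_interval" if b: "b \<in> M" for b
  proof (cases "b \<in> ?W")
    case True
    then have "val M g b = val ?W f b" using value_restr[OF M_open b g(1) oW(1)] g(2) by simp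
    moreover obtain t :: real where "val ?W f b = complex_of_real t" "0 \<le> t" "t \<le> 1" using v True by blast
    ultimately show ?thesis unfolding unit_interval_def by (intro image_eqI[of _ _ t]) auto
  next
    case False
    then have b': "b \<in> M - C" using b C by auto
    then have "val M g b = 0" using value_restr[OF M_open b g(1) oW(2) b'] g(3) value_zero[OF ez(4) b'] by simp
    then show ?thesis by (simp add: unit_interval)
  qed
  \<comment> \<open>On \<open>N\<close> the section is one and off \<open>C\<close> it is zero, and
    values tell one from zero.\<close>
  have NC: "N \<subseteq> C"
  proof (rule ccontr)
    assume "\<not> N \<subseteq> C"
    then obtain b where b: "b \<in> N" "b \<in> M - C" "b \<in> M" using N WM by blast
    have "val M g b = 1"
      using value_restr[OF M_open b(3) g(1) oW(4) b(1)] gN value_one[OF N(1) b(1) one_closed[OF N(1)]] by simp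
    moreover have "val M g b = 0"
      using value_restr[OF M_open b(3) g(1) oW(2) b(2)] g(3) value_zero[OF ez(4) b(2)] by simp
    ultimately show False by simp
  qed
  let ?h = "\<one>\<^bsub>sections \<O> M\<^esub> \<ominus>\<^bsub>sections \<O> M\<^esub> g"
  interpret RM: cring "sections \<O> M" using O_cring M_open .
  interpret RN: cring "sections \<O> N" using O_cring N(1) .
  interpret RC: cring "sections \<O> (M - C)" using O_cring ez(4) .
  have "hole N C ?h"
    unfolding hole_def
  proof (intro conjI ballI)
    show "?h \<in> sec \<O> M" using g by simp
    show "restr \<O> M N ?h = \<zero>\<^bsub>sections \<O> N\<^esub>"
      unfolding O_restr_minus[OF M_open oW(4) RM.one_closed g(1)] O_restr_one[OF M_open oW(4)] gN
      by (simp add: a_minus_def RN.r_neg)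
    show "restr \<O> M (M - C) ?h = \<one>\<^bsub>sections \<O> (M - C)\<^esub>"
      unfolding O_restr_minus[OF M_open oW(2) RM.one_closed g(1)] O_restr_one[OF M_open oW(2)] g(3)
      by (simp add: a_minus_def)
    show "val M ?h b \<in> unit_interval" if "b \<in> M" for b
      using that gv[OF that] g by (simp add: value_minus value_one[OF _ _ one_closed] unit_interval)
  qed (use N C NC in auto)
  then show ?thesis using N C by blast
qed

text \<open>The product vanishes on each of \<open>N\<close> and N', hence on their union by gluing,
  and off both compact sets each factor is one.\<close>

lemma hole_mult:
  assumes h: "hole N C h" and h': "hole N' C' h'"
  shows "hole (N \<union> N') (C \<union> C') (h \<otimes>\<^bsub>sections \<O> M\<^esub> h')"
proof -
  note H = h[unfolded hole_def] and H' = h'[unfolded hole_def]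
  have hs: "h \<in> sec \<O> M" "h' \<in> sec \<O> M" "openin X N" "openin X N'" "compactin X C" "compactin X C'"
    using H H' by auto
  interpret RM: cring "sections \<O> M" using O_cring M_open .
  let ?g = "h \<otimes>\<^bsub>sections \<O> M\<^esub> h'" and ?N = "N \<union> N'" and ?C = "C \<union> C'"
  have g: "?g \<in> sec \<O> M" using hs by simp
  have oN: "openin X ?N" "openin X (M - C)" "openin X (M - C')" "openin X (M - ?C)"
    using hs compact_open_diff[OF M_open] compactin_Un[OF hs(5,6)] by auto
  have o: "N \<in> opens_in X M" "N' \<in> opens_in X M" "?N \<in> opens_in X M" "M - C \<in> opens_in X M" "M - C' \<in> opens_in X M"
    "M - ?C \<in> opens_in X M" using opens_M hs oN by auto
  have o2: "N \<in> opens_in X ?N" "N' \<in> opens_in X ?N" "M - ?C \<in> opens_in X (M - C)" "M - ?C \<in> opens_in X (M - C')"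
    using hs oN by (auto simp: opens_in_iff)
  interpret R1: cring "sections \<O> N" using O_cring hs(3) .
  interpret R2: cring "sections \<O> N'" using O_cring hs(4) .
  interpret R3: cring "sections \<O> (M - ?C)" using O_cring oN(4) .
  have z: "restr \<O> M N ?g = \<zero>\<^bsub>sections \<O> N\<^esub>" "restr \<O> M N' ?g = \<zero>\<^bsub>sections \<O> N'\<^esub>"
    using H H' hs O_restr_closed[OF M_open o(1)] O_restr_closed[OF M_open o(2)]
    by (simp_all add: O_restr_mult[OF M_open o(1)] O_restr_mult[OF M_open o(2)])
  have "restr \<O> M ?N ?g = \<zero>\<^bsub>sections \<O> ?N\<^esub>"
  proof (rule sheaf_eqI2[OF O_sheaf oN(1) _ _ hs(3,4) refl])
    show "restr \<O> M ?N ?g \<in> sec \<O> ?N" using O_restr_closed[OF M_open o(3) g] .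
    show "\<zero>\<^bsub>sections \<O> ?N\<^esub> \<in> sec \<O> ?N" using self.zero_closed[OF oN(1)] by simp
    show "restr \<O> ?N N (restr \<O> M ?N ?g) = restr \<O> ?N N \<zero>\<^bsub>sections \<O> ?N\<^esub>"
      using O_restr_restr[OF M_open o(3) o2(1) g] O_restr_zero[OF oN(1) o2(1)] z by simp
    show "restr \<O> ?N N' (restr \<O> M ?N ?g) = restr \<O> ?N N' \<zero>\<^bsub>sections \<O> ?N\<^esub>"
      using O_restr_restr[OF M_open o(3) o2(2) g] O_restr_zero[OF oN(1) o2(2)] z by simp
  qed
  moreover have "restr \<O> M (M - ?C) ?g = \<one>\<^bsub>sections \<O> (M - ?C)\<^esub>"
  proof -
    have "restr \<O> M (M - ?C) h = \<one>\<^bsub>sections \<O> (M - ?C)\<^esub>" "restr \<O> M (M - ?C) h' = \<one>\<^bsub>sections \<O> (M - ?C)\<^esub>"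
      using O_restr_restr[OF M_open o(4) o2(3) hs(1)] O_restr_restr[OF M_open o(5) o2(4) hs(2)]
        O_restr_one[OF oN(2) o2(3)] O_restr_one[OF oN(3) o2(4)] H H' by auto
    then show ?thesis using hs by (simp add: O_restr_mult[OF M_open o(6)])
  qed
  ultimately show ?thesis
    unfolding hole_def using g oN H H' hs by (auto simp: compactin_Un value_mult unit_interval)
qed

lemma hole_empty: "hole {} {} \<one>\<^bsub>sections \<O> M\<^esub>"
proof -
  have e: "openin X {}" "{} \<in> opens_in X M" by (auto simp: opens_in_iff)
  \<comment> \<open>Over the empty set any two sections coincide, since locality imposes no
    condition there.\<close>
  have "restr \<O> M {} \<one>\<^bsub>sections \<O> M\<^esub> = \<zero>\<^bsub>sections \<O> {}\<^esub>"
    by (rule O_eqI[OF e(1)]) (use O_restr_closed[OF M_open e(2) one_closed[OF M_open]] self.zero_closed[OF e(1)] in auto)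
  then show ?thesis
    unfolding hole_def using O_restr_one[OF M_open opens_M[OF M_open]] one_closed[OF M_open] value_one[OF M_open _ one_closed[OF M_open]]
    by (auto simp: unit_interval)
qed

lemma hole_compact:
  assumes W: "openin X W" and K: "compactin X K" "K \<subseteq> W"
  shows "\<exists>N C h. hole N C h \<and> K \<subseteq> N \<and> C \<subseteq> W"
proof -
  let ?\<U> = "{N. \<exists>C h. hole N C h \<and> C \<subseteq> W}"
  have "K \<subseteq> \<Union>?\<U>" using hole_at[OF W] K by blast
  moreover have "openin X N" if "N \<in> ?\<U>" for N using that by (auto simp: hole_def)
  ultimately obtain \<V> where V: "finite \<V>" "\<V> \<subseteq> ?\<U>" "K \<subseteq> \<Union>\<V>" using K(1) unfolding compactin_def by meson
  have "\<exists>C h. hole (\<Union>\<V>) C h \<and> C \<subseteq> W" using V(1,2)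
  proof (induction \<V> rule: finite_induct)
    case empty
    then show ?case using hole_empty by auto
  next
    case (insert N \<V>)
    then obtain C h C' h' where "hole N C h" "C \<subseteq> W" "hole (\<Union>\<V>) C' h'" "C' \<subseteq> W" by auto
    then show ?case using hole_mult[of N C h "\<Union>\<V>" C' h'] by (intro exI[of _ "C \<union> C'"]) auto
  qed
  then show ?thesis using V(3) by blast
qed

end

text \<open>\<open>\<V>\<close> indexes a refinement of the given cover, \<open>idx\<close> tells in
  which member of the cover an index lies, and \<open>lt\<close> is the order for telescoping. The
  terms are formed over any open set and any finite set of indices, because the whole index set is
  only locally finite.\<close>

locale partition_data = formal_mfd X \<O>
  for X :: "'a topology" and \<O> :: "('a, complex, 'r) presheaf" +
  fixes \<V> :: "'i set" and h :: "'i \<Rightarrow> 'r" and lt :: "'i \<Rightarrow> 'i \<Rightarrow> bool" and idx :: "'i \<Rightarrow> 'j"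
  assumes h: "i \<in> \<V> \<Longrightarrow> h i \<in> sec \<O> (topspace X)"
    and hv: "i \<in> \<V> \<Longrightarrow> b \<in> topspace X \<Longrightarrow>
      value_at X \<O> (topspace X) (h i) b \<in> formal_mfd.unit_interval"
    and irr: "\<not> lt i i" and tr: "lt i j \<Longrightarrow> lt j k \<Longrightarrow> lt i k"
    and tot: "i \<noteq> j \<Longrightarrow> lt i j \<or> lt j i"
begin

definition hr :: "'a set \<Rightarrow> 'i \<Rightarrow> 'r" where "hr W i = restr \<O> M W (h i)"

definition piece :: "'a set \<Rightarrow> 'i set \<Rightarrow> 'i \<Rightarrow> 'r" where
  "piece W J j = (\<one>\<^bsub>sections \<O> W\<^esub> \<ominus>\<^bsub>sections \<O> W\<^esub> hr W j) \<otimes>\<^bsub>sections \<O> W\<^esub>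
     (\<Otimes>\<^bsub>sections \<O> W\<^esub>i\<in>J. if lt i j then hr W i else \<one>\<^bsub>sections \<O> W\<^esub>)"

text \<open>Groups the telescoping terms by member of the original cover, since the refinement has
  an index set of its own.\<close>

definition pieces :: "'j \<Rightarrow> 'a set \<Rightarrow> 'i set \<Rightarrow> 'r" where
  "pieces \<alpha> W J = (\<Oplus>\<^bsub>sections \<O> W\<^esub>j\<in>J. if idx j = \<alpha> then piece W J j else \<zero>\<^bsub>sections \<O> W\<^esub>)"

lemma hr_closed: "openin X W \<Longrightarrow> i \<in> \<V> \<Longrightarrow> hr W i \<in> sec \<O> W"
  unfolding hr_def using O_restr_closed[OF M_open opens_M h] .

lemma prod_closed:
  assumes W: "openin X W" and J: "J \<subseteq> \<V>"
  shows "(\<Otimes>\<^bsub>sections \<O> W\<^esub>i\<in>J. if lt i j then hr W i else \<one>\<^bsub>sections \<O> W\<^esub>) \<in> sec \<O> W"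
proof -
  interpret R: cring "sections \<O> W" using O_cring W .
  show ?thesis by (rule R.finprod_closed) (use J hr_closed[OF W] in auto)
qed

lemma piece_closed:
  assumes W: "openin X W" and J: "J \<subseteq> \<V>" "j \<in> \<V>"
  shows "piece W J j \<in> sec \<O> W"
proof -
  interpret R: cring "sections \<O> W" using O_cring W .
  show ?thesis unfolding piece_def using prod_closed[OF W J(1), of j] hr_closed[OF W J(2)] by simp
qed

lemma pieces_closed:
  assumes W: "openin X W" and J: "J \<subseteq> \<V>"
  shows "pieces \<alpha> W J \<in> sec \<O> W"
proof -
  interpret R: cring "sections \<O> W" using O_cring W .
  show ?thesis unfolding pieces_def by (rule R.finsum_closed) (use J piece_closed[OF W J] in auto)
qed

lemma restr_hom:
  assumes W: "openin X W" "W' \<in> opens_in X W"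
  shows "ring_hom_cring (sections \<O> W) (sections \<O> W') (restr \<O> W W')"
  using O_cring O_ring_hom[OF W] W
  by (auto intro!: ring_hom_cring.intro ring_hom_cring_axioms.intro simp: opens_in_iff)

lemma restr_hr: "openin X W \<Longrightarrow> W' \<in> opens_in X W \<Longrightarrow> i \<in> \<V> \<Longrightarrow> restr \<O> W W' (hr W i) = hr W' i"
  unfolding hr_def using O_restr_restr[OF M_open opens_M _ h] .

lemma restr_piece:
  assumes W: "openin X W" "W' \<in> opens_in X W" and J: "J \<subseteq> \<V>" "j \<in> \<V>"
  shows "restr \<O> W W' (piece W J j) = piece W' J j"
proof -
  interpret R: ring_hom_cring "sections \<O> W" "sections \<O> W'" "restr \<O> W W'" using restr_hom W .
  have W': "openin X W'" using W by (simp add: opens_in_iff)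
  have "restr \<O> W W' (\<Otimes>\<^bsub>sections \<O> W\<^esub>i\<in>J. if lt i j then hr W i else \<one>\<^bsub>sections \<O> W\<^esub>) =
    (\<Otimes>\<^bsub>sections \<O> W'\<^esub>i\<in>J. (restr \<O> W W' \<circ> (\<lambda>i. if lt i j then hr W i else \<one>\<^bsub>sections \<O> W\<^esub>)) i)"
    by (rule R.hom_finprod) (use J hr_closed[OF W(1)] in auto)
  also have "\<dots> = (\<Otimes>\<^bsub>sections \<O> W'\<^esub>i\<in>J. if lt i j then hr W' i else \<one>\<^bsub>sections \<O> W'\<^esub>)"
    by (rule R.S.finprod_cong) (use J hr_closed[OF W'] restr_hr[OF W] in \<open>auto simp: simp_implies_def\<close>)
  finally show ?thesis
    unfolding piece_def
    using O_restr_minus[OF W R.R.one_closed hr_closed[OF W(1) J(2)]] hr_closed[OF W(1) J(2)] prod_closed[OF W(1) J(1), of j]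
      restr_hr[OF W J(2)] by simp
qed

lemma restr_pieces:
  assumes W: "openin X W" "W' \<in> opens_in X W" and J: "J \<subseteq> \<V>"
  shows "restr \<O> W W' (pieces \<alpha> W J) = pieces \<alpha> W' J"
proof -
  interpret R: ring_hom_cring "sections \<O> W" "sections \<O> W'" "restr \<O> W W'" using restr_hom W .
  have W': "openin X W'" using W by (simp add: opens_in_iff)
  have "restr \<O> W W' (pieces \<alpha> W J) =
    (\<Oplus>\<^bsub>sections \<O> W'\<^esub>j\<in>J. (restr \<O> W W' \<circ> (\<lambda>j. if idx j = \<alpha> then piece W J j else \<zero>\<^bsub>sections \<O> W\<^esub>)) j)"
    unfolding pieces_def by (rule R.hom_finsum) (use J piece_closed[OF W(1) J] in auto)
  also have "\<dots> = pieces \<alpha> W' J"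
    unfolding pieces_def
    by (rule R.S.finsum_cong) (use J piece_closed[OF W' J] restr_piece[OF W J] in \<open>auto simp: simp_implies_def\<close>)
  finally show ?thesis .
qed

lemma piece_zero:
  assumes W: "openin X W" and J: "J \<subseteq> \<V>" and j: "hr W j = \<one>\<^bsub>sections \<O> W\<^esub>"
  shows "piece W J j = \<zero>\<^bsub>sections \<O> W\<^esub>"
proof -
  interpret R: cring "sections \<O> W" using O_cring W .
  show ?thesis using prod_closed[OF W J] by (simp add: piece_def j a_minus_def R.r_neg)
qed

text \<open>An index whose \<open>h\<close> is one on \<open>W\<close> contributes the term 0 and,
  to other terms, the factor 1. Sums over different finite index sets therefore agree where the
  surplus indices are inactive.\<close>

lemma pieces_mono:
  assumes W: "openin X W" and J: "J \<subseteq> J'" "J' \<subseteq> \<V>" "finite J'"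
    and one: "\<And>j. j \<in> J' - J \<Longrightarrow> hr W j = \<one>\<^bsub>sections \<O> W\<^esub>"
  shows "pieces \<alpha> W J = pieces \<alpha> W J'"
proof -
  interpret R: cring "sections \<O> W" using O_cring W .
  have JV: "J \<subseteq> \<V>" using J by blast
  have eq: "piece W J j = piece W J' j" for j
  proof -
    have "(\<Otimes>\<^bsub>sections \<O> W\<^esub>i\<in>J. if lt i j then hr W i else \<one>\<^bsub>sections \<O> W\<^esub>) =
       (\<Otimes>\<^bsub>sections \<O> W\<^esub>i\<in>J'. if lt i j then hr W i else \<one>\<^bsub>sections \<O> W\<^esub>)"
      by (rule R.finprod_mono_neutral_cong_left[OF J(3,1)]) (use one hr_closed[OF W] J(2) in auto)
    then show ?thesis by (simp add: piece_def)
  qed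
  show ?thesis
    unfolding pieces_def
    by (rule R.add.finprod_mono_neutral_cong_left[OF J(3,1)])
      (use one piece_zero[OF W J(2)] piece_closed[OF W J(2)] J(2) eq in auto)
qed

lemma pieces_zero:
  assumes W: "openin X W" and J: "J \<subseteq> \<V>"
    and one: "\<And>j. j \<in> J \<Longrightarrow> idx j = \<alpha> \<Longrightarrow> hr W j = \<one>\<^bsub>sections \<O> W\<^esub>"
  shows "pieces \<alpha> W J = \<zero>\<^bsub>sections \<O> W\<^esub>"
proof -
  interpret R: cring "sections \<O> W" using O_cring W .
  have "pieces \<alpha> W J = (\<Oplus>\<^bsub>sections \<O> W\<^esub>j\<in>J. \<zero>\<^bsub>sections \<O> W\<^esub>)"
    unfolding pieces_def by (rule R.finsum_cong) (use one piece_zero[OF W J] in \<open>auto simp: simp_implies_def\<close>)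
  then show ?thesis by simp
qed

text \<open>Each index \<open>j\<close> belongs to exactly one group, that of \<open>idx j\<close>,
  so interchanging the sums leaves a single copy of its term.\<close>

lemma sum_pieces:
  assumes W: "openin X W" and J: "J \<subseteq> \<V>" "finite J" and A: "finite A" "idx ` J \<subseteq> A"
  shows "(\<Oplus>\<^bsub>sections \<O> W\<^esub>\<alpha>\<in>A. pieces \<alpha> W J) = (\<Oplus>\<^bsub>sections \<O> W\<^esub>j\<in>J. piece W J j)"
proof -
  interpret R: cring "sections \<O> W" using O_cring W .
  note pc = piece_closed[OF W J(1)]
  let ?d = "\<lambda>\<alpha> j. if idx j = \<alpha> then piece W J j else \<zero>\<^bsub>sections \<O> W\<^esub>"
  have "(\<Oplus>\<^bsub>sections \<O> W\<^esub>\<alpha>\<in>A. \<Oplus>\<^bsub>sections \<O> W\<^esub>j\<in>L. ?d \<alpha> j) = (\<Oplus>\<^bsub>sections \<O> W\<^esub>j\<in>L. piece W J j)"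
    if "finite L" "L \<subseteq> J" for L
    using that
  proof (induction L rule: finite_induct)
    case (insert j L)
    have L: "\<And>i. i \<in> insert j L \<Longrightarrow> piece W J i \<in> sec \<O> W" using insert.prems J pc by blast
    have d: "?d \<alpha> i \<in> sec \<O> W" if "i \<in> insert j L" for \<alpha> i using L[OF that] by simp
    have s: "(\<Oplus>\<^bsub>sections \<O> W\<^esub>j\<in>L. ?d \<alpha> j) \<in> sec \<O> W" for \<alpha> by (rule R.finsum_closed) (use d in auto)
    have "(\<Oplus>\<^bsub>sections \<O> W\<^esub>\<alpha>\<in>A. \<Oplus>\<^bsub>sections \<O> W\<^esub>j\<in>insert j L. ?d \<alpha> j) =
        (\<Oplus>\<^bsub>sections \<O> W\<^esub>\<alpha>\<in>A. ?d \<alpha> j \<oplus>\<^bsub>sections \<O> W\<^esub> (\<Oplus>\<^bsub>sections \<O> W\<^esub>j\<in>L. ?d \<alpha> j))"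
      by (rule R.finsum_cong) (use insert.hyps d s in \<open>auto simp: simp_implies_def R.finsum_insert\<close>)
    also have "\<dots> = (\<Oplus>\<^bsub>sections \<O> W\<^esub>\<alpha>\<in>A. ?d \<alpha> j) \<oplus>\<^bsub>sections \<O> W\<^esub>
        (\<Oplus>\<^bsub>sections \<O> W\<^esub>\<alpha>\<in>A. \<Oplus>\<^bsub>sections \<O> W\<^esub>j\<in>L. ?d \<alpha> j)"
      by (rule R.finsum_addf) (use d s in auto)
    also have "(\<Oplus>\<^bsub>sections \<O> W\<^esub>\<alpha>\<in>A. ?d \<alpha> j) = piece W J j"
      using R.finsum_singleton[of "idx j" A "\<lambda>\<alpha>. piece W J j"] A L insert.prems by auto
    also have "(\<Oplus>\<^bsub>sections \<O> W\<^esub>\<alpha>\<in>A. \<Oplus>\<^bsub>sections \<O> W\<^esub>j\<in>L. ?d \<alpha> j) = (\<Oplus>\<^bsub>sections \<O> W\<^esub>j\<in>L. piece W J j)"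
      using insert by auto
    finally show ?case using insert.hyps L by (subst R.finsum_insert) auto
  qed simp
  from this[OF J(2) subset_refl] show ?thesis unfolding pieces_def .
qed

text \<open>The telescoping sum falls short of one by the product of all h. Near each point one
  factor is zero, so this product vanishes locally and hence altogether.\<close>

lemma sum_pieces_one:
  assumes W: "openin X W" and J: "J \<subseteq> \<V>" "finite J" and A: "finite A" "idx ` J \<subseteq> A"
    and zero: "\<And>a. a \<in> W \<Longrightarrow> \<exists>j\<in>J. \<exists>N. openin X N \<and> a \<in> N \<and> N \<subseteq> W \<and> hr N j = \<zero>\<^bsub>sections \<O> N\<^esub>"
  shows "(\<Oplus>\<^bsub>sections \<O> W\<^esub>\<alpha>\<in>A. pieces \<alpha> W J) = \<one>\<^bsub>sections \<O> W\<^esub>"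
proof -
  interpret R: cring "sections \<O> W" using O_cring W .
  let ?Q = "\<Otimes>\<^bsub>sections \<O> W\<^esub>j\<in>J. hr W j"
  have Qc: "?Q \<in> sec \<O> W" by (rule R.finprod_closed) (use J hr_closed[OF W] in auto)
  have "?Q = \<zero>\<^bsub>sections \<O> W\<^esub>"
  proof (rule O_eqI[OF W Qc R.zero_closed])
    fix a assume a: "a \<in> W"
    then obtain j N where j: "j \<in> J" and N: "openin X N" "a \<in> N" "N \<subseteq> W" and z: "hr N j = \<zero>\<^bsub>sections \<O> N\<^esub>"
      using zero by blast
    have o: "N \<in> opens_in X W" using N by (simp add: opens_in_iff)
    interpret H: ring_hom_cring "sections \<O> W" "sections \<O> N" "restr \<O> W N" using restr_hom W o .
    have "restr \<O> W N ?Q = (\<Otimes>\<^bsub>sections \<O> N\<^esub>i\<in>J. (restr \<O> W N \<circ> hr W) i)"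
      by (rule H.hom_finprod) (use J hr_closed[OF W] in auto)
    also have "\<dots> = (\<Otimes>\<^bsub>sections \<O> N\<^esub>i\<in>insert j (J - {j}). hr N i)"
      by (rule H.S.finprod_cong) (use J j hr_closed[OF N(1)] restr_hr[OF W o] in \<open>auto simp: simp_implies_def\<close>)
    also have "\<dots> = hr N j \<otimes>\<^bsub>sections \<O> N\<^esub> (\<Otimes>\<^bsub>sections \<O> N\<^esub>i\<in>J - {j}. hr N i)"
      by (rule H.S.finprod_insert) (use J j hr_closed[OF N(1)] in auto)
    also have "\<dots> = \<zero>\<^bsub>sections \<O> N\<^esub>"
      unfolding z by (rule H.S.l_null, rule H.S.finprod_closed) (use J hr_closed[OF N(1)] in auto)
    finally show "\<exists>N\<in>opens_in X W. a \<in> N \<and> restr \<O> W N ?Q = restr \<O> W N \<zero>\<^bsub>sections \<O> W\<^esub>"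
      using N(2) o by (intro bexI[of _ N]) auto
  qed
  moreover have "(\<Oplus>\<^bsub>sections \<O> W\<^esub>j\<in>J. piece W J j) \<oplus>\<^bsub>sections \<O> W\<^esub> ?Q = \<one>\<^bsub>sections \<O> W\<^esub>"
    unfolding piece_def
    by (rule R.telescoping_partition[OF J(2) _ irr tr]) (use J hr_closed[OF W] tot in blast)+
  moreover have "(\<Oplus>\<^bsub>sections \<O> W\<^esub>j\<in>J. piece W J j) \<in> sec \<O> W"
    by (rule R.finsum_closed) (use J piece_closed[OF W J(1)] in auto)
  ultimately show ?thesis using sum_pieces[OF W J A] by simp
qed

lemma value_finprod_unit:
  assumes W: "openin X W" "b \<in> W" and "finite J" "\<And>i. i \<in> J \<Longrightarrow> f i \<in> sec \<O> W \<and> val W (f i) b \<in> unit_interval"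
  shows "val W (\<Otimes>\<^bsub>sections \<O> W\<^esub>i\<in>J. f i) b \<in> unit_interval"
  using assms(3,4)
proof (induction J rule: finite_induct)
  interpret R: cring "sections \<O> W" using O_cring W(1) .
  case empty
  then show ?case using value_one[OF W one_closed[OF W(1)]] by (simp add: unit_interval)
next
  interpret R: cring "sections \<O> W" using O_cring W(1) .
  case (insert i J)
  then show ?case by (subst R.finprod_insert) (auto simp: value_mult[OF W] unit_interval)
qed

lemma piece_value:
  assumes W: "openin X W" "b \<in> W" and J: "J \<subseteq> \<V>" "finite J" "j \<in> \<V>"
  shows "val W (piece W J j) b \<in> unit_interval"
proof -
  interpret R: cring "sections \<O> W" using O_cring W(1) .
  have bM: "b \<in> M" using W openin_subset by blast
  have hrv: "val W (hr W i) b \<in> unit_interval" if "i \<in> \<V>" for i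
    unfolding hr_def using value_restr[OF M_open bM h[OF that] opens_M[OF W(1)] W(2)] hv[OF that bM] by simp
  have "val W (\<Otimes>\<^bsub>sections \<O> W\<^esub>i\<in>J. if lt i j then hr W i else \<one>\<^bsub>sections \<O> W\<^esub>) b \<in> unit_interval"
    by (rule value_finprod_unit[OF W J(2)])
      (use J hr_closed[OF W(1)] hrv value_one[OF W one_closed[OF W(1)]] in \<open>auto simp: unit_interval\<close>)
  then show ?thesis
    unfolding piece_def using hr_closed[OF W(1) J(3)] hrv[OF J(3)] prod_closed[OF W(1) J(1), of j]
    by (simp add: value_mult[OF W] value_minus[OF W] value_one[OF W] unit_interval)
qed

text \<open>Each term has its value in [0, 1]. Nonnegativity is the part that passes to
  sums.\<close>

lemma pieces_value:
  assumes W: "openin X W" "b \<in> W" and J: "J \<subseteq> \<V>" "finite J"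
  shows "\<exists>t::real\<ge>0. val W (pieces \<alpha> W J) b = complex_of_real t"
proof -
  interpret R: cring "sections \<O> W" using O_cring W(1) .
  note pc = piece_closed[OF W(1) J(1)]
  let ?d = "\<lambda>j. if idx j = \<alpha> then piece W J j else \<zero>\<^bsub>sections \<O> W\<^esub>"
  have "\<exists>t::real\<ge>0. val W (\<Oplus>\<^bsub>sections \<O> W\<^esub>j\<in>L. ?d j) b = complex_of_real t" if "finite L" "L \<subseteq> J" for L
    using that
  proof (induction L rule: finite_induct)
    case empty
    then show ?case using value_zero[OF W] by auto
  next
    case (insert j L)
    then obtain t :: real where t: "t \<ge> 0" "val W (\<Oplus>\<^bsub>sections \<O> W\<^esub>j\<in>L. ?d j) b = complex_of_real t" by auto
    have L: "\<And>i. i \<in> insert j L \<Longrightarrow> ?d i \<in> sec \<O> W" using insert.prems J pc by auto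
    have s: "(\<Oplus>\<^bsub>sections \<O> W\<^esub>j\<in>L. ?d j) \<in> sec \<O> W" by (rule R.finsum_closed) (use L in auto)
    have "val W (?d j) b \<in> unit_interval"
      using piece_value[OF W J, of j] insert.prems J value_zero[OF W] by (auto simp: unit_interval)
    then obtain u :: real where u: "u \<ge> 0" "val W (?d j) b = complex_of_real u" unfolding unit_interval_def by auto
    have "(\<Oplus>\<^bsub>sections \<O> W\<^esub>j\<in>insert j L. ?d j) = ?d j \<oplus>\<^bsub>sections \<O> W\<^esub> (\<Oplus>\<^bsub>sections \<O> W\<^esub>j\<in>L. ?d j)"
      by (rule R.finsum_insert) (use insert.hyps L in auto)
    moreover have "val W (?d j \<oplus>\<^bsub>sections \<O> W\<^esub> (\<Oplus>\<^bsub>sections \<O> W\<^esub>j\<in>L. ?d j)) b = complex_of_real (u + t)"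
      using value_add[OF W L[of j] s] u t by simp
    ultimately show ?case using u(1) t(1) by (metis add_nonneg_nonneg)
  qed
  from this[OF J(2) subset_refl] show ?thesis unfolding pieces_def .
qed

end

section \<open>Locally finite refinements and the partition of unity in \<O>\<close>

context formal_mfd
begin

lemma paracompact_refine:
  assumes "\<And>W. W \<in> \<W> \<Longrightarrow> openin X W" "\<Union>\<W> = M"
  shows "\<exists>\<V>. (\<forall>V\<in>\<V>. openin X V \<and> (\<exists>W\<in>\<W>. V \<subseteq> W)) \<and> \<Union>\<V> = M \<and> locally_finite_in X \<V>"
proof -
  have "paracompact_space X" using fm by (simp add: formal_manifold_def)
  then show ?thesis unfolding paracompact_space_def by (elim allE[of _ \<W>]) (use assms in blast)
qed

text \<open>A shrinking argument that uses paracompactness twice. One locally finite refinement has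
  members inside compact subsets of the cover; a further one has closures inside members of the
  former. Collecting these closures member by member gives compact sets that still cover, and a hole
  is made around each.\<close>

lemma hole_cover:
  fixes U :: "'i \<Rightarrow> 'a set"
  assumes U: "\<And>\<alpha>. \<alpha> \<in> \<Gamma> \<Longrightarrow> openin X (U \<alpha>)" and cov: "(\<Union>\<alpha>\<in>\<Gamma>. U \<alpha>) = M"
  obtains \<V> :: "'a set set" and idx N D h where
    "locally_finite_in X \<V>" "\<And>V. V \<in> \<V> \<Longrightarrow> idx V \<in> \<Gamma>" "\<And>V. V \<in> \<V> \<Longrightarrow> V \<subseteq> U (idx V)"
    "\<And>V. V \<in> \<V> \<Longrightarrow> hole (N V) (D V) (h V)" "\<And>V. V \<in> \<V> \<Longrightarrow> D V \<subseteq> V" "\<And>a. a \<in> M \<Longrightarrow> \<exists>V\<in>\<V>. a \<in> N V"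
proof -
  let ?\<W> = "{W. openin X W \<and> (\<exists>\<alpha>\<in>\<Gamma>. \<exists>K. compactin X K \<and> W \<subseteq> K \<and> K \<subseteq> U \<alpha>)}"
  have "\<Union>?\<W> = M"
  proof
    show "M \<subseteq> \<Union>?\<W>"
    proof
      fix a assume "a \<in> M"
      then obtain \<alpha> where al: "\<alpha> \<in> \<Gamma>" "a \<in> U \<alpha>" using cov by blast
      obtain N C h where "hole N C h" "a \<in> N" "C \<subseteq> U \<alpha>" using hole_at[OF U[OF al(1)] al(2)] by blast
      then show "a \<in> \<Union>?\<W>" using al(1) unfolding hole_def by blast
    qed
  qed (use openin_subset in blast)
  from paracompact_refine[OF _ this] obtain \<V> where
    V0: "\<forall>V\<in>\<V>. openin X V \<and> (\<exists>W\<in>?\<W>. V \<subseteq> W)" "\<Union>\<V> = M" "locally_finite_in X \<V>" by auto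
  have V: "openin X V" "\<exists>W\<in>?\<W>. V \<subseteq> W" if "V \<in> \<V>" for V using V0(1) that by blast+
  have "\<exists>\<alpha> K. \<alpha> \<in> \<Gamma> \<and> compactin X K \<and> V \<subseteq> K \<and> K \<subseteq> U \<alpha>" if "V \<in> \<V>" for V using V(2)[OF that] by blast
  then obtain idx Kf where idx: "\<And>V. V \<in> \<V> \<Longrightarrow> idx V \<in> \<Gamma> \<and> compactin X (Kf V) \<and> V \<subseteq> Kf V \<and> Kf V \<subseteq> U (idx V)"
    by metis
  let ?\<Q> = "{P. openin X P \<and> (\<exists>V\<in>\<V>. X closure_of P \<subseteq> V)}"
  have "\<Union>?\<Q> = M"
  proof
    show "M \<subseteq> \<Union>?\<Q>"
    proof
      fix a assume "a \<in> M"
      then obtain V where v: "V \<in> \<V>" "a \<in> V" using V0(2) by blast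
      obtain N C h where N: "hole N C h" "a \<in> N" "C \<subseteq> V" using hole_at[OF V(1)[OF v(1)] v(2)] by blast
      then have "closedin X C" using compactin_imp_closedin[OF hausdorff] by (simp add: hole_def)
      then have "X closure_of N \<subseteq> C" using N(1) by (intro closure_of_minimal) (auto simp: hole_def)
      then show "a \<in> \<Union>?\<Q>" using N v(1) unfolding hole_def by blast
    qed
  qed (use openin_subset in blast)
  from paracompact_refine[OF _ this] obtain \<P> where
    P: "\<forall>P\<in>\<P>. openin X P \<and> (\<exists>W\<in>?\<Q>. P \<subseteq> W)" "\<Union>\<P> = M" "locally_finite_in X \<P>" by auto
  have "\<exists>V. V \<in> \<V> \<and> X closure_of P \<subseteq> V" if "P \<in> \<P>" for P
    using bspec[OF P(1) that] closure_of_mono[of P _ X] by blast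
  then obtain jf where jf: "\<And>P. P \<in> \<P> \<Longrightarrow> jf P \<in> \<V> \<and> X closure_of P \<subseteq> jf P" by metis
  \<comment> \<open>By local finiteness this union of closures is closed; inside the compact set
    \<open>Kf V\<close> it is therefore compact.\<close>
  define cl where "cl V = \<Union>((\<lambda>P. X closure_of P) ` {P \<in> \<P>. jf P = V})" for V
  have cl_compact: "compactin X (cl V)" "cl V \<subseteq> V" if v: "V \<in> \<V>" for V
  proof -
    have "locally_finite_in X ((\<lambda>P. X closure_of P) ` {P \<in> \<P>. jf P = V})"
      by (rule locally_finite_in_closure, rule locally_finite_in_subset[OF P(3)]) auto
    then have "closedin X (cl V)" unfolding cl_def by (intro closedin_locally_finite_Union) auto
    moreover show "cl V \<subseteq> V" using jf unfolding cl_def by blast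
    ultimately show "compactin X (cl V)" using closed_compactin[of X "Kf V" "cl V"] idx[OF v] by blast
  qed
  have "\<exists>N D h. hole N D h \<and> cl V \<subseteq> N \<and> D \<subseteq> V" if "V \<in> \<V>" for V
    by (rule hole_compact[OF V(1)[OF that] cl_compact[OF that]])
  then obtain N D h where hD: "\<And>V. V \<in> \<V> \<Longrightarrow> hole (N V) (D V) (h V) \<and> cl V \<subseteq> N V \<and> D V \<subseteq> V" by metis
  show ?thesis
  proof (rule that[of \<V> idx N D h])
    fix a assume a: "a \<in> M"
    then obtain p where p: "p \<in> \<P>" "a \<in> p" using P(2) by blast
    then have "a \<in> X closure_of p" using a by (meson closure_of_subset_Int IntI subsetD)
    then have "a \<in> cl (jf p)" using p unfolding cl_def by blast
    then show "\<exists>V\<in>\<V>. a \<in> N V" using hD jf[OF p(1)] by blast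
  qed (use V0(3) idx hD in blast)+
qed

text \<open>Near a point only the finitely many refinement members meeting a fixed neighbourhood are
  active. The grouped telescoping sums over these finite sets agree on overlaps and are glued to
  global sections.\<close>

lemma partition_exists:
  fixes U :: "'i \<Rightarrow> 'a set"
  assumes U: "\<And>\<alpha>. \<alpha> \<in> \<Gamma> \<Longrightarrow> openin X (U \<alpha>)" and cov: "(\<Union>\<alpha>\<in>\<Gamma>. U \<alpha>) = M"
  obtains e S where "\<And>\<alpha>. e \<alpha> \<in> sec \<O> M" "\<And>\<alpha>. closedin X (S \<alpha>)" "\<And>\<alpha>. \<alpha> \<in> \<Gamma> \<Longrightarrow> S \<alpha> \<subseteq> U \<alpha>"
    "\<And>\<alpha>. restr \<O> M (M - S \<alpha>) (e \<alpha>) = \<zero>\<^bsub>sections \<O> (M - S \<alpha>)\<^esub>"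
    "\<And>\<alpha> b. b \<in> M \<Longrightarrow> \<exists>t::real\<ge>0. val M (e \<alpha>) b = complex_of_real t"
    "\<And>a. a \<in> M \<Longrightarrow> \<exists>N A. openin X N \<and> a \<in> N \<and> finite A \<and> A \<subseteq> \<Gamma> \<and> (\<forall>\<alpha>\<in>\<Gamma> - A. S \<alpha> \<inter> N = {}) \<and>
       (\<Oplus>\<^bsub>sections \<O> N\<^esub>\<alpha>\<in>A. restr \<O> M N (e \<alpha>)) = \<one>\<^bsub>sections \<O> N\<^esub>"
proof -
  obtain \<V> :: "'a set set" and idx N D h where lf: "locally_finite_in X \<V>"
    and idx: "\<And>V. V \<in> \<V> \<Longrightarrow> idx V \<in> \<Gamma>" "\<And>V. V \<in> \<V> \<Longrightarrow> V \<subseteq> U (idx V)"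
    and hole: "\<And>V. V \<in> \<V> \<Longrightarrow> hole (N V) (D V) (h V)" and D: "\<And>V. V \<in> \<V> \<Longrightarrow> D V \<subseteq> V"
    and cN: "\<And>a. a \<in> M \<Longrightarrow> \<exists>V\<in>\<V>. a \<in> N V"
    using hole_cover[OF U cov] by metis
  \<comment> \<open>Supplies the strict total order on the members of the refinement along which the
    sum telescopes.\<close>
  obtain r :: "'a set rel" where r: "Well_order r" "Field r = UNIV"
    using well_ordering by (elim exE conjE)
  define lt where "lt i j \<longleftrightarrow> (i, j) \<in> r \<and> i \<noteq> j" for i j
  have lin: "trans r" "antisym r" "total_on UNIV r"
    using r by (auto simp: well_order_on_def linear_order_on_def partial_order_on_def preorder_on_def)
  have h: "h i \<in> sec \<O> M" "b \<in> M \<Longrightarrow> val M (h i) b \<in> unit_interval" if "i \<in> \<V>" for i b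
    using hole[OF that] by (auto simp: hole_def)
  have irr: "\<not> lt i i" for i by (simp add: lt_def)
  have tr: "lt i k" if "lt i j" "lt j k" for i j k
    using that lin(1,2) unfolding lt_def by (meson antisymD transD)
  have tot: "lt i j \<or> lt j i" if "i \<noteq> j" for i j
    using that lin(3) unfolding lt_def total_on_def by blast
  interpret P: partition_data X \<O> \<V> h lt idx
    by unfold_locales (fact h(1), fact h(2), fact irr, fact tr, fact tot)
  define T where "T = P.pieces"
  let ?hr = P.hr
  \<comment> \<open>Off \<open>D j\<close> the section \<open>h j\<close> is one, so the index
    \<open>j\<close> is inactive there.\<close>
  have one: "?hr W j = \<one>\<^bsub>sections \<O> W\<^esub>" if W: "openin X W" and j: "j \<in> \<V>" and dis: "W \<inter> D j = {}" for W j
  proof -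
    have Dc: "openin X (M - D j)" using compact_open_diff[OF M_open] hole[OF j] by (simp add: hole_def)
    have o: "M - D j \<in> opens_in X M" "W \<in> opens_in X (M - D j)"
      using Dc W dis openin_subset[OF W] by (auto simp: opens_in_iff)
    show ?thesis
      using O_restr_restr[OF M_open o h(1)[OF j]] hole[OF j] O_restr_one[OF Dc o(2)]
      by (simp add: P.hr_def hole_def)
  qed
  have "\<exists>N. openin X N \<and> a \<in> N \<and> finite {V \<in> \<V>. V \<inter> N \<noteq> {}}" if "a \<in> M" for a
    using lf that unfolding locally_finite_in_def by blast
  then obtain Nb where Nb: "\<And>a. a \<in> M \<Longrightarrow> openin X (Nb a) \<and> a \<in> Nb a \<and> finite {V \<in> \<V>. V \<inter> Nb a \<noteq> {}}" by metis
  define Jb where "Jb a = {V \<in> \<V>. V \<inter> Nb a \<noteq> {}}" for a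
  have Jb: "finite (Jb a)" "Jb a \<subseteq> \<V>" if "a \<in> M" for a using Nb[OF that] by (auto simp: Jb_def)
  have "\<exists>t\<in>sec \<O> M. \<forall>a\<in>M. restr \<O> M (Nb a) t = T \<alpha> (Nb a) (Jb a)" for \<alpha>
  proof (rule O_glue_local[OF M_open])
    show "openin X (Nb a) \<and> a \<in> Nb a \<and> Nb a \<subseteq> M \<and> T \<alpha> (Nb a) (Jb a) \<in> sec \<O> (Nb a)" if "a \<in> M" for a
      using Nb[OF that] openin_subset P.pieces_closed[OF _ Jb(2)[OF that]] unfolding T_def by blast
    fix a b assume ab: "a \<in> M" "b \<in> M"
    let ?W = "Nb a \<inter> Nb b" and ?J = "Jb a \<union> Jb b"
    have W: "openin X ?W" "?W \<in> opens_in X (Nb a)" "?W \<in> opens_in X (Nb b)"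
      using Nb[OF ab(1)] Nb[OF ab(2)] by (auto simp: opens_in_iff)
    have J: "?J \<subseteq> \<V>" "finite ?J" using Jb[OF ab(1)] Jb[OF ab(2)] by auto
    have 1: "?hr ?W j = \<one>\<^bsub>sections \<O> ?W\<^esub>" if "j \<in> ?J - Jb a \<or> j \<in> ?J - Jb b" for j
    proof (rule one[OF W(1)])
      show "j \<in> \<V>" using that J by blast
      then show "?W \<inter> D j = {}" using that D[of j] by (auto simp: Jb_def)
    qed
    \<comment> \<open>Both local sums are compared with the one over the union of the two index
      sets. A surplus index \<open>j\<close> misses one of the two neighbourhoods, and
      \<open>D j\<close> lies inside \<open>j\<close>.\<close>
    have "T \<alpha> ?W (Jb a) = T \<alpha> ?W ?J" "T \<alpha> ?W (Jb b) = T \<alpha> ?W ?J"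
      unfolding T_def using 1 by (auto intro!: P.pieces_mono[OF W(1) _ J])
    then show "restr \<O> (Nb a) ?W (T \<alpha> (Nb a) (Jb a)) = restr \<O> (Nb b) ?W (T \<alpha> (Nb b) (Jb b))"
      using P.restr_pieces[OF _ W(2) Jb(2)[OF ab(1)]] P.restr_pieces[OF _ W(3) Jb(2)[OF ab(2)]]
        Nb[OF ab(1)] Nb[OF ab(2)] unfolding T_def by auto
  qed
  then obtain e where e: "\<And>\<alpha>. e \<alpha> \<in> sec \<O> M" "\<And>\<alpha> a. a \<in> M \<Longrightarrow> restr \<O> M (Nb a) (e \<alpha>) = T \<alpha> (Nb a) (Jb a)" by metis
  \<comment> \<open>A locally finite union of closed sets is closed, although a group may comprise
    infinitely many compact sets.\<close>
  define S where "S \<alpha> = \<Union>(D ` {j \<in> \<V>. idx j = \<alpha>})" for \<alpha>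
  show ?thesis
  proof (rule that[of e S])
    fix \<alpha>
    show "e \<alpha> \<in> sec \<O> M" by (rule e)
    have "locally_finite_in X (D ` {j \<in> \<V>. idx j = \<alpha>})"
      by (rule locally_finite_in_refinement[OF locally_finite_in_subset[OF lf]]) (use D in auto)
    then show cS: "closedin X (S \<alpha>)" unfolding S_def
      by (intro closedin_locally_finite_Union)
        (use hole compactin_imp_closedin[OF hausdorff] in \<open>auto simp: hole_def\<close>)
    show "S \<alpha> \<subseteq> U \<alpha>" if "\<alpha> \<in> \<Gamma>" using D idx(2) unfolding S_def by blast
    have MS: "openin X (M - S \<alpha>)" using cS by blast
    show "restr \<O> M (M - S \<alpha>) (e \<alpha>) = \<zero>\<^bsub>sections \<O> (M - S \<alpha>)\<^esub>"
    proof (rule O_eqI[OF MS O_restr_closed[OF M_open opens_M[OF MS] e(1)]])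
      show "\<zero>\<^bsub>sections \<O> (M - S \<alpha>)\<^esub> \<in> sec \<O> (M - S \<alpha>)" using self.zero_closed[OF MS] by simp
      fix a assume a: "a \<in> M - S \<alpha>"
      then have aM: "a \<in> M" by blast
      let ?W = "Nb a \<inter> (M - S \<alpha>)"
      have W: "openin X ?W" "?W \<in> opens_in X (Nb a)" "?W \<in> opens_in X (M - S \<alpha>)" "Nb a \<in> opens_in X M" "M - S \<alpha> \<in> opens_in X M"
        using Nb[OF aM] MS openin_subset by (auto simp: opens_in_iff)
      have "restr \<O> (M - S \<alpha>) ?W (restr \<O> M (M - S \<alpha>) (e \<alpha>)) = restr \<O> (Nb a) ?W (T \<alpha> (Nb a) (Jb a))"
        using O_restr_restr[OF M_open W(5,3) e(1)] O_restr_restr[OF M_open W(4,2) e(1)] e(2)[OF aM] by simp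
      also have "\<dots> = T \<alpha> ?W (Jb a)"
        unfolding T_def by (rule P.restr_pieces[OF _ W(2) Jb(2)[OF aM]]) (use Nb[OF aM] in blast)+
      also have "\<dots> = \<zero>\<^bsub>sections \<O> ?W\<^esub>"
        unfolding T_def
      proof (rule P.pieces_zero[OF W(1) Jb(2)[OF aM]])
        fix j assume "j \<in> Jb a" "idx j = \<alpha>"
        then show "?hr ?W j = \<one>\<^bsub>sections \<O> ?W\<^esub>"
          using Jb(2)[OF aM] by (intro one[OF W(1)]) (auto simp: S_def)
      qed
      finally show "\<exists>W\<in>opens_in X (M - S \<alpha>). a \<in> W \<and> restr \<O> (M - S \<alpha>) W (restr \<O> M (M - S \<alpha>) (e \<alpha>)) =
          restr \<O> (M - S \<alpha>) W \<zero>\<^bsub>sections \<O> (M - S \<alpha>)\<^esub>"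
        using W(3) a Nb[OF aM] O_restr_zero[OF MS W(3)] by (intro bexI[of _ ?W]) auto
    qed
    fix b assume b: "b \<in> M"
    have o: "openin X (Nb b)" "b \<in> Nb b" using Nb[OF b] by auto
    have "val M (e \<alpha>) b = val (Nb b) (T \<alpha> (Nb b) (Jb b)) b"
      using value_restr[OF M_open b e(1) opens_M[OF o(1)] o(2)] e(2)[OF b] by simp
    then show "\<exists>t::real\<ge>0. val M (e \<alpha>) b = complex_of_real t"
      using P.pieces_value[OF o Jb(2,1)[OF b]] unfolding T_def by simp
  next
    fix a assume a: "a \<in> M"
    have o: "openin X (Nb a)" "a \<in> Nb a" "Nb a \<in> opens_in X M" using Nb[OF a] opens_M by auto
    let ?A = "idx ` Jb a"
    interpret R: cring "sections \<O> (Nb a)" using O_cring o(1) .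
    have "(\<Oplus>\<^bsub>sections \<O> (Nb a)\<^esub>\<alpha>\<in>?A. restr \<O> M (Nb a) (e \<alpha>)) = (\<Oplus>\<^bsub>sections \<O> (Nb a)\<^esub>\<alpha>\<in>?A. T \<alpha> (Nb a) (Jb a))"
      by (simp only: e(2)[OF a])
    also have "\<dots> = \<one>\<^bsub>sections \<O> (Nb a)\<^esub>"
      unfolding T_def
    proof (rule P.sum_pieces_one[OF o(1) Jb(2,1)[OF a]])
      fix b assume b: "b \<in> Nb a"
      then have bM: "b \<in> M" using o(1) openin_subset by blast
      obtain V where V: "V \<in> \<V>" "b \<in> N V" using cN[OF bM] by blast
      have hV: "openin X (N V)" "N V \<subseteq> V" "restr \<O> M (N V) (h V) = \<zero>\<^bsub>sections \<O> (N V)\<^esub>"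
        using hole[OF V(1)] D[OF V(1)] by (auto simp: hole_def)
      have VJ: "V \<in> Jb a" using V hV b by (auto simp: Jb_def)
      let ?W = "N V \<inter> Nb a"
      have W: "openin X ?W" "?W \<in> opens_in X (N V)" using hV o by (auto simp: opens_in_iff)
      have "?hr ?W V = \<zero>\<^bsub>sections \<O> ?W\<^esub>"
        using O_restr_restr[OF M_open opens_M[OF hV(1)] W(2) h(1)[OF V(1)]] hV(3) O_restr_zero[OF hV(1) W(2)]
        by (simp add: P.hr_def)
      then show "\<exists>j\<in>Jb a. \<exists>N. openin X N \<and> b \<in> N \<and> N \<subseteq> Nb a \<and> ?hr N j = \<zero>\<^bsub>sections \<O> N\<^esub>"
        using VJ W(1) V(2) b by blast
    qed (use Jb[OF a] in auto)
    finally have sum: "(\<Oplus>\<^bsub>sections \<O> (Nb a)\<^esub>\<alpha>\<in>?A. restr \<O> M (Nb a) (e \<alpha>)) = \<one>\<^bsub>sections \<O> (Nb a)\<^esub>" .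
    have dis: "\<forall>\<alpha>\<in>\<Gamma> - ?A. S \<alpha> \<inter> Nb a = {}"
    proof (intro ballI equals0I)
      fix \<alpha> x assume al: "\<alpha> \<in> \<Gamma> - ?A" and "x \<in> S \<alpha> \<inter> Nb a"
      then obtain j where j: "j \<in> \<V>" "idx j = \<alpha>" "x \<in> D j" "x \<in> Nb a" unfolding S_def by auto
      then have "j \<in> Jb a" using D[OF j(1)] by (auto simp: Jb_def)
      then show False using al j(2) by blast
    qed
    have "?A \<subseteq> \<Gamma>" using idx(1) Jb(2)[OF a] by blast
    then show "\<exists>N A. openin X N \<and> a \<in> N \<and> finite A \<and> A \<subseteq> \<Gamma> \<and> (\<forall>\<alpha>\<in>\<Gamma> - A. S \<alpha> \<inter> N = {}) \<and>
       (\<Oplus>\<^bsub>sections \<O> N\<^esub>\<alpha>\<in>A. restr \<O> M N (e \<alpha>)) = \<one>\<^bsub>sections \<O> N\<^esub>"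
      using o(1,2) sum dis Jb(1)[OF a] by blast
  qed
qed

end

section \<open>The reduction and the sheaf of densities\<close>

context formal_mfd
begin

text \<open>Values and densities are both families of functions on points, extended by zero and
  acted on through values; \<open>ev\<close> exhibits such a family, with index type
  \<open>unit\<close> for the former and charts for the latter. Gluing is then pointwise, and only
  locality of membership remains specific.\<close>

lemma sheaf_of_modules_functions:
  fixes F :: "('a, 'r, 's) presheaf" and ev :: "'s \<Rightarrow> 'i \<Rightarrow> 'a \<Rightarrow> complex"
  assumes inj: "\<And>s t. ev s = ev t \<Longrightarrow> s = t" and surj: "\<And>g. \<exists>s. ev s = g"
    and restr: "\<And>U V s. ev (restr F U V s) = (\<lambda>i a. if a \<in> V then ev s i a else 0)"
    and zero: "\<And>U. ev \<zero>\<^bsub>sections F U\<^esub> = (\<lambda>i a. 0)"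
    and add: "\<And>U s t. ev (s \<oplus>\<^bsub>sections F U\<^esub> t) = (\<lambda>i a. ev s i a + ev t i a)"
    and smult: "\<And>U f s. ev (f \<odot>\<^bsub>sections F U\<^esub> s) = (\<lambda>i a. val U f a * ev s i a)"
    and supp: "\<And>U s i a. openin X U \<Longrightarrow> s \<in> sec F U \<Longrightarrow> a \<notin> U \<Longrightarrow> ev s i a = 0"
    and zero_cl: "\<And>U. openin X U \<Longrightarrow> \<zero>\<^bsub>sections F U\<^esub> \<in> sec F U"
    and add_cl: "\<And>U s t. openin X U \<Longrightarrow> s \<in> sec F U \<Longrightarrow> t \<in> sec F U \<Longrightarrow> s \<oplus>\<^bsub>sections F U\<^esub> t \<in> sec F U"
    and smult_cl: "\<And>U f s. openin X U \<Longrightarrow> f \<in> sec \<O> U \<Longrightarrow> s \<in> sec F U \<Longrightarrow> f \<odot>\<^bsub>sections F U\<^esub> s \<in> sec F U"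
    and restr_cl: "\<And>U V s. openin X U \<Longrightarrow> V \<in> opens_in X U \<Longrightarrow> s \<in> sec F U \<Longrightarrow> restr F U V s \<in> sec F V"
    and loc: "\<And>U s. openin X U \<Longrightarrow> (\<And>i a. a \<notin> U \<Longrightarrow> ev s i a = 0) \<Longrightarrow>
       (\<And>a. a \<in> U \<Longrightarrow> \<exists>V\<in>opens_in X U. a \<in> V \<and> restr F U V s \<in> sec F V) \<Longrightarrow> s \<in> sec F U"
  shows "sheaf_of_modules X \<O> F"
proof -
  have eqI: "s = t" if "\<And>i a. ev s i a = ev t i a" for s t by (rule inj) (use that in blast)
  have "sheaf_of_sets X F"
    unfolding sheaf_of_sets_def
  proof (intro conjI allI impI ballI)
    show "restr F U U s = s" if "openin X U" "s \<in> sec F U" for U s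
      by (rule eqI) (use supp[OF that] in \<open>simp add: restr\<close>)
    show "restr F U V \<in> sec F U \<rightarrow> sec F V" if "openin X U \<and> V \<in> opens_in X U" for U V
      using restr_cl that by blast
    show "restr F V W (restr F U V s) = restr F U W s" if "openin X U \<and> V \<in> opens_in X U \<and> W \<in> opens_in X V" for U V W s
      by (rule eqI) (use that in \<open>auto simp: restr opens_in_iff\<close>)
    fix \<U> s assume *: "(\<forall>V\<in>\<U>. openin X V \<and> s V \<in> sec F V) \<and>
      (\<forall>V\<in>\<U>. \<forall>W\<in>\<U>. restr F V (V \<inter> W) (s V) = restr F W (V \<inter> W) (s W))"
    have compat: "ev (s V) i a = ev (s W) i a" if "V \<in> \<U>" "W \<in> \<U>" "a \<in> V" "a \<in> W" for V W a i
    proof -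
      have "restr F V (V \<inter> W) (s V) = restr F W (V \<inter> W) (s W)" using * that(1,2) by blast
      then have "ev (restr F V (V \<inter> W) (s V)) i a = ev (restr F W (V \<inter> W) (s W)) i a" by (rule arg_cong)
      then show ?thesis using that(3,4) by (simp add: restr)
    qed
    have o: "openin X V" "s V \<in> sec F V" "V \<subseteq> \<Union>\<U>" if "V \<in> \<U>" for V using conjunct1[OF *] that by auto
    have oU: "openin X (\<Union>\<U>)" using o(1) by blast
    \<comment> \<open>At \<open>a\<close> the glued family takes the value of some member whose
      domain contains \<open>a\<close>; compatibility makes all of them equal.\<close>
    obtain t where t: "ev t = (\<lambda>i a. if a \<in> \<Union>\<U> then ev (s (SOME V. V \<in> \<U> \<and> a \<in> V)) i a else 0)"
      using surj by (rule exE)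
    have tV: "ev t i a = ev (s V) i a" if V: "V \<in> \<U>" "a \<in> V" for V a i
    proof -
      have "\<exists>V. V \<in> \<U> \<and> a \<in> V" using V by blast
      from someI_ex[OF this] have S: "(SOME V. V \<in> \<U> \<and> a \<in> V) \<in> \<U>" "a \<in> (SOME V. V \<in> \<U> \<and> a \<in> V)" by blast+
      have "a \<in> \<Union>\<U>" using V by blast
      then have "ev t i a = ev (s (SOME V. V \<in> \<U> \<and> a \<in> V)) i a" unfolding t by (rule if_P)
      also have "\<dots> = ev (s V) i a" by (rule compat[OF S(1) V(1) S(2) V(2)])
      finally show ?thesis .
    qed
    have rt: "restr F (\<Union>\<U>) V t = s V" if "V \<in> \<U>" for V
      by (rule eqI) (use tV[OF that] supp[OF o(1,2)[OF that]] in \<open>simp add: restr\<close>)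
    show "\<exists>!t. t \<in> sec F (\<Union>\<U>) \<and> (\<forall>V\<in>\<U>. restr F (\<Union>\<U>) V t = s V)"
    proof (rule ex1I[of _ t])
      have "t \<in> sec F (\<Union>\<U>)"
      proof (rule loc[OF oU])
        fix a assume "a \<in> \<Union>\<U>"
        then obtain V where "V \<in> \<U>" "a \<in> V" by blast
        then show "\<exists>V\<in>opens_in X (\<Union>\<U>). a \<in> V \<and> restr F (\<Union>\<U>) V t \<in> sec F V"
          using o rt by (intro bexI[of _ V]) (auto simp: opens_in_iff)
      qed (simp add: t)
      then show "t \<in> sec F (\<Union>\<U>) \<and> (\<forall>V\<in>\<U>. restr F (\<Union>\<U>) V t = s V)" using rt by blast
      fix t' assume t': "t' \<in> sec F (\<Union>\<U>) \<and> (\<forall>V\<in>\<U>. restr F (\<Union>\<U>) V t' = s V)"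
      show "t' = t"
      proof (rule eqI)
        fix i a
        show "ev t' i a = ev t i a"
        proof (cases "a \<in> \<Union>\<U>")
          case True
          then obtain V where V: "V \<in> \<U>" "a \<in> V" by blast
          have "ev t' i a = ev (restr F (\<Union>\<U>) V t') i a" using V by (simp add: restr)
          then show ?thesis using t' V tV[OF V] by simp
        next
          case False
          then show ?thesis using supp[OF oU conjunct1[OF t']] unfolding t by simp
        qed
      qed
    qed
  qed
  moreover have "Module.module (sections \<O> U) (sections F U)" if U: "openin X U" for U
  proof (rule moduleI[OF O_cring[OF U]])
    interpret R: cring "sections \<O> U" by (rule O_cring[OF U])
    note ev = add smult zero
    show "abelian_group (sections F U)"
    proof (rule abelian_groupI)
      fix s assume s: "s \<in> sec F U"
      have "const U (-1) \<odot>\<^bsub>sections F U\<^esub> s \<oplus>\<^bsub>sections F U\<^esub> s = \<zero>\<^bsub>sections F U\<^esub>"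
      proof (rule eqI)
        fix i a show "ev (const U (-1) \<odot>\<^bsub>sections F U\<^esub> s \<oplus>\<^bsub>sections F U\<^esub> s) i a = ev \<zero>\<^bsub>sections F U\<^esub> i a"
          by (cases "a \<in> U") (use value_const[OF U] supp[OF U s] in \<open>simp_all add: ev\<close>)
      qed
      then show "\<exists>t\<in>sec F U. t \<oplus>\<^bsub>sections F U\<^esub> s = \<zero>\<^bsub>sections F U\<^esub>"
        using smult_cl[OF U const_closed[OF U] s] by blast
    qed (use add_cl[OF U] zero_cl[OF U] in \<open>auto intro!: eqI simp: ev\<close>)
    fix f s assume f: "f \<in> sec \<O> U" and s: "s \<in> sec F U"
    { fix g assume g: "g \<in> sec \<O> U"
      show "(f \<oplus>\<^bsub>sections \<O> U\<^esub> g) \<odot>\<^bsub>sections F U\<^esub> s = f \<odot>\<^bsub>sections F U\<^esub> s \<oplus>\<^bsub>sections F U\<^esub> g \<odot>\<^bsub>sections F U\<^esub> s"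
      proof (rule eqI)
        fix i a show "ev ((f \<oplus>\<^bsub>sections \<O> U\<^esub> g) \<odot>\<^bsub>sections F U\<^esub> s) i a =
            ev (f \<odot>\<^bsub>sections F U\<^esub> s \<oplus>\<^bsub>sections F U\<^esub> g \<odot>\<^bsub>sections F U\<^esub> s) i a"
          by (cases "a \<in> U") (use value_add[OF U _ f g] supp[OF U s] in \<open>simp_all add: ev algebra_simps\<close>)
      qed
      show "(f \<otimes>\<^bsub>sections \<O> U\<^esub> g) \<odot>\<^bsub>sections F U\<^esub> s = f \<odot>\<^bsub>sections F U\<^esub> (g \<odot>\<^bsub>sections F U\<^esub> s)"
      proof (rule eqI)
        fix i a show "ev ((f \<otimes>\<^bsub>sections \<O> U\<^esub> g) \<odot>\<^bsub>sections F U\<^esub> s) i a =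
            ev (f \<odot>\<^bsub>sections F U\<^esub> (g \<odot>\<^bsub>sections F U\<^esub> s)) i a"
          by (cases "a \<in> U") (use value_mult[OF U _ f g] supp[OF U s] in \<open>simp_all add: ev\<close>)
      qed }
    { fix t assume t: "t \<in> sec F U"
      show "f \<odot>\<^bsub>sections F U\<^esub> (s \<oplus>\<^bsub>sections F U\<^esub> t) = f \<odot>\<^bsub>sections F U\<^esub> s \<oplus>\<^bsub>sections F U\<^esub> f \<odot>\<^bsub>sections F U\<^esub> t"
        by (rule eqI) (simp add: ev algebra_simps) }
  next
    fix s assume s: "s \<in> sec F U"
    show "\<one>\<^bsub>sections \<O> U\<^esub> \<odot>\<^bsub>sections F U\<^esub> s = s"
    proof (rule eqI)
      fix i a show "ev (\<one>\<^bsub>sections \<O> U\<^esub> \<odot>\<^bsub>sections F U\<^esub> s) i a = ev s i a"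
        by (cases "a \<in> U") (use value_one[OF U _ one_closed[OF U]] supp[OF U s] in \<open>simp_all add: smult\<close>)
    qed
  qed (rule smult_cl[OF U])
  moreover have "restr F U V (s \<oplus>\<^bsub>sections F U\<^esub> t) = restr F U V s \<oplus>\<^bsub>sections F V\<^esub> restr F U V t" for U V s t
    by (rule eqI) (simp add: restr add)
  moreover have "restr F U V (f \<odot>\<^bsub>sections F U\<^esub> s) = restr \<O> U V f \<odot>\<^bsub>sections F V\<^esub> restr F U V s"
    if "openin X U" "V \<in> opens_in X U" "f \<in> sec \<O> U" for U V f s
    by (rule eqI) (use value_restr[OF that(1) _ that(3,2)] that(2) in \<open>auto simp: restr smult opens_in_iff\<close>)
  ultimately show ?thesis unfolding sheaf_of_modules_def by simp
qed

section \<open>The reduction as a module sheaf\<close>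

abbreviation red where "red \<equiv> reduction X \<O>"
abbreviation dens where "dens \<equiv> density_sheaf X \<O>"

lemma red_simps:
  "restr red U V g = (\<lambda>a. if a \<in> V then g a else 0)"
  "\<zero>\<^bsub>sections red U\<^esub> = (\<lambda>a. 0)"
  "g \<oplus>\<^bsub>sections red U\<^esub> h = (\<lambda>a. g a + h a)"
  "f \<odot>\<^bsub>sections red U\<^esub> g = (\<lambda>a. val U f a * g a)"
  by (simp_all add: reduction_def)

lemma red_sec: "g \<in> sec red U \<longleftrightarrow> (\<forall>a. a \<notin> U \<longrightarrow> g a = 0) \<and>
    (\<forall>a\<in>U. \<exists>V\<in>opens_in X U. a \<in> V \<and> (\<exists>f\<in>sec \<O> V. \<forall>b\<in>V. g b = val V f b))"
  by (simp add: reduction_def)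

lemma red_support: "g \<in> sec red U \<Longrightarrow> a \<notin> U \<Longrightarrow> g a = 0"
  by (simp add: red_sec)

text \<open>Being locally a value function is a transitive notion: local sections of the reduction
  are, after shrinking, value functions themselves.\<close>

lemma red_local:
  assumes "\<And>a. a \<notin> U \<Longrightarrow> g a = 0"
    and "\<And>a. a \<in> U \<Longrightarrow> \<exists>V\<in>opens_in X U. a \<in> V \<and> (\<exists>h\<in>sec red V. \<forall>b\<in>V. g b = h b)"
  shows "g \<in> sec red U"
  unfolding red_sec
proof (intro conjI allI impI ballI)
  fix a assume "a \<in> U"
  then obtain V h where V: "V \<in> opens_in X U" "a \<in> V" "h \<in> sec red V" "\<And>b. b \<in> V \<Longrightarrow> g b = h b"
    using assms(2) by meson
  then obtain W f where W: "W \<in> opens_in X V" "a \<in> W" "f \<in> sec \<O> W" "\<And>b. b \<in> W \<Longrightarrow> h b = val W f b"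
    unfolding red_sec by meson
  have "W \<in> opens_in X U" "W \<subseteq> V" using V(1) W(1) by (auto simp: opens_in_iff)
  then show "\<exists>V\<in>opens_in X U. a \<in> V \<and> (\<exists>f\<in>sec \<O> V. \<forall>b\<in>V. g b = val V f b)"
    using V(4) W by (metis subsetD)
qed (use assms in auto)

lemma red_restr: "V \<in> opens_in X U \<Longrightarrow> g \<in> sec red U \<Longrightarrow> (\<lambda>a. if a \<in> V then g a else 0) \<in> sec red V"
  unfolding red_sec
proof (intro conjI allI impI ballI, goal_cases)
  case (2 a)
  then have "a \<in> U" by (auto simp: opens_in_iff)
  with 2 obtain W f where W: "W \<in> opens_in X U" "a \<in> W" "f \<in> sec \<O> W" "\<And>b. b \<in> W \<Longrightarrow> g b = val W f b"
    by meson
  have o: "openin X W" "W \<inter> V \<in> opens_in X W" "W \<inter> V \<in> opens_in X V" using W(1) 2(1) by (auto simp: opens_in_iff)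
  have "\<forall>b\<in>W \<inter> V. (if b \<in> V then g b else 0) = val (W \<inter> V) (restr \<O> W (W \<inter> V) f) b"
    using W value_restr[OF o(1) _ W(3) o(2)] by simp
  then show ?case using o 2 W(2) O_restr_closed[OF o(1,2) W(3)] by (intro bexI[of _ "W \<inter> V"] conjI bexI) auto
qed auto

lemma red_value: "openin X U \<Longrightarrow> f \<in> sec \<O> U \<Longrightarrow> (\<lambda>a. if a \<in> U then val U f a else 0) \<in> sec red U"
  unfolding red_sec by (auto simp: opens_in_iff intro!: exI[of _ U])

lemma
  assumes g: "g \<in> sec red U" and h: "h \<in> sec red U"
  shows red_add: "(\<lambda>a. g a + h a) \<in> sec red U" and red_mult: "(\<lambda>a. g a * h a) \<in> sec red U"
proof -
  have loc: "\<exists>V\<in>opens_in X U. a \<in> V \<and> (\<exists>f\<in>sec \<O> V. \<exists>k\<in>sec \<O> V. \<forall>b\<in>V. g b = val V f b \<and> h b = val V k b)"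
    if "a \<in> U" for a
  proof -
    obtain W f where W: "W \<in> opens_in X U" "a \<in> W" "f \<in> sec \<O> W" "\<And>b. b \<in> W \<Longrightarrow> g b = val W f b"
      using g \<open>a \<in> U\<close> unfolding red_sec by meson
    obtain W' k where W': "W' \<in> opens_in X U" "a \<in> W'" "k \<in> sec \<O> W'" "\<And>b. b \<in> W' \<Longrightarrow> h b = val W' k b"
      using h \<open>a \<in> U\<close> unfolding red_sec by meson
    let ?V = "W \<inter> W'"
    have o: "openin X W" "openin X W'" "?V \<in> opens_in X W" "?V \<in> opens_in X W'" "?V \<in> opens_in X U"
      using W(1) W'(1) by (auto simp: opens_in_iff)
    have "\<forall>b\<in>?V. g b = val ?V (restr \<O> W ?V f) b \<and> h b = val ?V (restr \<O> W' ?V k) b"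
      using W W' value_restr[OF o(1) _ W(3) o(3)] value_restr[OF o(2) _ W'(3) o(4)] by simp
    then show ?thesis using o W W' O_restr_closed[OF o(1,3) W(3)] O_restr_closed[OF o(2,4) W'(3)] by blast
  qed
  have "\<exists>V\<in>opens_in X U. a \<in> V \<and> (\<exists>f\<in>sec \<O> V. \<forall>b\<in>V. g b + h b = val V f b) \<and>
     (\<exists>f\<in>sec \<O> V. \<forall>b\<in>V. g b * h b = val V f b)" if "a \<in> U" for a
  proof -
    obtain V f k where V: "V \<in> opens_in X U" "a \<in> V" "f \<in> sec \<O> V" "k \<in> sec \<O> V"
      "\<And>b. b \<in> V \<Longrightarrow> g b = val V f b \<and> h b = val V k b" using loc[OF \<open>a \<in> U\<close>] by meson
    have Vo: "openin X V" using V(1) by (simp add: opens_in_iff)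
    interpret R: cring "sections \<O> V" by (rule O_cring[OF Vo])
    have "\<forall>b\<in>V. g b + h b = val V (f \<oplus>\<^bsub>sections \<O> V\<^esub> k) b" "\<forall>b\<in>V. g b * h b = val V (f \<otimes>\<^bsub>sections \<O> V\<^esub> k) b"
      using V(5) value_add[OF Vo _ V(3,4)] value_mult[OF Vo _ V(3,4)] by simp_all
    then show ?thesis using V R.a_closed R.m_closed by blast
  qed
  then have loc': "\<And>a. a \<in> U \<Longrightarrow> \<exists>V\<in>opens_in X U. a \<in> V \<and> (\<exists>f\<in>sec \<O> V. \<forall>b\<in>V. g b + h b = val V f b)"
    "\<And>a. a \<in> U \<Longrightarrow> \<exists>V\<in>opens_in X U. a \<in> V \<and> (\<exists>f\<in>sec \<O> V. \<forall>b\<in>V. g b * h b = val V f b)" by blast+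
  show "(\<lambda>a. g a + h a) \<in> sec red U"
    unfolding red_sec using loc'(1) red_support[OF g] red_support[OF h] by simp
  show "(\<lambda>a. g a * h a) \<in> sec red U"
    unfolding red_sec using loc'(2) red_support[OF g] by simp
qed

lemma red_smult:
  assumes U: "openin X U" and V: "V \<in> opens_in X U" and f: "f \<in> sec \<O> U" and g: "g \<in> sec red V"
  shows "(\<lambda>a. val U f a * g a) \<in> sec red V"
proof -
  have "(\<lambda>a. if a \<in> V then val V (restr \<O> U V f) a else 0) \<in> sec red V"
    using V by (intro red_value O_restr_closed[OF U V f]) (simp add: opens_in_iff)
  from red_mult[OF this g] show ?thesis
  proof (rule back_subst[of "\<lambda>g. g \<in> sec red V"])
    have "(if a \<in> V then val V (restr \<O> U V f) a else 0) * g a = val U f a * g a" for a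
      using value_restr[OF U _ f V, of a] V red_support[OF g] by (auto simp: opens_in_iff)
    then show "(\<lambda>a. (if a \<in> V then val V (restr \<O> U V f) a else 0) * g a) = (\<lambda>a. val U f a * g a)" by blast
  qed
qed

lemma red_zero: "(\<lambda>a. 0) \<in> sec red U" if "openin X U"
  using value_const[OF that, of _ 0] const_closed[OF that, of 0] that unfolding red_sec
  by (intro conjI ballI bexI[of _ U] bexI[of _ "const U 0"]) (auto simp: opens_in_iff)

lemma sheaf_of_modules_reduction: "sheaf_of_modules X \<O> red"
proof (rule sheaf_of_modules_functions[of "\<lambda>g (_ :: unit). g"])
  show "\<exists>s. (\<lambda>_::unit. s) = g" for g :: "unit \<Rightarrow> 'a \<Rightarrow> complex" by (rule exI[of _ "g ()"]) auto
  show "f \<odot>\<^bsub>sections red U\<^esub> s \<in> sec red U" if "openin X U" "f \<in> sec \<O> U" "s \<in> sec red U" for U f s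
    using red_smult[OF that(1) _ that(2,3)] that(1) by (simp add: red_simps opens_in_iff)
  show "s \<in> sec red U" if o: "openin X U" and z: "\<And>(i::unit) a. a \<notin> U \<Longrightarrow> s a = 0"
    and l: "\<And>a. a \<in> U \<Longrightarrow> \<exists>V\<in>opens_in X U. a \<in> V \<and> restr red U V s \<in> sec red V" for U s
  proof (rule red_local)
    fix a assume "a \<in> U"
    then obtain V where V: "V \<in> opens_in X U" "a \<in> V" "restr red U V s \<in> sec red V" using l by blast
    then show "\<exists>V\<in>opens_in X U. a \<in> V \<and> (\<exists>h\<in>sec red V. \<forall>b\<in>V. s b = h b)"
      by (intro bexI[of _ V] conjI bexI[OF _ V(3)]) (auto simp: red_simps)
  qed (use z in blast)
  show "s = t" if "(\<lambda>_ :: unit. s) = (\<lambda>_. t)" for s t :: "'a \<Rightarrow> complex" using fun_cong[OF that] by simp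
  show "s \<oplus>\<^bsub>sections red U\<^esub> t \<in> sec red U" if "s \<in> sec red U" "t \<in> sec red U" for U s t
    unfolding red_simps by (rule red_add[OF that])
  show "restr red U V s \<in> sec red V" if "V \<in> opens_in X U" "s \<in> sec red U" for U V s
    unfolding red_simps by (rule red_restr[OF that])
  show "\<zero>\<^bsub>sections red U\<^esub> \<in> sec red U" if "openin X U" for U
    unfolding red_simps by (rule red_zero[OF that])
  show "s a = 0" if "s \<in> sec red U" "a \<notin> U" for U s a by (rule red_support[OF that])
qed (simp_all add: red_simps)

section \<open>The sheaf of densities\<close>

lemma dens_simps:
  "restr dens U V \<rho> = (\<lambda>c a. if a \<in> V then \<rho> c a else 0)"
  "\<zero>\<^bsub>sections dens U\<^esub> = (\<lambda>c a. 0)"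
  "\<rho> \<oplus>\<^bsub>sections dens U\<^esub> \<sigma> = (\<lambda>c a. \<rho> c a + \<sigma> c a)"
  "f \<odot>\<^bsub>sections dens U\<^esub> \<rho> = (\<lambda>c a. val U f a * \<rho> c a)"
  by (simp_all add: density_sheaf_def)

lemma dens_sec: "\<rho> \<in> sec dens U \<longleftrightarrow> (\<forall>c. c \<notin> charts X \<O> \<longrightarrow> \<rho> c = (\<lambda>a. 0)) \<and>
    (\<forall>c\<in>charts X \<O>. \<rho> c \<in> sec red (U \<inter> chart_dom c)) \<and>
    (\<forall>c\<in>charts X \<O>. \<forall>c'\<in>charts X \<O>. \<forall>a\<in>U \<inter> chart_dom c \<inter> chart_dom c'.
       \<rho> c a = complex_of_real \<bar>transition_det c c' a\<bar> * \<rho> c' a)"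
  by (simp add: density_sheaf_def)

lemma dens_support: "\<rho> \<in> sec dens U \<Longrightarrow> a \<notin> U \<or> c \<notin> charts X \<O> \<or> a \<notin> chart_dom c \<Longrightarrow> \<rho> c a = 0"
  unfolding dens_sec using red_support[of "\<rho> c" "U \<inter> chart_dom c" a] by (cases "c \<in> charts X \<O>") auto

lemma chart_open: "c \<in> charts X \<O> \<Longrightarrow> openin X (chart_dom c)"
  by (simp add: charts_def)

text \<open>The transformation law is a condition at single points, and smoothness of a coefficient
  function is local by \<open>red_local\<close>.\<close>

lemma dens_local:
  assumes U: "openin X U" and "\<And>c a. a \<notin> U \<Longrightarrow> \<rho> c a = 0"
    and "\<And>a. a \<in> U \<Longrightarrow> \<exists>V\<in>opens_in X U. a \<in> V \<and> restr dens U V \<rho> \<in> sec dens V"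
  shows "\<rho> \<in> sec dens U"
proof -
  have loc: "\<exists>V\<in>opens_in X U. a \<in> V \<and> (\<exists>\<sigma>\<in>sec dens V. \<forall>b\<in>V. \<forall>c. \<rho> c b = \<sigma> c b)" if "a \<in> U" for a
  proof -
    obtain V where V: "V \<in> opens_in X U" "a \<in> V" "restr dens U V \<rho> \<in> sec dens V" using assms(3) \<open>a \<in> U\<close> by blast
    have "\<forall>b\<in>V. \<forall>c. \<rho> c b = restr dens U V \<rho> c b" by (simp add: dens_simps)
    then show ?thesis using V by blast
  qed
  have zero: "\<rho> c a = 0" if out: "a \<notin> U \<or> c \<notin> charts X \<O> \<or> a \<notin> chart_dom c" for a c
  proof (cases "a \<in> U")
    case True
    from loc[OF True] obtain V \<sigma> where V: "\<sigma> \<in> sec dens V" "\<rho> c a = \<sigma> c a" by blast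
    show ?thesis unfolding V(2) by (rule dens_support[OF V(1)]) (use out True in blast)
  qed (rule assms(2))
  show ?thesis
    unfolding dens_sec
  proof (intro conjI allI impI ballI)
    show "\<rho> c = (\<lambda>a. 0)" if "c \<notin> charts X \<O>" for c using zero that by blast
    show "\<rho> c a = complex_of_real \<bar>transition_det c c' a\<bar> * \<rho> c' a"
      if cc: "c \<in> charts X \<O>" "c' \<in> charts X \<O>" and aU: "a \<in> U \<inter> chart_dom c \<inter> chart_dom c'" for c c' a
    proof -
      have "a \<in> U" using aU by blast
      from loc[OF this] obtain V \<sigma> where V: "a \<in> V" "\<sigma> \<in> sec dens V" "\<forall>b\<in>V. \<forall>c. \<rho> c b = \<sigma> c b"
        by (elim bexE conjE)
      have "\<sigma> c a = complex_of_real \<bar>transition_det c c' a\<bar> * \<sigma> c' a"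
        using V(1,2) cc aU unfolding dens_sec by blast
      then show ?thesis using V(1,3) by simp
    qed
    fix c assume c: "c \<in> charts X \<O>"
    show "\<rho> c \<in> sec red (U \<inter> chart_dom c)"
    proof (rule red_local)
      fix a assume "a \<notin> U \<inter> chart_dom c"
      then show "\<rho> c a = 0" using zero by blast
    next
      fix a assume a: "a \<in> U \<inter> chart_dom c"
      then have "a \<in> U" by blast
      from loc[OF this] obtain V \<sigma> where V: "V \<in> opens_in X U" "a \<in> V" "\<sigma> \<in> sec dens V" "\<forall>b\<in>V. \<forall>c. \<rho> c b = \<sigma> c b"
        by (elim bexE conjE)
      then have "\<sigma> c \<in> sec red (V \<inter> chart_dom c)" using c unfolding dens_sec by blast
      then show "\<exists>V\<in>opens_in X (U \<inter> chart_dom c). a \<in> V \<and> (\<exists>h\<in>sec red V. \<forall>b\<in>V. \<rho> c b = h b)"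
        using V a chart_open[OF c] by (intro bexI[of _ "V \<inter> chart_dom c"]) (auto simp: opens_in_iff)
    qed
  qed
qed

lemma sheaf_of_modules_density: "sheaf_of_modules X \<O> dens"
proof (rule sheaf_of_modules_functions[of "\<lambda>\<rho>. \<rho>"])
  show "\<zero>\<^bsub>sections dens U\<^esub> \<in> sec dens U" if "openin X U" for U
    unfolding dens_sec dens_simps
    by (intro conjI allI impI ballI red_zero openin_Int[OF that chart_open]) simp_all
  fix U s assume U: "openin X U" and s: "s \<in> sec dens U"
  have s': "s c = (\<lambda>a. 0)" if "c \<notin> charts X \<O>" for c using s that unfolding dens_sec by blast
  have s'': "s c \<in> sec red (U \<inter> chart_dom c)" if "c \<in> charts X \<O>" for c using s that unfolding dens_sec by blast
  have tr: "s c a = complex_of_real \<bar>transition_det c c' a\<bar> * s c' a"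
    if "s \<in> sec dens U" "c \<in> charts X \<O>" "c' \<in> charts X \<O>" "a \<in> U \<inter> chart_dom c \<inter> chart_dom c'" for s c c' a
    using that unfolding dens_sec by blast
  show "s \<oplus>\<^bsub>sections dens U\<^esub> t \<in> sec dens U" if t: "t \<in> sec dens U" for t
    unfolding dens_sec dens_simps
  proof (intro conjI allI impI ballI)
    show "(\<lambda>a. s c a + t c a) = (\<lambda>a. 0)" if "c \<notin> charts X \<O>" for c
      using dens_support[OF s] dens_support[OF t] that by simp
    show "(\<lambda>a. s c a + t c a) \<in> sec red (U \<inter> chart_dom c)" if "c \<in> charts X \<O>" for c
      by (rule red_add[OF s''[OF that]]) (use t that in \<open>unfold dens_sec, blast\<close>)
    show "s c a + t c a = complex_of_real \<bar>transition_det c c' a\<bar> * (s c' a + t c' a)"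
      if "c \<in> charts X \<O>" "c' \<in> charts X \<O>" "a \<in> U \<inter> chart_dom c \<inter> chart_dom c'" for c c' a
      unfolding tr[OF s that] tr[OF t that] by (rule distrib_left[symmetric])
  qed
  show "f \<odot>\<^bsub>sections dens U\<^esub> s \<in> sec dens U" if f: "f \<in> sec \<O> U" for f
    unfolding dens_sec dens_simps
  proof (intro conjI allI impI ballI)
    show "(\<lambda>a. val U f a * s c a) = (\<lambda>a. 0)" if "c \<notin> charts X \<O>" for c using s'[OF that] by simp
    show "(\<lambda>a. val U f a * s c a) \<in> sec red (U \<inter> chart_dom c)" if "c \<in> charts X \<O>" for c
      by (rule red_smult[OF U _ f s''[OF that]]) (simp add: opens_in_iff openin_Int[OF U chart_open[OF that]])
    show "val U f a * s c a = complex_of_real \<bar>transition_det c c' a\<bar> * (val U f a * s c' a)"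
      if "c \<in> charts X \<O>" "c' \<in> charts X \<O>" "a \<in> U \<inter> chart_dom c \<inter> chart_dom c'" for c c' a
      unfolding tr[OF s that] by simp
  qed
  show "restr dens U V s \<in> sec dens V" if V: "V \<in> opens_in X U" for V
    unfolding dens_sec dens_simps
  proof (intro conjI allI impI ballI)
    fix c assume c: "c \<in> charts X \<O>"
    have "(\<lambda>a. if a \<in> V \<inter> chart_dom c then s c a else 0) \<in> sec red (V \<inter> chart_dom c)"
      by (rule red_restr[of _ "U \<inter> chart_dom c"])
        (use s''[OF c] V chart_open[OF c] in \<open>auto simp: opens_in_iff\<close>)
    moreover have "(\<lambda>a. if a \<in> V \<inter> chart_dom c then s c a else 0) = (\<lambda>a. if a \<in> V then s c a else 0)"
      using dens_support[OF s] by auto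
    ultimately show "(\<lambda>a. if a \<in> V then s c a else 0) \<in> sec red (V \<inter> chart_dom c)" by simp
  next
    fix c c' a assume cc: "c \<in> charts X \<O>" "c' \<in> charts X \<O>" and a: "a \<in> V \<inter> chart_dom c \<inter> chart_dom c'"
    then have "a \<in> U \<inter> chart_dom c \<inter> chart_dom c'" using V by (auto simp: opens_in_iff)
    from tr[OF s cc this] show "(if a \<in> V then s c a else 0) = complex_of_real \<bar>transition_det c c' a\<bar> * (if a \<in> V then s c' a else 0)"
      using a by simp
  qed (use s' in auto)
  show "s i a = 0" if "a \<notin> U" for i a using dens_support[OF s] that by blast
qed (rule dens_local | simp_all add: dens_simps)+

end

section \<open>Integration of densities\<close>

text \<open>\<open>chart_integral\<close> replaces the coordinates from \<open>n\<close> on by zero.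
  Continuity of this replacement makes the transported integrands measurable.\<close>

lemma continuous_truncation:
  "continuous_map (powertop_real UNIV) (Euclidean_space n) (\<lambda>x i. if i < n then x i else 0)"
proof -
  have "continuous_map (powertop_real UNIV) euclideanreal (\<lambda>x. if i < n then x i else 0)" for i
    by (cases "i < n") (auto intro: continuous_map_product_projection)
  then have "continuous_map (powertop_real UNIV) (powertop_real UNIV) (\<lambda>x i. if i < n then x i else 0)"
    by (subst continuous_map_componentwise_UNIV) auto
  then show ?thesis unfolding Euclidean_space_def by (auto simp: continuous_map_in_subtopology)
qed

lemma continuous_map_Euclidean_coordinate: "continuous_map (Euclidean_space n) euclideanreal (\<lambda>x. x i)"
  unfolding Euclidean_space_def by (intro continuous_map_from_subtopology continuous_map_product_projection) simp

lemma Hausdorff_Euclidean_space: "Hausdorff_space (Euclidean_space n)"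
  unfolding Euclidean_space_def by (intro Hausdorff_space_subtopology) (simp add: Hausdorff_space_product_topology)

text \<open>The integrand is bounded on the compact set and supported in a box of finite measure,
  whose sides come from the compact images under the coordinates.\<close>

lemma integrable_Euclidean_space:
  fixes G :: "(nat \<Rightarrow> real) \<Rightarrow> complex"
  assumes G: "continuous_map (Euclidean_space n) euclidean G"
    and C: "compactin (Euclidean_space n) C" "\<And>x. x \<in> topspace (Euclidean_space n) \<Longrightarrow> x \<notin> C \<Longrightarrow> G x = 0"
  shows "integrable (\<Pi>\<^sub>M i\<in>{..<n}. lborel) (\<lambda>x. G (\<lambda>i. if i < n then x i else 0))"
proof -
  let ?t = "\<lambda>x i. if i < n then x i else (0::real)"
  let ?M = "\<Pi>\<^sub>M i\<in>{..<n}. lborel :: real measure"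
  have t: "?t x \<in> topspace (Euclidean_space n)" for x by (simp add: topspace_Euclidean_space)
  have "continuous_map (powertop_real UNIV) euclidean (G \<circ> ?t)"
    by (rule continuous_map_compose[OF continuous_truncation G])
  then have "G \<circ> ?t \<in> borel_measurable borel"
    unfolding euclidean_product_topology by (intro borel_measurable_continuous_onI) simp
  \<comment> \<open>On countably many coordinates the Borel sets of the product topology are those
    of the product \<sigma>-algebra, where measurability can be checked coordinatewise.\<close>
  then have Gm: "G \<circ> ?t \<in> borel_measurable (\<Pi>\<^sub>M i\<in>(UNIV :: nat set). borel)"
    by (subst measurable_cong_sets[OF sets_PiM_equal_borel refl])
  have "?t \<in> measurable ?M (\<Pi>\<^sub>M i\<in>(UNIV :: nat set). borel)"
  proof (rule measurable_PiM_single')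
    fix i
    show "(\<lambda>x. if i < n then x i else 0) \<in> borel_measurable ?M"
    proof (cases "i < n")
      case True
      then have "(\<lambda>x. x i) \<in> measurable ?M lborel" by (intro measurable_component_singleton) simp
      then show ?thesis using True by simp
    qed simp
  qed auto
  from measurable_comp[OF this Gm] have m: "(\<lambda>x. G (?t x)) \<in> borel_measurable ?M"
    by (simp add: o_def cong: if_cong)
  have "compact (G ` C)" using image_compactin[OF C(1) G] by simp
  then have "bounded (G ` C)" by (rule compact_imp_bounded)
  then obtain b where b: "\<And>x. x \<in> C \<Longrightarrow> norm (G x) \<le> b" unfolding bounded_iff by blast
  have "\<exists>r. \<forall>x\<in>C. \<bar>x i\<bar> \<le> r" for i
  proof -
    have "compact ((\<lambda>x. x i) ` C)" using image_compactin[OF C(1) continuous_map_Euclidean_coordinate] by simp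
    then have "bounded ((\<lambda>x. x i) ` C)" by (rule compact_imp_bounded)
    then show ?thesis unfolding bounded_iff by auto
  qed
  then obtain r where r: "\<And>x i. x \<in> C \<Longrightarrow> \<bar>x i\<bar> \<le> r i" by metis
  let ?A = "\<Pi>\<^sub>E i\<in>{..<n}. {- r i .. r i}"
  interpret product_sigma_finite "\<lambda>_::nat. lborel :: real measure" by standard
  have A: "x \<in> ?A" if "?t x \<in> C" "x \<in> space ?M" for x
  proof -
    have "- r i \<le> x i \<and> x i \<le> r i" if "i < n" for i
      using r[OF \<open>?t x \<in> C\<close>, of i] that by (simp add: abs_le_iff minus_le_iff)
    then show ?thesis using that(2) by (auto simp: space_PiM PiE_iff)
  qed
  show ?thesis
  proof (rule integrableI_bounded_set[where A = ?A and B = "max b 0"])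
    show "?A \<in> sets ?M" by (intro sets_PiM_I_finite) auto
    have "emeasure ?M ?A = (\<Prod>i<n. emeasure lborel {- r i .. r i})" by (intro emeasure_PiM) auto
    also have "\<dots> < \<infinity>" by (simp add: emeasure_lborel_Icc_eq prod_ennreal less_top[symmetric] ennreal_prod_eq_top)
    finally show "emeasure ?M ?A < \<infinity>" .
    show "AE x in ?M. x \<in> ?A \<longrightarrow> norm (G (?t x)) \<le> max b 0"
      using b C(2)[OF t] by (intro AE_I2 impI) (metis max.cobounded2 max.coboundedI1 norm_zero)
    show "AE x in ?M. x \<notin> ?A \<longrightarrow> G (?t x) = 0" using A C(2)[OF t] by (intro AE_I2) blast
  qed (rule m)
qed

context formal_mfd
begin

lemma charts_cover: "(\<Union>c\<in>charts X \<O>. chart_dom c) = M"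
proof
  show "M \<subseteq> (\<Union>c\<in>charts X \<O>. chart_dom c)"
  proof
    fix a assume "a \<in> M"
    then obtain U n k \<phi> \<Psi> where c: "formal_chart X \<O> U n k \<phi> \<Psi>" "a \<in> U" by (rule chart_at)
    show "a \<in> (\<Union>c\<in>charts X \<O>. chart_dom c)"
      using formal_chart.chart_in_charts[OF c(1)] c(2) by force
  qed
qed (use chart_open openin_subset in blast)

lemma value_finsum:
  assumes V: "openin X V" "a \<in> V" and "finite A" and f: "\<And>i. i \<in> A \<Longrightarrow> f i \<in> sec \<O> V"
  shows "val V (\<Oplus>\<^bsub>sections \<O> V\<^esub>i\<in>A. f i) a = (\<Sum>i\<in>A. val V (f i) a)"
  using assms(3) f
proof (induction A rule: finite_induct)
  interpret R: cring "sections \<O> V" by (rule O_cring[OF V(1)])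
  case empty then show ?case by (simp add: value_zero[OF V])
next
  interpret R: cring "sections \<O> V" by (rule O_cring[OF V(1)])
  case (insert i A)
  then have "f i \<in> sec \<O> V" "f \<in> A \<rightarrow> sec \<O> V" by auto
  then show ?case
    using insert value_add[OF V \<open>f i \<in> sec \<O> V\<close> R.finsum_closed[OF \<open>f \<in> A \<rightarrow> sec \<O> V\<close>]] by simp
qed

text \<open>The construction in \<O> is applied to the cover by all charts, indexed by the charts
  themselves, and then reduced to values. Local sums of sections equal to one become sums of values
  equal to 1.\<close>

lemma partition_of_unity_exists: "\<exists>p. partition_of_unity X \<O> p"
proof -
  obtain e S where e: "\<And>c. e c \<in> sec \<O> M" and S: "\<And>c. closedin X (S c)" "\<And>c. c \<in> charts X \<O> \<Longrightarrow> S c \<subseteq> chart_dom c"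
    and z: "\<And>c. restr \<O> M (M - S c) (e c) = \<zero>\<^bsub>sections \<O> (M - S c)\<^esub>"
    and re: "\<And>c b. b \<in> M \<Longrightarrow> \<exists>t::real\<ge>0. val M (e c) b = complex_of_real t"
    and lf: "\<And>a. a \<in> M \<Longrightarrow> \<exists>N A. openin X N \<and> a \<in> N \<and> finite A \<and> A \<subseteq> charts X \<O> \<and> (\<forall>c\<in>charts X \<O> - A. S c \<inter> N = {}) \<and>
       (\<Oplus>\<^bsub>sections \<O> N\<^esub>c\<in>A. restr \<O> M N (e c)) = \<one>\<^bsub>sections \<O> N\<^esub>"
    using partition_exists[where \<Gamma> = "charts X \<O>" and U = chart_dom, OF chart_open charts_cover] by blast
  \<comment> \<open>The values are known to be real and nonnegative, so taking real parts loses
    nothing.\<close>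
  define p where "p c a = (if a \<in> M then Re (val M (e c) a) else 0)" for c a
  have p: "complex_of_real (p c a) = (if a \<in> M then val M (e c) a else 0)" "0 \<le> p c a" for c a
    using re[of a c] by (auto simp: p_def)
  have pS: "a \<in> S c" if "p c a \<noteq> 0" for c a
  proof (rule ccontr)
    assume "a \<notin> S c"
    moreover have a: "a \<in> M" using that by (simp add: p_def split: if_splits)
    ultimately have "a \<in> M - S c" by blast
    moreover have "openin X (M - S c)" using S(1) by blast
    ultimately have "val M (e c) a = 0"
      using value_restr[OF M_open a e opens_M[of "M - S c"], of c] z[of c] value_zero[of "M - S c" a] by simp
    then show False using that by (simp add: p_def split: if_splits)
  qed
  have "partition_of_unity X \<O> p"
    unfolding partition_of_unity_def
  proof (intro conjI ballI allI)
    fix c assume c: "c \<in> charts X \<O>"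
    show "(\<lambda>a. complex_of_real (p c a)) \<in> sec red M" unfolding p by (rule red_value[OF M_open e])
    show "X closure_of {a. p c a \<noteq> 0} \<subseteq> chart_dom c"
      using closure_of_minimal[OF _ S(1), of "{a. p c a \<noteq> 0}" c] pS S(2)[OF c] by blast
  next
    fix a assume a: "a \<in> M"
    obtain N A where N: "openin X N" "a \<in> N" "finite A" "A \<subseteq> charts X \<O>" "\<forall>c\<in>charts X \<O> - A. S c \<inter> N = {}"
       "(\<Oplus>\<^bsub>sections \<O> N\<^esub>c\<in>A. restr \<O> M N (e c)) = \<one>\<^bsub>sections \<O> N\<^esub>" using lf[OF a] by blast
    have sub: "{c \<in> charts X \<O>. \<exists>b\<in>N. p c b \<noteq> 0} \<subseteq> A" using N(5) pS by blast
    show "\<exists>V. openin X V \<and> a \<in> V \<and> finite {c \<in> charts X \<O>. \<exists>b\<in>V. p c b \<noteq> 0}"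
      by (intro exI[of _ N] conjI N(1,2) finite_subset[OF sub N(3)])
    have "(\<Sum>c\<in>{c \<in> charts X \<O>. p c a \<noteq> 0}. p c a) = (\<Sum>c\<in>A. p c a)"
      by (rule sum.mono_neutral_left) (use sub N(2-4) in auto)
    moreover have "complex_of_real (\<Sum>c\<in>A. p c a) = (\<Sum>c\<in>A. val N (restr \<O> M N (e c)) a)"
      using value_restr[OF M_open a e opens_M[OF N(1)] N(2)] a by (simp add: p)
    moreover have "\<dots> = 1"
      using value_finsum[OF N(1-3), of "\<lambda>c. restr \<O> M N (e c)"] O_restr_closed[OF M_open opens_M[OF N(1)] e]
        N(6) value_one[OF N(1,2) one_closed[OF N(1)]] by simp
    ultimately show "(\<Sum>c\<in>{c \<in> charts X \<O>. p c a \<noteq> 0}. p c a) = 1" by (metis of_real_eq_1_iff)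
  qed (use p in auto)
  then show ?thesis by blast
qed

text \<open>A compact subset of the chart has a closed image in Euclidean space. The extension by
  zero is therefore continuous there, and it has compact support.\<close>

lemma chart_integrable:
  assumes c: "c \<in> charts X \<O>" and g: "g \<in> sec red (chart_dom c)"
    and C: "compactin X C" "C \<subseteq> chart_dom c" "\<And>a. a \<notin> C \<Longrightarrow> g a = 0"
  shows "integrable (\<Pi>\<^sub>M i\<in>{..<chart_dim c}. lborel)
    (\<lambda>x. let y = (\<lambda>i. if i < chart_dim c then x i else 0) in if y \<in> chart_image c then g (chart_inv c y) else 0)"
proof -
  let ?E = "Euclidean_space (chart_dim c)" and ?I = "chart_image c" and ?X = "subtopology X (chart_dom c)"
  define G where "G y = (if y \<in> ?I then g (chart_inv c y) else 0)" for y
  have c': "openin X (chart_dom c)" "openin ?E ?I" "homeomorphic_map ?X (subtopology ?E ?I) (chart_map c)"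
    "smooth_on (chart_dim c) ?I (\<lambda>x. g (chart_inv c x))"
    using c g by (auto simp: charts_def opens_in_iff)
  have dom: "topspace ?X = chart_dom c" using openin_subset[OF c'(1)] by auto
  have inj: "inj_on (chart_map c) (chart_dom c)"
    using homeomorphic_imp_injective_map[OF c'(3)] dom by simp
  have "compactin ?X C" using C by (simp add: compactin_subtopology)
  then have "compactin (subtopology ?E ?I) (chart_map c ` C)"
    by (rule image_compactin[OF _ homeomorphic_imp_continuous_map[OF c'(3)]])
  then have CE: "compactin ?E (chart_map c ` C)" by (simp add: compactin_subtopology)
  then have cl: "closedin ?E (chart_map c ` C)" by (rule compactin_imp_closedin[OF Hausdorff_Euclidean_space])
  have G0: "G y = 0" if "y \<notin> chart_map c ` C" for y
  proof (cases "y \<in> ?I")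
    case True
    then obtain a where a: "a \<in> chart_dom c" "y = chart_map c a" by blast
    then have "a \<notin> C" using that by blast
    then show ?thesis using C(3) a inj by (simp add: G_def)
  qed (simp add: G_def)
  have cont: "continuous_map (subtopology ?E ?I) euclidean (\<lambda>x. g (chart_inv c x))"
    by (rule smooth_on_continuous[OF c'(4)])
  have "continuous_map ?E euclidean G"
    unfolding continuous_map_def
  proof (intro conjI allI impI)
    fix V :: "complex set" assume V: "openin euclidean V"
    have "openin (subtopology ?E ?I) {x \<in> topspace (subtopology ?E ?I). g (chart_inv c x) \<in> V}"
      by (rule openin_continuous_map_preimage[OF cont V])
    then have 1: "openin ?E {x \<in> topspace (subtopology ?E ?I). g (chart_inv c x) \<in> V}"
      using openin_trans_full[OF _ c'(2)] by blast
    have 2: "openin ?E (if 0 \<in> V then topspace ?E - chart_map c ` C else {})"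
      using cl by auto
    have "{x \<in> topspace ?E. G x \<in> V} = {x \<in> topspace (subtopology ?E ?I). g (chart_inv c x) \<in> V} \<union>
        (if 0 \<in> V then topspace ?E - chart_map c ` C else {})"
    proof (intro equalityI subsetI)
      fix x assume x: "x \<in> {x \<in> topspace ?E. G x \<in> V}"
      show "x \<in> {x \<in> topspace (subtopology ?E ?I). g (chart_inv c x) \<in> V} \<union>
        (if 0 \<in> V then topspace ?E - chart_map c ` C else {})"
      proof (cases "x \<in> ?I")
        case True then show ?thesis using x by (simp add: G_def)
      next
        case False
        then have "x \<notin> chart_map c ` C" using C(2) by blast
        then show ?thesis using x False by (simp add: G_def)
      qed
    next
      fix x assume x: "x \<in> {x \<in> topspace (subtopology ?E ?I). g (chart_inv c x) \<in> V} \<union>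
        (if 0 \<in> V then topspace ?E - chart_map c ` C else {})"
      show "x \<in> {x \<in> topspace ?E. G x \<in> V}"
        using x G0[of x] by (cases "x \<in> ?I") (auto simp: G_def split: if_splits)
    qed
    then show "openin ?E {x \<in> topspace ?E. G x \<in> V}" using openin_Un[OF 1 2] by simp
  qed auto
  from integrable_Euclidean_space[OF this CE] G0 show ?thesis by (simp add: G_def Let_def)
qed

lemma
  assumes c: "c \<in> charts X \<O>" and g: "g \<in> sec red (chart_dom c)"
    and C: "compactin X C" "C \<subseteq> chart_dom c" "\<And>a. a \<notin> C \<Longrightarrow> g a = 0"
  shows chart_integral_smult: "chart_integral c (\<lambda>a. k * g a) = k * chart_integral c g"
    and chart_integral_add: "h \<in> sec red (chart_dom c) \<Longrightarrow> (\<And>a. a \<notin> C \<Longrightarrow> h a = 0) \<Longrightarrow>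
      chart_integral c (\<lambda>a. g a + h a) = chart_integral c g + chart_integral c h"
proof -
  let ?i = "\<lambda>g x. let y = (\<lambda>i. if i < chart_dim c then x i else 0) in if y \<in> chart_image c then g (chart_inv c y) else 0"
  note int = chart_integrable[OF c _ C(1,2)]
  have "?i (\<lambda>a. k * g a) = (\<lambda>x. k * ?i g x)" by (auto simp: Let_def)
  then show "chart_integral c (\<lambda>a. k * g a) = k * chart_integral c g"
    unfolding chart_integral_def by simp
  assume h: "h \<in> sec red (chart_dom c)" "\<And>a. a \<notin> C \<Longrightarrow> h a = 0"
  have "?i (\<lambda>a. g a + h a) = (\<lambda>x. ?i g x + ?i h x)" by (auto simp: Let_def)
  then show "chart_integral c (\<lambda>a. g a + h a) = chart_integral c g + chart_integral c h"
    unfolding chart_integral_def using Bochner_Integration.integral_add[OF int[OF g C(3)] int[OF h]] by simp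
qed

sublocale D: module_sheaf X \<O> dens
  by unfold_locales (rule sheaf_of_modules_density)

sublocale R: module_sheaf X \<O> red
  by unfold_locales (rule sheaf_of_modules_reduction)

lemma dens_complex_scale:
  assumes U: "openin X U" and r: "\<rho> \<in> sec dens U"
  shows "complex_scale \<O> dens U k \<rho> = (\<lambda>c a. k * \<rho> c a)"
proof (intro ext)
  fix c a show "complex_scale \<O> dens U k \<rho> c a = k * \<rho> c a"
    by (cases "a \<in> U") (use value_const[OF U] dens_support[OF r] in \<open>simp_all add: complex_scale_const dens_simps\<close>)
qed

section \<open>Linearity of the integral on densities with support in a fixed compact set\<close>

definition dens_supp :: "'a set \<Rightarrow> 'a density set" where
  "dens_supp K = {\<rho> \<in> sec dens M. \<forall>a. a \<notin> K \<longrightarrow> (\<forall>c. \<rho> c a = 0)}"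

lemma density_integral_zero: "density_integral X \<O> (\<lambda>c a. 0) = 0"
  by (simp add: density_integral_def Let_def)

context
  fixes K assumes K: "compactin X K"
begin

text \<open>The sum that defines the integral runs over charts depending on the density. By local
  finiteness only a finite set \<open>B\<close> of charts has \<open>p\<close> nonzero somewhere on
  \<open>K\<close>, and it serves for all densities supported there, so linearity can be proved
  chart by chart.\<close>

lemma density_integral_eq:
  obtains p B where "finite B" "B \<subseteq> charts X \<O>"
    "\<And>\<rho>. \<rho> \<in> dens_supp K \<Longrightarrow> density_integral X \<O> \<rho> = (\<Sum>c\<in>B. chart_integral c (\<lambda>a. complex_of_real (p c a) * \<rho> c a))"
    "\<And>c. c \<in> B \<Longrightarrow> \<exists>C. compactin X C \<and> C \<subseteq> chart_dom c \<and> (\<forall>\<rho>\<in>dens_supp K.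
      (\<lambda>a. complex_of_real (p c a) * \<rho> c a) \<in> sec red (chart_dom c) \<and> (\<forall>a. a \<notin> C \<longrightarrow> complex_of_real (p c a) * \<rho> c a = 0))"
proof -
  define p where "p = (SOME p. partition_of_unity X \<O> p)"
  have p: "partition_of_unity X \<O> p" unfolding p_def by (rule someI_ex[OF partition_of_unity_exists])
  define B where "B = {c \<in> charts X \<O>. \<exists>a\<in>K. p c a \<noteq> 0}"
  have KM: "K \<subseteq> M" using compactin_subset_topspace[OF K] .
  have "\<exists>V. openin X V \<and> a \<in> V \<and> finite {c \<in> charts X \<O>. \<exists>b\<in>V. p c b \<noteq> 0}" if "a \<in> K" for a
    using conjunct1[OF conjunct2[OF p[unfolded partition_of_unity_def]]] that KM by (auto dest!: bspec)
  then have "\<forall>a\<in>K. \<exists>V. openin X V \<and> a \<in> V \<and> finite {c \<in> charts X \<O>. \<exists>b\<in>V. p c b \<noteq> 0}" by (rule ballI)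
  from bchoice[OF this] obtain V where
    V: "\<And>a. a \<in> K \<Longrightarrow> openin X (V a) \<and> a \<in> V a \<and> finite {c \<in> charts X \<O>. \<exists>b\<in>V a. p c b \<noteq> 0}" by auto
  have "\<And>U. U \<in> V ` K \<Longrightarrow> openin X U" "K \<subseteq> \<Union>(V ` K)" using V by blast+
  from compactinD[OF K this] obtain \<F> where F: "finite \<F>" "\<F> \<subseteq> V ` K" "K \<subseteq> \<Union>\<F>" by blast
  have "B \<subseteq> (\<Union>W\<in>\<F>. {c \<in> charts X \<O>. \<exists>b\<in>W. p c b \<noteq> 0})" using F(3) by (auto simp: B_def)
  moreover have "finite (\<Union>W\<in>\<F>. {c \<in> charts X \<O>. \<exists>b\<in>W. p c b \<noteq> 0})" using F V by (intro finite_UN_I) auto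
  ultimately have fB: "finite B" by (rule finite_subset)
  show ?thesis
  proof (rule that[of B p])
    show "finite B" "B \<subseteq> charts X \<O>" using fB by (auto simp: B_def)
    fix \<rho> assume r: "\<rho> \<in> dens_supp K"
    have "density_integral X \<O> \<rho> = (\<Sum>c\<in>{c \<in> charts X \<O>. \<exists>a. complex_of_real (p c a) * \<rho> c a \<noteq> 0}.
        chart_integral c (\<lambda>a. complex_of_real (p c a) * \<rho> c a))"
      unfolding density_integral_def Let_def p_def by (rule refl)
    also have "\<dots> = (\<Sum>c\<in>B. chart_integral c (\<lambda>a. complex_of_real (p c a) * \<rho> c a))"
    proof (rule sum.mono_neutral_left[OF fB])
      show "{c \<in> charts X \<O>. \<exists>a. complex_of_real (p c a) * \<rho> c a \<noteq> 0} \<subseteq> B"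
        using r by (auto simp: B_def dens_supp_def)
      show "\<forall>c\<in>B - {c \<in> charts X \<O>. \<exists>a. complex_of_real (p c a) * \<rho> c a \<noteq> 0}.
          chart_integral c (\<lambda>a. complex_of_real (p c a) * \<rho> c a) = 0"
      proof
        fix c assume "c \<in> B - {c \<in> charts X \<O>. \<exists>a. complex_of_real (p c a) * \<rho> c a \<noteq> 0}"
        then have "(\<lambda>a. complex_of_real (p c a) * \<rho> c a) = (\<lambda>a. 0)" by (auto simp: B_def)
        then show "chart_integral c (\<lambda>a. complex_of_real (p c a) * \<rho> c a) = 0"
          by (simp only: chart_integral_def Let_def if_cancel) simp
      qed
    qed
    finally show "density_integral X \<O> \<rho> = (\<Sum>c\<in>B. chart_integral c (\<lambda>a. complex_of_real (p c a) * \<rho> c a))" .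
  next
    fix c assume "c \<in> B"
    then have c: "c \<in> charts X \<O>" by (simp add: B_def)
    have pc: "(\<lambda>a. complex_of_real (p c a)) \<in> sec red M" "X closure_of {a. p c a \<noteq> 0} \<subseteq> chart_dom c"
      using p c by (auto simp: partition_of_unity_def)
    let ?C = "X closure_of {a. p c a \<noteq> 0} \<inter> K"
    have dM: "chart_dom c \<in> opens_in X M" using chart_open[OF c] by (rule opens_M)
    have pM: "{a. p c a \<noteq> 0} \<subseteq> M" using red_support[OF pc(1)] by auto
    then have pcl: "{a. p c a \<noteq> 0} \<subseteq> X closure_of {a. p c a \<noteq> 0}" by (rule closure_of_subset)
    show "\<exists>C. compactin X C \<and> C \<subseteq> chart_dom c \<and> (\<forall>\<rho>\<in>dens_supp K.
      (\<lambda>a. complex_of_real (p c a) * \<rho> c a) \<in> sec red (chart_dom c) \<and> (\<forall>a. a \<notin> C \<longrightarrow> complex_of_real (p c a) * \<rho> c a = 0))"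
    proof (intro exI[of _ ?C] conjI ballI)
      show "compactin X ?C" using closed_Int_compactin[OF closedin_closure_of K] .
      show "?C \<subseteq> chart_dom c" using pc(2) by blast
      fix \<rho> assume r: "\<rho> \<in> dens_supp K"
      show "\<forall>a. a \<notin> ?C \<longrightarrow> complex_of_real (p c a) * \<rho> c a = 0"
        using r pcl by (auto simp: dens_supp_def)
      have "M \<inter> chart_dom c = chart_dom c" using dM by (auto simp: opens_in_iff)
      then have rc: "\<rho> c \<in> sec red (chart_dom c)" using r c unfolding dens_supp_def dens_sec by force
      have "(\<lambda>a. (if a \<in> chart_dom c then complex_of_real (p c a) else 0) * \<rho> c a) \<in> sec red (chart_dom c)"
        by (rule red_mult[OF red_restr[OF dM pc(1)] rc])
      moreover have "(if a \<in> chart_dom c then complex_of_real (p c a) else 0) * \<rho> c a = complex_of_real (p c a) * \<rho> c a" for a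
        using red_support[OF rc] by simp
      ultimately show "(\<lambda>a. complex_of_real (p c a) * \<rho> c a) \<in> sec red (chart_dom c)" by simp
    qed
  qed
qed

lemma dens_supp_add:
  assumes "\<rho> \<in> dens_supp K" "\<sigma> \<in> dens_supp K" shows "(\<lambda>c a. \<rho> c a + \<sigma> c a) \<in> dens_supp K"
proof -
  have "\<rho> \<oplus>\<^bsub>sections dens M\<^esub> \<sigma> \<in> sec dens M"
    by (rule D.add_closed[OF M_open]) (use assms in \<open>simp_all add: dens_supp_def\<close>)
  then show ?thesis using assms by (simp add: dens_supp_def dens_simps)
qed

lemma dens_supp_scale:
  assumes "\<rho> \<in> dens_supp K" shows "(\<lambda>c a. k * \<rho> c a) \<in> dens_supp K"
proof -
  have r: "\<rho> \<in> sec dens M" using assms by (simp add: dens_supp_def)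
  have "complex_scale \<O> dens M k \<rho> = (\<lambda>c a. k * \<rho> c a)"
    by (rule dens_complex_scale[OF M_open r])
  then have "(\<lambda>c a. k * \<rho> c a) \<in> sec dens M" using D.complex_scale_closed[OF M_open r, of k] by simp
  then show ?thesis using assms by (simp add: dens_supp_def)
qed

lemma density_integral_add:
  assumes r: "\<rho> \<in> dens_supp K" and s: "\<sigma> \<in> dens_supp K"
  shows "density_integral X \<O> (\<lambda>c a. \<rho> c a + \<sigma> c a) = density_integral X \<O> \<rho> + density_integral X \<O> \<sigma>"
proof -
  obtain p B where B: "finite B" "B \<subseteq> charts X \<O>"
    and eq: "\<And>\<rho>. \<rho> \<in> dens_supp K \<Longrightarrow> density_integral X \<O> \<rho> = (\<Sum>c\<in>B. chart_integral c (\<lambda>a. complex_of_real (p c a) * \<rho> c a))"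
    and C: "\<And>c. c \<in> B \<Longrightarrow> \<exists>C. compactin X C \<and> C \<subseteq> chart_dom c \<and> (\<forall>\<rho>\<in>dens_supp K.
      (\<lambda>a. complex_of_real (p c a) * \<rho> c a) \<in> sec red (chart_dom c) \<and> (\<forall>a. a \<notin> C \<longrightarrow> complex_of_real (p c a) * \<rho> c a = 0))"
    by (rule density_integral_eq) blast
  have "chart_integral c (\<lambda>a. complex_of_real (p c a) * (\<rho> c a + \<sigma> c a)) =
      chart_integral c (\<lambda>a. complex_of_real (p c a) * \<rho> c a) + chart_integral c (\<lambda>a. complex_of_real (p c a) * \<sigma> c a)"
    if "c \<in> B" for c
  proof -
    obtain C where C: "compactin X C" "C \<subseteq> chart_dom c" "\<And>\<rho>. \<rho> \<in> dens_supp K \<Longrightarrow>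
      (\<lambda>a. complex_of_real (p c a) * \<rho> c a) \<in> sec red (chart_dom c) \<and> (\<forall>a. a \<notin> C \<longrightarrow> complex_of_real (p c a) * \<rho> c a = 0)"
      using C[OF \<open>c \<in> B\<close>] by blast
    have c: "c \<in> charts X \<O>" using that B(2) by blast
    show ?thesis unfolding distrib_left
      by (rule chart_integral_add[OF c _ C(1,2)]) (use C(3)[OF r] C(3)[OF s] in blast)+
  qed
  then show ?thesis by (simp add: eq[OF r] eq[OF s] eq[OF dens_supp_add[OF r s]] sum.distrib)
qed

lemma density_integral_scale:
  assumes r: "\<rho> \<in> dens_supp K"
  shows "density_integral X \<O> (\<lambda>c a. k * \<rho> c a) = k * density_integral X \<O> \<rho>"
proof -
  obtain p B where B: "finite B" "B \<subseteq> charts X \<O>"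
    and eq: "\<And>\<rho>. \<rho> \<in> dens_supp K \<Longrightarrow> density_integral X \<O> \<rho> = (\<Sum>c\<in>B. chart_integral c (\<lambda>a. complex_of_real (p c a) * \<rho> c a))"
    and C: "\<And>c. c \<in> B \<Longrightarrow> \<exists>C. compactin X C \<and> C \<subseteq> chart_dom c \<and> (\<forall>\<rho>\<in>dens_supp K.
      (\<lambda>a. complex_of_real (p c a) * \<rho> c a) \<in> sec red (chart_dom c) \<and> (\<forall>a. a \<notin> C \<longrightarrow> complex_of_real (p c a) * \<rho> c a = 0))"
    by (rule density_integral_eq) blast
  have "chart_integral c (\<lambda>a. complex_of_real (p c a) * (k * \<rho> c a)) = k * chart_integral c (\<lambda>a. complex_of_real (p c a) * \<rho> c a)"
    if "c \<in> B" for c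
  proof -
    obtain C where C: "compactin X C" "C \<subseteq> chart_dom c" "\<And>\<rho>. \<rho> \<in> dens_supp K \<Longrightarrow>
      (\<lambda>a. complex_of_real (p c a) * \<rho> c a) \<in> sec red (chart_dom c) \<and> (\<forall>a. a \<notin> C \<longrightarrow> complex_of_real (p c a) * \<rho> c a = 0)"
      using C[OF \<open>c \<in> B\<close>] by blast
    have c: "c \<in> charts X \<O>" using that B(2) by blast
    show ?thesis unfolding mult.left_commute[of _ k]
      by (rule chart_integral_smult[OF c _ C(1,2)]) (use C(3)[OF r] in blast)+
  qed
  then show ?thesis by (simp add: eq[OF r] eq[OF dens_supp_scale[OF r]] sum_distrib_left)
qed

end

end

section \<open>Compactly supported formal densities\<close>

locale formal_mfd_module = formal_mfd X \<O>
  for X :: "'a topology" and \<O> :: "('a, complex, 'r) presheaf" +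
  fixes F :: "('a, 'r, 'm) presheaf"
  assumes modules: "sheaf_of_modules X \<O> F"
begin

sublocale FS: module_sheaf X \<O> F
  by unfold_locales (rule modules)

sublocale FD: hausdorff_module_sheaves X \<O> F dens
  by unfold_locales (rule hausdorff)

sublocale DR: hausdorff_module_sheaves X \<O> dens red
  by unfold_locales (rule hausdorff)

lemma dens_zero_outside:
  assumes "openin X U" "restr dens U (U - K) \<rho> = \<zero>\<^bsub>sections dens (U - K)\<^esub>" "a \<in> U" "a \<notin> K"
  shows "\<rho> c a = 0"
  using fun_cong[OF fun_cong[OF assms(2)], of c a] assms(3,4) by (simp add: dens_simps)

lemma dop_zero_outside:
  assumes U: "openin X U" and D: "FD.dop U K r D" and u: "u \<in> sec F U" and a: "a \<notin> K"
  shows "D U u c a = 0"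
proof (cases "a \<in> U")
  case True
  note d = FD.dopD[OF D]
  have UU: "U \<in> opens_in X U" using U by (simp add: opens_in_iff)
  have o: "U - K \<in> opens_in X U" "U - K \<in> opens_in X (U - K)"
    using FD.openin_minus_compact[OF U d(2)] by (auto simp: opens_in_iff)
  have "restr dens U (U - K) (D U u) = \<zero>\<^bsub>sections dens (U - K)\<^esub>"
    using FD.additive_hom_restr[OF d(6) UU o(1) u] d(4) o(2) FS.restr_closed[OF U o(1) u]
    by (simp add: vanishes_on_def)
  from dens_zero_outside[OF U this True a] show ?thesis .
next
  case False
  have UU: "U \<in> opens_in X U" using U by (simp add: opens_in_iff)
  show ?thesis
    using dens_support[OF FD.additive_hom_closed[OF FD.dopD(6)[OF D] UU u]] False by blast
qed

text \<open>Densities are stored as functions extended by zero. One over \<open>U\<close> with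
  support in a compact K \<subseteq> U is therefore literally a density on the whole manifold, and
  no second notion of integral is required.\<close>

lemma dop_dens_supp:
  assumes U: "openin X U" and D: "FD.dop U K r D" and u: "u \<in> sec F U"
  shows "D U u \<in> dens_supp K"
proof -
  note d = FD.dopD[OF D]
  have UU: "U \<in> opens_in X U" using U by (simp add: opens_in_iff)
  note cl = FD.additive_hom_closed[OF d(6) UU u]
  have MK: "openin X (M - K)" by (rule FD.openin_minus_compact[OF M_open d(2)])
  have z: "D U u c a = 0" if "a \<notin> K" for c a by (rule dop_zero_outside[OF U D u that])
  have "D U u \<in> sec dens M"
  proof (rule dens_local[OF M_open])
    show "D U u c a = 0" if "a \<notin> M" for c a
      using z that compactin_subset_topspace[OF d(2)] by blast
    fix a assume a: "a \<in> M"
    show "\<exists>V\<in>opens_in X M. a \<in> V \<and> restr dens M V (D U u) \<in> sec dens V"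
    proof (cases "a \<in> K")
      case True
      have "restr dens M U (D U u) = D U u" using dens_support[OF cl] by (auto simp: dens_simps fun_eq_iff)
      then show ?thesis using True d(3) cl opens_M[OF U] by (intro bexI[of _ U]) auto
    next
      case False
      have "restr dens M (M - K) (D U u) = \<zero>\<^bsub>sections dens (M - K)\<^esub>" using z by (auto simp: dens_simps fun_eq_iff)
      then show ?thesis using False a opens_M[OF MK] D.zero_closed[OF MK] by (intro bexI[of _ "M - K"]) auto
    qed
  qed
  then show ?thesis using z by (simp add: dens_supp_def)
qed

section \<open>The vector spaces of formal densities\<close>

abbreviation FDs where "FDs \<equiv> formal_densities X \<O> F"
abbreviation rh where "rh \<equiv> rho X \<O> F"

lemma FDs_simps:
  "\<zero>\<^bsub>FDs U\<^esub> = (\<lambda>u\<in>sec F U. 0)"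
  "\<eta> \<oplus>\<^bsub>FDs U\<^esub> \<theta> = (\<lambda>u\<in>sec F U. \<eta> u + \<theta> u)"
  "c \<odot>\<^bsub>FDs U\<^esub> \<eta> = (\<lambda>u\<in>sec F U. c * \<eta> u)"
  by (simp_all add: formal_densities_def)

lemma FDs_carrier:
  assumes "openin X U"
  shows "\<eta> \<in> carrier (FDs U) \<longleftrightarrow> (\<exists>K r D. FD.dop U K r D \<and> \<eta> = rh U D)"
  unfolding formal_densities_def by (auto simp: FD.carrier_Diff_c[OF assms])

context
  fixes U assumes U: "openin X U"
begin

lemma UU: "U \<in> opens_in X U"
  using U by (simp add: opens_in_iff)

lemma rho_add:
  assumes D: "FD.dop U K r D" and E: "FD.dop U K r E"
  shows "rh U (FD.mk U (\<lambda>V s. D V s \<oplus>\<^bsub>sections dens V\<^esub> E V s)) = rh U D \<oplus>\<^bsub>FDs U\<^esub> rh U E"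
  unfolding rho_def FDs_simps
proof (rule restrict_ext)
  fix u assume u: "u \<in> sec F U"
  show "density_integral X \<O> (FD.mk U (\<lambda>V s. D V s \<oplus>\<^bsub>sections dens V\<^esub> E V s) U u) =
      (\<lambda>u\<in>sec F U. density_integral X \<O> (D U u)) u + (\<lambda>u\<in>sec F U. density_integral X \<O> (E U u)) u"
    using density_integral_add[OF FD.dopD(2)[OF D] dop_dens_supp[OF U D u] dop_dens_supp[OF U E u]] u
    by (simp add: FD.mk_apply[OF UU u] dens_simps)
qed

lemma rho_scale:
  assumes D: "FD.dop U K r D"
  shows "rh U (FD.mk U (\<lambda>V s. complex_scale \<O> dens V c (D V s))) = c \<odot>\<^bsub>FDs U\<^esub> rh U D"
  unfolding rho_def FDs_simps
proof (rule restrict_ext)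
  fix u assume u: "u \<in> sec F U"
  note cl = FD.additive_hom_closed[OF FD.dopD(6)[OF D] UU u]
  show "density_integral X \<O> (FD.mk U (\<lambda>V s. complex_scale \<O> dens V c (D V s)) U u) =
      c * (\<lambda>u\<in>sec F U. density_integral X \<O> (D U u)) u"
    using density_integral_scale[OF FD.dopD(2)[OF D] dop_dens_supp[OF U D u]] u
    by (simp add: FD.mk_apply[OF UU u] dens_complex_scale[OF U cl])
qed

lemma rho_zero:
  assumes D: "FD.dop U {} r D"
  shows "rh U D = \<zero>\<^bsub>FDs U\<^esub>"
  unfolding rho_def FDs_simps
proof (rule restrict_ext)
  fix u assume u: "u \<in> sec F U"
  have "D U u = (\<lambda>c a. 0)" using dop_zero_outside[OF U D u] by auto
  then show "density_integral X \<O> (D U u) = 0" using density_integral_zero by simp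
qed

text \<open>Both operators are moved into one space \<open>Diff_Kr\<close> by uniting the compact
  sets and taking the larger order, where \<rho> is additive.\<close>

lemma FDs_add_closed:
  assumes "\<eta> \<in> carrier (FDs U)" "\<theta> \<in> carrier (FDs U)"
  shows "\<eta> \<oplus>\<^bsub>FDs U\<^esub> \<theta> \<in> carrier (FDs U)"
proof -
  obtain K r D K' r' E where D: "FD.dop U K r D" "\<eta> = rh U D" and E: "FD.dop U K' r' E" "\<theta> = rh U E"
    using assms by (auto simp: FDs_carrier[OF U])
  note d = FD.dopD[OF D(1)] and e = FD.dopD[OF E(1)]
  have K: "compactin X (K \<union> K')" "K \<union> K' \<subseteq> U" using compactin_Un[OF d(2) e(2)] d(3) e(3) by auto
  have D': "FD.dop U (K \<union> K') (max r r') D" by (rule FD.dop_mono[OF U D(1) _ K]) auto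
  have E': "FD.dop U (K \<union> K') (max r r') E" by (rule FD.dop_mono[OF U E(1) _ K]) auto
  show ?thesis
    unfolding FDs_carrier[OF U] D(2) E(2) rho_add[OF D' E', symmetric] using FD.dop_add[OF U D' E'] by blast
qed

lemma FDs_smult_closed: "\<eta> \<in> carrier (FDs U) \<Longrightarrow> c \<odot>\<^bsub>FDs U\<^esub> \<eta> \<in> carrier (FDs U)"
  using rho_scale[symmetric] FD.dop_smult[OF U] by (fastforce simp: FDs_carrier[OF U])

lemma FDs_zero_closed: "\<zero>\<^bsub>FDs U\<^esub> \<in> carrier (FDs U)"
  using rho_zero[OF FD.dop_zero[OF U], symmetric] FD.dop_zero[OF U] by (auto simp: FDs_carrier[OF U])

lemma FDs_restrict: "\<eta> \<in> carrier (FDs U) \<Longrightarrow> (\<lambda>u\<in>sec F U. \<eta> u) = \<eta>"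
  by (auto simp: FDs_carrier[OF U] rho_def)

lemma module_FDs: "Module.module complex_ring (FDs U)"
proof (rule moduleI[OF cring_complex_ring])
  show "abelian_group (FDs U)"
  proof (rule abelian_groupI)
    fix \<eta> assume e: "\<eta> \<in> carrier (FDs U)"
    have "(-1) \<odot>\<^bsub>FDs U\<^esub> \<eta> \<oplus>\<^bsub>FDs U\<^esub> \<eta> = \<zero>\<^bsub>FDs U\<^esub>"
      unfolding FDs_simps by (rule restrict_ext) simp
    then show "\<exists>\<theta>\<in>carrier (FDs U). \<theta> \<oplus>\<^bsub>FDs U\<^esub> \<eta> = \<zero>\<^bsub>FDs U\<^esub>"
      using FDs_smult_closed[OF e] by blast
    have "\<zero>\<^bsub>FDs U\<^esub> \<oplus>\<^bsub>FDs U\<^esub> \<eta> = (\<lambda>u\<in>sec F U. \<eta> u)" unfolding FDs_simps by (rule restrict_ext) simp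
    then show "\<zero>\<^bsub>FDs U\<^esub> \<oplus>\<^bsub>FDs U\<^esub> \<eta> = \<eta>" using FDs_restrict[OF e] by simp
  qed (auto simp: FDs_zero_closed FDs_add_closed, auto simp: FDs_simps intro!: restrict_ext)
  fix \<eta> assume e: "\<eta> \<in> carrier (FDs U)"
  show "\<one>\<^bsub>complex_ring\<^esub> \<odot>\<^bsub>FDs U\<^esub> \<eta> = \<eta>" using FDs_restrict[OF e] by (simp add: FDs_simps)
qed (auto simp: FDs_smult_closed, auto simp: FDs_simps algebra_simps intro!: restrict_ext)

lemma FDs_finsum:
  assumes "finite J" "\<And>j. j \<in> J \<Longrightarrow> g j \<in> carrier (FDs U)"
  shows "(\<Oplus>\<^bsub>FDs U\<^esub>j\<in>J. g j) = (\<lambda>u\<in>sec F U. \<Sum>j\<in>J. g j u)"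
  using assms
proof (induction J rule: finite_induct)
  interpret Module.module complex_ring "FDs U" by (rule module_FDs)
  case empty then show ?case by (simp add: FDs_simps)
next
  interpret Module.module complex_ring "FDs U" by (rule module_FDs)
  case (insert j J)
  then have "g \<in> J \<rightarrow> carrier (FDs U)" "g j \<in> carrier (FDs U)" by auto
  then show ?case using insert by (auto simp: FDs_simps intro!: restrict_ext)
qed

lemma final_family_FDs:
  "final_family (FDs U) ({K. compactin X K \<and> K \<subseteq> U} \<times> (UNIV :: nat set))
     (\<lambda>(K, r). quotient_topology (Diff_Kr_topology X \<O> F U K r) (rh U)) (\<lambda>_ \<eta>. \<eta>)"
proof (rule final_family.intro, rule module_FDs)
  show "(\<lambda>\<eta>. \<eta>) \<in> topspace (case Kr of (K, r) \<Rightarrow> quotient_topology (Diff_Kr_topology X \<O> F U K r) (rh U)) \<rightarrow> carrier (FDs U)"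
    if *: "Kr \<in> {K. compactin X K \<and> K \<subseteq> U} \<times> (UNIV :: nat set)" for Kr
  proof -
    obtain K r where Kr: "Kr = (K, r)" "compactin X K" "K \<subseteq> U" using * by auto
    show ?thesis
      using Kr by (auto simp: topspace_quotient_topology Diff_Kr_topology_def topspace_seminorm_topology
        FD.carrier_Diff_Kr[OF U Kr(2,3)] FDs_carrier[OF U]) blast
  qed
qed

end

lemma topspace_quotient_rho:
  assumes "openin X U" "compactin X K" "K \<subseteq> U"
  shows "topspace (quotient_topology (Diff_Kr_topology X \<O> F U K r) (rh U)) = rh U ` {D. FD.dop U K r D}"
    "topspace (Diff_Kr_topology X \<O> F U K r) = {D. FD.dop U K r D}"
  by (simp_all add: topspace_quotient_topology Diff_Kr_topology_def topspace_seminorm_topology FD.carrier_Diff_Kr[OF assms])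

text \<open>Sections of the reduction are continuous in charts and so locally bounded; finitely many
  bounds suffice on the compact support. This makes \<open>Sup\<close> in the seminorms a genuine
  supremum.\<close>

lemma red_bounded:
  assumes U: "openin X U" and g: "g \<in> sec red U" and C: "compactin X C" "C \<subseteq> U" "\<And>a. a \<notin> C \<Longrightarrow> g a = 0"
  shows "\<exists>b\<ge>0. \<forall>a. cmod (g a) \<le> b"
proof -
  let ?N = "{N. openin X N \<and> (\<exists>b. \<forall>x\<in>N. cmod (g x) \<le> b)}"
  have "C \<subseteq> \<Union>?N"
  proof
    fix a assume "a \<in> C"
    then have a: "a \<in> U" "a \<in> M" using C U openin_subset by blast+
    obtain U\<^sub>0 n k \<phi> \<Psi> where ch: "formal_chart X \<O> U\<^sub>0 n k \<phi> \<Psi>" "a \<in> U\<^sub>0" by (rule chart_at[OF a(2)])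
    have U0: "openin X U\<^sub>0" using formal_chart.U0[OF ch(1)] .
    let ?V = "U \<inter> U\<^sub>0"
    have V: "?V \<in> opens_in X U\<^sub>0" "?V \<in> opens_in X U" "openin X ?V" using U U0 by (auto simp: opens_in_iff)
    let ?g = "\<lambda>a. if a \<in> ?V then g a else 0"
    have "continuous_map (subtopology X ?V) euclidean ?g"
      by (rule formal_chart.reduction_continuous_chart[OF ch(1) V(1) red_restr[OF V(2) g]])
    from openin_continuous_map_preimage[OF this, of "ball 0 (cmod (g a) + 1)"]
    have "openin (subtopology X ?V) {x \<in> topspace (subtopology X ?V). ?g x \<in> ball 0 (cmod (g a) + 1)}" by simp
    then have o: "openin X {x \<in> topspace (subtopology X ?V). ?g x \<in> ball 0 (cmod (g a) + 1)}"
      using openin_trans_full[OF _ V(3)] by blast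
    show "a \<in> \<Union>?N"
    proof (rule UnionI)
      show "{x \<in> topspace (subtopology X ?V). ?g x \<in> ball 0 (cmod (g a) + 1)} \<in> ?N"
        using o by (auto intro!: exI[of _ "cmod (g a) + 1"])
      show "a \<in> {x \<in> topspace (subtopology X ?V). ?g x \<in> ball 0 (cmod (g a) + 1)}" using a ch(2) by simp
    qed
  qed
  from compactinD[OF C(1) _ this] obtain \<F> where F: "finite \<F>" "\<F> \<subseteq> ?N" "C \<subseteq> \<Union>\<F>" by auto
  have "\<forall>N\<in>\<F>. \<exists>b. \<forall>x\<in>N. cmod (g x) \<le> b" using F(2) by blast
  from bchoice[OF this] obtain b where b: "\<And>N x. N \<in> \<F> \<Longrightarrow> x \<in> N \<Longrightarrow> cmod (g x) \<le> b N" by auto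
  let ?b = "Max (insert 0 (b ` \<F>))"
  have "cmod (g a) \<le> ?b" for a
  proof (cases "a \<in> C")
    case True
    then obtain N where N: "N \<in> \<F>" "a \<in> N" using F(3) by blast
    have "b N \<le> ?b" using F(1) N(1) by (intro Max_ge) auto
    then show ?thesis using b[OF N] by linarith
  next
    case False
    then show ?thesis using F(1) C(3) by simp
  qed
  moreover have "0 \<le> ?b" using F(1) by (intro Max_ge) auto
  ultimately show ?thesis by blast
qed

section \<open>The seminorms on spaces of operators\<close>

definition op_seminorm :: "'a set \<Rightarrow> ('a set \<Rightarrow> 'a density \<Rightarrow> 'a \<Rightarrow> complex) \<Rightarrow> 'm \<Rightarrow> ('a set \<Rightarrow> 'm \<Rightarrow> 'a density) \<Rightarrow> real" where
  "op_seminorm U Y u D = Sup (insert 0 ((\<lambda>a. cmod (Y U (D U u) a)) ` U))"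

context
  fixes U Y K' r' u
  assumes U: "openin X U" and Y: "DR.dop U K' r' Y" and u: "u \<in> sec F U"
begin

lemma op_seminorm_bdd:
  assumes D: "FD.dop U K r D"
  shows "bdd_above (insert 0 ((\<lambda>a. cmod (Y U (D U u) a)) ` U))"
proof -
  note y = DR.dopD[OF Y]
  have UU: "U \<in> opens_in X U" using U by (simp add: opens_in_iff)
  have Du: "D U u \<in> sec dens U" by (rule FD.additive_hom_closed[OF FD.dopD(6)[OF D] UU u])
  have cl: "Y U (D U u) \<in> sec red U" by (rule DR.additive_hom_closed[OF y(6) UU Du])
  have o: "U - K' \<in> opens_in X U" "U - K' \<in> opens_in X (U - K')"
    using FD.openin_minus_compact[OF U y(2)] by (auto simp: opens_in_iff)
  have "restr red U (U - K') (Y U (D U u)) = \<zero>\<^bsub>sections red (U - K')\<^esub>"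
    using DR.additive_hom_restr[OF y(6) UU o(1) Du] y(4) o(2) D.restr_closed[OF U o(1) Du]
    by (simp add: vanishes_on_def)
  then have z: "Y U (D U u) a = 0" if "a \<notin> K'" for a
    using that red_support[OF cl, of a] by (cases "a \<in> U") (auto simp: red_simps fun_eq_iff split: if_splits)
  obtain b where "0 \<le> b" "\<And>a. cmod (Y U (D U u) a) \<le> b" using red_bounded[OF U cl y(2,3) z] by blast
  then show ?thesis by (intro bdd_aboveI[of _ b]) auto
qed

lemma op_seminorm_upper: "FD.dop U K r D \<Longrightarrow> a \<in> U \<Longrightarrow> cmod (Y U (D U u) a) \<le> op_seminorm U Y u D"
  unfolding op_seminorm_def by (intro cSup_upper op_seminorm_bdd) auto

lemma op_seminorm_nonneg: "FD.dop U K r D \<Longrightarrow> 0 \<le> op_seminorm U Y u D"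
  unfolding op_seminorm_def by (intro cSup_upper op_seminorm_bdd) auto

lemma op_seminorm_least: "0 \<le> B \<Longrightarrow> (\<And>a. a \<in> U \<Longrightarrow> cmod (Y U (D U u) a) \<le> B) \<Longrightarrow> op_seminorm U Y u D \<le> B"
  unfolding op_seminorm_def by (intro cSup_least) auto

lemma op_seminorm_add:
  assumes D: "FD.dop U K r D" and E: "FD.dop U K r E"
  shows "op_seminorm U Y u (FD.mk U (\<lambda>V s. D V s \<oplus>\<^bsub>sections dens V\<^esub> E V s)) \<le> op_seminorm U Y u D + op_seminorm U Y u E"
proof (rule op_seminorm_least)
  show "0 \<le> op_seminorm U Y u D + op_seminorm U Y u E" using op_seminorm_nonneg[OF D] op_seminorm_nonneg[OF E] by simp
  have UU: "U \<in> opens_in X U" using U by (simp add: opens_in_iff)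
  note cl = FD.additive_hom_closed[OF FD.dopD(6)[OF D] UU u] FD.additive_hom_closed[OF FD.dopD(6)[OF E] UU u]
  fix a assume a: "a \<in> U"
  have "Y U (FD.mk U (\<lambda>V s. D V s \<oplus>\<^bsub>sections dens V\<^esub> E V s) U u) a = Y U (D U u) a + Y U (E U u) a"
    using DR.additive_hom_add[OF DR.dopD(6)[OF Y] UU cl] by (simp add: FD.mk_apply[OF UU u] red_simps)
  also have "cmod \<dots> \<le> cmod (Y U (D U u) a) + cmod (Y U (E U u) a)" by (rule norm_triangle_ineq)
  also have "\<dots> \<le> op_seminorm U Y u D + op_seminorm U Y u E" using op_seminorm_upper[OF D a] op_seminorm_upper[OF E a] by simp
  finally show "cmod (Y U (FD.mk U (\<lambda>V s. D V s \<oplus>\<^bsub>sections dens V\<^esub> E V s) U u) a) \<le> op_seminorm U Y u D + op_seminorm U Y u E" .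
qed

lemma op_seminorm_zero:
  assumes D: "FD.dop U {} r D"
  shows "op_seminorm U Y u D \<le> 0"
proof (rule op_seminorm_least)
  have UU: "U \<in> opens_in X U" using U by (simp add: opens_in_iff)
  have "D U u = \<zero>\<^bsub>sections dens U\<^esub>" using dop_zero_outside[OF U D u] by (auto simp: dens_simps fun_eq_iff)
  then show "cmod (Y U (D U u) a) \<le> 0" for a
    using DR.additive_hom_zero[OF DR.dopD(6)[OF Y] UU] by (simp add: red_simps)
qed simp

end

text \<open>Subadditivity and vanishing at the zero operator hold for all these seminorms, so
  continuity of a linear map reduces to dominating each seminorm of the target by one of the
  source.\<close>

lemma continuous_map_Diff_Kr:
  assumes U: "openin X U" and K: "compactin X K" "K \<subseteq> U" and V: "openin X V" and L: "compactin X L" "L \<subseteq> V"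
    and lin: "complex_linear (Diff_Kr X \<O> F dens U K r) (Diff_Kr X \<O> F dens V L r) f"
    and op_seminorm: "\<And>Y K' r' u. DR.dop V K' r' Y \<Longrightarrow> u \<in> sec F V \<Longrightarrow>
      \<exists>Y' L' r' u'. DR.dop U L' r' Y' \<and> u' \<in> sec F U \<and> (\<forall>D. FD.dop U K r D \<longrightarrow> op_seminorm V Y u (f D) \<le> op_seminorm U Y' u' D)"
  shows "continuous_map (Diff_Kr_topology X \<O> F U K r) (Diff_Kr_topology X \<O> F V L r) f"
  unfolding Diff_Kr_topology_def op_seminorm_def[symmetric] DR.carrier_Diff_c[OF U] DR.carrier_Diff_c[OF V]
proof (rule continuous_map_seminorm_topology[OF FD.module_Diff_Kr[OF U K] FD.module_Diff_Kr[OF V L] lin], goal_cases)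
  case (1 q x y)
  then obtain Y u K' r' where q: "q = op_seminorm V Y u" "DR.dop V K' r' Y" "u \<in> sec F V"
    unfolding op_seminorm_def by blast
  show ?case
    using 1 op_seminorm_add[OF V q(2,3), of L r x y] unfolding q(1) by (simp add: FD.carrier_Diff_Kr[OF V L] FD.Diff_ops)
next
  case (2 q)
  then obtain Y u K' r' where q: "q = op_seminorm V Y u" "DR.dop V K' r' Y" "u \<in> sec F V"
    unfolding op_seminorm_def by blast
  obtain Y' L' s u' where Y': "DR.dop U L' s Y'" "u' \<in> sec F U" "\<And>D. FD.dop U K r D \<Longrightarrow> op_seminorm V Y u (f D) \<le> op_seminorm U Y' u' D"
    using op_seminorm[OF q(2,3)] by blast
  have "op_seminorm U Y' u' \<zero>\<^bsub>Diff_Kr X \<O> F dens U K r\<^esub> \<le> 0"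
    unfolding FD.Diff_ops by (rule op_seminorm_zero[OF U Y'(1,2) FD.dop_zero[OF U]])
  then show ?case
    using Y' unfolding q(1) FD.carrier_Diff_Kr[OF U K]
    by (intro bexI[of _ "op_seminorm U Y' u'"] CollectI exI[of _ Y'] exI[of _ u'] conjI ballI) (auto simp: op_seminorm_def fun_eq_iff)
qed

end

lemma complex_linear_closed: "complex_linear V W f \<Longrightarrow> x \<in> carrier V \<Longrightarrow> f x \<in> carrier W"
  by (auto simp: complex_linear_def)

context formal_mfd_module
begin

section \<open>Continuity of cutting and extending\<close>

lemma hole_cutoff:
  assumes h: "hole N C h"
  defines "\<kappa> \<equiv> \<one>\<^bsub>sections \<O> M\<^esub> \<ominus>\<^bsub>sections \<O> M\<^esub> h"
  shows "\<kappa> \<in> sec \<O> M" "restr \<O> M (M - C) \<kappa> = \<zero>\<^bsub>sections \<O> (M - C)\<^esub>" "\<And>a. a \<in> N \<Longrightarrow> val M \<kappa> a = 1"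
proof -
  interpret R: cring "sections \<O> M" by (rule O_cring[OF M_open])
  have hM: "h \<in> sec \<O> M" and N: "openin X N" and C: "compactin X C"
    and z: "restr \<O> M N h = \<zero>\<^bsub>sections \<O> N\<^esub>" and o: "restr \<O> M (M - C) h = \<one>\<^bsub>sections \<O> (M - C)\<^esub>"
    using h by (auto simp: hole_def)
  show "\<kappa> \<in> sec \<O> M" unfolding \<kappa>_def using hM by simp
  have MC: "openin X (M - C)" by (rule compact_open_diff[OF M_open C])
  interpret R': cring "sections \<O> (M - C)" by (rule O_cring[OF MC])
  show "restr \<O> M (M - C) \<kappa> = \<zero>\<^bsub>sections \<O> (M - C)\<^esub>"
    unfolding \<kappa>_def O_restr_minus[OF M_open opens_M[OF MC] R.one_closed hM] o O_restr_one[OF M_open opens_M[OF MC]]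
    by (simp add: a_minus_def R'.r_neg)
  fix a assume a: "a \<in> N"
  then have aM: "a \<in> M" using N openin_subset by blast
  have "val M h a = 0"
    using value_restr[OF M_open aM hM opens_M[OF N] a] z value_zero[OF N a] by simp
  then show "val M \<kappa> a = 1"
    unfolding \<kappa>_def using value_minus[OF M_open aM R.one_closed hM] value_one[OF M_open aM R.one_closed] by simp
qed

lemma cut_section_zero:
  assumes V: "openin X V" and e: "e \<in> sec \<O> M"
    and S: "closedin X S" "S \<subseteq> V" "restr \<O> M (M - S) e = \<zero>\<^bsub>sections \<O> (M - S)\<^esub>" and u: "u \<in> sec F V"
  shows "restr F V (V - S) (restr \<O> M V e \<odot>\<^bsub>sections F V\<^esub> u) = \<zero>\<^bsub>sections F (V - S)\<^esub>"
proof -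
  have o: "V \<in> opens_in X M" "V - S \<in> opens_in X V" "M - S \<in> opens_in X M" "V - S \<in> opens_in X (M - S)"
    "openin X (V - S)" "openin X (M - S)"
    using V S(1) openin_subset[OF V] by (auto simp: opens_in_iff)
  have "restr \<O> V (V - S) (restr \<O> M V e) = \<zero>\<^bsub>sections \<O> (V - S)\<^esub>"
    using O_restr_restr[OF M_open o(1,2) e] O_restr_restr[OF M_open o(3,4) e] S(3) O_restr_zero[OF o(6,4)] by simp
  then show ?thesis
    using FS.restr_smult[OF V o(2) O_restr_closed[OF M_open o(1) e] u] FS.smult_l_null[OF o(5) FS.restr_closed[OF V o(2) u]]
    by simp
qed

context
  fixes V assumes V: "openin X V"
begin

lemma V_opens: "V \<in> opens_in X M" "V \<in> opens_in X V" "M \<in> opens_in X M" "M \<inter> V = V" "V \<subseteq> M"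
  using V openin_subset[OF V] by (auto simp: opens_in_iff)

text \<open>With u' the extension by zero of \<open>e u\<close>, the density of the cut operator at
  \<open>u\<close> is the restriction of D u' to \<open>V\<close>. The test operator
  \<open>Y\<close> is the restriction of its own extension by zero, so the seminorm for
  \<open>Y\<close> and \<open>u\<close> is at most the one for this extension and u'.\<close>

lemma continuous_cut_op:
  assumes K: "compactin X K" and e: "e \<in> sec \<O> M"
    and S: "closedin X S" "S \<subseteq> V" "restr \<O> M (M - S) e = \<zero>\<^bsub>sections \<O> (M - S)\<^esub>"
  shows "continuous_map (Diff_Kr_topology X \<O> F M K r) (Diff_Kr_topology X \<O> F V (K \<inter> S) r) (FD.cut_op M V e)"
proof -
  have KM: "K \<subseteq> M" by (rule compactin_subset_topspace[OF K])
  have MS: "M \<inter> S \<subseteq> V" using S(2) by blast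
  have KS: "compactin X (K \<inter> S)" "K \<inter> S \<subseteq> V" using closed_Int_compactin[OF S(1) K] S(2) by (auto simp: Int_commute)
  show ?thesis
  proof (rule continuous_map_Diff_Kr[OF M_open K KM V KS FD.cut_op_linear[OF M_open V_opens(1) e S(1) MS S(3) K KM]])
    fix Y K' r' u assume Y: "DR.dop V K' r' Y" and u: "u \<in> sec F V"
    let ?Y = "DR.ext_op M V K' Y" and ?w = "restr \<O> M V e \<odot>\<^bsub>sections F V\<^esub> u"
    define u' where "u' = FS.extz M V S ?w"
    note Y' = DR.dop_ext_op[OF M_open V_opens(1) Y]
    have w: "?w \<in> sec F V" by (rule FS.smult_closed[OF V O_restr_closed[OF M_open V_opens(1) e] u])
    have MSo: "openin X (M - S)" using S(1) by blast
    have w0: "restr F V (V - S) ?w = \<zero>\<^bsub>sections F (V - S)\<^esub>"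
      by (rule cut_section_zero[OF V e S u])
    note ez = FS.extz[OF M_open V V_opens(5) MSo MS w w0]
    have u': "u' \<in> sec F M" "restr F M V u' = ?w" unfolding u'_def using ez by auto
    have "op_seminorm V Y u (FD.cut_op M V e D) \<le> op_seminorm M ?Y u' D" if D: "FD.dop M K r D" for D
    proof (rule op_seminorm_least[OF V Y u])
      show "0 \<le> op_seminorm M ?Y u' D" by (rule op_seminorm_nonneg[OF M_open Y' u'(1) D])
      fix a assume a: "a \<in> V"
      note d = FD.dopD[OF D]
      have s: "D M u' \<in> sec dens M" by (rule FD.additive_hom_closed[OF d(6) V_opens(3) u'(1)])
      have "FD.cut_op M V e D V u = restr dens M V (D M u')"
        using FD.additive_hom_restr[OF d(6) V_opens(3,1) u'(1)] u'(2)
        by (simp add: FD.cut_op_def FD.mk_apply[OF V_opens(2) u])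
      then have "Y V (FD.cut_op M V e D V u) = restr red M V (?Y M (D M u'))"
        using DR.ext_op_props(2)[OF M_open V_opens(1) Y V_opens(3) s] by (simp add: V_opens(4))
      then have "Y V (FD.cut_op M V e D V u) a = ?Y M (D M u') a" using a by (simp add: red_simps)
      then show "cmod (Y V (FD.cut_op M V e D V u) a) \<le> op_seminorm M ?Y u' D"
        using op_seminorm_upper[OF M_open Y' u'(1) D, of a] a V_opens(5) by auto
    qed
    then show "\<exists>Y' L' r' u'. DR.dop M L' r' Y' \<and> u' \<in> sec F M \<and>
        (\<forall>D. FD.dop M K r D \<longrightarrow> op_seminorm V Y u (FD.cut_op M V e D) \<le> op_seminorm M Y' u' D)"
      using Y' u'(1) by blast
  qed
qed

text \<open>A seminorm on \<open>M\<close> is pulled back to \<open>V\<close> by multiplying its differential operator with a cutoff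
  function that is 1 near \<open>K\<close> and has compact support in \<open>V\<close>.\<close>

lemma continuous_ext_op:
  assumes K: "compactin X K" "K \<subseteq> V"
  shows "continuous_map (Diff_Kr_topology X \<O> F V K r) (Diff_Kr_topology X \<O> F M K r) (FD.ext_op M V K)"
proof -
  have KM: "K \<subseteq> M" by (rule compactin_subset_topspace[OF K(1)])
  obtain N C h where h: "hole N C h" "K \<subseteq> N" "C \<subseteq> V" using hole_compact[OF V K] by blast
  obtain \<kappa> where c: "\<kappa> \<in> sec \<O> M" "restr \<O> M (M - C) \<kappa> = \<zero>\<^bsub>sections \<O> (M - C)\<^esub>" "\<And>a. a \<in> N \<Longrightarrow> val M \<kappa> a = 1"
    using hole_cutoff[OF h(1)] by blast
  have C: "closedin X C" "M \<inter> C \<subseteq> V"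
    using h(1,3) compactin_imp_closedin[OF hausdorff] by (auto simp: hole_def)
  show ?thesis
  proof (rule continuous_map_Diff_Kr[OF V K M_open K(1) KM FD.ext_op_linear[OF M_open V_opens(1) K]])
    fix Y K' r' u assume Y: "DR.dop M K' r' Y" and u: "u \<in> sec F M"
    let ?Y = "DR.cut_op M V \<kappa> Y" and ?u = "restr F M V u"
    note Y' = DR.dop_cut_op[OF M_open V_opens(1) c(1) C c(2) Y]
    have u': "?u \<in> sec F V" by (rule FS.restr_closed[OF M_open V_opens(1) u])
    have "op_seminorm M Y u (FD.ext_op M V K D) \<le> op_seminorm V ?Y ?u D" if D: "FD.dop V K r D" for D
    proof (rule op_seminorm_least[OF M_open Y u])
      show n: "0 \<le> op_seminorm V ?Y ?u D" by (rule op_seminorm_nonneg[OF V Y' u' D])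
      fix a assume a: "a \<in> M"
      let ?s = "FD.ext_op M V K D M u"
      note d = FD.dopD[OF D] and y = DR.dopD[OF Y]
      note p = FD.ext_op_props[OF M_open V_opens(1) D V_opens(3) u, unfolded V_opens(4)]
      show "cmod (Y M ?s a) \<le> op_seminorm V ?Y ?u D"
      proof (cases "a \<in> V")
        case True
        have Du: "D V ?u \<in> sec dens V" by (rule FD.additive_hom_closed[OF d(6) V_opens(2) u'])
        \<comment> \<open>\<O> acts on densities through values only. The value of \<kappa> is 1 on
          \<open>K\<close>, and off \<open>K\<close> the density is zero.\<close>
        have "restr \<O> M V \<kappa> \<odot>\<^bsub>sections dens V\<^esub> D V ?u = D V ?u"
        proof (intro ext)
          fix i b
          show "(restr \<O> M V \<kappa> \<odot>\<^bsub>sections dens V\<^esub> D V ?u) i b = D V ?u i b"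
          proof (cases "b \<in> K")
            case True
            then have b: "b \<in> M" "b \<in> V" "b \<in> N" using KM K(2) h(2) by blast+
            show ?thesis
              using value_restr[OF M_open b(1) c(1) V_opens(1) b(2)] c(3)[OF b(3)] by (simp add: dens_simps)
          next
            case False
            then show ?thesis using dop_zero_outside[OF V D u' False] by (simp add: dens_simps)
          qed
        qed
        then have "?Y V (D V ?u) = Y V (restr dens M V ?s)"
          using p(2) by (simp add: DR.cut_op_def DR.mk_apply[OF V_opens(2) Du])
        also have "\<dots> = restr red M V (Y M ?s)"
          using DR.additive_hom_restr[OF y(6) V_opens(3,1) p(1)] by simp
        finally have "Y M ?s a = ?Y V (D V ?u) a" using True by (simp add: red_simps)
        then show ?thesis using op_seminorm_upper[OF V Y' u' D True] by simp
      next
        case False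
        have MK: "openin X (M - K)" by (rule FD.openin_minus_compact[OF M_open K(1)])
        have "restr red M (M - K) (Y M ?s) = \<zero>\<^bsub>sections red (M - K)\<^esub>"
          by (rule DR.additive_hom_local[OF y(6) V_opens(3) opens_M[OF MK] p(1,3)])
        from fun_cong[OF this, of a] have "Y M ?s a = 0" using a False K(2) by (auto simp: red_simps split: if_splits)
        then show ?thesis using n by simp
      qed
    qed
    then show "\<exists>Y' L' r' u'. DR.dop V L' r' Y' \<and> u' \<in> sec F V \<and>
        (\<forall>D. FD.dop V K r D \<longrightarrow> op_seminorm M Y u (FD.ext_op M V K D) \<le> op_seminorm V Y' u' D)"
      using Y' u' by blast
  qed
qed

text \<open>Extending the operator by zero leaves the resulting density unchanged as a function, so
  the two integrals are the same expression.\<close>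

lemma ext_map_rho:
  assumes D: "FD.dop V K r D"
  shows "ext_map F M V (rh V D) = rh M (FD.ext_op M V K D)"
  unfolding ext_map_def rho_def
proof (rule restrict_ext)
  fix u assume u: "u \<in> sec F M"
  have u': "restr F M V u \<in> sec F V" by (rule FS.restr_closed[OF M_open V_opens(1) u])
  note p = FD.ext_op_props[OF M_open V_opens(1) D V_opens(3) u, unfolded V_opens(4)]
  have "FD.ext_op M V K D M u = D V (restr F M V u)"
  proof (intro ext)
    fix c a
    show "FD.ext_op M V K D M u c a = D V (restr F M V u) c a"
    proof (cases "a \<in> V")
      case True
      then show ?thesis using fun_cong[OF fun_cong[OF p(2)], of c a] by (simp add: dens_simps)
    next
      case False
      then have "a \<notin> K" using FD.dopD(3)[OF D] by blast
      then show ?thesis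
        using dop_zero_outside[OF M_open FD.dop_ext_op[OF M_open V_opens(1) D] u] dop_zero_outside[OF V D u'] by simp
    qed
  qed
  then show "(\<lambda>u\<in>sec F V. density_integral X \<O> (D V u)) (restr F M V u) = density_integral X \<O> (FD.ext_op M V K D M u)"
    using u' by simp
qed

lemma ext_map_linear: "complex_linear (FDs V) (FDs M) (ext_map F M V)"
proof -
  have "ext_map F M V \<eta> \<in> carrier (FDs M)" if "\<eta> \<in> carrier (FDs V)" for \<eta>
  proof -
    obtain K r D where D: "FD.dop V K r D" "\<eta> = rh V D" using \<open>\<eta> \<in> carrier (FDs V)\<close> by (auto simp: FDs_carrier[OF V])
    show ?thesis unfolding D(2) ext_map_rho[OF D(1)] FDs_carrier[OF M_open]
      using FD.dop_ext_op[OF M_open V_opens(1) D(1)] by blast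
  qed
  then have 1: "ext_map F M V \<in> carrier (FDs V) \<rightarrow> carrier (FDs M)" by blast
  have 2: "ext_map F M V (\<eta> \<oplus>\<^bsub>FDs V\<^esub> \<theta>) = ext_map F M V \<eta> \<oplus>\<^bsub>FDs M\<^esub> ext_map F M V \<theta>" for \<eta> \<theta>
    unfolding FDs_simps ext_map_def
    by (rule restrict_ext) (simp add: FS.restr_closed[OF M_open V_opens(1)])
  have 3: "ext_map F M V (c \<odot>\<^bsub>FDs V\<^esub> \<eta>) = c \<odot>\<^bsub>FDs M\<^esub> ext_map F M V \<eta>" for c \<eta>
    unfolding FDs_simps ext_map_def
    by (rule restrict_ext) (simp add: FS.restr_closed[OF M_open V_opens(1)])
  show ?thesis unfolding complex_linear_def by (intro conjI ballI allI 1 2 3)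
qed

lemma continuous_ext_map_quotient:
  assumes K: "compactin X K" "K \<subseteq> V"
  shows "continuous_map (quotient_topology (Diff_Kr_topology X \<O> F V K r) (rh V))
    (quotient_topology (Diff_Kr_topology X \<O> F M K r) (rh M)) (ext_map F M V)"
  by (rule continuous_map_quotient_topology[OF continuous_ext_op[OF K]])
    (simp add: topspace_quotient_rho(2)[OF V K] ext_map_rho)

text \<open>For \<open>\<eta> = \<rho>(D)\<close> this is \<open>\<rho>(D \<circ> e)\<close>; the formula shows that it does not depend on the choice of \<open>D\<close>.\<close>

definition cut_density :: "'r \<Rightarrow> 'a set \<Rightarrow> ('m \<Rightarrow> complex) \<Rightarrow> 'm \<Rightarrow> complex" where
  "cut_density e S \<eta> = (\<lambda>u\<in>sec F V. \<eta> (FS.extz M V S (restr \<O> M V e \<odot>\<^bsub>sections F V\<^esub> u)))"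

context
  fixes e S
  assumes e: "e \<in> sec \<O> M"
    and S: "closedin X S" "S \<subseteq> V" "restr \<O> M (M - S) e = \<zero>\<^bsub>sections \<O> (M - S)\<^esub>"
begin

lemma MS: "openin X (M - S)" "M \<inter> S \<subseteq> V"
  using S by auto

lemma cut_ext:
  assumes u: "u \<in> sec F V"
  shows "FS.extz M V S (restr \<O> M V e \<odot>\<^bsub>sections F V\<^esub> u) \<in> sec F M"
    "restr F M V (FS.extz M V S (restr \<O> M V e \<odot>\<^bsub>sections F V\<^esub> u)) = restr \<O> M V e \<odot>\<^bsub>sections F V\<^esub> u"
    "restr F M (M - S) (FS.extz M V S (restr \<O> M V e \<odot>\<^bsub>sections F V\<^esub> u)) = \<zero>\<^bsub>sections F (M - S)\<^esub>"
  using FS.extz[OF M_open V V_opens(5) MS FS.smult_closed[OF V O_restr_closed[OF M_open V_opens(1) e] u]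
      cut_section_zero[OF V e S u]] by auto

text \<open>Applied to the extension of \<open>e u\<close>, \<open>D\<close> yields a density that
  vanishes off S \<subseteq> V. As a function it coincides with its restriction to \<open>V\<close>,
  and so do the integrals.\<close>

lemma cut_density_rho:
  assumes D: "FD.dop M K r D"
  shows "cut_density e S (rh M D) = rh V (FD.cut_op M V e D)"
  unfolding cut_density_def rho_def
proof (rule restrict_ext)
  fix u assume u: "u \<in> sec F V"
  note d = FD.dopD[OF D] and x = cut_ext[OF u]
  let ?x = "FS.extz M V S (restr \<O> M V e \<odot>\<^bsub>sections F V\<^esub> u)"
  have "FD.cut_op M V e D V u = D V (restr F M V ?x)"
    by (simp add: FD.cut_op_def FD.mk_apply[OF V_opens(2) u] x(2))
  also have "\<dots> = restr dens M V (D M ?x)"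
    using FD.additive_hom_restr[OF d(6) V_opens(3,1) x(1)] by simp
  also have "\<dots> = D M ?x"
  proof (intro ext)
    fix c a
    show "restr dens M V (D M ?x) c a = D M ?x c a"
    proof (cases "a \<in> V")
      case True then show ?thesis by (simp add: dens_simps)
    next
      case False
      have "restr dens M (M - S) (D M ?x) = \<zero>\<^bsub>sections dens (M - S)\<^esub>"
        by (rule FD.additive_hom_local[OF d(6) V_opens(3) opens_M[OF MS(1)] x(1,3)])
      then have "D M ?x c a = 0" if "a \<in> M"
        using dens_zero_outside[OF M_open _ that] False S(2) by blast
      moreover have "D M ?x c a = 0" if "a \<notin> M"
        using dens_support[OF FD.additive_hom_closed[OF d(6) V_opens(3) x(1)]] that by blast
      ultimately show ?thesis using False by (auto simp: dens_simps)
    qed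
  qed
  finally show "(\<lambda>u\<in>sec F M. density_integral X \<O> (D M u)) ?x = density_integral X \<O> (FD.cut_op M V e D V u)"
    using x(1) by simp
qed

lemma cut_density_linear: "complex_linear (FDs M) (FDs V) (cut_density e S)"
proof -
  have "cut_density e S \<eta> \<in> carrier (FDs V)" if "\<eta> \<in> carrier (FDs M)" for \<eta>
  proof -
    obtain K r D where D: "FD.dop M K r D" "\<eta> = rh M D" using \<open>\<eta> \<in> carrier (FDs M)\<close> by (auto simp: FDs_carrier[OF M_open])
    show ?thesis unfolding D(2) cut_density_rho[OF D(1)] FDs_carrier[OF V]
      using FD.dop_cut_op[OF M_open V_opens(1) e S(1) MS(2) S(3) D(1)] by blast
  qed
  then have 1: "cut_density e S \<in> carrier (FDs M) \<rightarrow> carrier (FDs V)" by blast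
  have 2: "cut_density e S (\<eta> \<oplus>\<^bsub>FDs M\<^esub> \<theta>) = cut_density e S \<eta> \<oplus>\<^bsub>FDs V\<^esub> cut_density e S \<theta>" for \<eta> \<theta>
    unfolding FDs_simps cut_density_def by (rule restrict_ext) (simp add: cut_ext(1))
  have 3: "cut_density e S (c \<odot>\<^bsub>FDs M\<^esub> \<eta>) = c \<odot>\<^bsub>FDs V\<^esub> cut_density e S \<eta>" for c \<eta>
    unfolding FDs_simps cut_density_def by (rule restrict_ext) (simp add: cut_ext(1))
  show ?thesis unfolding complex_linear_def by (intro conjI ballI allI 1 2 3)
qed

text \<open>The cut operator is supported in K \<inter> S, and an operator with empty support
  integrates to zero. This is the source of finiteness of the components.\<close>

lemma cut_density_disjoint:
  assumes D: "FD.dop M K r D" and KS: "K \<inter> S = {}"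
  shows "cut_density e S (rh M D) = \<zero>\<^bsub>FDs V\<^esub>"
  unfolding cut_density_rho[OF D]
  by (rule rho_zero[OF V]) (use FD.dop_cut_op[OF M_open V_opens(1) e S(1) MS(2) S(3) D] KS in simp)

lemma continuous_cut_density_quotient:
  assumes K: "compactin X K"
  shows "continuous_map (quotient_topology (Diff_Kr_topology X \<O> F M K r) (rh M))
    (quotient_topology (Diff_Kr_topology X \<O> F V (K \<inter> S) r) (rh V)) (cut_density e S)"
  by (rule continuous_map_quotient_topology[OF continuous_cut_op[OF K e S]])
    (simp add: topspace_quotient_rho(2)[OF M_open K compactin_subset_topspace[OF K]] cut_density_rho)

text \<open>The extension by zero of the restriction of \<open>e u\<close> is \<open>e u\<close>
  itself. Extended back to M, the component is thus the functional u \<mapsto> \<eta>(e u), the form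
  in which the components are summed.\<close>

lemma ext_cut_density:
  assumes u: "u \<in> sec F M"
  shows "cut_density e S \<eta> (restr F M V u) = \<eta> (e \<odot>\<^bsub>sections F M\<^esub> u)"
proof -
  have uV: "restr F M V u \<in> sec F V" by (rule FS.restr_closed[OF M_open V_opens(1) u])
  have "FS.extz M V S (restr \<O> M V e \<odot>\<^bsub>sections F V\<^esub> restr F M V u) = e \<odot>\<^bsub>sections F M\<^esub> u"
  proof (rule FS.extz_eqI[OF M_open V V_opens(5) MS FS.smult_closed[OF M_open e u]])
    show "restr F M V (e \<odot>\<^bsub>sections F M\<^esub> u) = restr \<O> M V e \<odot>\<^bsub>sections F V\<^esub> restr F M V u"
      by (rule FS.restr_smult[OF M_open V_opens(1) e u])
    show "restr F M (M - S) (e \<odot>\<^bsub>sections F M\<^esub> u) = \<zero>\<^bsub>sections F (M - S)\<^esub>"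
      using FS.restr_smult[OF M_open opens_M[OF MS(1)] e u] S(3)
        FS.smult_l_null[OF MS(1) FS.restr_closed[OF M_open opens_M[OF MS(1)] u]] by simp
  qed
  then show ?thesis using uV by (simp add: cut_density_def)
qed

end

end

end

section \<open>The canonical map and its right inverse\<close>

locale formal_density_cover = formal_mfd_module X \<O> F
  for X :: "'a topology" and \<O> :: "('a, complex, 'r) presheaf" and F :: "('a, 'r, 'm) presheaf" +
  fixes \<Gamma> :: "'i set" and U :: "'i \<Rightarrow> 'a set" and e :: "'i \<Rightarrow> 'r" and S :: "'i \<Rightarrow> 'a set"
  assumes U: "\<alpha> \<in> \<Gamma> \<Longrightarrow> openin X (U \<alpha>)"
    and e: "e \<alpha> \<in> sec \<O> (topspace X)"
    and S_closed: "closedin X (S \<alpha>)" and S_sub: "\<alpha> \<in> \<Gamma> \<Longrightarrow> S \<alpha> \<subseteq> U \<alpha>"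
    and e_zero: "restr \<O> (topspace X) (topspace X - S \<alpha>) (e \<alpha>) = \<zero>\<^bsub>sections \<O> (topspace X - S \<alpha>)\<^esub>"
    and e_sum: "a \<in> topspace X \<Longrightarrow> \<exists>N A. openin X N \<and> a \<in> N \<and> finite A \<and> A \<subseteq> \<Gamma> \<and> (\<forall>\<alpha>\<in>\<Gamma> - A. S \<alpha> \<inter> N = {}) \<and>
       (\<Oplus>\<^bsub>sections \<O> N\<^esub>\<alpha>\<in>A. restr \<O> (topspace X) N (e \<alpha>)) = \<one>\<^bsub>sections \<O> N\<^esub>"
begin

sublocale MF: module_family \<Gamma> "\<lambda>\<alpha>. FDs (U \<alpha>)"
  by (rule module_family.intro, rule module_FDs, rule U)

abbreviation "DS \<equiv> direct_sum \<Gamma> (\<lambda>\<alpha>. FDs (U \<alpha>))"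
abbreviation "DST \<equiv> direct_sum_topology \<Gamma> (\<lambda>\<alpha>. FDs (U \<alpha>)) (\<lambda>\<alpha>. formal_densities_topology X \<O> F (U \<alpha>))"
abbreviation "FDT \<equiv> formal_densities_topology X \<O> F M"
abbreviation "sumext \<equiv> sum_ext X \<O> F \<Gamma> U"

lemma DST_final: "DST = final_locally_convex_topology DS \<Gamma> (\<lambda>\<alpha>. formal_densities_topology X \<O> F (U \<alpha>)) MF.inj"
  unfolding direct_sum_topology_def MF.inj_def[abs_def] by (rule refl)

lemma topspace_FDT: "openin X V \<Longrightarrow> topspace (formal_densities_topology X \<O> F V) = carrier (FDs V)"
  unfolding formal_densities_topology_def by (rule final_family.topspace_final[OF final_family_FDs])

lemma final_family_DS: "final_family DS \<Gamma> (\<lambda>\<alpha>. formal_densities_topology X \<O> F (U \<alpha>)) MF.inj"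
proof (rule final_family.intro[OF MF.module_direct_sum])
  show "MF.inj \<alpha> \<in> topspace (formal_densities_topology X \<O> F (U \<alpha>)) \<rightarrow> carrier DS" if "\<alpha> \<in> \<Gamma>" for \<alpha>
    using MF.inj_linear[OF that] by (simp add: complex_linear_def topspace_FDT[OF U[OF that]])
qed

text \<open>\<open>sum_ext\<close> sums over the exact set of nonzero components, which changes with
  the argument. Allowing any larger finite set lets two arguments and their sum be compared over a
  common index set.\<close>

lemma sum_ext_apply:
  assumes x: "x \<in> carrier DS" and J: "finite J" "J \<subseteq> \<Gamma>" "\<And>\<alpha>. \<alpha> \<in> \<Gamma> - J \<Longrightarrow> x \<alpha> = \<zero>\<^bsub>FDs (U \<alpha>)\<^esub>"
  shows "sumext x = (\<lambda>u\<in>sec F M. \<Sum>\<alpha>\<in>J. x \<alpha> (restr F M (U \<alpha>) u))"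
proof -
  let ?J = "{\<alpha> \<in> \<Gamma>. x \<alpha> \<noteq> \<zero>\<^bsub>FDs (U \<alpha>)\<^esub>}"
  have sub: "?J \<subseteq> J" using J(3) by blast
  then have fin: "finite ?J" using J(1) finite_subset by blast
  have xc: "x \<alpha> \<in> carrier (FDs (U \<alpha>))" if "\<alpha> \<in> \<Gamma>" for \<alpha>
    using x that by (auto simp: MF.direct_sum_carrier)
  have "sumext x = (\<lambda>u\<in>sec F M. \<Sum>\<alpha>\<in>?J. ext_map F M (U \<alpha>) (x \<alpha>) u)"
    unfolding sum_ext_def
  proof (rule FDs_finsum[OF M_open fin])
    show "ext_map F M (U \<alpha>) (x \<alpha>) \<in> carrier (FDs M)" if "\<alpha> \<in> ?J" for \<alpha>
      by (rule complex_linear_closed[OF ext_map_linear[OF U] xc]) (use that in auto)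
  qed
  also have "\<dots> = (\<lambda>u\<in>sec F M. \<Sum>\<alpha>\<in>J. x \<alpha> (restr F M (U \<alpha>) u))"
  proof (rule restrict_ext)
    fix u assume u: "u \<in> sec F M"
    have "(\<Sum>\<alpha>\<in>?J. ext_map F M (U \<alpha>) (x \<alpha>) u) = (\<Sum>\<alpha>\<in>?J. x \<alpha> (restr F M (U \<alpha>) u))"
      using u by (simp add: ext_map_def)
    also have "\<dots> = (\<Sum>\<alpha>\<in>J. x \<alpha> (restr F M (U \<alpha>) u))"
    proof (rule sum.mono_neutral_left[OF J(1) sub], rule ballI)
      fix \<alpha> assume "\<alpha> \<in> J - ?J"
      then have "\<alpha> \<in> \<Gamma>" "x \<alpha> = \<zero>\<^bsub>FDs (U \<alpha>)\<^esub>" using J(2) by auto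
      then show "x \<alpha> (restr F M (U \<alpha>) u) = 0"
        using FS.restr_closed[OF M_open opens_M[OF U] u] by (simp add: FDs_simps)
    qed
    finally show "(\<Sum>\<alpha>\<in>?J. ext_map F M (U \<alpha>) (x \<alpha>) u) = (\<Sum>\<alpha>\<in>J. x \<alpha> (restr F M (U \<alpha>) u))" .
  qed
  finally show ?thesis .
qed

lemma sum_ext_closed: "x \<in> carrier DS \<Longrightarrow> sumext x \<in> carrier (FDs M)"
proof -
  assume x: "x \<in> carrier DS"
  interpret Mo: Module.module complex_ring "FDs M" by (rule module_FDs[OF M_open])
  show "sumext x \<in> carrier (FDs M)"
    unfolding sum_ext_def
  proof (rule Mo.finsum_closed, rule funcsetI)
    fix \<alpha> assume "\<alpha> \<in> {\<alpha> \<in> \<Gamma>. x \<alpha> \<noteq> \<zero>\<^bsub>FDs (U \<alpha>)\<^esub>}"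
    then have a: "\<alpha> \<in> \<Gamma>" by blast
    then have "x \<alpha> \<in> carrier (FDs (U \<alpha>))" using x by (auto simp: MF.direct_sum_carrier)
    then show "ext_map F M (U \<alpha>) (x \<alpha>) \<in> carrier (FDs M)" by (rule complex_linear_closed[OF ext_map_linear[OF U[OF a]]])
  qed
qed

lemma sum_ext_linear: "complex_linear DS (FDs M) sumext"
  unfolding complex_linear_def
proof (intro conjI ballI allI)
  show "sumext \<in> carrier DS \<rightarrow> carrier (FDs M)" using sum_ext_closed by blast
  fix x assume x: "x \<in> carrier DS"
  let ?J = "\<lambda>x. {\<alpha> \<in> \<Gamma>. x \<alpha> \<noteq> \<zero>\<^bsub>FDs (U \<alpha>)\<^esub>}"
  have fx: "finite (?J x)" using x by (simp add: MF.direct_sum_carrier)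
  have rc: "restr F M (U \<alpha>) u \<in> sec F (U \<alpha>)" if "\<alpha> \<in> \<Gamma>" "u \<in> sec F M" for \<alpha> u
    using FS.restr_closed[OF M_open opens_M[OF U] that(2)] that(1) .
  { fix y assume y: "y \<in> carrier DS"
    have fy: "finite (?J y)" using y by (simp add: MF.direct_sum_carrier)
    let ?K = "?J x \<union> ?J y"
    have K: "finite ?K" "?K \<subseteq> \<Gamma>" using fx fy by auto
    have z: "(x \<oplus>\<^bsub>DS\<^esub> y) \<alpha> = \<zero>\<^bsub>FDs (U \<alpha>)\<^esub>" if "\<alpha> \<in> \<Gamma> - ?K" for \<alpha>
      using that by (auto simp: MF.direct_sum_ops FDs_simps intro!: restrict_ext)
    have 1: "sumext (x \<oplus>\<^bsub>DS\<^esub> y) = (\<lambda>u\<in>sec F M. \<Sum>\<alpha>\<in>?K. (x \<oplus>\<^bsub>DS\<^esub> y) \<alpha> (restr F M (U \<alpha>) u))"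
      by (rule sum_ext_apply[OF MF.direct_sum_add_closed[OF x y] K z])
    have 2: "sumext x = (\<lambda>u\<in>sec F M. \<Sum>\<alpha>\<in>?K. x \<alpha> (restr F M (U \<alpha>) u))"
      by (rule sum_ext_apply[OF x K]) auto
    have 3: "sumext y = (\<lambda>u\<in>sec F M. \<Sum>\<alpha>\<in>?K. y \<alpha> (restr F M (U \<alpha>) u))"
      by (rule sum_ext_apply[OF y K]) auto
    have 4: "(\<Sum>\<alpha>\<in>?K. (x \<oplus>\<^bsub>DS\<^esub> y) \<alpha> (restr F M (U \<alpha>) u)) =
        (\<Sum>\<alpha>\<in>?K. x \<alpha> (restr F M (U \<alpha>) u)) + (\<Sum>\<alpha>\<in>?K. y \<alpha> (restr F M (U \<alpha>) u))" if "u \<in> sec F M" for u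
      unfolding sum.distrib[symmetric] by (rule sum.cong) (use rc that in \<open>auto simp: MF.direct_sum_ops FDs_simps\<close>)
    show "sumext (x \<oplus>\<^bsub>DS\<^esub> y) = sumext x \<oplus>\<^bsub>FDs M\<^esub> sumext y"
      unfolding 1 2 3 FDs_simps(2) by (rule restrict_ext) (simp add: 4) }
  fix c
  have z: "(c \<odot>\<^bsub>DS\<^esub> x) \<alpha> = \<zero>\<^bsub>FDs (U \<alpha>)\<^esub>" if "\<alpha> \<in> \<Gamma> - ?J x" for \<alpha>
    using that complex_module_smult_r_null[OF module_FDs[OF U]] by (auto simp: MF.direct_sum_ops)
  have J: "?J x \<subseteq> \<Gamma>" by blast
  have 1: "sumext (c \<odot>\<^bsub>DS\<^esub> x) = (\<lambda>u\<in>sec F M. \<Sum>\<alpha>\<in>?J x. (c \<odot>\<^bsub>DS\<^esub> x) \<alpha> (restr F M (U \<alpha>) u))"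
    by (rule sum_ext_apply[OF MF.direct_sum_smult_closed[OF x] fx J z])
  have 2: "sumext x = (\<lambda>u\<in>sec F M. \<Sum>\<alpha>\<in>?J x. x \<alpha> (restr F M (U \<alpha>) u))"
    by (rule sum_ext_apply[OF x fx J]) auto
  have 3: "(\<Sum>\<alpha>\<in>?J x. (c \<odot>\<^bsub>DS\<^esub> x) \<alpha> (restr F M (U \<alpha>) u)) = c * (\<Sum>\<alpha>\<in>?J x. x \<alpha> (restr F M (U \<alpha>) u))"
    if "u \<in> sec F M" for u
    unfolding sum_distrib_left by (rule sum.cong) (use rc that in \<open>auto simp: MF.direct_sum_ops FDs_simps\<close>)
  show "sumext (c \<odot>\<^bsub>DS\<^esub> x) = c \<odot>\<^bsub>FDs M\<^esub> sumext x"
    unfolding 1 2 FDs_simps(3) by (rule restrict_ext) (simp add: 3)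
qed

lemma sum_ext_inj:
  assumes a: "\<alpha> \<in> \<Gamma>" and v: "v \<in> carrier (FDs (U \<alpha>))"
  shows "sumext (MF.inj \<alpha> v) = ext_map F M (U \<alpha>) v"
proof -
  have x: "MF.inj \<alpha> v \<in> carrier DS" using MF.inj_linear[OF a] v by (auto simp: complex_linear_def)
  have J: "finite {\<alpha>}" "{\<alpha>} \<subseteq> \<Gamma>" using a by auto
  have z: "MF.inj \<alpha> v \<beta> = \<zero>\<^bsub>FDs (U \<beta>)\<^esub>" if "\<beta> \<in> \<Gamma> - {\<alpha>}" for \<beta> using that by (simp add: MF.inj_def)
  have "sumext (MF.inj \<alpha> v) = (\<lambda>u\<in>sec F M. \<Sum>\<beta>\<in>{\<alpha>}. MF.inj \<alpha> v \<beta> (restr F M (U \<beta>) u))"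
    by (rule sum_ext_apply[OF x J]) (rule z)
  also have "\<dots> = ext_map F M (U \<alpha>) v"
    unfolding ext_map_def by (rule restrict_ext) (use a in \<open>simp add: MF.inj_def\<close>)
  finally show ?thesis .
qed

text \<open>A competitor on the target is fixed, after which the universal properties of the direct
  sum and of each summand reduce the claim to the images of \<open>Diff_Kr\<close>. There extension
  keeps both the compact set and the order.\<close>

lemma continuous_sum_ext: "continuous_map DST FDT sumext"
  unfolding formal_densities_topology_def[of _ _ _ M]
proof (rule final_family.continuous_map_into_final[OF final_family_FDs[OF M_open]])
  show "sumext \<in> topspace DST \<rightarrow> carrier (FDs M)"
    unfolding DST_final final_family.topspace_final[OF final_family_DS] using sum_ext_closed by blast
  fix T' assume T': "locally_convex_space (FDs M) T'"
    and c: "\<And>Kr. Kr \<in> {K. compactin X K \<and> K \<subseteq> M} \<times> (UNIV :: nat set) \<Longrightarrow>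
      continuous_map (case Kr of (K, r) \<Rightarrow> quotient_topology (Diff_Kr_topology X \<O> F M K r) (rh M)) T' (\<lambda>\<eta>. \<eta>)"
  show "continuous_map DST T' sumext"
    unfolding DST_final
  proof (rule final_family.continuous_map_from_final[OF final_family_DS sum_ext_linear T'])
    fix \<alpha> assume a: "\<alpha> \<in> \<Gamma>"
    note Ua = U[OF a]
    have "continuous_map (formal_densities_topology X \<O> F (U \<alpha>)) T' (ext_map F M (U \<alpha>))"
      unfolding formal_densities_topology_def
    proof (rule final_family.continuous_map_from_final[OF final_family_FDs[OF Ua] ext_map_linear[OF Ua] T'])
      fix Kr assume "Kr \<in> {K. compactin X K \<and> K \<subseteq> U \<alpha>} \<times> (UNIV :: nat set)"
      then obtain K r where Kr: "Kr = (K, r)" "compactin X K" "K \<subseteq> U \<alpha>" by auto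
      have "(K, r) \<in> {K. compactin X K \<and> K \<subseteq> M} \<times> (UNIV :: nat set)"
        using Kr compactin_subset_topspace by auto
      from c[OF this] have "continuous_map (quotient_topology (Diff_Kr_topology X \<O> F M K r) (rh M)) T' (\<lambda>\<eta>. \<eta>)" by simp
      from continuous_map_compose[OF continuous_ext_map_quotient[OF Ua Kr(2,3)] this]
      show "continuous_map (case Kr of (K, r) \<Rightarrow> quotient_topology (Diff_Kr_topology X \<O> F (U \<alpha>) K r) (rh (U \<alpha>))) T'
          (\<lambda>\<eta>. ext_map F M (U \<alpha>) \<eta>)"
        by (simp add: Kr(1) o_def)
    qed
    then show "continuous_map (formal_densities_topology X \<O> F (U \<alpha>)) T' (\<lambda>v. sumext (MF.inj \<alpha> v))"
      by (rule continuous_map_eq) (simp add: topspace_FDT[OF Ua] sum_ext_inj[OF a])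
  qed
qed

definition split :: "('m \<Rightarrow> complex) \<Rightarrow> 'i \<Rightarrow> 'm \<Rightarrow> complex" where
  "split \<eta> = (\<lambda>\<alpha>\<in>\<Gamma>. cut_density (U \<alpha>) (e \<alpha>) (S \<alpha>) \<eta>)"

abbreviation meets where "meets K \<equiv> {\<alpha> \<in> \<Gamma>. K \<inter> S \<alpha> \<noteq> {}}"

text \<open>Finitely many of the neighbourhoods on which all but finitely many members of the
  partition vanish cover the compact set.\<close>

lemma finite_meets:
  assumes K: "compactin X K" shows "finite (meets K)"
proof -
  let ?N = "{N. openin X N \<and> finite (meets N)}"
  have "K \<subseteq> \<Union>?N"
  proof
    fix a assume "a \<in> K"
    then have "a \<in> M" using compactin_subset_topspace[OF K] by blast
    then obtain N A where N: "openin X N" "a \<in> N" "finite A" "\<forall>\<alpha>\<in>\<Gamma> - A. S \<alpha> \<inter> N = {}" using e_sum by meson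
    have "meets N \<subseteq> A" using N(4) by blast
    then have "finite (meets N)" using N(3) by (rule finite_subset)
    then show "a \<in> \<Union>?N" using N(1,2) by blast
  qed
  from compactinD[OF K _ this] obtain \<F> where F: "finite \<F>" "\<F> \<subseteq> ?N" "K \<subseteq> \<Union>\<F>" by auto
  have "meets K \<subseteq> (\<Union>N\<in>\<F>. meets N)" using F(3) by blast
  moreover have "finite (\<Union>N\<in>\<F>. meets N)" using F(1,2) by (intro finite_UN_I) auto
  ultimately show ?thesis by (rule finite_subset)
qed

lemma cut_closed:
  "\<alpha> \<in> \<Gamma> \<Longrightarrow> \<eta> \<in> carrier (FDs M) \<Longrightarrow> cut_density (U \<alpha>) (e \<alpha>) (S \<alpha>) \<eta> \<in> carrier (FDs (U \<alpha>))"
  by (rule complex_linear_closed[OF cut_density_linear[OF U e S_closed S_sub e_zero]])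

lemma split_zero:
  assumes D: "FD.dop M K r D" and a: "\<alpha> \<in> \<Gamma> - meets K"
  shows "split (rh M D) \<alpha> = \<zero>\<^bsub>FDs (U \<alpha>)\<^esub>"
  using cut_density_disjoint[OF U e S_closed S_sub e_zero D] a by (auto simp: split_def)

lemma split_closed:
  assumes "\<eta> \<in> carrier (FDs M)" shows "split \<eta> \<in> carrier DS"
proof -
  obtain K r D where D: "FD.dop M K r D" "\<eta> = rh M D" using assms by (auto simp: FDs_carrier[OF M_open])
  have "finite {\<alpha> \<in> \<Gamma>. split \<eta> \<alpha> \<noteq> \<zero>\<^bsub>FDs (U \<alpha>)\<^esub>}"
    by (rule finite_subset[OF _ finite_meets[OF FD.dopD(2)[OF D(1)]]]) (use split_zero[OF D(1)] D(2) in blast)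
  then show ?thesis
    using cut_closed[OF _ assms] by (auto simp: MF.direct_sum_carrier PiE_iff split_def)
qed

lemma split_linear: "complex_linear (FDs M) DS split"
  unfolding complex_linear_def
proof (intro conjI ballI allI)
  show "split \<in> carrier (FDs M) \<rightarrow> carrier DS" using split_closed by blast
  note l = cut_density_linear[OF U e S_closed S_sub e_zero, unfolded complex_linear_def]
  fix x assume x: "x \<in> carrier (FDs M)"
  show "split (x \<oplus>\<^bsub>FDs M\<^esub> y) = split x \<oplus>\<^bsub>DS\<^esub> split y" if "y \<in> carrier (FDs M)" for y
    unfolding split_def MF.direct_sum_ops by (rule restrict_ext) (use l x that in simp)
  show "split (c \<odot>\<^bsub>FDs M\<^esub> x) = c \<odot>\<^bsub>DS\<^esub> split x" for c
    unfolding split_def MF.direct_sum_ops by (rule restrict_ext) (use l x in simp)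
qed

text \<open>For operators supported in a given \<open>K\<close> the components that can be nonzero
  are known in advance. On the image of one \<open>Diff_Kr\<close> the right inverse is therefore a
  finite sum of continuous maps with a fixed index set.\<close>

lemma split_finsum:
  assumes D: "FD.dop M K r D"
  shows "split (rh M D) = (\<Oplus>\<^bsub>DS\<^esub>\<alpha>\<in>meets K. MF.inj \<alpha> (cut_density (U \<alpha>) (e \<alpha>) (S \<alpha>) (rh M D)))"
proof -
  have r: "rh M D \<in> carrier (FDs M)" using D by (auto simp: FDs_carrier[OF M_open])
  have "(\<Oplus>\<^bsub>DS\<^esub>\<alpha>\<in>meets K. MF.inj \<alpha> (cut_density (U \<alpha>) (e \<alpha>) (S \<alpha>) (rh M D))) =
      (\<lambda>\<alpha>\<in>\<Gamma>. if \<alpha> \<in> meets K then cut_density (U \<alpha>) (e \<alpha>) (S \<alpha>) (rh M D) else \<zero>\<^bsub>FDs (U \<alpha>)\<^esub>)"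
    by (rule MF.finsum_inj_apply[OF finite_meets[OF FD.dopD(2)[OF D]]]) (use cut_closed[OF _ r] in auto)
  also have "\<dots> = split (rh M D)"
    unfolding split_def by (rule restrict_ext) (use split_zero[OF D] in \<open>auto simp: split_def\<close>)
  finally show ?thesis by simp
qed

text \<open>A competitor on the direct sum is fixed. On the image of \<open>Diff_Kr\<close> each of
  the finitely many components maps into the image for K \<inter> S \<alpha> with the same order,
  and from there continuously into its summand.\<close>

lemma continuous_split: "continuous_map FDT DST split"
  unfolding DST_final
proof (rule final_family.continuous_map_into_final[OF final_family_DS])
  show "split \<in> topspace FDT \<rightarrow> carrier DS" using split_closed by (simp add: topspace_FDT)
  fix T' assume T': "locally_convex_space DS T'"
    and c: "\<And>\<alpha>. \<alpha> \<in> \<Gamma> \<Longrightarrow> continuous_map (formal_densities_topology X \<O> F (U \<alpha>)) T' (MF.inj \<alpha>)"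
  show "continuous_map FDT T' split"
    unfolding formal_densities_topology_def
  proof (rule final_family.continuous_map_from_final[OF final_family_FDs[OF M_open] split_linear T'])
    fix Kr assume "Kr \<in> {K. compactin X K \<and> K \<subseteq> M} \<times> (UNIV :: nat set)"
    then obtain K r where Kr: "Kr = (K, r)" "compactin X K" "K \<subseteq> M" by auto
    let ?Q = "quotient_topology (Diff_Kr_topology X \<O> F M K r) (rh M)"
    have "continuous_map ?Q T' (\<lambda>\<eta>. \<Oplus>\<^bsub>DS\<^esub>\<alpha>\<in>meets K. MF.inj \<alpha> (cut_density (U \<alpha>) (e \<alpha>) (S \<alpha>) \<eta>))"
    proof (rule continuous_map_finsum[OF T' finite_meets[OF Kr(2)]])
      fix \<alpha> assume "\<alpha> \<in> meets K"
      then have a: "\<alpha> \<in> \<Gamma>" by blast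
      let ?QU = "quotient_topology (Diff_Kr_topology X \<O> F (U \<alpha>) (K \<inter> S \<alpha>) r) (rh (U \<alpha>))"
      have KS: "compactin X (K \<inter> S \<alpha>)" "K \<inter> S \<alpha> \<subseteq> U \<alpha>"
        using closed_Int_compactin[OF S_closed Kr(2), of \<alpha>] S_sub[OF a] by (auto simp: Int_commute)
      have 1: "continuous_map ?Q ?QU (cut_density (U \<alpha>) (e \<alpha>) (S \<alpha>))"
        by (rule continuous_cut_density_quotient[OF U[OF a] e S_closed S_sub[OF a] e_zero Kr(2)])
      have "(K \<inter> S \<alpha>, r) \<in> {K. compactin X K \<and> K \<subseteq> U \<alpha>} \<times> (UNIV :: nat set)" using KS by auto
      from final_family.continuous_map_final_component[OF final_family_FDs[OF U[OF a]] this]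
      have 2: "continuous_map ?QU (formal_densities_topology X \<O> F (U \<alpha>)) (\<lambda>\<eta>. \<eta>)"
        by (simp add: formal_densities_topology_def)
      from continuous_map_compose[OF continuous_map_compose[OF 1 2] c[OF a]]
      show "continuous_map ?Q T' (\<lambda>\<eta>. MF.inj \<alpha> (cut_density (U \<alpha>) (e \<alpha>) (S \<alpha>) \<eta>))" by (simp add: o_def)
    qed
    then have "continuous_map ?Q T' split"
      by (rule continuous_map_eq) (auto simp: topspace_quotient_rho(1)[OF M_open Kr(2,3)] split_finsum)
    then show "continuous_map (case Kr of (K, r) \<Rightarrow> quotient_topology (Diff_Kr_topology X \<O> F M K r) (rh M)) T' (\<lambda>\<eta>. split \<eta>)"
      by (simp add: Kr(1))
  qed
qed

lemma dop_finsum_smult: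
  assumes D: "FD.dop M K r D" and N: "openin X N" and v: "v \<in> sec F N" and A: "finite A" "\<And>\<alpha>. f \<alpha> \<in> sec \<O> N"
  shows "D N ((\<Oplus>\<^bsub>sections \<O> N\<^esub>\<alpha>\<in>A. f \<alpha>) \<odot>\<^bsub>sections F N\<^esub> v) c a = (\<Sum>\<alpha>\<in>A. D N (f \<alpha> \<odot>\<^bsub>sections F N\<^esub> v) c a)"
  using A(1)
proof (induction A rule: finite_induct)
  interpret R: cring "sections \<O> N" by (rule O_cring[OF N])
  note ah = FD.dopD(6)[OF D]
  case empty
  then show ?case
    using FS.smult_l_null[OF N v] FD.additive_hom_zero[OF ah opens_M[OF N]] by (simp add: dens_simps)
next
  interpret R: cring "sections \<O> N" by (rule O_cring[OF N])
  note ah = FD.dopD(6)[OF D]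
  case (insert \<alpha> A)
  have s: "(\<Oplus>\<^bsub>sections \<O> N\<^esub>\<alpha>\<in>A. f \<alpha>) \<in> sec \<O> N" using A(2) by auto
  have "(\<Oplus>\<^bsub>sections \<O> N\<^esub>\<alpha>\<in>insert \<alpha> A. f \<alpha>) = f \<alpha> \<oplus>\<^bsub>sections \<O> N\<^esub> (\<Oplus>\<^bsub>sections \<O> N\<^esub>\<alpha>\<in>A. f \<alpha>)"
    using insert.hyps A(2) by (intro R.finsum_insert) auto
  then have "D N ((\<Oplus>\<^bsub>sections \<O> N\<^esub>\<alpha>\<in>insert \<alpha> A. f \<alpha>) \<odot>\<^bsub>sections F N\<^esub> v) =
      D N (f \<alpha> \<odot>\<^bsub>sections F N\<^esub> v) \<oplus>\<^bsub>sections dens N\<^esub> D N ((\<Oplus>\<^bsub>sections \<O> N\<^esub>\<alpha>\<in>A. f \<alpha>) \<odot>\<^bsub>sections F N\<^esub> v)"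
    using FD.additive_hom_add[OF ah opens_M[OF N] FS.smult_closed[OF N A(2) v] FS.smult_closed[OF N s v], of \<alpha>]
      FS.smult_l_distr[OF N A(2) s v, of \<alpha>] by simp
  then show ?case using insert by (simp add: dens_simps)
qed

text \<open>Off \<open>K\<close> both sides vanish. At a point of \<open>K\<close> the sum may be
  taken over the indices of a neighbourhood on which the finite sum of the sections is one: the two
  index sets differ only by sections whose support misses the point, and their terms are zero
  there.\<close>

lemma dop_sum:
  assumes D: "FD.dop M K r D" and u: "u \<in> sec F M"
  shows "(\<Sum>\<alpha>\<in>meets K. D M (e \<alpha> \<odot>\<^bsub>sections F M\<^esub> u) c a) = D M u c a"
proof (cases "a \<in> K")
  case False
  then show ?thesis
    using dop_zero_outside[OF M_open D _ False] u FS.smult_closed[OF M_open e u] by simp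
next
  case True
  note d = FD.dopD[OF D]
  have a: "a \<in> M" using True compactin_subset_topspace[OF d(2)] by blast
  let ?t = "\<lambda>\<alpha>. D M (e \<alpha> \<odot>\<^bsub>sections F M\<^esub> u) c a"
  note MM = opens_M[OF M_open]
  note eu = FS.smult_closed[OF M_open e u]
  obtain N A where N: "openin X N" "a \<in> N" "finite A" "A \<subseteq> \<Gamma>" "\<forall>\<alpha>\<in>\<Gamma> - A. S \<alpha> \<inter> N = {}"
    "(\<Oplus>\<^bsub>sections \<O> N\<^esub>\<alpha>\<in>A. restr \<O> M N (e \<alpha>)) = \<one>\<^bsub>sections \<O> N\<^esub>" using e_sum[OF a] by blast
  have t0: "?t \<alpha> = 0" if "a \<notin> S \<alpha>" for \<alpha>
  proof -
    have o: "openin X (M - S \<alpha>)" using S_closed by blast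
    have "restr F M (M - S \<alpha>) (e \<alpha> \<odot>\<^bsub>sections F M\<^esub> u) = \<zero>\<^bsub>sections F (M - S \<alpha>)\<^esub>"
      using FS.restr_smult[OF M_open opens_M[OF o] e u] e_zero
        FS.smult_l_null[OF o FS.restr_closed[OF M_open opens_M[OF o] u]] by simp
    from FD.additive_hom_local[OF d(6) MM opens_M[OF o] eu this]
    show ?thesis using dens_zero_outside[OF M_open _ a that] by blast
  qed
  have fin: "finite (meets K)" by (rule finite_meets[OF d(2)])
  have "(\<Sum>\<alpha>\<in>meets K. ?t \<alpha>) = (\<Sum>\<alpha>\<in>meets K \<union> A. ?t \<alpha>)"
    by (rule sum.mono_neutral_left) (use fin N(3,4) True in \<open>auto intro!: t0\<close>)
  also have "\<dots> = (\<Sum>\<alpha>\<in>A. ?t \<alpha>)"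
    by (rule sum.mono_neutral_right) (use fin N(2,3,5) in \<open>auto intro!: t0\<close>)
  also have "\<dots> = (\<Sum>\<alpha>\<in>A. D N (restr \<O> M N (e \<alpha>) \<odot>\<^bsub>sections F N\<^esub> restr F M N u) c a)"
  proof (rule sum.cong[OF refl])
    fix \<alpha>
    have "restr dens M N (D M (e \<alpha> \<odot>\<^bsub>sections F M\<^esub> u)) = D N (restr \<O> M N (e \<alpha>) \<odot>\<^bsub>sections F N\<^esub> restr F M N u)"
      using FD.additive_hom_restr[OF d(6) MM opens_M[OF N(1)] eu] FS.restr_smult[OF M_open opens_M[OF N(1)] e u] by simp
    from fun_cong[OF fun_cong[OF this], of c a]
    show "?t \<alpha> = D N (restr \<O> M N (e \<alpha>) \<odot>\<^bsub>sections F N\<^esub> restr F M N u) c a" using N(2) by (simp add: dens_simps)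
  qed
  also have "\<dots> = D N (\<one>\<^bsub>sections \<O> N\<^esub> \<odot>\<^bsub>sections F N\<^esub> restr F M N u) c a"
    using dop_finsum_smult[OF D N(1) FS.restr_closed[OF M_open opens_M[OF N(1)] u] N(3), of "\<lambda>\<alpha>. restr \<O> M N (e \<alpha>)"]
      O_restr_closed[OF M_open opens_M[OF N(1)] e] N(6) by simp
  also have "\<dots> = restr dens M N (D M u) c a"
    using FS.smult_one[OF N(1) FS.restr_closed[OF M_open opens_M[OF N(1)] u]]
      FD.additive_hom_restr[OF d(6) MM opens_M[OF N(1)] u] by simp
  also have "\<dots> = D M u c a" using N(2) by (simp add: dens_simps)
  finally show ?thesis .
qed

lemma density_integral_sum:
  assumes K: "compactin X K" and "finite A" "\<And>\<alpha>. \<alpha> \<in> A \<Longrightarrow> \<rho> \<alpha> \<in> dens_supp K"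
  shows "density_integral X \<O> (\<lambda>c a. \<Sum>\<alpha>\<in>A. \<rho> \<alpha> c a) = (\<Sum>\<alpha>\<in>A. density_integral X \<O> (\<rho> \<alpha>)) \<and>
    (\<lambda>c a. \<Sum>\<alpha>\<in>A. \<rho> \<alpha> c a) \<in> dens_supp K"
  using assms(2,3)
proof (induction A rule: finite_induct)
  case empty
  then show ?case using density_integral_zero D.zero_closed[OF M_open] by (simp add: dens_supp_def dens_simps)
next
  case (insert \<alpha> A)
  then show ?case
    using density_integral_add[OF K, of "\<rho> \<alpha>" "\<lambda>c a. \<Sum>\<alpha>\<in>A. \<rho> \<alpha> c a"]
      dens_supp_add[OF K, of "\<rho> \<alpha>" "\<lambda>c a. \<Sum>\<alpha>\<in>A. \<rho> \<alpha> c a"] by simp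
qed

text \<open>The sum of the functionals u \<mapsto> \<eta>(e u) moves inside the integral, since all
  densities involved are supported in the same \<open>K\<close>; inside, the densities add up to D u
  at every point.\<close>

lemma sum_ext_split:
  assumes "\<eta> \<in> carrier (FDs M)" shows "sumext (split \<eta>) = \<eta>"
proof -
  obtain K r D where D: "FD.dop M K r D" "\<eta> = rh M D" using assms by (auto simp: FDs_carrier[OF M_open])
  note d = FD.dopD[OF D(1)]
  have "sumext (split \<eta>) = (\<lambda>u\<in>sec F M. \<Sum>\<alpha>\<in>meets K. split \<eta> \<alpha> (restr F M (U \<alpha>) u))"
    by (rule sum_ext_apply[OF split_closed[OF assms] finite_meets[OF d(2)]])
      (use split_zero[OF D(1)] D(2) in auto)
  also have "\<dots> = (\<lambda>u\<in>sec F M. \<eta> u)"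
  proof (rule restrict_ext)
    fix u assume u: "u \<in> sec F M"
    note eu = FS.smult_closed[OF M_open e u]
    have "(\<Sum>\<alpha>\<in>meets K. split \<eta> \<alpha> (restr F M (U \<alpha>) u)) = (\<Sum>\<alpha>\<in>meets K. \<eta> (e \<alpha> \<odot>\<^bsub>sections F M\<^esub> u))"
      by (rule sum.cong) (use ext_cut_density[OF U e S_closed S_sub e_zero u] in \<open>auto simp: split_def\<close>)
    also have "\<dots> = (\<Sum>\<alpha>\<in>meets K. density_integral X \<O> (D M (e \<alpha> \<odot>\<^bsub>sections F M\<^esub> u)))"
      unfolding D(2) rho_def using eu by simp
    also have "\<dots> = density_integral X \<O> (\<lambda>c a. \<Sum>\<alpha>\<in>meets K. D M (e \<alpha> \<odot>\<^bsub>sections F M\<^esub> u) c a)"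
      using density_integral_sum[OF d(2) finite_meets[OF d(2)], of "\<lambda>\<alpha>. D M (e \<alpha> \<odot>\<^bsub>sections F M\<^esub> u)"]
        dop_dens_supp[OF M_open D(1) eu] by simp
    also have "\<dots> = \<eta> u" unfolding D(2) rho_def dop_sum[OF D(1) u] using u by simp
    finally show "(\<Sum>\<alpha>\<in>meets K. split \<eta> \<alpha> (restr F M (U \<alpha>) u)) = \<eta> u" .
  qed
  also have "\<dots> = \<eta>" by (rule FDs_restrict[OF M_open assms])
  finally show ?thesis .
qed

lemma open_map_sum_ext: "open_map DST FDT sumext"
proof (rule open_map_right_inverse[OF MF.module_direct_sum module_FDs[OF M_open] sum_ext_linear split_linear])
  show "sumext (split \<eta>) = \<eta>" if "\<eta> \<in> carrier (FDs M)" for \<eta> by (rule sum_ext_split[OF that])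
  show "topspace DST = carrier DS" unfolding DST_final by (rule final_family.topspace_final[OF final_family_DS])
  show "topspace FDT = carrier (FDs M)" by (rule topspace_FDT[OF M_open])
  show "continuous_map FDT DST split" by (rule continuous_split)
  show "continuous_map DST DST (\<lambda>x. a \<oplus>\<^bsub>DS\<^esub> x)" if "a \<in> carrier DS" for a
    unfolding DST_final by (rule final_family.continuous_map_translation[OF final_family_DS that])
  show "continuous_map FDT FDT (\<lambda>x. a \<oplus>\<^bsub>FDs M\<^esub> x)" if "a \<in> carrier (FDs M)" for a
    unfolding formal_densities_topology_def
    by (rule final_family.continuous_map_translation[OF final_family_FDs[OF M_open] that])
qed

lemma sum_ext_surj: "sumext ` carrier DS = carrier (FDs M)"
proof (intro equalityI subsetI)
  fix \<eta> assume e: "\<eta> \<in> carrier (FDs M)"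
  show "\<eta> \<in> sumext ` carrier DS"
    by (rule image_eqI[OF _ split_closed[OF e]]) (rule sum_ext_split[OF e, symmetric])
qed (use sum_ext_closed in blast)

end

theorem proposition2p15:
  fixes X :: "'a topology" and \<O> :: "('a, complex, 'r) presheaf"
    and \<F> :: "('a, 'r, 'm) presheaf"
    and \<Gamma> :: "'i set" and U :: "'i \<Rightarrow> 'a set"
  assumes "formal_manifold X \<O>"
    and "sheaf_of_modules X \<O> \<F>"
    and "\<And>\<alpha>. \<alpha> \<in> \<Gamma> \<Longrightarrow> openin X (U \<alpha>)"
    and "(\<Union>\<alpha>\<in>\<Gamma>. U \<alpha>) = topspace X"
  shows "complex_linear (density_sum X \<O> \<F> \<Gamma> U) (formal_densities X \<O> \<F> (topspace X))
           (sum_ext X \<O> \<F> \<Gamma> U) \<and>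
         (\<exists>R. complex_linear (formal_densities X \<O> \<F> (topspace X)) (density_sum X \<O> \<F> \<Gamma> U) R \<and>
              continuous_map (formal_densities_topology X \<O> \<F> (topspace X))
                (density_sum_topology X \<O> \<F> \<Gamma> U) R \<and>
              (\<forall>\<eta>\<in>carrier (formal_densities X \<O> \<F> (topspace X)). sum_ext X \<O> \<F> \<Gamma> U (R \<eta>) = \<eta>)) \<and>
         continuous_map (density_sum_topology X \<O> \<F> \<Gamma> U)
           (formal_densities_topology X \<O> \<F> (topspace X)) (sum_ext X \<O> \<F> \<Gamma> U) \<and>
         open_map (density_sum_topology X \<O> \<F> \<Gamma> U)
           (formal_densities_topology X \<O> \<F> (topspace X)) (sum_ext X \<O> \<F> \<Gamma> U) \<and>
         sum_ext X \<O> \<F> \<Gamma> U ` carrier (density_sum X \<O> \<F> \<Gamma> U)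
           = carrier (formal_densities X \<O> \<F> (topspace X))"
proof -
  interpret formal_mfd X \<O> by (rule formal_mfd.intro[OF assms(1)])
  obtain e S where e: "\<And>\<alpha>. e \<alpha> \<in> sec \<O> (topspace X)" and S: "\<And>\<alpha>. closedin X (S \<alpha>)"
    and SU: "\<And>\<alpha>. \<alpha> \<in> \<Gamma> \<Longrightarrow> S \<alpha> \<subseteq> U \<alpha>"
    and z: "\<And>\<alpha>. restr \<O> (topspace X) (topspace X - S \<alpha>) (e \<alpha>) = \<zero>\<^bsub>sections \<O> (topspace X - S \<alpha>)\<^esub>"
    and lf: "\<And>a. a \<in> topspace X \<Longrightarrow> \<exists>N A. openin X N \<and> a \<in> N \<and> finite A \<and> A \<subseteq> \<Gamma> \<and>
       (\<forall>\<alpha>\<in>\<Gamma> - A. S \<alpha> \<inter> N = {}) \<and>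
       (\<Oplus>\<^bsub>sections \<O> N\<^esub>\<alpha>\<in>A. restr \<O> (topspace X) N (e \<alpha>)) = \<one>\<^bsub>sections \<O> N\<^esub>"
    by (rule partition_exists[where \<Gamma> = \<Gamma> and U = U, OF assms(3,4)]) blast+
  interpret formal_density_cover X \<O> \<F> \<Gamma> U e S
    by unfold_locales (rule assms(2), erule assms(3), rule e, rule S, erule SU, rule z, erule lf)
  show ?thesis
    using sum_ext_linear split_linear continuous_split sum_ext_split continuous_sum_ext open_map_sum_ext sum_ext_surj
    by blast
qed

end
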